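(* Let $P(x)=\alpha\prod_{j=1}^l(\langle N_j,x\rangle+c_j)$, where $l\ge1$, $N_j\in\mathbb{C}^n\setminus\{0\}$, $\alpha\in\mathbb{C}\setminus\{0\}$ and $c_j\in\mathbb{C}$, $j=1,\ldots,l$. Then for an open subset $X\subseteq\mathbb{R}^n$ the following are equivalent. (i) $X$ is $P$-convex for supports. (ii) $X$ is $P$-convex for singular supports. (iii) For every $j\in\{1,\ldots,l\}$, with $W=\mathrm{span}\{\mathrm{Re}\,N_j,\mathrm{Im}\,N_j\}\subseteq\mathbb{R}^n$, the boundary distance $d_X$ satisfies the minimum principle in $x+W$ for every $x\in\mathbb{R}^n$.
   Context: For $N\in\mathbb{C}^n$, $\langle N,x\rangle=\sum_k N_kx_k$ where here $N_k$ denote the coordinates of $N$, and $\mathrm{Re}\,N,\mathrm{Im}\,N\in\mathbb{R}^n$ are taken coordinatewise; the span is over $\mathbb{R}$. $P(-D)$ is the constant coefficient differential operator associated with $\xi\mapsto P(-\xi)$, $D=(-i\partial_1,\ldots,-i\partial_n)$. $\mathscr{E}'(X)$ is the space of distributions with compact support in $X$. An open set $X\subseteq\mathbb{R}^n$ is $P$-convex for supports if for every compact $K\subseteq X$ there is a compact $L\subseteq X$ such that for every $u\in\mathscr{E}'(X)$ with $\mathrm{supp}\,P(-D)u\subseteq K$ one has $\mathrm{supp}\,u\subseteq L$. It is $P$-convex for singular supports if for every compact $K\subseteq X$ there is a compact $L\subseteq X$ such that for every $u\in\mathscr{E}'(X)$ with $\mathrm{sing\,supp}\,P(-D)u\subseteq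 K$ one has $\mathrm{sing\,supp}\,u\subseteq L$. The boundary distance is $d_X(x)=\mathrm{dist}(x,X^c)$ for $x\in X$, with respect to the Euclidean norm, $X^c=\mathbb{R}^n\setminus X$ (with $\mathrm{dist}(x,\emptyset)=+\infty$). A function $f$ on $X$ satisfies the minimum principle in a closed set $F\subseteq\mathbb{R}^n$ if for every (non-empty) compact set $K\subseteq F\cap X$ one has $\min_{x\in K}f(x)=\min_{x\in\partial_FK}f(x)$, where $\partial_FK$ is the boundary of $K$ in $F$. *)

theory Defs
  imports "HOL-Analysis.Analysis" "HOL-Library.Poly_Mapping"
begin

text \<open>Polynomials in the variables indexed by \<open>'n\<close> are finitely supported functions from
  multi-indices to coefficients; the product is the convolution of \<open>Poly_Mapping\<close>.\<close>

type_synonym 'n multi_index = "'n \<Rightarrow>\<^sub>0 nat"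
type_synonym 'n cpoly = "'n multi_index \<Rightarrow>\<^sub>0 complex"

definition mi_abs :: "'n::finite multi_index \<Rightarrow> nat" where
  "mi_abs m = (\<Sum>k\<in>UNIV. Poly_Mapping.lookup m k)"

definition const_poly :: "complex \<Rightarrow> 'n cpoly" where
  "const_poly c = Poly_Mapping.single 0 c"

definition var_poly :: "'n \<Rightarrow> 'n cpoly" where
  "var_poly k = Poly_Mapping.single (Poly_Mapping.single k 1) 1"

text \<open>The polynomial \<open>x \<mapsto> \<Sum>\<^sub>k N\<^sub>k x\<^sub>k\<close>; it is bilinear, without complex conjugation.\<close>

definition linear_poly :: "complex ^ 'n::finite \<Rightarrow> 'n cpoly" where
  "linear_poly N = (\<Sum>k\<in>UNIV. const_poly (N $ k) * var_poly k)"

text \<open>The polynomial \<open>\<xi> \<mapsto> P (-\<xi>)\<close>: the coefficient of \<open>\<xi>\<^sup>m\<close> is multiplied by \<open>(-1)\<^bsup>|m|\<^esup>\<close>.\<close>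

definition reflect_vars :: "'n::finite cpoly \<Rightarrow> 'n cpoly" where
  "reflect_vars P = Poly_Mapping.mapp (\<lambda>m c. (-1) ^ mi_abs m * c) P"

lemma finite_mi_abs_le: "finite {m :: 'n::finite multi_index. mi_abs m \<le> b}"
proof -
  have "Poly_Mapping.lookup m k \<le> mi_abs m" for m :: "'n multi_index" and k
    unfolding mi_abs_def by (rule member_le_sum) auto
  then have "Poly_Mapping.lookup m k \<le> b" if "mi_abs m \<le> b" for m :: "'n multi_index" and k
    using that le_trans by blast
  then have "Poly_Mapping.lookup ` {m :: 'n multi_index. mi_abs m \<le> b} \<subseteq> UNIV \<rightarrow>\<^sub>E {..b}"
    by (simp add: PiE_UNIV_domain image_subset_iff)
  moreover have "finite ((UNIV :: 'n set) \<rightarrow>\<^sub>E {..b})"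
    by (intro finite_PiE) auto
  ultimately have "finite (Poly_Mapping.lookup ` {m :: 'n multi_index. mi_abs m \<le> b})"
    by (rule finite_subset)
  then show ?thesis
    by (rule finite_imageD) (simp add: inj_on_def lookup_inject)
qed

definition partial_deriv :: "'n::finite \<Rightarrow> (real ^ 'n \<Rightarrow> complex) \<Rightarrow> real ^ 'n \<Rightarrow> complex" where
  "partial_deriv k f = (\<lambda>x. frechet_derivative f (at x) (axis k 1))"

definition partial_derivs :: "'n::finite list \<Rightarrow> (real ^ 'n \<Rightarrow> complex) \<Rightarrow> real ^ 'n \<Rightarrow> complex" where
  "partial_derivs ks f = fold partial_deriv ks f"

text \<open>Only used for open \<open>U\<close>.  If all iterated partial derivatives are differentiable
  then they are all continuous, so this is the class \<open>C\<^sup>\<infinity>(U)\<close>.\<close>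

definition smooth_fun_on :: "(real ^ 'n::finite) set \<Rightarrow> (real ^ 'n \<Rightarrow> complex) \<Rightarrow> bool" where
  "smooth_fun_on U f \<longleftrightarrow> (\<forall>ks. \<forall>x\<in>U. partial_derivs ks f differentiable (at x))"

text \<open>\<open>mi_deriv m\<close> is \<open>\<partial>\<^sup>m\<close>, where the order of the partial derivatives is chosen arbitrarily;
  it is applied to smooth functions only, where by Schwarz's theorem the order is irrelevant.\<close>

definition mi_deriv :: "'n::finite multi_index \<Rightarrow> (real ^ 'n \<Rightarrow> complex) \<Rightarrow> real ^ 'n \<Rightarrow> complex" where
  "mi_deriv m f = partial_derivs (SOME ks. \<forall>k. count_list ks k = Poly_Mapping.lookup m k) f"

lemma ex_list_of_multi_index:
  "\<exists>ks :: 'n::finite list. \<forall>k. count_list ks k = Poly_Mapping.lookup m k"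
proof -
  obtain ks :: "'n list" where "mset ks = Abs_multiset (Poly_Mapping.lookup m)"
    using ex_mset by blast
  then have "count (mset ks) = Poly_Mapping.lookup m"
    by (simp add: Abs_multiset_inverse)
  then show ?thesis
    by (metis count_mset)
qed

definition fun_support :: "(real ^ 'n::finite \<Rightarrow> complex) \<Rightarrow> (real ^ 'n) set" where
  "fun_support f = closure {x. f x \<noteq> 0}"

definition test_funs :: "(real ^ 'n::finite) set \<Rightarrow> (real ^ 'n \<Rightarrow> complex) set" where
  "test_funs U = {\<phi>. smooth_fun_on UNIV \<phi> \<and> compact (fun_support \<phi>) \<and> fun_support \<phi> \<subseteq> U}"

text \<open>A functional on test functions is represented by a total function, of which
  only the values on \<open>test_funs X\<close> are relevant.\<close>

type_synonym 'n functional = "(real ^ 'n \<Rightarrow> complex) \<Rightarrow> complex"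

definition is_distribution :: "(real ^ 'n::finite) set \<Rightarrow> 'n functional \<Rightarrow> bool" where
  "is_distribution X u \<longleftrightarrow>
     (\<forall>\<phi>\<in>test_funs X. \<forall>\<psi>\<in>test_funs X. u (\<lambda>x. \<phi> x + \<psi> x) = u \<phi> + u \<psi>) \<and>
     (\<forall>\<phi>\<in>test_funs X. \<forall>c. u (\<lambda>x. c * \<phi> x) = c * u \<phi>) \<and>
     (\<forall>K. compact K \<and> K \<subseteq> X \<longrightarrow>
        (\<exists>C b. \<forall>\<phi>\<in>test_funs X. fun_support \<phi> \<subseteq> K \<longrightarrow>
           cmod (u \<phi>) \<le> C * (\<Sum>m\<in>{m. mi_abs m \<le> b}. SUP x. cmod (mi_deriv m \<phi> x))))"

definition dist_supp :: "(real ^ 'n::finite) set \<Rightarrow> 'n functional \<Rightarrow> (real ^ 'n) set" where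
  "dist_supp X u =
     {x\<in>X. \<not> (\<exists>V. open V \<and> x \<in> V \<and> V \<subseteq> X \<and> (\<forall>\<phi>\<in>test_funs V. u \<phi> = 0))}"

definition dist_sing_supp :: "(real ^ 'n::finite) set \<Rightarrow> 'n functional \<Rightarrow> (real ^ 'n) set" where
  "dist_sing_supp X u =
     {x\<in>X. \<not> (\<exists>V f. open V \<and> x \<in> V \<and> V \<subseteq> X \<and> smooth_fun_on V f \<and>
                 (\<forall>\<phi>\<in>test_funs V. u \<phi> = (\<integral>y. f y * \<phi> y \<partial>lborel)))}"

definition compact_dists :: "(real ^ 'n::finite) set \<Rightarrow> 'n functional set" where
  "compact_dists X = {u. is_distribution X u \<and> compact (dist_supp X u)}"

definition dist_deriv :: "'n::finite multi_index \<Rightarrow> 'n functional \<Rightarrow> 'n functional" where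
  "dist_deriv m u = (\<lambda>\<phi>. (-1) ^ mi_abs m * u (mi_deriv m \<phi>))"

text \<open>\<open>diff_op Q u\<close> is \<open>Q(D)u\<close> with \<open>D = -\<i> \<partial>\<close>.\<close>

definition diff_op :: "'n::finite cpoly \<Rightarrow> 'n functional \<Rightarrow> 'n functional" where
  "diff_op Q u =
     (\<lambda>\<phi>. \<Sum>m\<in>Poly_Mapping.keys Q.
        Poly_Mapping.lookup Q m * (-\<i>) ^ mi_abs m * dist_deriv m u \<phi>)"

definition diff_op_neg :: "'n::finite cpoly \<Rightarrow> 'n functional \<Rightarrow> 'n functional" where
  "diff_op_neg P = diff_op (reflect_vars P)"

definition P_convex_supports :: "'n::finite cpoly \<Rightarrow> (real ^ 'n) set \<Rightarrow> bool" where
  "P_convex_supports P X \<longleftrightarrow>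
     (\<forall>K. compact K \<and> K \<subseteq> X \<longrightarrow>
        (\<exists>L. compact L \<and> L \<subseteq> X \<and>
           (\<forall>u\<in>compact_dists X. dist_supp X (diff_op_neg P u) \<subseteq> K \<longrightarrow> dist_supp X u \<subseteq> L)))"

definition P_convex_sing_supports :: "'n::finite cpoly \<Rightarrow> (real ^ 'n) set \<Rightarrow> bool" where
  "P_convex_sing_supports P X \<longleftrightarrow>
     (\<forall>K. compact K \<and> K \<subseteq> X \<longrightarrow>
        (\<exists>L. compact L \<and> L \<subseteq> X \<and>
           (\<forall>u\<in>compact_dists X.
              dist_sing_supp X (diff_op_neg P u) \<subseteq> K \<longrightarrow> dist_sing_supp X u \<subseteq> L)))"

text \<open>Extended real valued, so that the distance to the empty set is \<open>\<infinity>\<close>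
  (\<open>infdist\<close> would give \<open>0\<close>).\<close>

definition boundary_dist :: "'a::metric_space set \<Rightarrow> 'a \<Rightarrow> ereal" where
  "boundary_dist X x = (INF y\<in>- X. ereal (dist x y))"

definition is_min_on :: "('a \<Rightarrow> 'b::order) \<Rightarrow> 'a set \<Rightarrow> 'b \<Rightarrow> bool" where
  "is_min_on f K v \<longleftrightarrow> v \<in> f ` K \<and> (\<forall>x\<in>K. v \<le> f x)"

text \<open>Both minima are required to exist and to coincide.\<close>

definition minimum_principle ::
    "'a::topological_space set \<Rightarrow> ('a \<Rightarrow> 'b::order) \<Rightarrow> 'a set \<Rightarrow> bool" where
  "minimum_principle X f F \<longleftrightarrow>
     (\<forall>K. compact K \<and> K \<noteq> {} \<and> K \<subseteq> F \<inter> X \<longrightarrow>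
        (\<exists>v. is_min_on f K v \<and> is_min_on f (top_of_set F frontier_of K) v))"

definition Re_vec :: "complex ^ 'n::finite \<Rightarrow> real ^ 'n" where
  "Re_vec N = (\<chi> k. Re (N $ k))"

definition Im_vec :: "complex ^ 'n::finite \<Rightarrow> real ^ 'n" where
  "Im_vec N = (\<chi> k. Im (N $ k))"

end

theory Submission
  imports Defs "HOL-Complex_Analysis.Complex_Analysis"
begin

text \<open>P-convexity of either kind holds for a product if and only if it holds for every factor, so
  consider one factor \<open>L = \<langle>N,D\<rangle> + c\<close>, which differentiates along the leaves \<open>x + W\<close>.

  Suppose the minimum principle holds.  If \<open>u\<close> vanishes, or is smooth, near one point and
  \<open>Lu\<close> does so on the surrounding leaves, then so does \<open>u\<close> near the points of the leaf close to it.
  Indeed, subtract a smooth solution to reduce to \<open>Lu = 0\<close> and divide by an exponential solution: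
  the regularisations of \<open>u\<close> at scale \<open>\<epsilon>\<close> become constant or holomorphic on the leaves.  They
  are \<open>O(\<epsilon>\<^bsup>-n\<^esup>)\<close>, while near the given point suitable combinations of scales differ from a
  smooth function by \<open>O(\<epsilon>\<^bsup>m+1\<^esup>)\<close> with \<open>m\<close> arbitrary, so that by Hadamard's three circles theorem they
  converge uniformly.  Hence the (singular) support \<open>S\<close> of \<open>u\<close> is open in the leaves outside the
  one of \<open>Lu\<close>, and the minimum principle for \<open>S \<inter> (x + W)\<close> bounds \<open>d\<^sub>X\<close> on \<open>S\<close> from below.

  Conversely, let the minimum of \<open>d\<^sub>X\<close> over a compact \<open>K\<close> in a leaf be attained at \<open>x\<^sub>0\<close> and be
  smaller than the minimum over the boundary, and let \<open>x\<^sub>0 + v\<close> be a point nearest to \<open>x\<^sub>0\<close> outside \<open>X\<close>.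
  Then \<open>v \<notin> W\<close>.  For \<open>0 \<le> t < 1\<close> the surface measure on \<open>K + tv\<close> times an exponential solution is
  singular at \<open>x\<^sub>0 + tv\<close>, and its image under \<open>L\<close> is supported in \<open>\<partial>K + tv\<close>.  These sets
  remain in a compact subset of \<open>X\<close> as \<open>t \<rightarrow> 1\<close>, but \<open>x\<^sub>0 + tv\<close> does not.\<close>

subsection \<open>Smooth functions\<close>

text \<open>\<open>P(-D)u\<close> pairs with \<phi> as u pairs with \<open>P(D)\<phi>\<close>. So a
  linear factor acts on test functions as \<open>opL\<close>, while functions and regularisations
  satisfy equations for its transpose \<open>opT\<close>. The exponential solution turns
  \<open>opT\<close> into a multiple of the vector field \<open>dN N\<close>; the constant c then
  costs only a factor in the estimates. The obstacle is the rate of approximation. At a single scale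
  a regularisation differs from a smooth function by O(\<epsilon>) in general, which interpolation
  with exponent \<theta> cannot balance against the growth in 1/\<epsilon>. Extrapolation over
  \<epsilon>, \<epsilon>/2, ..., \<epsilon>/2^m raises the order for every mollifier, and m is
  chosen once \<theta> and the growth exponent are known. For supports the small bound may be any
  positive number. Smoothness reduces to continuity, as derivatives of a homogeneous solution are
  again homogeneous solutions, with the same \<eta> and \<theta>. In the converse one family of
  distributions serves both notions: the image is controlled by its support, the distribution itself
  by its singular support, and sing supp is part of supp.\<close>

lemma partial_deriv_eqI:
  "(f has_derivative f') (at x) \<Longrightarrow> partial_deriv k f x = f' (axis k 1)"
  unfolding partial_deriv_def by (metis frechet_derivative_at)

lemma has_derivative_partial_deriv:
  fixes f :: "real ^ 'n::finite \<Rightarrow> complex"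
  assumes "f differentiable (at x)"
  shows "(f has_derivative (\<lambda>h. \<Sum>k\<in>UNIV. h $ k *\<^sub>R partial_deriv k f x)) (at x)"
proof -
  let ?D = "frechet_derivative f (at x)"
  have D: "(f has_derivative ?D) (at x)"
    using assms frechet_derivative_works by blast
  interpret bounded_linear ?D
    using D by (rule has_derivative_bounded_linear)
  have "?D h = (\<Sum>k\<in>UNIV. h $ k *\<^sub>R partial_deriv k f x)" for h
  proof -
    have "?D h = ?D (\<Sum>k\<in>UNIV. (h $ k) *\<^sub>R axis k 1)"
      by (metis (no_types, lifting) basis_expansion scalar_mult_eq_scaleR sum.cong)
    then show ?thesis
      by (simp add: sum scaleR partial_deriv_def)
  qed
  then show ?thesis
    using D by (metis (no_types, lifting) ext)
qed

lemma has_derivative_cong_open: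
  assumes "open U" "x \<in> U" "\<And>y. y \<in> U \<Longrightarrow> f y = g y"
  shows "(f has_derivative D) (at x) \<longleftrightarrow> (g has_derivative D) (at x)"
  by (metis assms has_derivative_transform_within_open)

lemma differentiable_cong_open:
  assumes "open U" "x \<in> U" "\<And>y. y \<in> U \<Longrightarrow> f y = g y"
  shows "f differentiable (at x) \<longleftrightarrow> g differentiable (at x)"
  unfolding differentiable_def using has_derivative_cong_open[OF assms] by simp

lemma partial_deriv_cong:
  assumes "open U" "x \<in> U" "\<And>y. y \<in> U \<Longrightarrow> f y = g y"
  shows "partial_deriv k f x = partial_deriv k g x"
  unfolding partial_deriv_def frechet_derivative_def
  using has_derivative_cong_open[OF assms] by simp

lemma partial_derivs_Nil [simp]: "partial_derivs [] f = f"
  and partial_derivs_Cons [simp]: "partial_derivs (k # ks) f = partial_derivs ks (partial_deriv k f)"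
  and partial_derivs_append: "partial_derivs (ks @ ls) f = partial_derivs ls (partial_derivs ks f)"
  by (simp_all add: partial_derivs_def)

lemma partial_derivs_cong:
  assumes "open U" "x \<in> U" "\<And>y. y \<in> U \<Longrightarrow> f y = g y"
  shows "partial_derivs ks f x = partial_derivs ks g x"
  using assms(2,3)
proof (induction ks arbitrary: f g x)
  case (Cons k ks)
  have "partial_deriv k f y = partial_deriv k g y" if "y \<in> U" for y
    by (rule partial_deriv_cong[OF assms(1) that Cons.prems(2)])
  from Cons.IH[OF Cons.prems(1) this] show ?case
    by simp
qed simp

lemma smooth_fun_onD: "smooth_fun_on U f \<Longrightarrow> x \<in> U \<Longrightarrow> f differentiable (at x)"
  unfolding smooth_fun_on_def by (metis partial_derivs_Nil)

lemma smooth_partial_derivs: "smooth_fun_on U f \<Longrightarrow> smooth_fun_on U (partial_derivs ks f)"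
  unfolding smooth_fun_on_def by (metis partial_derivs_append)

lemma smooth_partial_deriv: "smooth_fun_on U f \<Longrightarrow> smooth_fun_on U (partial_deriv k f)"
  using smooth_partial_derivs[of U f "[k]"] by simp

lemma smooth_fun_on_subset: "smooth_fun_on U f \<Longrightarrow> V \<subseteq> U \<Longrightarrow> smooth_fun_on V f"
  unfolding smooth_fun_on_def by blast

lemma smooth_fun_on_local:
  assumes "\<And>x. x \<in> U \<Longrightarrow> \<exists>V. x \<in> V \<and> smooth_fun_on V f"
  shows "smooth_fun_on U f"
  using assms unfolding smooth_fun_on_def by blast

lemma smooth_fun_on_cong:
  assumes "open U" "\<And>y. y \<in> U \<Longrightarrow> f y = g y"
  shows "smooth_fun_on U f \<longleftrightarrow> smooth_fun_on U g"
proof -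
  have "partial_derivs ks f differentiable (at x) \<longleftrightarrow> partial_derivs ks g differentiable (at x)"
    if "x \<in> U" for ks x
    by (rule differentiable_cong_open[OF assms(1) that]) (use partial_derivs_cong assms in metis)
  then show ?thesis
    by (simp add: smooth_fun_on_def)
qed

lemma smooth_fun_on_continuous: "smooth_fun_on U f \<Longrightarrow> continuous_on U f"
  by (meson continuous_at_imp_continuous_on differentiable_imp_continuous_within smooth_fun_onD)

lemma smooth_has_derivative:
  "smooth_fun_on U f \<Longrightarrow> x \<in> U \<Longrightarrow>
   (f has_derivative (\<lambda>h. \<Sum>k\<in>UNIV. h $ k *\<^sub>R partial_deriv k f x)) (at x)"
  by (simp add: has_derivative_partial_deriv smooth_fun_onD)

text \<open>Iterated partial derivatives never leave a class closed under partial differentiation,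
  so differentiability of its members is enough. Derivatives have to agree with members on U only;
  as U is open, further derivatives on U are not affected.\<close>

lemma smooth_fun_on_coinduct:
  assumes "open U" "R f"
    and diff: "\<And>f x. R f \<Longrightarrow> x \<in> U \<Longrightarrow> f differentiable (at x)"
    and step: "\<And>f k. R f \<Longrightarrow> \<exists>g. R g \<and> (\<forall>x\<in>U. partial_deriv k f x = g x)"
  shows "smooth_fun_on U f"
proof -
  have *: "\<exists>g. R g \<and> (\<forall>x\<in>U. partial_derivs ks f x = g x)" for ks
  proof (induction ks rule: rev_induct)
    case Nil
    then show ?case using assms(2) by auto
  next
    case (snoc k ks)
    then obtain g where "R g" and g: "\<And>x. x \<in> U \<Longrightarrow> partial_derivs ks f x = g x" by blast
    then obtain h where "R h" "\<forall>x\<in>U. partial_deriv k g x = h x" using step by blast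
    moreover have "partial_derivs (ks @ [k]) f x = partial_deriv k g x" if "x \<in> U" for x
      using partial_deriv_cong[OF assms(1) that g] by (simp add: partial_derivs_append)
    ultimately show ?case by auto
  qed
  show ?thesis
    unfolding smooth_fun_on_def
  proof (intro allI ballI)
    fix ks x
    assume "x \<in> U"
    obtain g where "R g" and g: "\<And>x. x \<in> U \<Longrightarrow> partial_derivs ks f x = g x"
      using *[of ks] by blast
    show "partial_derivs ks f differentiable (at x)"
      using differentiable_cong_open[OF assms(1) \<open>x \<in> U\<close> g] diff[OF \<open>R g\<close> \<open>x \<in> U\<close>] by simp
  qed
qed

text \<open>Polynomials in the generators G. Product and chain rule turn generators into such
  polynomials, so these form a class to which \<open>smooth_fun_on_coinduct\<close> applies even
  where the generators alone do not.\<close>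

inductive_set smooth_alg :: "('a \<Rightarrow> complex) set \<Rightarrow> ('a \<Rightarrow> complex) set" for G where
  const: "(\<lambda>x. c) \<in> smooth_alg G"
| base: "g \<in> G \<Longrightarrow> g \<in> smooth_alg G"
| add: "f \<in> smooth_alg G \<Longrightarrow> g \<in> smooth_alg G \<Longrightarrow> (\<lambda>x. f x + g x) \<in> smooth_alg G"
| mult: "f \<in> smooth_alg G \<Longrightarrow> g \<in> smooth_alg G \<Longrightarrow> (\<lambda>x. f x * g x) \<in> smooth_alg G"

lemma partial_deriv_const: "partial_deriv k (\<lambda>x. c) x = 0"
  by (rule partial_deriv_eqI[OF has_derivative_const])

lemma partial_deriv_add:
  assumes "f differentiable (at x)" "g differentiable (at x)"
  shows "partial_deriv k (\<lambda>x. f x + g x) x = partial_deriv k f x + partial_deriv k g x"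
  unfolding partial_deriv_def[of k f] partial_deriv_def[of k g]
  by (rule partial_deriv_eqI) (use assms frechet_derivative_works in \<open>auto intro!: has_derivative_add\<close>)

lemma partial_deriv_mult:
  assumes "f differentiable (at x)" "g differentiable (at x)"
  shows "partial_deriv k (\<lambda>x. f x * g x) x = f x * partial_deriv k g x + partial_deriv k f x * g x"
  unfolding partial_deriv_def[of k f] partial_deriv_def[of k g]
  by (rule partial_deriv_eqI[OF has_derivative_mult]) (use assms frechet_derivative_works in auto)

lemma smooth_alg_smooth:
  fixes G :: "(real ^ 'n::finite \<Rightarrow> complex) set"
  assumes "open U" "f \<in> smooth_alg G"
    and diff: "\<And>g x. g \<in> G \<Longrightarrow> x \<in> U \<Longrightarrow> g differentiable (at x)"
    and step: "\<And>g k. g \<in> G \<Longrightarrow> \<exists>h\<in>smooth_alg G. \<forall>x\<in>U. partial_deriv k g x = h x"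
  shows "smooth_fun_on U f"
proof -
  have d: "f differentiable (at x)" if "f \<in> smooth_alg G" "x \<in> U" for f x
    using that by (induction rule: smooth_alg.induct) (auto simp: diff)
  show ?thesis
  proof (rule smooth_fun_on_coinduct[where R = "\<lambda>f. f \<in> smooth_alg G"])
    fix f k
    assume "f \<in> smooth_alg G"
    then show "\<exists>g. g \<in> smooth_alg G \<and> (\<forall>x\<in>U. partial_deriv k f x = g x)"
    proof (induction rule: smooth_alg.induct)
      case (const c)
      show ?case
        by (rule exI[of _ "\<lambda>x. 0"]) (simp add: partial_deriv_const smooth_alg.const)
    next
      case (base g)
      then show ?case using step by blast
    next
      case (add f g)
      then obtain f' g' where "f' \<in> smooth_alg G" "g' \<in> smooth_alg G"
        "\<forall>x\<in>U. partial_deriv k f x = f' x" "\<forall>x\<in>U. partial_deriv k g x = g' x" by blast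
      then show ?case
        by (intro exI[of _ "\<lambda>x. f' x + g' x"])
          (simp add: partial_deriv_add d add smooth_alg.add)
    next
      case (mult f g)
      then obtain f' g' where "f' \<in> smooth_alg G" "g' \<in> smooth_alg G"
        "\<forall>x\<in>U. partial_deriv k f x = f' x" "\<forall>x\<in>U. partial_deriv k g x = g' x" by blast
      then show ?case
        by (intro exI[of _ "\<lambda>x. f x * g' x + f' x * g x"])
          (simp add: partial_deriv_mult d mult smooth_alg.add smooth_alg.mult)
    qed
  qed (use assms d in auto)
qed

lemma smooth_alg_smooth_funs:
  assumes "open U" "f \<in> smooth_alg {f. smooth_fun_on U f}"
  shows "smooth_fun_on U f"
  using assms
  by (rule smooth_alg_smooth) (auto simp: smooth_fun_onD intro!: smooth_alg.base smooth_partial_deriv)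

lemma smooth_const: "open U \<Longrightarrow> smooth_fun_on U (\<lambda>x. c)"
  by (intro smooth_alg_smooth_funs) (auto intro: smooth_alg.intros)

lemma smooth_add: "open U \<Longrightarrow> smooth_fun_on U f \<Longrightarrow> smooth_fun_on U g \<Longrightarrow> smooth_fun_on U (\<lambda>x. f x + g x)"
  by (intro smooth_alg_smooth_funs) (auto intro: smooth_alg.intros)

lemma smooth_mult: "open U \<Longrightarrow> smooth_fun_on U f \<Longrightarrow> smooth_fun_on U g \<Longrightarrow> smooth_fun_on U (\<lambda>x. f x * g x)"
  by (intro smooth_alg_smooth_funs) (auto intro: smooth_alg.intros)

lemma smooth_cmult: "open U \<Longrightarrow> smooth_fun_on U f \<Longrightarrow> smooth_fun_on U (\<lambda>x. c * f x)"
  by (intro smooth_mult smooth_const)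

lemma smooth_minus: "open U \<Longrightarrow> smooth_fun_on U f \<Longrightarrow> smooth_fun_on U (\<lambda>x. - f x)"
  using smooth_cmult[of U f "-1"] by simp

lemma smooth_diff: "open U \<Longrightarrow> smooth_fun_on U f \<Longrightarrow> smooth_fun_on U g \<Longrightarrow> smooth_fun_on U (\<lambda>x. f x - g x)"
  using smooth_add[of U f "\<lambda>x. - g x"] smooth_minus by force

lemma smooth_sum:
  "open U \<Longrightarrow> (\<And>i. i \<in> I \<Longrightarrow> smooth_fun_on U (f i)) \<Longrightarrow> smooth_fun_on U (\<lambda>x. \<Sum>i\<in>I. f i x)"
  by (induction I rule: infinite_finite_induct) (auto simp: smooth_const smooth_add)

text \<open>With 1/f as an additional generator, its derivative -(1/f) f' (1/f) is again a
  polynomial in generators.\<close>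

lemma smooth_inverse:
  assumes "open U" "smooth_fun_on U f" "\<And>x. x \<in> U \<Longrightarrow> f x \<noteq> 0"
  shows "smooth_fun_on U (\<lambda>x. inverse (f x))"
proof (rule smooth_alg_smooth[where G = "{f. smooth_fun_on U f} \<union> {\<lambda>x. inverse (f x)}", OF assms(1)])
  let ?G = "{f. smooth_fun_on U f} \<union> {\<lambda>x. inverse (f x)}"
  show "(\<lambda>x. inverse (f x)) \<in> smooth_alg ?G"
    by (rule smooth_alg.base) auto
  show "g differentiable (at x)" if "g \<in> ?G" "x \<in> U" for g x
    using that assms smooth_fun_onD by (fastforce intro: derivative_intros)
  show "\<exists>h\<in>smooth_alg ?G. \<forall>x\<in>U. partial_deriv k g x = h x" if "g \<in> ?G" for g k
  proof (cases "smooth_fun_on U g")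
    case True
    then show ?thesis by (intro bexI[of _ "partial_deriv k g"]) (auto intro: smooth_alg.base smooth_partial_deriv)
  next
    case False
    with that have g: "g = (\<lambda>x. inverse (f x))" by auto
    let ?h = "\<lambda>x. (-1) * ((inverse (f x) * partial_deriv k f x) * inverse (f x))"
    have "(\<lambda>x. inverse (f x)) \<in> ?G" "partial_deriv k f \<in> ?G"
      using assms(2) smooth_partial_deriv by blast+
    then have h: "?h \<in> smooth_alg ?G"
      by (intro smooth_alg.mult smooth_alg.const smooth_alg.base)
    have "partial_deriv k g x = ?h x" if "x \<in> U" for x
    proof -
      have "(f has_derivative frechet_derivative f (at x)) (at x)"
        using assms that frechet_derivative_works smooth_fun_onD by blast
      from Deriv.has_derivative_inverse[OF _ this] assms(3) that show ?thesis
        unfolding g by (subst partial_deriv_eqI) (auto simp: partial_deriv_def)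
    qed
    then show ?thesis
      by (intro bexI[OF _ h] ballI)
  qed
qed

section \<open>Affine substitutions and linearity of iterated derivatives\<close>

lemma partial_deriv_affine:
  assumes "f differentiable (at (c *\<^sub>R x + a))"
  shows "(\<lambda>x. f (c *\<^sub>R x + a)) differentiable (at x)"
    and "partial_deriv k (\<lambda>x. f (c *\<^sub>R x + a)) x = c *\<^sub>R partial_deriv k f (c *\<^sub>R x + a)"
proof -
  let ?D = "frechet_derivative f (at (c *\<^sub>R x + a))"
  have D: "(f has_derivative ?D) (at (c *\<^sub>R x + a))"
    using assms frechet_derivative_works by blast
  then have *: "((\<lambda>x. f (c *\<^sub>R x + a)) has_derivative (\<lambda>h. ?D (c *\<^sub>R h))) (at x)"
    by (rule has_derivative_compose[rotated]) (auto intro!: derivative_eq_intros)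
  then show "(\<lambda>x. f (c *\<^sub>R x + a)) differentiable (at x)"
    by (auto simp: differentiable_def)
  have "bounded_linear ?D"
    using D by (rule has_derivative_bounded_linear)
  then show "partial_deriv k (\<lambda>x. f (c *\<^sub>R x + a)) x = c *\<^sub>R partial_deriv k f (c *\<^sub>R x + a)"
    unfolding partial_deriv_eqI[OF *]
    by (simp add: partial_deriv_def linear_simps)
qed

lemma smooth_affine:
  assumes "open U" "open V" "smooth_fun_on U f" "\<And>x. x \<in> V \<Longrightarrow> c *\<^sub>R x + a \<in> U"
  shows "smooth_fun_on V (\<lambda>x. f (c *\<^sub>R x + a))"
proof (rule smooth_fun_on_coinduct[OF \<open>open V\<close>,
      where R = "\<lambda>g. \<exists>\<phi>. smooth_fun_on U \<phi> \<and> g = (\<lambda>x. \<phi> (c *\<^sub>R x + a))"], goal_cases)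
  case 1
  then show ?case using assms by blast
next
  case (2 g x)
  then show ?case using partial_deriv_affine(1) smooth_fun_onD assms(4) by blast
next
  case (3 g k)
  then obtain \<phi> where \<phi>: "smooth_fun_on U \<phi>" "g = (\<lambda>x. \<phi> (c *\<^sub>R x + a))" by blast
  then show ?case
    using assms
    by (intro exI[of _ "\<lambda>x. complex_of_real c * partial_deriv k \<phi> (c *\<^sub>R x + a)"])
      (auto simp: partial_deriv_affine(2) smooth_fun_onD scaleR_conv_of_real[where 'a=complex]
        intro!: exI[of _ "\<lambda>x. complex_of_real c * partial_deriv k \<phi> x"] smooth_cmult smooth_partial_deriv)
qed

lemma partial_deriv_affine_UNIV:
  assumes "smooth_fun_on UNIV f"
  shows "partial_deriv k (\<lambda>x. f (c *\<^sub>R x + a)) = (\<lambda>x. complex_of_real c * partial_deriv k f (c *\<^sub>R x + a))"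
  using assms by (auto simp: fun_eq_iff partial_deriv_affine(2) smooth_fun_onD scaleR_conv_of_real[where 'a=complex])

lemma partial_deriv_cmult:
  assumes "f differentiable (at x)"
  shows "partial_deriv k (\<lambda>x. c * f x) x = c * partial_deriv k f x"
  using assms by (simp add: partial_deriv_mult partial_deriv_const)

lemma partial_derivs_affine:
  assumes "smooth_fun_on UNIV f"
  shows "partial_derivs ks (\<lambda>x. f (c *\<^sub>R x + a)) =
    (\<lambda>x. complex_of_real c ^ length ks * partial_derivs ks f (c *\<^sub>R x + a))"
  using assms
proof (induction ks rule: rev_induct)
  case (snoc k ks)
  have sm: "smooth_fun_on UNIV (\<lambda>x. partial_derivs ks f (c *\<^sub>R x + a))"
    by (rule smooth_affine[where U=UNIV]) (auto simp: snoc.prems smooth_partial_derivs)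
  show ?case
    unfolding partial_derivs_append snoc.IH[OF snoc.prems]
    using snoc.prems partial_deriv_affine_UNIV[of "partial_derivs ks f" k c a]
    by (auto simp: fun_eq_iff partial_deriv_cmult smooth_fun_onD[OF sm] smooth_partial_derivs)
qed auto

lemma partial_derivs_add:
  assumes "open U" "smooth_fun_on U f" "smooth_fun_on U g" "x \<in> U"
  shows "partial_derivs ks (\<lambda>x. f x + g x) x = partial_derivs ks f x + partial_derivs ks g x"
  using assms(4)
proof (induction ks arbitrary: x rule: rev_induct)
  case (snoc k ks)
  have "partial_derivs (ks @ [k]) (\<lambda>x. f x + g x) x = partial_deriv k (\<lambda>x. partial_derivs ks f x + partial_derivs ks g x) x"
    by (simp add: partial_derivs_append partial_deriv_cong[OF assms(1) snoc.prems snoc.IH])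
  then show ?case
    using assms snoc by (simp add: partial_derivs_append partial_deriv_add smooth_fun_onD[OF smooth_partial_derivs])
qed auto

lemma partial_derivs_cmult:
  assumes "open U" "smooth_fun_on U f" "x \<in> U"
  shows "partial_derivs ks (\<lambda>x. c * f x) x = c * partial_derivs ks f x"
  using assms(3)
proof (induction ks arbitrary: x rule: rev_induct)
  case (snoc k ks)
  have "partial_derivs (ks @ [k]) (\<lambda>x. c * f x) x = partial_deriv k (\<lambda>x. c * partial_derivs ks f x) x"
    by (simp add: partial_derivs_append partial_deriv_cong[OF assms(1) snoc.prems snoc.IH])
  then show ?case
    using assms snoc by (simp add: partial_derivs_append partial_deriv_cmult smooth_fun_onD[OF smooth_partial_derivs])
qed auto

lemma partial_derivs_diff:
  assumes "open U" "smooth_fun_on U f" "smooth_fun_on U g" "x \<in> U"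
  shows "partial_derivs ks (\<lambda>x. f x - g x) x = partial_derivs ks f x - partial_derivs ks g x"
  using partial_derivs_add[OF assms(1,2) smooth_cmult[OF assms(1,3), of "-1"] assms(4)]
    partial_derivs_cmult[OF assms(1,3,4), of _ "-1"] by simp

lemma has_vector_derivative_line:
  assumes "smooth_fun_on U f" "x + t *\<^sub>R e \<in> U"
  shows "((\<lambda>t. f (x + t *\<^sub>R e)) has_vector_derivative
     (\<Sum>k\<in>UNIV. e $ k *\<^sub>R partial_deriv k f (x + t *\<^sub>R e))) (at t within T)"
proof -
  have "((\<lambda>t. x + t *\<^sub>R e) has_derivative (\<lambda>h. h *\<^sub>R e)) (at t within T)"
    by (auto intro!: derivative_eq_intros)
  from has_derivative_compose[OF this, of f, OF smooth_has_derivative[OF assms]] show ?thesis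
    by (simp add: has_vector_derivative_def scaleR_sum_right)
qed

lemma axis_sum: "(\<Sum>k\<in>UNIV. axis j (1::real) $ k *\<^sub>R (g k :: complex)) = g j"
  by (simp add: axis_def if_distrib[of "\<lambda>a. a *\<^sub>R _"] cong: if_cong)

text \<open>Differentiate \<open>f(x+se\<^sub>j+te\<^sub>k) - f(x+se\<^sub>j) = \<integral>\<^sub>0\<^sup>t \<partial>\<^sub>kf(x+se\<^sub>j+\<tau>e\<^sub>k) d\<tau>\<close> first in \<open>s\<close>, then in \<open>t\<close>.\<close>
lemma partial_deriv_commute:
  fixes f :: "real ^ 'n::finite \<Rightarrow> complex"
  assumes U: "open U" and f: "smooth_fun_on U f" and x: "x \<in> U"
  shows "partial_deriv j (partial_deriv k f) x = partial_deriv k (partial_deriv j f) x"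
proof -
  let ?ej = "axis j (1::real) :: real^'n" and ?ek = "axis k (1::real) :: real^'n"
  obtain e where e: "e > 0" "ball x e \<subseteq> U" using U x openE by blast
  define d where "d = e / 3"
  have d: "d > 0" using e by (simp add: d_def)
  have in_ball: "x + s *\<^sub>R ?ej + t *\<^sub>R ?ek \<in> U" if "\<bar>s\<bar> \<le> d" "\<bar>t\<bar> \<le> d" for s t
  proof -
    have "norm (s *\<^sub>R ?ej + t *\<^sub>R ?ek) \<le> \<bar>s\<bar> + \<bar>t\<bar>"
      by (rule order_trans[OF norm_triangle_ineq]) simp
    also have "\<dots> < e" using that d by (simp add: d_def)
    finally have "x + (s *\<^sub>R ?ej + t *\<^sub>R ?ek) \<in> ball x e"
      by (simp only: mem_ball dist_norm) (metis add_diff_cancel_left' norm_minus_commute)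
    then show ?thesis
      using e by (auto simp: add.assoc)
  qed
  have in_ball0: "x + t *\<^sub>R ?ek \<in> U" "x + t *\<^sub>R ?ej \<in> U" if "\<bar>t\<bar> \<le> d" for t
    using in_ball[of 0 t] in_ball[of t 0] that d by auto
  have swap: "x + s *\<^sub>R ?ej + t *\<^sub>R ?ek = (x + t *\<^sub>R ?ek) + s *\<^sub>R ?ej" for s t
    by simp
  note cont = continuous_on_compose2[OF smooth_fun_on_continuous]
  have A: "partial_deriv j f (x + t *\<^sub>R ?ek) - partial_deriv j f x
        = integral {0..t} (\<lambda>\<tau>. partial_deriv j (partial_deriv k f) (x + \<tau> *\<^sub>R ?ek))"
    if t: "0 \<le> t" "t \<le> d" for t
  proof -
    have ftc: "integral {0..t} (\<lambda>\<tau>. partial_deriv k f (x + s *\<^sub>R ?ej + \<tau> *\<^sub>R ?ek)) =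
        f (x + s *\<^sub>R ?ej + t *\<^sub>R ?ek) - f (x + s *\<^sub>R ?ej)" if "\<bar>s\<bar> \<le> d" for s
    proof -
      have "((\<lambda>\<tau>. f (x + s *\<^sub>R ?ej + \<tau> *\<^sub>R ?ek)) has_vector_derivative
          partial_deriv k f (x + s *\<^sub>R ?ej + \<tau> *\<^sub>R ?ek)) (at \<tau> within {0..t})" if "\<tau> \<in> {0..t}" for \<tau>
        using has_vector_derivative_line[OF f, of "x + s *\<^sub>R ?ej" \<tau> ?ek "{0..t}"]
          in_ball[of s \<tau>] \<open>\<bar>s\<bar> \<le> d\<close> that t by (simp add: axis_sum)
      from fundamental_theorem_of_calculus[OF t(1) this] show ?thesis
        by (simp add: integral_unique)
    qed
    have "((\<lambda>s. integral (cbox 0 t) (\<lambda>\<tau>. partial_deriv k f (x + s *\<^sub>R ?ej + \<tau> *\<^sub>R ?ek)))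
      has_vector_derivative integral (cbox 0 t) (\<lambda>\<tau>. partial_deriv j (partial_deriv k f) (x + 0 *\<^sub>R ?ej + \<tau> *\<^sub>R ?ek)))
      (at 0 within {-d<..<d})"
    proof (rule leibniz_rule_vector_derivative)
      fix s \<tau> assume *: "s \<in> {-d<..<d}" "\<tau> \<in> cbox 0 t"
      have "x + s *\<^sub>R ?ej + \<tau> *\<^sub>R ?ek \<in> U"
        by (rule in_ball) (use * t in auto)
      then show "((\<lambda>s. partial_deriv k f (x + s *\<^sub>R ?ej + \<tau> *\<^sub>R ?ek)) has_vector_derivative
          partial_deriv j (partial_deriv k f) (x + s *\<^sub>R ?ej + \<tau> *\<^sub>R ?ek)) (at s within {-d<..<d})"
        using has_vector_derivative_line[OF smooth_partial_deriv[OF f], of "x + \<tau> *\<^sub>R ?ek" s ?ej k "{-d<..<d}"]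
        unfolding swap by (simp add: axis_sum)
    next
      fix s assume "s \<in> {-d<..<d}"
      then show "(\<lambda>\<tau>. partial_deriv k f (x + s *\<^sub>R ?ej + \<tau> *\<^sub>R ?ek)) integrable_on cbox 0 t"
        using t by (intro integrable_continuous cont[OF smooth_partial_deriv[OF f]])
          (auto intro!: continuous_intros in_ball)
    next
      show "continuous_on ({-d<..<d} \<times> cbox 0 t)
        (\<lambda>(s, \<tau>). partial_deriv j (partial_deriv k f) (x + s *\<^sub>R ?ej + \<tau> *\<^sub>R ?ek))"
        unfolding split_beta
        using t by (intro cont[OF smooth_partial_deriv[OF smooth_partial_deriv[OF f]]])
          (auto intro!: continuous_intros in_ball)
    qed (use d in auto)
    moreover have "at 0 within {-d<..<d} = at 0"
      by (rule at_within_open) (use d in auto)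
    ultimately have "((\<lambda>s. integral (cbox 0 t) (\<lambda>\<tau>. partial_deriv k f (x + s *\<^sub>R ?ej + \<tau> *\<^sub>R ?ek)))
      has_vector_derivative integral {0..t} (\<lambda>\<tau>. partial_deriv j (partial_deriv k f) (x + \<tau> *\<^sub>R ?ek))) (at 0)"
      by (simp only: cbox_interval scaleR_zero_left add_0_right)
    then have "((\<lambda>s. f (x + s *\<^sub>R ?ej + t *\<^sub>R ?ek) - f (x + s *\<^sub>R ?ej))
      has_vector_derivative integral {0..t} (\<lambda>\<tau>. partial_deriv j (partial_deriv k f) (x + \<tau> *\<^sub>R ?ek))) (at 0)"
      by (rule has_vector_derivative_transform_within_open[where S = "{-d<..<d}"])
        (use d in \<open>auto simp: cbox_interval ftc\<close>)
    moreover have "((\<lambda>s. f (x + s *\<^sub>R ?ej + t *\<^sub>R ?ek) - f (x + s *\<^sub>R ?ej))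
      has_vector_derivative partial_deriv j f (x + t *\<^sub>R ?ek) - partial_deriv j f x) (at 0)"
      using has_vector_derivative_diff[OF has_vector_derivative_line[OF f, of "x + t *\<^sub>R ?ek" 0 ?ej UNIV]
        has_vector_derivative_line[OF f, of "x" 0 ?ej UNIV]] in_ball0[of t] t x
      by (simp add: axis_sum algebra_simps)
    ultimately show ?thesis using vector_derivative_unique_at by blast
  qed
  have "((\<lambda>t. integral {0..t} (\<lambda>\<tau>. partial_deriv j (partial_deriv k f) (x + \<tau> *\<^sub>R ?ek)))
     has_vector_derivative partial_deriv j (partial_deriv k f) (x + 0 *\<^sub>R ?ek)) (at 0 within {0..d})"
    using d by (intro integral_has_vector_derivative cont[OF smooth_partial_deriv[OF smooth_partial_deriv[OF f]]])
        (auto intro!: continuous_intros in_ball0)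
  then have "((\<lambda>t. partial_deriv j f (x + t *\<^sub>R ?ek) - partial_deriv j f x)
     has_vector_derivative partial_deriv j (partial_deriv k f) x) (at 0 within {0..d})"
    unfolding scaleR_zero_left add_0_right
    by (rule has_vector_derivative_transform[rotated 2]) (use d A in auto)
  moreover have "((\<lambda>t. partial_deriv j f (x + t *\<^sub>R ?ek) - partial_deriv j f x)
     has_vector_derivative partial_deriv k (partial_deriv j f) x) (at 0 within {0..d})"
    using has_vector_derivative_diff[OF has_vector_derivative_line[OF smooth_partial_deriv[OF f], of "x" 0 ?ek j "{0..d}"]
       has_vector_derivative_const] x by (simp add: axis_sum)
  moreover have "at (0::real) within {0..d} \<noteq> bot"
    using d by (simp add: at_within_Icc_at_right)
  ultimately show ?thesis
    using vector_derivative_unique_within by blast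
qed

subsection \<open>Test functions\<close>

lemma closed_fun_support: "closed (fun_support f)"
  by (simp add: fun_support_def)

lemma not_in_fun_support: "x \<notin> fun_support f \<Longrightarrow> f x = 0"
  unfolding fun_support_def using closure_subset[of "{x. f x \<noteq> 0}"] by auto

lemma fun_support_subset: "closed S \<Longrightarrow> (\<And>x. f x \<noteq> 0 \<Longrightarrow> x \<in> S) \<Longrightarrow> fun_support f \<subseteq> S"
  unfolding fun_support_def by (rule closure_minimal) auto

lemma fun_support_partial_deriv: "fun_support (partial_deriv k f) \<subseteq> fun_support f"
proof (rule fun_support_subset[OF closed_fun_support], rule ccontr)
  fix x assume *: "partial_deriv k f x \<noteq> 0" "x \<notin> fun_support f"
  have "partial_deriv k f x = partial_deriv k (\<lambda>_. 0) x"
    by (rule partial_deriv_cong[of "- fun_support f"])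
      (use * in \<open>auto simp: closed_fun_support not_in_fun_support\<close>)
  with * show False by (simp add: partial_deriv_const)
qed

lemma partial_deriv_outside_support: "x \<notin> fun_support f \<Longrightarrow> partial_deriv k f x = 0"
  using fun_support_partial_deriv[of k f] not_in_fun_support[of x "partial_deriv k f"] by auto

lemma fun_support_partial_derivs: "fun_support (partial_derivs ks f) \<subseteq> fun_support f"
proof (induction ks arbitrary: f)
  case (Cons k ks)
  then show ?case using fun_support_partial_deriv by fastforce
qed auto

lemma test_funsI:
  "smooth_fun_on UNIV \<phi> \<Longrightarrow> compact S \<Longrightarrow> S \<subseteq> U \<Longrightarrow> (\<And>x. \<phi> x \<noteq> 0 \<Longrightarrow> x \<in> S) \<Longrightarrow> \<phi> \<in> test_funs U"
  unfolding test_funs_def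
  using fun_support_subset[of S \<phi>] closed_Int_compact[OF closed_fun_support[of \<phi>], of S]
  by (auto simp: compact_imp_closed Int_absorb2)

lemma test_funsD:
  assumes "\<phi> \<in> test_funs U"
  shows "smooth_fun_on UNIV \<phi>" "compact (fun_support \<phi>)" "fun_support \<phi> \<subseteq> U"
  using assms by (auto simp: test_funs_def)

lemma test_funs_mono: "\<phi> \<in> test_funs U \<Longrightarrow> U \<subseteq> V \<Longrightarrow> \<phi> \<in> test_funs V"
  by (auto simp: test_funs_def)

lemma test_funs_zero: "(\<lambda>x. 0) \<in> test_funs U"
  by (rule test_funsI[of _ "{}"]) (auto simp: smooth_const)

lemma test_funs_add:
  assumes "\<phi> \<in> test_funs U" "\<psi> \<in> test_funs U"
  shows "(\<lambda>x. \<phi> x + \<psi> x) \<in> test_funs U"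
proof (rule test_funsI[of _ "fun_support \<phi> \<union> fun_support \<psi>"])
  fix x assume "\<phi> x + \<psi> x \<noteq> 0"
  then show "x \<in> fun_support \<phi> \<union> fun_support \<psi>"
    using not_in_fun_support[of x \<phi>] not_in_fun_support[of x \<psi>] by (cases "\<phi> x = 0") auto
qed (use assms in \<open>auto simp: test_funs_def intro: smooth_add\<close>)

text \<open>Nothing is known about f outside U. But U and the complement of the support of \<phi>
  are open and cover the space, and on the second set the product is 0.\<close>

lemma test_funs_smooth_mult:
  assumes "open U" "smooth_fun_on U f" "\<phi> \<in> test_funs U"
  shows "(\<lambda>x. f x * \<phi> x) \<in> test_funs U"
proof (rule test_funsI[of _ "fun_support \<phi>"])
  show "smooth_fun_on UNIV (\<lambda>x. f x * \<phi> x)"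
  proof (rule smooth_fun_on_local)
    fix x
    have 1: "smooth_fun_on U (\<lambda>x. f x * \<phi> x)"
      by (intro smooth_mult assms smooth_fun_on_subset[OF test_funsD(1)[OF assms(3)]]) auto
    have "smooth_fun_on (- fun_support \<phi>) (\<lambda>x. f x * \<phi> x) \<longleftrightarrow> smooth_fun_on (- fun_support \<phi>) (\<lambda>x. 0)"
      by (rule smooth_fun_on_cong) (auto simp: closed_fun_support not_in_fun_support)
    then have 2: "smooth_fun_on (- fun_support \<phi>) (\<lambda>x. f x * \<phi> x)"
      by (simp add: smooth_const open_Compl closed_fun_support)
    show "\<exists>V. x \<in> V \<and> smooth_fun_on V (\<lambda>x. f x * \<phi> x)"
      using 1 2 test_funsD(3)[OF assms(3)] by (metis ComplI subsetD)
  qed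
  show "x \<in> fun_support \<phi>" if "f x * \<phi> x \<noteq> 0" for x
    using that not_in_fun_support[of x \<phi>] by auto
qed (use assms in \<open>auto simp: test_funs_def\<close>)

lemma test_funs_cmult: "open U \<Longrightarrow> \<phi> \<in> test_funs U \<Longrightarrow> (\<lambda>x. c * \<phi> x) \<in> test_funs U"
  by (rule test_funs_smooth_mult) (auto intro: smooth_const)

lemma test_funs_sum:
  "(\<And>i. i \<in> I \<Longrightarrow> \<phi> i \<in> test_funs U) \<Longrightarrow> (\<lambda>x. \<Sum>i\<in>I. \<phi> i x) \<in> test_funs U"
  by (induction I rule: infinite_finite_induct) (auto simp: test_funs_zero test_funs_add)

lemma test_funs_partial_derivs: "\<phi> \<in> test_funs U \<Longrightarrow> partial_derivs ks \<phi> \<in> test_funs U"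
  by (rule test_funsI[of _ "fun_support \<phi>"])
    (use fun_support_partial_derivs not_in_fun_support[of _ "partial_derivs ks \<phi>"] in
      \<open>auto simp: test_funs_def smooth_partial_derivs\<close>)

lemma test_funs_partial_deriv: "\<phi> \<in> test_funs U \<Longrightarrow> partial_deriv k \<phi> \<in> test_funs U"
  using test_funs_partial_derivs[of \<phi> U "[k]"] by simp

lemma test_funs_affine:
  assumes "\<phi> \<in> test_funs U" "c \<noteq> 0" "\<And>x. c *\<^sub>R x + a \<in> fun_support \<phi> \<Longrightarrow> x \<in> V"
  shows "(\<lambda>x. \<phi> (c *\<^sub>R x + a)) \<in> test_funs V"
proof (rule test_funsI[of _ "(\<lambda>y. (1/c) *\<^sub>R (y - a)) ` fun_support \<phi>"])
  show "smooth_fun_on UNIV (\<lambda>x. \<phi> (c *\<^sub>R x + a))"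
    by (rule smooth_affine[OF _ _ test_funsD(1)[OF assms(1)]]) auto
  show "compact ((\<lambda>y. (1/c) *\<^sub>R (y - a)) ` fun_support \<phi>)"
    by (intro compact_continuous_image continuous_intros test_funsD(2)[OF assms(1)])
  show "(\<lambda>y. (1/c) *\<^sub>R (y - a)) ` fun_support \<phi> \<subseteq> V"
    using assms(2,3) by auto
  fix x assume "\<phi> (c *\<^sub>R x + a) \<noteq> 0"
  then have "c *\<^sub>R x + a \<in> fun_support \<phi>" using not_in_fun_support by blast
  then show "x \<in> (\<lambda>y. (1/c) *\<^sub>R (y - a)) ` fun_support \<phi>"
    using assms(2) by (intro image_eqI) auto
qed

section \<open>Bounds and integrals of test functions\<close>

lemma test_funs_continuous: "\<phi> \<in> test_funs U \<Longrightarrow> continuous_on A \<phi>"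
  using smooth_fun_on_continuous[OF test_funsD(1)] continuous_on_subset by blast

lemma test_funs_bounded:
  assumes "\<phi> \<in> test_funs U"
  obtains B where "B \<ge> 0" "\<And>x. cmod (\<phi> x) \<le> B"
proof -
  have "compact (\<phi> ` fun_support \<phi>)"
    by (intro compact_continuous_image test_funs_continuous[OF assms] test_funsD(2)[OF assms])
  then obtain B where B: "\<And>x. x \<in> fun_support \<phi> \<Longrightarrow> cmod (\<phi> x) \<le> B"
    by (meson bounded_iff compact_imp_bounded image_eqI)
  have "cmod (\<phi> x) \<le> \<bar>B\<bar>" for x
    using B[of x] not_in_fun_support[of x \<phi>] by (cases "x \<in> fun_support \<phi>") auto
  then show ?thesis using that[of "\<bar>B\<bar>"] by auto
qed

lemma test_funs_derivs_bounded:
  assumes "\<phi> \<in> test_funs U"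
  obtains B where "B \<ge> 0" "\<And>ks x. length ks \<le> b \<Longrightarrow> cmod (partial_derivs ks \<phi> x) \<le> B"
proof -
  have fin: "finite {ks :: 'a list. length ks \<le> b}"
    using finite_lists_length_le[of "UNIV :: 'a set" b] by simp
  have "\<forall>ks. \<exists>B. B \<ge> 0 \<and> (\<forall>x. cmod (partial_derivs ks \<phi> x) \<le> B)"
    using test_funs_bounded[OF test_funs_partial_derivs[OF assms]] by metis
  then obtain B where B: "\<And>ks. B ks \<ge> 0" "\<And>ks x. cmod (partial_derivs ks \<phi> x) \<le> B ks" by metis
  show ?thesis
  proof (rule that[of "\<Sum>ks\<in>{ks. length ks \<le> b}. B ks"])
    show "cmod (partial_derivs ks \<phi> x) \<le> (\<Sum>ks\<in>{ks. length ks \<le> b}. B ks)" if "length ks \<le> b" for ks x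
      using B(2)[of ks x] member_le_sum[of ks "{ks. length ks \<le> b}" B] B(1) fin that by fastforce
  qed (simp add: B sum_nonneg)
qed

text \<open>Pairings with test functions use the Lebesgue integral, while differentiation under the
  integral and the fundamental theorem of calculus concern integrals over boxes. This is the bridge
  for continuous functions vanishing outside a box.\<close>

lemma lborel_integral_cbox:
  fixes f :: "'a::euclidean_space \<Rightarrow> complex"
  assumes "continuous_on (cbox a b) f" "\<And>x. x \<notin> cbox a b \<Longrightarrow> f x = 0"
  shows "integrable lborel f" "integral\<^sup>L lborel f = integral (cbox a b) f"
proof -
  have "(\<lambda>x. indicator (cbox a b) x *\<^sub>R f x) = f"
    using assms(2) by (auto simp: indicator_def)
  then show int: "integrable lborel f"
    using borel_integrable_compact[OF compact_cbox assms(1)] by simp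
  have "integral\<^sup>L lborel f = integral UNIV f"
    using integral_lborel[OF int] by simp
  also have "\<dots> = integral (cbox a b) f"
    by (rule integral_spike_set) (auto simp: assms(2) intro: negligible_subset[of "{}"])
  finally show "integral\<^sup>L lborel f = integral (cbox a b) f" .
qed

lemma integrable_test_fun:
  assumes "\<phi> \<in> test_funs U"
  shows "integrable lborel \<phi>"
proof -
  obtain a where a: "fun_support \<phi> \<subseteq> cbox (-a) a"
    using bounded_subset_cbox_symmetric[OF compact_imp_bounded[OF test_funsD(2)[OF assms]]] by metis
  show ?thesis
    by (rule lborel_integral_cbox(1)[OF test_funs_continuous[OF assms]], rule not_in_fun_support)
      (use a in auto)
qed

lemma integral_translate:
  fixes f :: "'a::euclidean_space \<Rightarrow> complex"
  shows "(\<integral>x. f (x + a) \<partial>lborel) = (\<integral>x. f x \<partial>lborel)"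
proof (cases "integrable lborel f")
  case True
  then have m: "f \<in> borel_measurable lborel" by auto
  have "(\<integral>x. f x \<partial>lborel) = (\<integral>x. f x \<partial>distr lborel borel ((+) a))"
    by (simp add: lborel_distr_plus)
  also have "\<dots> = (\<integral>x. f (a + x) \<partial>lborel)"
    by (rule integral_distr) (use m in auto)
  finally show ?thesis by (simp add: add.commute)
next
  case False
  \<comment> \<open>Both integrals are 0 by convention once non-integrability is seen to be
    translation invariant too.\<close>
  have "\<not> integrable lborel (\<lambda>x. f (x + a))"
  proof
    assume *: "integrable lborel (\<lambda>x. f (x + a))"
    then have "integrable (distr lborel borel ((+) (-a))) (\<lambda>x. f (x + a))"
      by (simp add: lborel_distr_plus)
    then have "integrable lborel (\<lambda>x. f (- a + x + a))"
      by (subst (asm) integrable_distr_eq) (use * in auto)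
    with False show False by simp
  qed
  with False show ?thesis by (simp add: not_integrable_integral_eq)
qed

text \<open>The integral of \<open>\<phi>(x + te)\<close> does not depend on \<open>t\<close>.\<close>
lemma integral_line_deriv_zero:
  fixes \<phi> :: "'a::euclidean_space \<Rightarrow> complex"
  assumes der: "\<And>x t. ((\<lambda>t. \<phi> (x + t *\<^sub>R e)) has_vector_derivative \<phi>' (x + t *\<^sub>R e)) (at t)"
    and cont: "continuous_on UNIV \<phi>" "continuous_on UNIV \<phi>'"
    and bdd: "bounded {x. \<phi> x \<noteq> 0 \<or> \<phi>' x \<noteq> 0}"
  shows "(\<integral>x. \<phi>' x \<partial>lborel) = 0"
proof -
  obtain r where r: "r > 0" "\<And>x. \<phi> x \<noteq> 0 \<or> \<phi>' x \<noteq> 0 \<Longrightarrow> norm x \<le> r"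
    using bdd unfolding bounded_pos by blast
  \<comment> \<open>One box contains the supports of all translates with |t| \<le> 1, so that the
    Leibniz rule is applied on a fixed domain.\<close>
  obtain c where c: "cball 0 (r + norm e) \<subseteq> cbox (-c) (c::'a)"
    using bounded_subset_cbox_symmetric[OF bounded_cball] by metis
  have out: "norm (x + t *\<^sub>R e) > r" if "x \<notin> cbox (-c) c" "\<bar>t\<bar> \<le> 1" for x t
  proof -
    have "norm x > r + norm e" using c that by (metis mem_cball_0 not_le subsetD)
    moreover have "norm x \<le> norm (x + t *\<^sub>R e) + norm (t *\<^sub>R e)"
      by (metis add_diff_cancel norm_triangle_ineq4)
    moreover have "norm (t *\<^sub>R e) \<le> norm e"
      using that by (simp add: mult_left_le_one_le)
    ultimately show ?thesis by linarith
  qed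
  have I: "integral (cbox (-c) c) (\<lambda>x. \<phi> (x + t *\<^sub>R e)) = (\<integral>x. \<phi> x \<partial>lborel)" if "\<bar>t\<bar> \<le> 1" for t
  proof -
    have "integral (cbox (-c) c) (\<lambda>x. \<phi> (x + t *\<^sub>R e)) = (\<integral>x. \<phi> (x + t *\<^sub>R e) \<partial>lborel)"
      using out that r(2) by (subst lborel_integral_cbox(2)[of "-c" c])
        (auto intro!: continuous_on_compose2[OF cont(1)] continuous_intros simp: not_le[symmetric])
    then show ?thesis by (simp add: integral_translate)
  qed
  have "((\<lambda>t. integral (cbox (-c) c) (\<lambda>x. \<phi> (x + t *\<^sub>R e))) has_vector_derivative
     integral (cbox (-c) c) (\<lambda>x. \<phi>' (x + 0 *\<^sub>R e))) (at 0 within {-1<..<1})"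
  proof (rule leibniz_rule_vector_derivative)
    show "((\<lambda>t. \<phi> (x + t *\<^sub>R e)) has_vector_derivative \<phi>' (x + t *\<^sub>R e)) (at t within {-1<..<1})" for x t
      using der has_vector_derivative_at_within by blast
    show "(\<lambda>x. \<phi> (x + t *\<^sub>R e)) integrable_on cbox (-c) c" for t
      by (intro integrable_continuous continuous_on_compose2[OF cont(1)] continuous_intros) auto
    show "continuous_on ({-1<..<1} \<times> cbox (-c) c) (\<lambda>(t, x). \<phi>' (x + t *\<^sub>R e))"
      unfolding split_beta by (intro continuous_on_compose2[OF cont(2)] continuous_intros) auto
  qed auto
  moreover have "at (0::real) within {-1<..<1} = at 0"
    by (rule at_within_open) auto
  ultimately have "((\<lambda>t. integral (cbox (-c) c) (\<lambda>x. \<phi> (x + t *\<^sub>R e))) has_vector_derivative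
     integral (cbox (-c) c) \<phi>') (at 0)"
    by simp
  then have "((\<lambda>t. (\<integral>x. \<phi> x \<partial>lborel)) has_vector_derivative integral (cbox (-c) c) \<phi>') (at 0)"
    by (rule has_vector_derivative_transform_within_open[where S = "{-1<..<1}"]) (use I in auto)
  then have "integral (cbox (-c) c) \<phi>' = 0"
    using vector_derivative_unique_at has_vector_derivative_const by blast
  moreover have "integral (cbox (-c) c) \<phi>' = (\<integral>x. \<phi>' x \<partial>lborel)"
    using out[of _ 0] r(2) continuous_on_subset[OF cont(2)]
    by (subst lborel_integral_cbox(2)[of "-c" c]) (auto simp: not_le[symmetric])
  ultimately show ?thesis by simp
qed

lemma integral_partial_deriv_zero:
  assumes "\<phi> \<in> test_funs U"
  shows "(\<integral>x. partial_deriv k \<phi> x \<partial>lborel) = 0"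
proof (rule integral_line_deriv_zero[where e = "axis k 1" and \<phi> = \<phi>])
  show "((\<lambda>t. \<phi> (x + t *\<^sub>R axis k 1)) has_vector_derivative partial_deriv k \<phi> (x + t *\<^sub>R axis k 1)) (at t)" for x t
    using has_vector_derivative_line[OF test_funsD(1)[OF assms], of x t "axis k 1" UNIV]
    by (simp add: axis_sum)
  have "{x. \<phi> x \<noteq> 0 \<or> partial_deriv k \<phi> x \<noteq> 0} \<subseteq> fun_support \<phi>"
    using not_in_fun_support[of _ \<phi>] partial_deriv_outside_support[of _ \<phi> k] by auto
  then show "bounded {x. \<phi> x \<noteq> 0 \<or> partial_deriv k \<phi> x \<noteq> 0}"
    by (rule bounded_subset[OF compact_imp_bounded[OF test_funsD(2)[OF assms]]])
qed (use assms in \<open>auto intro: test_funs_continuous test_funs_partial_deriv\<close>)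

lemma integral_by_parts:
  assumes V: "open V" and f: "smooth_fun_on V f" and \<phi>: "\<phi> \<in> test_funs V"
  shows "(\<integral>x. f x * partial_deriv k \<phi> x \<partial>lborel) = - (\<integral>x. partial_deriv k f x * \<phi> x \<partial>lborel)"
proof -
  have 1: "(\<lambda>x. f x * partial_deriv k \<phi> x) \<in> test_funs V"
    by (intro test_funs_smooth_mult V f test_funs_partial_deriv \<phi>)
  have 2: "(\<lambda>x. partial_deriv k f x * \<phi> x) \<in> test_funs V"
    by (intro test_funs_smooth_mult V f smooth_partial_deriv \<phi>)
  have 3: "(\<lambda>x. f x * \<phi> x) \<in> test_funs V"
    by (intro test_funs_smooth_mult V f \<phi>)
  have "partial_deriv k (\<lambda>x. f x * \<phi> x) x = f x * partial_deriv k \<phi> x + partial_deriv k f x * \<phi> x" for x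
  proof (cases "x \<in> V")
    case True
    then show ?thesis
      using f \<phi> by (intro partial_deriv_mult) (auto intro: smooth_fun_onD test_funsD)
  next
    \<comment> \<open>Off V the function f is arbitrary, but such a point lies outside the support
      of \<phi>, so every term vanishes.\<close>
    case False
    then have "x \<notin> fun_support \<phi>" "x \<notin> fun_support (\<lambda>x. f x * \<phi> x)"
      using \<phi> 3 by (auto simp: test_funs_def)
    then show ?thesis
      by (simp add: partial_deriv_outside_support not_in_fun_support)
  qed
  then have "(\<integral>x. f x * partial_deriv k \<phi> x + partial_deriv k f x * \<phi> x \<partial>lborel) = 0"
    using integral_partial_deriv_zero[OF 3, of k] by simp
  then show ?thesis
    using integrable_test_fun[OF 1] integrable_test_fun[OF 2] by (simp add: add_eq_0_iff2)
qed

subsection \<open>Multi-indices\<close>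

definition mi_of :: "'n list \<Rightarrow> 'n multi_index" where
  "mi_of ks = sum_list (map (\<lambda>k. Poly_Mapping.single k 1) ks)"

lemma lookup_mi_of: "Poly_Mapping.lookup (mi_of ks) k = count_list ks k"
  by (induction ks) (auto simp: mi_of_def lookup_add lookup_single)

lemma mi_of_append: "mi_of (ks @ ls) = mi_of ks + mi_of ls"
  by (simp add: mi_of_def)

lemma mi_abs_add: "mi_abs (m + m') = mi_abs m + mi_abs m'"
  by (simp add: mi_abs_def lookup_add sum.distrib)

lemma mi_abs_single: "mi_abs (Poly_Mapping.single k n) = n"
  by (simp add: mi_abs_def lookup_single when_def)

lemma mi_abs_zero: "mi_abs 0 = 0"
  by (simp add: mi_abs_def)

lemma mi_abs_mi_of: "mi_abs (mi_of ks) = length ks"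
  by (induction ks) (auto simp: mi_of_def mi_abs_add mi_abs_single mi_abs_zero)

lemma ex_mi_of: obtains ks where "m = mi_of (ks :: 'n::finite list)"
proof -
  obtain ks where "\<forall>k. count_list ks k = Poly_Mapping.lookup m k"
    using ex_list_of_multi_index by blast
  then have "m = mi_of ks"
    by (intro poly_mapping_eqI) (simp add: lookup_mi_of)
  then show ?thesis using that by blast
qed

lemma partial_deriv_partial_derivs:
  assumes "smooth_fun_on UNIV f"
  shows "partial_deriv k (partial_derivs ks f) = partial_derivs ks (partial_deriv k f)"
  using assms
proof (induction ks arbitrary: f)
  case (Cons l ks)
  have "partial_deriv k (partial_deriv l f) = partial_deriv l (partial_deriv k f)"
    using partial_deriv_commute[OF open_UNIV Cons.prems] by auto
  then show ?case
    using Cons.IH[OF smooth_partial_deriv[OF Cons.prems]] by simp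
qed auto

lemma partial_derivs_permute:
  assumes "smooth_fun_on UNIV f" "mset ks = mset ls"
  shows "partial_derivs ks f = partial_derivs ls f"
  using assms
proof (induction ks arbitrary: ls f)
  case (Cons k ks)
  then have "k \<in> set ls" by (metis list.set_intros(1) mset_eq_setD)
  then obtain l1 l2 where ls: "ls = l1 @ k # l2" by (meson split_list)
  have "partial_derivs ls f = partial_derivs (l1 @ l2) (partial_deriv k f)"
    using partial_deriv_partial_derivs[OF Cons.prems(1)] by (simp add: ls partial_derivs_append)
  also have "\<dots> = partial_derivs ks (partial_deriv k f)"
    by (rule Cons.IH[symmetric]) (use Cons.prems in \<open>auto simp: ls intro: smooth_partial_deriv\<close>)
  finally show ?case by simp
qed auto

text \<open>The list chosen in \<open>mi_deriv\<close> is a permutation of \<open>ks\<close>, and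
  partial derivatives of smooth functions commute. From here on, lists of directions replace
  multi-indices.\<close>

lemma mi_deriv_mi_of:
  assumes "smooth_fun_on UNIV f"
  shows "mi_deriv (mi_of ks) f = partial_derivs ks f"
proof -
  define ls where "ls = (SOME ls. \<forall>k. count_list ls k = Poly_Mapping.lookup (mi_of ks) k)"
  have "\<forall>k. count_list ls k = Poly_Mapping.lookup (mi_of ks) k"
    unfolding ls_def using ex_list_of_multi_index by (rule someI_ex)
  then have "mset ls = mset ks"
    by (intro multiset_eqI) (simp add: lookup_mi_of count_mset)
  then show ?thesis
    unfolding mi_deriv_def ls_def[symmetric] using partial_derivs_permute[OF assms] by blast
qed

lemma smooth_mi_deriv: "smooth_fun_on U f \<Longrightarrow> smooth_fun_on U (mi_deriv m f)"
  unfolding mi_deriv_def by (rule smooth_partial_derivs)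

lemma test_funs_mi_deriv: "\<phi> \<in> test_funs U \<Longrightarrow> mi_deriv m \<phi> \<in> test_funs U"
  unfolding mi_deriv_def by (rule test_funs_partial_derivs)

lemma mi_deriv_add:
  assumes "smooth_fun_on UNIV f"
  shows "mi_deriv (m + m') f = mi_deriv m (mi_deriv m' f)"
proof -
  obtain ks where m: "m = mi_of ks" by (rule ex_mi_of)
  obtain ls where m': "m' = mi_of ls" by (rule ex_mi_of)
  have "mi_deriv (m + m') f = partial_derivs (ls @ ks) f"
    using mi_deriv_mi_of[OF assms, of "ls @ ks"] by (simp add: m m' mi_of_append add.commute)
  then show ?thesis
    using assms by (simp add: m m' mi_deriv_mi_of partial_derivs_append smooth_partial_derivs)
qed

lemma mi_deriv_lin:
  assumes "smooth_fun_on UNIV f" "smooth_fun_on UNIV g"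
  shows "mi_deriv m (\<lambda>x. f x + g x) = (\<lambda>x. mi_deriv m f x + mi_deriv m g x)"
    and "mi_deriv m (\<lambda>x. c * f x) = (\<lambda>x. c * mi_deriv m f x)"
  unfolding mi_deriv_def using assms
  by (auto simp: partial_derivs_add[OF open_UNIV] partial_derivs_cmult[OF open_UNIV])

lemma cpoly_induct [case_names single sum]:
  assumes "\<And>m a. R (Poly_Mapping.single m a)" "\<And>P Q. R P \<Longrightarrow> R Q \<Longrightarrow> R (P + Q)"
  shows "R (P :: 'n cpoly)"
proof -
  have "P = (\<Sum>m\<in>Poly_Mapping.keys P. Poly_Mapping.single m (Poly_Mapping.lookup P m))"
    by (rule poly_mapping_eqI) (auto simp: lookup_sum lookup_single when_def in_keys_iff)
  moreover have "R (\<Sum>m\<in>A. Poly_Mapping.single m (Poly_Mapping.lookup P m))" for A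
  proof (induction A rule: infinite_finite_induct)
    case (insert m A)
    then show ?case by (simp add: assms)
  qed (use assms(1)[of 0 0] in auto)
  ultimately show ?thesis by metis
qed

subsection \<open>The operator \<open>P(D)\<close> on smooth functions\<close>

definition PD :: "'n::finite cpoly \<Rightarrow> (real ^ 'n \<Rightarrow> complex) \<Rightarrow> real ^ 'n \<Rightarrow> complex" where
  "PD P f = (\<lambda>x. \<Sum>m\<in>Poly_Mapping.keys P. Poly_Mapping.lookup P m * ((-\<i>) ^ mi_abs m * mi_deriv m f x))"

lemma smooth_PD: "open U \<Longrightarrow> smooth_fun_on U f \<Longrightarrow> smooth_fun_on U (PD P f)"
  unfolding PD_def by (intro smooth_sum smooth_cmult smooth_mi_deriv)

lemma test_funs_PD: "open U \<Longrightarrow> \<phi> \<in> test_funs U \<Longrightarrow> PD P \<phi> \<in> test_funs U"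
  unfolding PD_def by (intro test_funs_sum test_funs_cmult test_funs_mi_deriv)

lemma PD_zero: "PD 0 f = (\<lambda>x. 0)"
  by (simp add: PD_def)

lemma PD_add: "PD (P + Q) f = (\<lambda>x. PD P f x + PD Q f x)"
  unfolding PD_def
  by (rule ext, rule setsum_keys_plus_distrib) (auto simp: algebra_simps)

lemma PD_single: "PD (Poly_Mapping.single m a) f = (\<lambda>x. a * ((-\<i>) ^ mi_abs m * mi_deriv m f x))"
  by (auto simp: PD_def)

lemma PD_sum: "PD (\<Sum>i\<in>I. P i) f = (\<lambda>x. \<Sum>i\<in>I. PD (P i) f x)"
  by (induction I rule: infinite_finite_induct) (auto simp: PD_zero PD_add)

lemma PD_lin:
  assumes "smooth_fun_on UNIV f" "smooth_fun_on UNIV g"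
  shows "PD P (\<lambda>x. f x + g x) = (\<lambda>x. PD P f x + PD P g x)"
    and "PD P (\<lambda>x. c * f x) = (\<lambda>x. c * PD P f x)"
  unfolding PD_def using assms
  by (auto simp: mi_deriv_lin algebra_simps sum.distrib sum_distrib_left)

lemma PD_single_mult:
  assumes "smooth_fun_on UNIV f"
  shows "PD (Poly_Mapping.single m a * Q) f = PD (Poly_Mapping.single m a) (PD Q f)"
proof (induction Q rule: cpoly_induct)
  case (single m' b)
  have "mi_deriv m (\<lambda>x. b * ((-\<i>) ^ mi_abs m' * mi_deriv m' f x)) =
      (\<lambda>x. b * ((-\<i>) ^ mi_abs m' * mi_deriv m (mi_deriv m' f) x))"
    using assms by (simp add: mi_deriv_lin(2) smooth_mi_deriv smooth_cmult)
  then show ?case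
    using assms by (simp add: mult_single PD_single mi_abs_add mi_deriv_add power_add algebra_simps)
next
  case (sum P Q)
  then show ?case
    using assms by (simp add: distrib_left PD_add PD_lin smooth_PD)
qed

lemma PD_mult:
  assumes "smooth_fun_on UNIV f"
  shows "PD (P * Q) f = PD P (PD Q f)"
proof (induction P rule: cpoly_induct)
  case (single m a)
  show ?case by (rule PD_single_mult[OF assms])
next
  case (sum P1 P2)
  then show ?case by (simp add: distrib_right PD_add)
qed

lemma PD_const_poly: "smooth_fun_on UNIV f \<Longrightarrow> PD (const_poly c) f = (\<lambda>x. c * f x)"
  using mi_deriv_mi_of[of f "[]"] by (simp add: const_poly_def PD_single mi_abs_zero mi_of_def)

lemma PD_linear_factor:
  assumes "smooth_fun_on UNIV f"
  shows "PD (linear_poly N + const_poly c) f =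
    (\<lambda>x. - \<i> * (\<Sum>k\<in>UNIV. N $ k * partial_deriv k f x) + c * f x)"
proof -
  have "mi_deriv (Poly_Mapping.single k 1) f = partial_deriv k f" for k
    using mi_deriv_mi_of[OF assms, of "[k]"] by (simp add: mi_of_def)
  then show ?thesis
    using assms
    by (simp add: PD_add PD_const_poly linear_poly_def PD_sum PD_mult var_poly_def PD_single
        mi_abs_single smooth_cmult smooth_minus smooth_partial_deriv sum_distrib_left algebra_simps)
qed

subsection \<open>Distributions\<close>

text \<open>The working form of continuity: a common bound B on all derivatives of length at most b
  replaces the sum of suprema. In one direction each of the finitely many suprema is at most B; in
  the other B is taken to be the sum itself.\<close>

lemma is_distribution_iff:
  "is_distribution X u \<longleftrightarrow>
     (\<forall>\<phi>\<in>test_funs X. \<forall>\<psi>\<in>test_funs X. u (\<lambda>x. \<phi> x + \<psi> x) = u \<phi> + u \<psi>) \<and>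
     (\<forall>\<phi>\<in>test_funs X. \<forall>c. u (\<lambda>x. c * \<phi> x) = c * u \<phi>) \<and>
     (\<forall>K. compact K \<and> K \<subseteq> X \<longrightarrow>
        (\<exists>C b. C \<ge> 0 \<and> (\<forall>\<phi>\<in>test_funs X. \<forall>B. fun_support \<phi> \<subseteq> K \<longrightarrow>
           (\<forall>ks x. length ks \<le> b \<longrightarrow> cmod (partial_derivs ks \<phi> x) \<le> B) \<longrightarrow> cmod (u \<phi>) \<le> C * B)))"
proof -
  have "(\<exists>C b. \<forall>\<phi>\<in>test_funs X. fun_support \<phi> \<subseteq> K \<longrightarrow>
           cmod (u \<phi>) \<le> C * (\<Sum>m\<in>{m. mi_abs m \<le> b}. SUP x. cmod (mi_deriv m \<phi> x))) \<longleftrightarrow>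
        (\<exists>C b. C \<ge> 0 \<and> (\<forall>\<phi>\<in>test_funs X. \<forall>B. fun_support \<phi> \<subseteq> K \<longrightarrow>
           (\<forall>ks x. length ks \<le> b \<longrightarrow> cmod (partial_derivs ks \<phi> x) \<le> B) \<longrightarrow> cmod (u \<phi>) \<le> C * B))"
    (is "?L \<longleftrightarrow> ?R") for K
  proof
    assume ?L
    then obtain C b where C: "\<And>\<phi>. \<phi> \<in> test_funs X \<Longrightarrow> fun_support \<phi> \<subseteq> K \<Longrightarrow>
       cmod (u \<phi>) \<le> C * (\<Sum>m\<in>{m. mi_abs m \<le> b}. SUP x. cmod (mi_deriv m \<phi> x))" by blast
    have "cmod (u \<phi>) \<le> (\<bar>C\<bar> * card {m::'a multi_index. mi_abs m \<le> b}) * B"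
      if \<phi>: "\<phi> \<in> test_funs X" "fun_support \<phi> \<subseteq> K"
        and B: "\<And>ks x. length ks \<le> b \<Longrightarrow> cmod (partial_derivs ks \<phi> x) \<le> B" for \<phi> B
    proof -
      have S: "\<bar>SUP x. cmod (mi_deriv m \<phi> x)\<bar> \<le> B" if "mi_abs m \<le> b" for m
      proof -
        obtain ks where ks: "m = mi_of ks" by (rule ex_mi_of)
        have le: "cmod (mi_deriv m \<phi> x) \<le> B" for x
          using B[of ks x] that ks mi_deriv_mi_of[OF test_funsD(1)[OF \<phi>(1)], of ks]
          by (simp add: mi_abs_mi_of)
        then have "(SUP x. cmod (mi_deriv m \<phi> x)) \<le> B" by (intro cSUP_least) auto
        moreover have "0 \<le> (SUP x. cmod (mi_deriv m \<phi> x))"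
          by (rule cSUP_upper2[where x = 0]) (use le in \<open>auto intro!: bdd_aboveI[of _ B]\<close>)
        ultimately show ?thesis by simp
      qed
      have "cmod (u \<phi>) \<le> \<bar>C * (\<Sum>m\<in>{m. mi_abs m \<le> b}. SUP x. cmod (mi_deriv m \<phi> x))\<bar>"
        using C[OF \<phi>] by linarith
      also have "\<dots> = \<bar>C\<bar> * \<bar>\<Sum>m\<in>{m. mi_abs m \<le> b}. SUP x. cmod (mi_deriv m \<phi> x)\<bar>"
        by (simp add: abs_mult)
      also have "\<dots> \<le> \<bar>C\<bar> * (\<Sum>m\<in>{m::'a multi_index. mi_abs m \<le> b}. B)"
        by (intro mult_left_mono order_trans[OF sum_abs] sum_mono S) auto
      finally show ?thesis by simp
    qed
    then show ?R
      by (intro exI[of _ "\<bar>C\<bar> * card {m::'a multi_index. mi_abs m \<le> b}"] exI[of _ b]) auto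
  next
    assume ?R
    then obtain C b where C: "C \<ge> 0" "\<And>\<phi> B. \<phi> \<in> test_funs X \<Longrightarrow> fun_support \<phi> \<subseteq> K \<Longrightarrow>
       (\<And>ks x. length ks \<le> b \<Longrightarrow> cmod (partial_derivs ks \<phi> x) \<le> B) \<Longrightarrow> cmod (u \<phi>) \<le> C * B" by blast
    have "cmod (u \<phi>) \<le> C * (\<Sum>m\<in>{m. mi_abs m \<le> b}. SUP x. cmod (mi_deriv m \<phi> x))"
      if \<phi>: "\<phi> \<in> test_funs X" "fun_support \<phi> \<subseteq> K" for \<phi>
    proof (rule C(2)[OF \<phi>])
      have up: "cmod (mi_deriv m \<phi> x) \<le> (SUP x. cmod (mi_deriv m \<phi> x))" for m x
      proof -
        obtain B where "\<And>x. cmod (mi_deriv m \<phi> x) \<le> B"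
          using test_funs_bounded[OF test_funs_mi_deriv[OF \<phi>(1)]] by metis
        then show ?thesis by (intro cSUP_upper) (auto intro!: bdd_aboveI[of _ B])
      qed
      then have nonneg: "0 \<le> (SUP x. cmod (mi_deriv m \<phi> x))" for m
        using norm_ge_zero order_trans by blast
      fix ks :: "'a list" and x assume "length ks \<le> b"
      then have "(SUP x. cmod (mi_deriv (mi_of ks) \<phi> x)) \<le> (\<Sum>m\<in>{m. mi_abs m \<le> b}. SUP x. cmod (mi_deriv m \<phi> x))"
        by (intro member_le_sum) (auto simp: mi_abs_mi_of finite_mi_abs_le nonneg)
      with up[of "mi_of ks" x] show "cmod (partial_derivs ks \<phi> x) \<le> (\<Sum>m\<in>{m. mi_abs m \<le> b}. SUP x. cmod (mi_deriv m \<phi> x))"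
        by (simp add: mi_deriv_mi_of[OF test_funsD(1)[OF \<phi>(1)]])
    qed
    then show ?L by blast
  qed
  then show ?thesis
    unfolding is_distribution_def by simp
qed

lemma is_distribution_add:
  "is_distribution X u \<Longrightarrow> \<phi> \<in> test_funs X \<Longrightarrow> \<psi> \<in> test_funs X \<Longrightarrow> u (\<lambda>x. \<phi> x + \<psi> x) = u \<phi> + u \<psi>"
  by (simp add: is_distribution_def)

lemma is_distribution_cmult:
  "is_distribution X u \<Longrightarrow> \<phi> \<in> test_funs X \<Longrightarrow> u (\<lambda>x. c * \<phi> x) = c * u \<phi>"
  by (simp add: is_distribution_def)

lemma is_distribution_estimate:
  assumes "is_distribution X u" "compact K" "K \<subseteq> X"
  obtains C b where "C \<ge> 0" "\<And>\<phi> B. \<phi> \<in> test_funs X \<Longrightarrow> fun_support \<phi> \<subseteq> K \<Longrightarrow>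
       (\<And>ks x. length ks \<le> b \<Longrightarrow> cmod (partial_derivs ks \<phi> x) \<le> B) \<Longrightarrow> cmod (u \<phi>) \<le> C * B"
  using assms unfolding is_distribution_iff by metis

lemma is_distribution_zero: "is_distribution X u \<Longrightarrow> u (\<lambda>x. 0) = 0"
  using is_distribution_cmult[OF _ test_funs_zero, of X u 0] by simp

lemma is_distribution_diff:
  assumes "open X" "is_distribution X u" "\<phi> \<in> test_funs X" "\<psi> \<in> test_funs X"
  shows "u (\<lambda>x. \<phi> x - \<psi> x) = u \<phi> - u \<psi>"
  using is_distribution_add[OF assms(2,3) test_funs_cmult[OF assms(1,4), of "-1"]]
    is_distribution_cmult[OF assms(2,4), of "-1"] by simp

lemma is_distribution_sum:
  assumes "is_distribution X u" "\<And>i. i \<in> I \<Longrightarrow> \<phi> i \<in> test_funs X"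
  shows "u (\<lambda>x. \<Sum>i\<in>I. \<phi> i x) = (\<Sum>i\<in>I. u (\<phi> i))"
  using assms(2)
proof (induction I rule: infinite_finite_induct)
  case (insert i I)
  then show ?case
    using is_distribution_add[OF assms(1), of "\<phi> i" "\<lambda>x. \<Sum>i\<in>I. \<phi> i x"]
    by (simp add: test_funs_sum)
qed (auto simp: is_distribution_zero[OF assms(1)])

lemma is_distribution_cong:
  assumes "open X" "\<And>\<phi>. \<phi> \<in> test_funs X \<Longrightarrow> u \<phi> = v \<phi>"
  shows "is_distribution X u \<longleftrightarrow> is_distribution X v"
proof -
  have "is_distribution X v" if u: "is_distribution X u" and eq: "\<And>\<phi>. \<phi> \<in> test_funs X \<Longrightarrow> u \<phi> = v \<phi>" for u v
  proof -
    have "v (\<lambda>x. \<phi> x + \<psi> x) = v \<phi> + v \<psi>" if "\<phi> \<in> test_funs X" "\<psi> \<in> test_funs X" for \<phi> \<psi>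
      using is_distribution_add[OF u that] eq[OF that(1)] eq[OF that(2)] eq[OF test_funs_add[OF that]] by simp
    moreover have "v (\<lambda>x. c * \<phi> x) = c * v \<phi>" if "\<phi> \<in> test_funs X" for \<phi> c
      using is_distribution_cmult[OF u that] eq[OF that] eq[OF test_funs_cmult[OF assms(1) that]] by simp
    ultimately show ?thesis
      using u eq unfolding is_distribution_def by simp
  qed
  then show ?thesis using assms(2) by metis
qed

text \<open>P(D) loses at most d derivatives, with d and D depending on P alone. This carries the
  continuity of u over to u composed with P(D).\<close>

lemma PD_bound:
  obtains D d where "D \<ge> 0" "\<And>\<phi> B b ks x. smooth_fun_on UNIV \<phi> \<Longrightarrow>
     (\<And>ks x. length ks \<le> b + d \<Longrightarrow> cmod (partial_derivs ks \<phi> x) \<le> B) \<Longrightarrow> length ks \<le> b \<Longrightarrow>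
     cmod (partial_derivs ks (PD P \<phi>) x) \<le> D * B"
proof -
  have "\<exists>D\<ge>0. \<exists>d. \<forall>\<phi> B b ks x. smooth_fun_on UNIV \<phi> \<longrightarrow>
     (\<forall>ks x. length ks \<le> b + d \<longrightarrow> cmod (partial_derivs ks \<phi> x) \<le> B) \<longrightarrow> length ks \<le> b \<longrightarrow>
     cmod (partial_derivs ks (PD P \<phi>) x) \<le> D * B"
  proof (induction P rule: cpoly_induct)
    case (single m a)
    obtain ls where m: "m = mi_of ls" by (rule ex_mi_of)
    show ?case
    proof (intro exI[of _ "cmod a"] exI[of _ "length ls"] conjI allI impI)
      fix \<phi> :: "real^'a \<Rightarrow> complex" and B b x and ks :: "'a list"
      assume sm: "smooth_fun_on UNIV \<phi>"
        and B: "\<forall>ks x. length ks \<le> b + length ls \<longrightarrow> cmod (partial_derivs ks \<phi> x) \<le> B"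
        and ks: "length ks \<le> b"
      have "partial_derivs ks (PD (Poly_Mapping.single m a) \<phi>) x =
         a * ((-\<i>) ^ mi_abs m * partial_derivs (ls @ ks) \<phi> x)"
        using sm by (simp add: PD_single m mi_deriv_mi_of partial_derivs_cmult[OF open_UNIV]
          smooth_partial_derivs smooth_cmult partial_derivs_append)
      then show "cmod (partial_derivs ks (PD (Poly_Mapping.single m a) \<phi>) x) \<le> cmod a * B"
        using B ks by (simp add: norm_mult norm_power mult_left_mono)
    qed auto
  next
    case (sum P Q)
    then obtain D1 d1 D2 d2 where D: "D1 \<ge> 0" "D2 \<ge> 0"
      and 1: "\<forall>\<phi> B b ks x. smooth_fun_on UNIV \<phi> \<longrightarrow>
     (\<forall>ks x. length ks \<le> b + d1 \<longrightarrow> cmod (partial_derivs ks \<phi> x) \<le> B) \<longrightarrow> length ks \<le> b \<longrightarrow>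
     cmod (partial_derivs ks (PD P \<phi>) x) \<le> D1 * B"
      and 2: "\<forall>\<phi> B b ks x. smooth_fun_on UNIV \<phi> \<longrightarrow>
     (\<forall>ks x. length ks \<le> b + d2 \<longrightarrow> cmod (partial_derivs ks \<phi> x) \<le> B) \<longrightarrow> length ks \<le> b \<longrightarrow>
     cmod (partial_derivs ks (PD Q \<phi>) x) \<le> D2 * B" by blast
    show ?case
    proof (intro exI[of _ "D1 + D2"] exI[of _ "max d1 d2"] conjI allI impI)
      fix \<phi> :: "real^'a \<Rightarrow> complex" and B b x and ks :: "'a list"
      assume sm: "smooth_fun_on UNIV \<phi>"
        and B: "\<forall>ks x. length ks \<le> b + max d1 d2 \<longrightarrow> cmod (partial_derivs ks \<phi> x) \<le> B"
        and ks: "length ks \<le> b"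
      have "partial_derivs ks (PD (P + Q) \<phi>) x = partial_derivs ks (PD P \<phi>) x + partial_derivs ks (PD Q \<phi>) x"
        using sm by (simp add: PD_add partial_derivs_add[OF open_UNIV] smooth_PD)
      moreover have "cmod (partial_derivs ks (PD P \<phi>) x) \<le> D1 * B"
        using 1[rule_format, of \<phi> b B ks x] sm B ks by simp
      moreover have "cmod (partial_derivs ks (PD Q \<phi>) x) \<le> D2 * B"
        using 2[rule_format, of \<phi> b B ks x] sm B ks by simp
      ultimately show "cmod (partial_derivs ks (PD (P + Q) \<phi>) x) \<le> (D1 + D2) * B"
        by (metis add_mono distrib_right norm_triangle_le)
    qed (use D in auto)
  qed
  then obtain D d where D: "D \<ge> 0" and *: "\<forall>\<phi> B b ks x. smooth_fun_on UNIV \<phi> \<longrightarrow>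
     (\<forall>ks x. length ks \<le> b + d \<longrightarrow> cmod (partial_derivs ks \<phi> x) \<le> B) \<longrightarrow> length ks \<le> b \<longrightarrow>
     cmod (partial_derivs ks (PD P \<phi>) x) \<le> D * B" by (elim exE conjE)
  show ?thesis
    by (rule that[OF D], rule *[rule_format]) auto
qed

lemma is_distribution_PD:
  assumes X: "open X" and u: "is_distribution X u"
  shows "is_distribution X (\<lambda>\<phi>. u (PD P \<phi>))"
  unfolding is_distribution_iff
proof (intro conjI ballI allI impI)
  fix \<phi> \<psi> assume *: "\<phi> \<in> test_funs X" "\<psi> \<in> test_funs X"
  show "u (PD P (\<lambda>x. \<phi> x + \<psi> x)) = u (PD P \<phi>) + u (PD P \<psi>)"
    using * X u by (simp add: PD_lin test_funsD is_distribution_add test_funs_PD)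
next
  fix \<phi> c assume *: "\<phi> \<in> test_funs X"
  show "u (PD P (\<lambda>x. c * \<phi> x)) = c * u (PD P \<phi>)"
    using * X u by (simp add: PD_lin(2)[OF test_funsD(1) test_funsD(1)] is_distribution_cmult test_funs_PD)
next
  fix K assume "compact K \<and> K \<subseteq> X"
  then obtain C b where C: "C \<ge> 0" "\<And>\<phi> B. \<phi> \<in> test_funs X \<Longrightarrow> fun_support \<phi> \<subseteq> K \<Longrightarrow>
       (\<And>ks x. length ks \<le> b \<Longrightarrow> cmod (partial_derivs ks \<phi> x) \<le> B) \<Longrightarrow> cmod (u \<phi>) \<le> C * B"
    using is_distribution_estimate[OF u] by metis
  obtain D d where D: "D \<ge> 0" "\<And>\<phi> B b ks x. smooth_fun_on UNIV \<phi> \<Longrightarrow>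
     (\<And>ks x. length ks \<le> b + d \<Longrightarrow> cmod (partial_derivs ks \<phi> x) \<le> B) \<Longrightarrow> length ks \<le> b \<Longrightarrow>
     cmod (partial_derivs ks (PD P \<phi>) x) \<le> D * B"
    by (rule PD_bound[of P]) blast
  show "\<exists>C b. C \<ge> 0 \<and> (\<forall>\<phi>\<in>test_funs X. \<forall>B. fun_support \<phi> \<subseteq> K \<longrightarrow>
      (\<forall>ks x. length ks \<le> b \<longrightarrow> cmod (partial_derivs ks \<phi> x) \<le> B) \<longrightarrow> cmod (u (PD P \<phi>)) \<le> C * B)"
  proof (intro exI[of _ "C * D"] exI[of _ "b + d"] conjI ballI allI impI)
    fix \<phi> B assume \<phi>: "\<phi> \<in> test_funs X" "fun_support \<phi> \<subseteq> K"
      and B: "\<forall>ks x. length ks \<le> b + d \<longrightarrow> cmod (partial_derivs ks \<phi> x) \<le> B"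
    have "\<phi> \<in> test_funs (- (- fun_support \<phi>))"
      using \<phi> by (simp add: test_funs_def)
    have "PD P \<phi> x = 0" if "x \<notin> fun_support \<phi>" for x
      using not_in_fun_support[of x "mi_deriv _ \<phi>"] fun_support_partial_derivs that
      unfolding PD_def mi_deriv_def by (fastforce intro!: sum.neutral)
    then have "fun_support (PD P \<phi>) \<subseteq> K"
      using fun_support_subset[OF closed_fun_support[of \<phi>], of "PD P \<phi>"] \<phi>(2) by blast
    then have "cmod (u (PD P \<phi>)) \<le> C * (D * B)"
      using B by (intro C(2) D(2) test_funs_PD X \<phi>) (auto simp: test_funsD[OF \<phi>(1)])
    then show "cmod (u (PD P \<phi>)) \<le> C * D * B" by (simp add: mult.assoc)
  qed (use C D in auto)
qed

text \<open>The sign (-1)^|m| from \<open>reflect_vars\<close> cancels the one from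
  \<open>dist_deriv\<close>, so P(-D) is the transpose of P(D). All later arguments use this form,
  in which only test functions are differentiated.\<close>

lemma diff_op_neg_eq:
  assumes X: "open X" and u: "is_distribution X u" and \<phi>: "\<phi> \<in> test_funs X"
  shows "diff_op_neg P u \<phi> = u (PD P \<phi>)"
proof -
  have k: "Poly_Mapping.keys (reflect_vars P) = Poly_Mapping.keys P"
    by (auto simp: reflect_vars_def lookup_mapp in_keys_iff when_def split: if_splits)
  have "u (PD P \<phi>) = (\<Sum>m\<in>Poly_Mapping.keys P. u (\<lambda>x. Poly_Mapping.lookup P m * ((-\<i>) ^ mi_abs m * mi_deriv m \<phi> x)))"
    unfolding PD_def
    by (rule is_distribution_sum[OF u]) (intro test_funs_cmult X test_funs_mi_deriv \<phi>)
  also have "\<dots> = (\<Sum>m\<in>Poly_Mapping.keys P. Poly_Mapping.lookup P m * ((-\<i>) ^ mi_abs m * u (mi_deriv m \<phi>)))"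
    using X \<phi> by (intro sum.cong refl) (simp add: is_distribution_cmult[OF u] test_funs_cmult test_funs_mi_deriv)
  also have "\<dots> = diff_op_neg P u \<phi>"
    unfolding diff_op_neg_def diff_op_def k dist_deriv_def
    by (intro sum.cong refl)
      (auto simp: reflect_vars_def lookup_mapp power_mult_distrib[symmetric] mult.assoc mult.left_commute
        simp flip: power_mult_distrib)
  finally show ?thesis by simp
qed

lemma is_distribution_diff_op_neg:
  "open X \<Longrightarrow> is_distribution X u \<Longrightarrow> is_distribution X (diff_op_neg P u)"
  using is_distribution_cong[of X "diff_op_neg P u" "\<lambda>\<phi>. u (PD P \<phi>)"]
  by (simp add: diff_op_neg_eq is_distribution_PD)

lemma diff_op_neg_mult:
  assumes X: "open X" and u: "is_distribution X u" and \<phi>: "\<phi> \<in> test_funs X"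
  shows "diff_op_neg (P * Q) u \<phi> = diff_op_neg P (diff_op_neg Q u) \<phi>"
  using assms
  by (simp add: diff_op_neg_eq is_distribution_diff_op_neg test_funs_PD mult.commute[of P Q] PD_mult test_funsD)

definition represents :: "(real ^ 'n::finite) set \<Rightarrow> 'n functional \<Rightarrow> (real ^ 'n \<Rightarrow> complex) \<Rightarrow> bool" where
  "represents V u f \<longleftrightarrow> (\<forall>\<phi>\<in>test_funs V. u \<phi> = (\<integral>y. f y * \<phi> y \<partial>lborel))"

lemma dist_sing_supp_alt:
  "dist_sing_supp X u = {x\<in>X. \<not> (\<exists>V f. open V \<and> x \<in> V \<and> V \<subseteq> X \<and> smooth_fun_on V f \<and> represents V u f)}"
  by (simp add: dist_sing_supp_def represents_def)

lemma represents_subset: "represents V u f \<Longrightarrow> W \<subseteq> V \<Longrightarrow> represents W u f"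
  unfolding represents_def using test_funs_mono by blast

lemma represents_partial_derivs:
  assumes V: "open V" and f: "smooth_fun_on V f"
  obtains g where "smooth_fun_on V g"
    "\<And>\<phi>. \<phi> \<in> test_funs V \<Longrightarrow> (\<integral>y. f y * partial_derivs ks \<phi> y \<partial>lborel) = (\<integral>y. g y * \<phi> y \<partial>lborel)"
proof -
  have "\<exists>g. smooth_fun_on V g \<and> (\<forall>\<phi>\<in>test_funs V.
     (\<integral>y. f y * partial_derivs ks \<phi> y \<partial>lborel) = (\<integral>y. g y * \<phi> y \<partial>lborel))"
    using f
  proof (induction ks)
    case Nil
    then show ?case by auto
  next
    case (Cons k ks)
    then obtain g where g: "smooth_fun_on V g" "\<forall>\<phi>\<in>test_funs V.
     (\<integral>y. f y * partial_derivs ks \<phi> y \<partial>lborel) = (\<integral>y. g y * \<phi> y \<partial>lborel)" by blast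
    then have "(\<integral>y. f y * partial_derivs (k # ks) \<phi> y \<partial>lborel) = (\<integral>y. - partial_deriv k g y * \<phi> y \<partial>lborel)"
      if "\<phi> \<in> test_funs V" for \<phi>
      using that by (simp add: test_funs_partial_deriv integral_by_parts[OF V g(1) that])
    then show ?case
      using g V by (intro exI[of _ "\<lambda>y. - partial_deriv k g y"]) (auto intro: smooth_minus smooth_partial_deriv)
  qed
  then show ?thesis using that by blast
qed

lemma represents_PD:
  assumes "open X" "is_distribution X u" and V: "open V" "V \<subseteq> X"
    and f: "smooth_fun_on V f" "represents V u f"
  shows "\<exists>g. smooth_fun_on V g \<and> represents V (\<lambda>\<phi>. u (PD P \<phi>)) g"
proof (induction P rule: cpoly_induct)
  case (single m a)
  obtain ls where m: "m = mi_of ls" by (rule ex_mi_of)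
  obtain g where g: "smooth_fun_on V g"
    "\<And>\<phi>. \<phi> \<in> test_funs V \<Longrightarrow> (\<integral>y. f y * partial_derivs ls \<phi> y \<partial>lborel) = (\<integral>y. g y * \<phi> y \<partial>lborel)"
    by (rule represents_partial_derivs[OF V(1) f(1)]) blast
  have "u (PD (Poly_Mapping.single m a) \<phi>) = (\<integral>y. (a * (-\<i>) ^ mi_abs m * g y) * \<phi> y \<partial>lborel)"
    if \<phi>: "\<phi> \<in> test_funs V" for \<phi>
  proof -
    have "u (\<lambda>x. (a * (-\<i>) ^ mi_abs m) * partial_derivs ls \<phi> x) = (a * (-\<i>) ^ mi_abs m) * u (partial_derivs ls \<phi>)"
      using \<phi> V by (intro is_distribution_cmult[OF assms(2)] test_funs_partial_derivs) (rule test_funs_mono)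
    also have "\<dots> = (a * (-\<i>) ^ mi_abs m) * (\<integral>y. g y * \<phi> y \<partial>lborel)"
      using f(2) g(2)[OF \<phi>] test_funs_partial_derivs[OF \<phi>] by (simp add: represents_def)
    finally show ?thesis
      by (simp add: PD_single m mi_deriv_mi_of[OF test_funsD(1)[OF \<phi>]] mult.assoc)
  qed
  then show ?case
    using V g by (intro exI[of _ "\<lambda>y. a * (-\<i>) ^ mi_abs m * g y"]) (auto simp: represents_def intro: smooth_cmult)
next
  case (sum P Q)
  then obtain g h where g: "smooth_fun_on V g" "represents V (\<lambda>\<phi>. u (PD P \<phi>)) g"
    and h: "smooth_fun_on V h" "represents V (\<lambda>\<phi>. u (PD Q \<phi>)) h" by blast
  have "u (PD (P + Q) \<phi>) = (\<integral>y. (g y + h y) * \<phi> y \<partial>lborel)" if \<phi>: "\<phi> \<in> test_funs V" for \<phi>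
  proof -
    have "u (PD (P + Q) \<phi>) = u (PD P \<phi>) + u (PD Q \<phi>)"
      using \<phi> V unfolding PD_add
      by (intro is_distribution_add[OF assms(2)] test_funs_PD assms(1)) (auto intro: test_funs_mono)
    also have "\<dots> = (\<integral>y. g y * \<phi> y \<partial>lborel) + (\<integral>y. h y * \<phi> y \<partial>lborel)"
      using g h \<phi> by (simp add: represents_def)
    also have "\<dots> = (\<integral>y. g y * \<phi> y + h y * \<phi> y \<partial>lborel)"
      by (rule Bochner_Integration.integral_add[symmetric])
        (use V g h \<phi> in \<open>auto intro!: integrable_test_fun[OF test_funs_smooth_mult]\<close>)
    finally show ?thesis by (simp add: distrib_right)
  qed
  then show ?case
    using V g h by (intro exI[of _ "\<lambda>y. g y + h y"]) (auto simp: represents_def intro: smooth_add)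
qed

subsection \<open>Products of operators\<close>

lemma dist_suppI:
  assumes "x \<in> X"
    and *: "\<And>V. open V \<Longrightarrow> x \<in> V \<Longrightarrow> V \<subseteq> X \<Longrightarrow> \<forall>\<phi>\<in>test_funs V. u \<phi> = 0 \<Longrightarrow> False"
  shows "x \<in> dist_supp X u"
proof -
  have "\<not> (\<exists>V. open V \<and> x \<in> V \<and> V \<subseteq> X \<and> (\<forall>\<phi>\<in>test_funs V. u \<phi> = 0))"
  proof
    assume "\<exists>V. open V \<and> x \<in> V \<and> V \<subseteq> X \<and> (\<forall>\<phi>\<in>test_funs V. u \<phi> = 0)"
    then obtain V where "open V" "x \<in> V" "V \<subseteq> X" "\<forall>\<phi>\<in>test_funs V. u \<phi> = 0"
      by (elim exE conjE)
    then show False by (rule *)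
  qed
  with assms(1) show ?thesis
    unfolding dist_supp_def mem_Collect_eq by (rule conjI)
qed

lemma dist_suppD:
  assumes "x \<in> dist_supp X u" "open V" "x \<in> V" "V \<subseteq> X" "\<forall>\<phi>\<in>test_funs V. u \<phi> = 0"
  shows False
proof -
  have "\<not> (\<exists>V. open V \<and> x \<in> V \<and> V \<subseteq> X \<and> (\<forall>\<phi>\<in>test_funs V. u \<phi> = 0))"
    using assms(1) unfolding dist_supp_def mem_Collect_eq by (rule conjunct2)
  moreover have "\<exists>V. open V \<and> x \<in> V \<and> V \<subseteq> X \<and> (\<forall>\<phi>\<in>test_funs V. u \<phi> = 0)"
    by (intro exI[of _ V] conjI assms)
  ultimately show False by (rule notE)
qed

lemma dist_sing_suppI:
  assumes "x \<in> X"
    and *: "\<And>V f. open V \<Longrightarrow> x \<in> V \<Longrightarrow> V \<subseteq> X \<Longrightarrow> smooth_fun_on V f \<Longrightarrow> represents V u f \<Longrightarrow> False"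
  shows "x \<in> dist_sing_supp X u"
proof -
  have "\<not> (\<exists>V f. open V \<and> x \<in> V \<and> V \<subseteq> X \<and> smooth_fun_on V f \<and> represents V u f)"
  proof
    assume "\<exists>V f. open V \<and> x \<in> V \<and> V \<subseteq> X \<and> smooth_fun_on V f \<and> represents V u f"
    then obtain V f where "open V" "x \<in> V" "V \<subseteq> X" "smooth_fun_on V f" "represents V u f"
      by (elim exE conjE)
    then show False by (rule *)
  qed
  with assms(1) show ?thesis
    unfolding dist_sing_supp_alt mem_Collect_eq by (rule conjI)
qed

lemma dist_sing_suppD:
  assumes "x \<in> dist_sing_supp X u" "open V" "x \<in> V" "V \<subseteq> X" "smooth_fun_on V f" "represents V u f"
  shows False
proof -
  have "\<not> (\<exists>V f. open V \<and> x \<in> V \<and> V \<subseteq> X \<and> smooth_fun_on V f \<and> represents V u f)"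
    using assms(1) unfolding dist_sing_supp_alt mem_Collect_eq by (rule conjunct2)
  moreover have "\<exists>V f. open V \<and> x \<in> V \<and> V \<subseteq> X \<and> smooth_fun_on V f \<and> represents V u f"
    by (intro exI[of _ V] exI[of _ f] conjI assms)
  ultimately show False by (rule notE)
qed

lemma dist_supp_subset: "dist_supp X u \<subseteq> X" and dist_sing_supp_subset: "dist_sing_supp X u \<subseteq> X"
  by (auto simp: dist_supp_def dist_sing_supp_def)

lemma dist_supp_cong:
  assumes "\<And>\<phi>. \<phi> \<in> test_funs X \<Longrightarrow> u \<phi> = v \<phi>"
  shows "dist_supp X u = dist_supp X v"
proof -
  have "dist_supp X u \<subseteq> dist_supp X v" if eq: "\<And>\<phi>. \<phi> \<in> test_funs X \<Longrightarrow> u \<phi> = v \<phi>" for u v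
  proof
    fix x assume x: "x \<in> dist_supp X u"
    show "x \<in> dist_supp X v"
    proof (rule dist_suppI)
      fix V assume V: "open V" "x \<in> V" "V \<subseteq> X" "\<forall>\<phi>\<in>test_funs V. v \<phi> = 0"
      show False
        by (rule dist_suppD[OF x V(1-3)]) (use V(4) eq test_funs_mono[OF _ V(3)] in simp)
    qed (use x dist_supp_subset in auto)
  qed
  then show ?thesis using assms by (metis subset_antisym)
qed

lemma dist_sing_supp_cong:
  assumes "\<And>\<phi>. \<phi> \<in> test_funs X \<Longrightarrow> u \<phi> = v \<phi>"
  shows "dist_sing_supp X u = dist_sing_supp X v"
proof -
  have "dist_sing_supp X u \<subseteq> dist_sing_supp X v" if eq: "\<And>\<phi>. \<phi> \<in> test_funs X \<Longrightarrow> u \<phi> = v \<phi>" for u v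
  proof
    fix x assume x: "x \<in> dist_sing_supp X u"
    show "x \<in> dist_sing_supp X v"
    proof (rule dist_sing_suppI)
      fix V f assume V: "open V" "x \<in> V" "V \<subseteq> X" "smooth_fun_on V f" and f: "represents V v f"
      have "represents V u f"
        using f eq test_funs_mono[OF _ V(3)] unfolding represents_def by auto
      then show False by (rule dist_sing_suppD[OF x V])
    qed (use x dist_sing_supp_subset in auto)
  qed
  then show ?thesis using assms by (metis subset_antisym)
qed

text \<open>Differential operators are local: P(D) maps test functions of V to test functions of
  V.\<close>

lemma dist_supp_diff_op_neg:
  assumes "open X" "is_distribution X u"
  shows "dist_supp X (diff_op_neg P u) \<subseteq> dist_supp X u"
proof -
  have "dist_supp X (diff_op_neg P u) = dist_supp X (\<lambda>\<phi>. u (PD P \<phi>))"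
    by (rule dist_supp_cong) (rule diff_op_neg_eq[OF assms])
  moreover have "x \<in> dist_supp X u" if x: "x \<in> dist_supp X (\<lambda>\<phi>. u (PD P \<phi>))" for x
  proof (rule dist_suppI)
    fix V assume V: "open V" "x \<in> V" "V \<subseteq> X" "\<forall>\<phi>\<in>test_funs V. u \<phi> = 0"
    show False
      by (rule dist_suppD[OF x V(1-3)]) (use V(4) test_funs_PD[OF V(1)] in simp)
  qed (use x dist_supp_subset in auto)
  ultimately show ?thesis by auto
qed

lemma dist_sing_supp_diff_op_neg:
  assumes "open X" "is_distribution X u"
  shows "dist_sing_supp X (diff_op_neg P u) \<subseteq> dist_sing_supp X u"
proof -
  have "dist_sing_supp X (diff_op_neg P u) = dist_sing_supp X (\<lambda>\<phi>. u (PD P \<phi>))"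
    by (rule dist_sing_supp_cong) (rule diff_op_neg_eq[OF assms])
  moreover have "dist_sing_supp X (\<lambda>\<phi>. u (PD P \<phi>)) \<subseteq> dist_sing_supp X u"
  proof
    fix x assume x: "x \<in> dist_sing_supp X (\<lambda>\<phi>. u (PD P \<phi>))"
    show "x \<in> dist_sing_supp X u"
    proof (rule dist_sing_suppI)
      fix V f assume V: "open V" "x \<in> V" "V \<subseteq> X" and f: "smooth_fun_on V f" "represents V u f"
      obtain g where "smooth_fun_on V g" "represents V (\<lambda>\<phi>. u (PD P \<phi>)) g"
        using represents_PD[OF assms V(1,3) f] by metis
      then show False by (rule dist_sing_suppD[OF x V])
    qed (use x dist_sing_supp_subset in auto)
  qed
  ultimately show ?thesis by simp
qed

lemma open_Diff_dist_supp:
  assumes "open X" shows "open (X - dist_supp X u)"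
proof (subst open_subopen, intro ballI)
  fix x assume x: "x \<in> X - dist_supp X u"
  then have "\<exists>V. open V \<and> x \<in> V \<and> V \<subseteq> X \<and> (\<forall>\<phi>\<in>test_funs V. u \<phi> = 0)"
    using dist_suppI[of x X u] by (metis DiffE)
  then obtain V where V: "open V" "x \<in> V" "V \<subseteq> X" "\<forall>\<phi>\<in>test_funs V. u \<phi> = 0"
    by (elim exE conjE)
  have "V \<subseteq> X - dist_supp X u"
    using V(3) dist_suppD[OF _ V(1) _ V(3,4)] by auto
  with V show "\<exists>T. open T \<and> x \<in> T \<and> T \<subseteq> X - dist_supp X u"
    by (intro exI[of _ V] conjI)
qed

lemma open_Diff_dist_sing_supp:
  assumes "open X" shows "open (X - dist_sing_supp X u)"
proof (subst open_subopen, intro ballI)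
  fix x assume x: "x \<in> X - dist_sing_supp X u"
  then have "\<exists>V f. open V \<and> x \<in> V \<and> V \<subseteq> X \<and> smooth_fun_on V f \<and> represents V u f"
    using dist_sing_suppI[of x X u] by (metis DiffE)
  then obtain V f where V: "open V" "x \<in> V" "V \<subseteq> X" "smooth_fun_on V f" "represents V u f"
    by (elim exE conjE)
  have "V \<subseteq> X - dist_sing_supp X u"
    using V(3) dist_sing_suppD[OF _ V(1) _ V(3-5)] by auto
  with V show "\<exists>T. open T \<and> x \<in> T \<and> T \<subseteq> X - dist_sing_supp X u"
    by (intro exI[of _ V] conjI)
qed

lemma dist_sing_supp_subset_supp: "dist_sing_supp X u \<subseteq> dist_supp X u"
proof
  fix x assume x: "x \<in> dist_sing_supp X u"
  show "x \<in> dist_supp X u"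
  proof (rule dist_suppI)
    fix V assume V: "open V" "x \<in> V" "V \<subseteq> X" "\<forall>\<phi>\<in>test_funs V. u \<phi> = 0"
    then have "represents V u (\<lambda>x. 0)" unfolding represents_def by simp
    then show False by (rule dist_sing_suppD[OF x V(1-3) smooth_const[OF V(1)]])
  qed (use x dist_sing_supp_subset in auto)
qed

text \<open>Supports and singular supports are closed relative to X only, so their compactness has
  to be inherited from a compact set around them.\<close>

lemma compact_relatively_closed:
  assumes "compact S" "S \<subseteq> X" "T \<subseteq> S" "open (X - T)"
  shows "compact T"
proof -
  have "T = S - (X - T)" using assms by blast
  then show ?thesis using assms by (metis compact_diff)
qed

lemma compact_dists_diff_op_neg:
  assumes "open X" "u \<in> compact_dists X"
  shows "diff_op_neg P u \<in> compact_dists X"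
  using assms compact_relatively_closed[OF _ dist_supp_subset dist_supp_diff_op_neg open_Diff_dist_supp, of X u]
  by (simp add: compact_dists_def is_distribution_diff_op_neg)

text \<open>For a factor Q: PQu has no larger support than Qu, so the compact set for PQ works for
  Q. For the product: Qu again has compact support, so P confines Qu to a compact set L, and Q
  applied with L in place of K confines u.\<close>

lemma P_convex_supports_mult:
  assumes X: "open X"
  shows "P_convex_supports (P * Q) X \<longleftrightarrow> P_convex_supports P X \<and> P_convex_supports Q X"
proof -
  have eq: "dist_supp X (diff_op_neg (P * Q) u) = dist_supp X (diff_op_neg P (diff_op_neg Q u))"
    if "u \<in> compact_dists X" for u P Q
    using that by (intro dist_supp_cong diff_op_neg_mult X) (auto simp: compact_dists_def X)
  have left: "P_convex_supports Q X" if "P_convex_supports (P * Q) X" for P Q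
    unfolding P_convex_supports_def
  proof (intro allI impI)
    fix K assume "compact K \<and> K \<subseteq> X"
    then obtain L where L: "compact L" "L \<subseteq> X"
      "\<And>u. u \<in> compact_dists X \<Longrightarrow> dist_supp X (diff_op_neg (P * Q) u) \<subseteq> K \<Longrightarrow> dist_supp X u \<subseteq> L"
      using \<open>P_convex_supports (P * Q) X\<close> unfolding P_convex_supports_def by meson
    have "dist_supp X u \<subseteq> L" if u: "u \<in> compact_dists X" and K: "dist_supp X (diff_op_neg Q u) \<subseteq> K" for u
    proof (rule L(3)[OF u])
      have "dist_supp X (diff_op_neg P (diff_op_neg Q u)) \<subseteq> dist_supp X (diff_op_neg Q u)"
        using u by (intro dist_supp_diff_op_neg is_distribution_diff_op_neg X) (auto simp: compact_dists_def)
      then show "dist_supp X (diff_op_neg (P * Q) u) \<subseteq> K"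
        using K eq[OF u] by auto
    qed
    then show "\<exists>L. compact L \<and> L \<subseteq> X \<and> (\<forall>u\<in>compact_dists X. dist_supp X (diff_op_neg Q u) \<subseteq> K \<longrightarrow> dist_supp X u \<subseteq> L)"
      using L by blast
  qed
  have right: "P_convex_supports (P * Q) X" if P: "P_convex_supports P X" and Q: "P_convex_supports Q X"
    unfolding P_convex_supports_def
  proof (intro allI impI)
    fix K assume "compact K \<and> K \<subseteq> X"
    then obtain L where L: "compact L" "L \<subseteq> X"
      "\<And>u. u \<in> compact_dists X \<Longrightarrow> dist_supp X (diff_op_neg P u) \<subseteq> K \<Longrightarrow> dist_supp X u \<subseteq> L"
      using P unfolding P_convex_supports_def by meson
    obtain M where M: "compact M" "M \<subseteq> X"
      "\<And>u. u \<in> compact_dists X \<Longrightarrow> dist_supp X (diff_op_neg Q u) \<subseteq> L \<Longrightarrow> dist_supp X u \<subseteq> M"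
      using Q L(1,2) unfolding P_convex_supports_def by meson
    have "dist_supp X u \<subseteq> M" if "u \<in> compact_dists X" "dist_supp X (diff_op_neg (P * Q) u) \<subseteq> K" for u
      using that by (intro M(3) L(3) compact_dists_diff_op_neg X) (auto simp: eq)
    then show "\<exists>L. compact L \<and> L \<subseteq> X \<and> (\<forall>u\<in>compact_dists X. dist_supp X (diff_op_neg (P * Q) u) \<subseteq> K \<longrightarrow> dist_supp X u \<subseteq> L)"
      using M by blast
  qed
  show ?thesis
    using left[of P Q] left[of Q P] right by (auto simp: mult.commute)
qed

lemma P_convex_sing_supports_mult:
  assumes X: "open X"
  shows "P_convex_sing_supports (P * Q) X \<longleftrightarrow> P_convex_sing_supports P X \<and> P_convex_sing_supports Q X"
proof -
  have eq: "dist_sing_supp X (diff_op_neg (P * Q) u) = dist_sing_supp X (diff_op_neg P (diff_op_neg Q u))"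
    if "u \<in> compact_dists X" for u P Q
    using that by (intro dist_sing_supp_cong diff_op_neg_mult X) (auto simp: compact_dists_def X)
  have left: "P_convex_sing_supports Q X" if "P_convex_sing_supports (P * Q) X" for P Q
    unfolding P_convex_sing_supports_def
  proof (intro allI impI)
    fix K assume "compact K \<and> K \<subseteq> X"
    then obtain L where L: "compact L" "L \<subseteq> X"
      "\<And>u. u \<in> compact_dists X \<Longrightarrow> dist_sing_supp X (diff_op_neg (P * Q) u) \<subseteq> K \<Longrightarrow> dist_sing_supp X u \<subseteq> L"
      using \<open>P_convex_sing_supports (P * Q) X\<close> unfolding P_convex_sing_supports_def by meson
    have "dist_sing_supp X u \<subseteq> L" if u: "u \<in> compact_dists X" and K: "dist_sing_supp X (diff_op_neg Q u) \<subseteq> K" for u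
    proof (rule L(3)[OF u])
      have "dist_sing_supp X (diff_op_neg P (diff_op_neg Q u)) \<subseteq> dist_sing_supp X (diff_op_neg Q u)"
        using u by (intro dist_sing_supp_diff_op_neg is_distribution_diff_op_neg X) (auto simp: compact_dists_def)
      then show "dist_sing_supp X (diff_op_neg (P * Q) u) \<subseteq> K"
        using K eq[OF u] by auto
    qed
    then show "\<exists>L. compact L \<and> L \<subseteq> X \<and> (\<forall>u\<in>compact_dists X. dist_sing_supp X (diff_op_neg Q u) \<subseteq> K \<longrightarrow> dist_sing_supp X u \<subseteq> L)"
      using L by blast
  qed
  have right: "P_convex_sing_supports (P * Q) X" if P: "P_convex_sing_supports P X" and Q: "P_convex_sing_supports Q X"
    unfolding P_convex_sing_supports_def
  proof (intro allI impI)
    fix K assume "compact K \<and> K \<subseteq> X"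
    then obtain L where L: "compact L" "L \<subseteq> X"
      "\<And>u. u \<in> compact_dists X \<Longrightarrow> dist_sing_supp X (diff_op_neg P u) \<subseteq> K \<Longrightarrow> dist_sing_supp X u \<subseteq> L"
      using P unfolding P_convex_sing_supports_def by meson
    obtain M where M: "compact M" "M \<subseteq> X"
      "\<And>u. u \<in> compact_dists X \<Longrightarrow> dist_sing_supp X (diff_op_neg Q u) \<subseteq> L \<Longrightarrow> dist_sing_supp X u \<subseteq> M"
      using Q L(1,2) unfolding P_convex_sing_supports_def by meson
    have "dist_sing_supp X u \<subseteq> M" if "u \<in> compact_dists X" "dist_sing_supp X (diff_op_neg (P * Q) u) \<subseteq> K" for u
      using that by (intro M(3) L(3) compact_dists_diff_op_neg X) (auto simp: eq)
    then show "\<exists>L. compact L \<and> L \<subseteq> X \<and> (\<forall>u\<in>compact_dists X. dist_sing_supp X (diff_op_neg (P * Q) u) \<subseteq> K \<longrightarrow> dist_sing_supp X u \<subseteq> L)"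
      using M by blast
  qed
  show ?thesis
    using left[of P Q] left[of Q P] right by (auto simp: mult.commute)
qed

text \<open>The operator is inverted by the constant 1/c, and neither enlarges supports, so K itself
  confines u.\<close>

lemma P_convex_const:
  assumes X: "open X" and c: "c \<noteq> 0"
  shows "P_convex_supports (const_poly c) X" "P_convex_sing_supports (const_poly c) X"
proof -
  have *: "diff_op_neg (const_poly c) u \<phi> = c * u \<phi>" if "is_distribution X u" "\<phi> \<in> test_funs X" for u \<phi> c
    using that by (simp add: diff_op_neg_eq[OF X] PD_const_poly test_funsD is_distribution_cmult)
  have **: "diff_op_neg (const_poly (1/c)) (diff_op_neg (const_poly c) u) \<phi> = u \<phi>"
    if "is_distribution X u" "\<phi> \<in> test_funs X" for u \<phi>
    using c *[OF that] *[OF is_distribution_diff_op_neg[OF X that(1)] that(2)] by simp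
  have "dist_supp X u \<subseteq> dist_supp X (diff_op_neg (const_poly c) u)" if "is_distribution X u" for u
  proof -
    have "dist_supp X (diff_op_neg (const_poly (1/c)) (diff_op_neg (const_poly c) u)) = dist_supp X u"
      by (rule dist_supp_cong) (rule **[OF that])
    then show ?thesis
      using dist_supp_diff_op_neg[OF X is_distribution_diff_op_neg[OF X that]] by metis
  qed
  then show "P_convex_supports (const_poly c) X"
    unfolding P_convex_supports_def compact_dists_def by (metis (no_types, lifting) mem_Collect_eq order_trans)
  have "dist_sing_supp X u \<subseteq> dist_sing_supp X (diff_op_neg (const_poly c) u)" if "is_distribution X u" for u
  proof -
    have "dist_sing_supp X (diff_op_neg (const_poly (1/c)) (diff_op_neg (const_poly c) u)) = dist_sing_supp X u"
      by (rule dist_sing_supp_cong) (rule **[OF that])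
    then show ?thesis
      using dist_sing_supp_diff_op_neg[OF X is_distribution_diff_op_neg[OF X that]] by metis
  qed
  then show "P_convex_sing_supports (const_poly c) X"
    unfolding P_convex_sing_supports_def compact_dists_def by (metis (no_types, lifting) mem_Collect_eq order_trans)
qed

lemma P_convex_prod:
  assumes X: "open X" and "finite J"
  shows "P_convex_supports (\<Prod>j\<in>J. F j) X \<longleftrightarrow> (\<forall>j\<in>J. P_convex_supports (F j) X)"
    "P_convex_sing_supports (\<Prod>j\<in>J. F j) X \<longleftrightarrow> (\<forall>j\<in>J. P_convex_sing_supports (F j) X)"
proof -
  have 1: "(1 :: 'a cpoly) = const_poly 1" by (simp add: const_poly_def)
  show "P_convex_supports (\<Prod>j\<in>J. F j) X \<longleftrightarrow> (\<forall>j\<in>J. P_convex_supports (F j) X)"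
    using assms(2) by induction (simp_all add: 1 P_convex_const X P_convex_supports_mult)
  show "P_convex_sing_supports (\<Prod>j\<in>J. F j) X \<longleftrightarrow> (\<forall>j\<in>J. P_convex_sing_supports (F j) X)"
    using assms(2) by induction (simp_all add: 1 P_convex_const X P_convex_sing_supports_mult)
qed

subsection \<open>Bump functions\<close>

text \<open>The index j closes the family under differentiation: the derivative of
  \<open>flat_exp j\<close> is \<open>flat_exp (j + 2)\<close> minus j times
  \<open>flat_exp (j + 1)\<close>.\<close>

definition flat_exp :: "nat \<Rightarrow> real \<Rightarrow> real" where
  "flat_exp j t = (if t \<le> 0 then 0 else exp (- 1 / t) / t ^ j)"

lemma power_le_fact_exp:
  fixes x :: real
  assumes "x \<ge> 0"
  shows "x ^ n \<le> fact n * exp x"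
proof -
  have s: "(\<lambda>n. x ^ n /\<^sub>R fact n) sums exp x" by (rule exp_converges)
  have "(\<Sum>k\<in>{n}. x ^ k /\<^sub>R fact k) \<le> suminf (\<lambda>k. x ^ k /\<^sub>R fact k)"
    by (rule sum_le_suminf) (use s assms in \<open>auto simp: sums_iff\<close>)
  then have "x ^ n /\<^sub>R fact n \<le> exp x"
    using s by (simp add: sums_iff)
  then show ?thesis by (simp add: field_simps)
qed

text \<open>The exponential beats every power: x^(j+2) \<le> (j+2)! e^x at x = 1/t. The remaining
  factor t^2 makes the difference quotient at 0 tend to 0.\<close>

lemma flat_exp_le: "\<bar>flat_exp j t\<bar> \<le> fact (j + 2) * t\<^sup>2"
proof (cases "t \<le> 0")
  case False
  have "(1/t) ^ (j + 2) \<le> fact (j + 2) * exp (1/t)"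
    by (rule power_le_fact_exp) (use False in auto)
  then have "exp (- 1 / t) \<le> fact (j + 2) * t ^ (j + 2)"
    using False by (simp add: exp_minus field_simps)
  then have "exp (- 1 / t) / t ^ j \<le> fact (j + 2) * t ^ (j + 2) / t ^ j"
    using False by (intro divide_right_mono) auto
  also have "\<dots> = fact (j + 2) * t\<^sup>2" using False by (simp add: power_add power2_eq_square)
  finally show ?thesis using False by (simp add: flat_exp_def)
qed (simp add: flat_exp_def)

lemma flat_exp_deriv:
  "(flat_exp j has_field_derivative flat_exp (j + 2) t - real j * flat_exp (j + 1) t) (at t)"
proof -
  consider "t < 0" | "t = 0" | "t > 0" by linarith
  then show ?thesis
  proof cases
    case 1
    have "((\<lambda>_. 0) has_field_derivative 0) (at t)" by simp
    then have "(flat_exp j has_field_derivative 0) (at t)"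
      by (rule has_field_derivative_transform_within_open[where S = "{..<0}"])
        (use 1 in \<open>auto simp: flat_exp_def\<close>)
    then show ?thesis using 1 by (simp add: flat_exp_def)
  next
    case 3
    have "((\<lambda>t. exp (- 1 / t) / t ^ j) has_field_derivative
       (exp (- 1 / t) * (1 / t\<^sup>2)) / t ^ j - exp (- 1 / t) * (real j * t ^ (j - 1)) / (t ^ j)\<^sup>2) (at t)"
      using 3 by (auto intro!: derivative_eq_intros simp: power2_eq_square field_simps)
    moreover have "(exp (- 1 / t) * (1 / t\<^sup>2)) / t ^ j - exp (- 1 / t) * (real j * t ^ (j - 1)) / (t ^ j)\<^sup>2
       = flat_exp (j + 2) t - real j * flat_exp (j + 1) t"
      using 3 by (cases j) (auto simp: flat_exp_def power_add power2_eq_square field_simps)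
    ultimately have "((\<lambda>t. exp (- 1 / t) / t ^ j) has_field_derivative
        flat_exp (j + 2) t - real j * flat_exp (j + 1) t) (at t)" by simp
    then show ?thesis
      by (rule has_field_derivative_transform_within_open[where S = "{0<..}"])
        (use 3 in \<open>auto simp: flat_exp_def\<close>)
  next
    case 2
    have le: "\<bar>flat_exp j h\<bar> / \<bar>h\<bar> \<le> fact (j + 2) * \<bar>h\<bar>" if "h \<noteq> 0" for h
      using flat_exp_le[of j h] that by (simp add: divide_le_eq power2_eq_square mult.assoc)
    have "((\<lambda>h. \<bar>flat_exp j h\<bar> / \<bar>h\<bar>) \<longlongrightarrow> 0) (at 0)"
    proof (rule Lim_null_comparison[where g = "\<lambda>h. fact (j + 2) * \<bar>h\<bar>"])
      show "\<forall>\<^sub>F h in at 0. norm (\<bar>flat_exp j h\<bar> / \<bar>h\<bar>) \<le> fact (j + 2) * \<bar>h\<bar>"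
        using le by (auto simp: eventually_at_filter)
      show "((\<lambda>h::real. fact (j + 2) * \<bar>h\<bar>) \<longlongrightarrow> 0) (at 0)"
        by (auto intro!: tendsto_eq_intros)
    qed
    then have "((\<lambda>h. flat_exp j h / h) \<longlongrightarrow> 0) (at 0)"
      using tendsto_norm_zero_iff[of "\<lambda>h. flat_exp j h / h" "at 0"] by (simp add: abs_divide)
    then show ?thesis
      using 2 by (simp add: has_field_derivative_iff flat_exp_def[of _ 0])
  qed
qed

text \<open>All compositions \<open>flat_exp j\<close> with q are taken as generators at once,
  together with the smooth functions; the chain rule then leads from one index j to polynomials in
  the others.\<close>

lemma smooth_flat_exp_comp:
  fixes q :: "real ^ 'n::finite \<Rightarrow> real"
  assumes U: "open U" and q: "smooth_fun_on U (\<lambda>x. complex_of_real (q x))"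
  shows "smooth_fun_on U (\<lambda>x. complex_of_real (flat_exp j (q x)))"
proof (rule smooth_alg_smooth[OF U, where G = "{f. smooth_fun_on U f} \<union> range (\<lambda>j x. complex_of_real (flat_exp j (q x)))"])
  let ?G = "{f. smooth_fun_on U f} \<union> range (\<lambda>j x. complex_of_real (flat_exp j (q x)))"
  have G: "(\<lambda>x. complex_of_real (flat_exp j (q x))) \<in> smooth_alg ?G" for j
    by (rule smooth_alg.base) auto
  show "(\<lambda>x. complex_of_real (flat_exp j (q x))) \<in> smooth_alg ?G" by (rule G)
  have D: "((\<lambda>x. complex_of_real (flat_exp j (q x))) has_derivative
     (\<lambda>h. complex_of_real (flat_exp (j + 2) (q x) - real j * flat_exp (j + 1) (q x)) *
       frechet_derivative (\<lambda>x. complex_of_real (q x)) (at x) h)) (at x)" if x: "x \<in> U" for x j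
  proof -
    let ?D = "frechet_derivative (\<lambda>x. complex_of_real (q x)) (at x)"
    have d: "((\<lambda>x. complex_of_real (q x)) has_derivative ?D) (at x)"
      using smooth_fun_onD[OF q x] by (simp add: frechet_derivative_works)
    from bounded_linear.has_derivative[OF bounded_linear_Re this]
    have dq: "(q has_derivative (\<lambda>h. Re (?D h))) (at x)" by simp
    from bounded_linear.has_derivative[OF bounded_linear_of_real[where 'a = complex] this]
    have "((\<lambda>x. complex_of_real (q x)) has_derivative (\<lambda>h. complex_of_real (Re (?D h)))) (at x)" .
    \<comment> \<open>The derivative of a real valued function is real valued. This allows the chain
      rule to be applied to the real function q and the result to be moved back to the complex
      numbers.\<close>
    then have "?D = (\<lambda>h. complex_of_real (Re (?D h)))"
      using d has_derivative_unique by blast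
    then have *: "complex_of_real (Re (?D h)) = ?D h" for h by metis
    have "((\<lambda>x. flat_exp j (q x)) has_derivative
       (\<lambda>h. (flat_exp (j + 2) (q x) - real j * flat_exp (j + 1) (q x)) * Re (?D h))) (at x)"
      by (rule has_derivative_compose[OF dq flat_exp_deriv[of j "q x", unfolded has_field_derivative_def]])
    from bounded_linear.has_derivative[OF bounded_linear_of_real[where 'a = complex] this] show ?thesis
      by (simp only: of_real_mult *)
  qed
  show "g differentiable (at x)" if "g \<in> ?G" "x \<in> U" for g x
    using that(1)
  proof
    assume "g \<in> range (\<lambda>j x. complex_of_real (flat_exp j (q x)))"
    then obtain j where "g = (\<lambda>x. complex_of_real (flat_exp j (q x)))" by (elim rangeE)
    then show ?thesis using D[OF that(2), of j] by (auto simp: differentiable_def)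
  qed (use that(2) smooth_fun_onD in auto)
  show "\<exists>h\<in>smooth_alg ?G. \<forall>x\<in>U. partial_deriv k g x = h x" if "g \<in> ?G" for g k
    using that
  proof
    assume "g \<in> {f. smooth_fun_on U f}"
    then have "partial_deriv k g \<in> smooth_alg ?G"
      by (intro smooth_alg.base UnI1) (simp add: smooth_partial_deriv)
    then show ?thesis by (rule bexI[rotated]) simp
  next
    assume "g \<in> range (\<lambda>j x. complex_of_real (flat_exp j (q x)))"
    then obtain j where g: "g = (\<lambda>x. complex_of_real (flat_exp j (q x)))" by (elim rangeE)
    let ?h = "\<lambda>x. (complex_of_real (flat_exp (j + 2) (q x)) + (- of_nat j) * complex_of_real (flat_exp (j + 1) (q x)))
       * partial_deriv k (\<lambda>x. complex_of_real (q x)) x"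
    have "?h \<in> smooth_alg ?G"
      by (intro smooth_alg.mult smooth_alg.add G smooth_alg.const)
        (rule smooth_alg.base, simp add: smooth_partial_deriv q)
    moreover have "\<forall>x\<in>U. partial_deriv k g x = ?h x"
      using partial_deriv_eqI[OF D, of _ k j] unfolding g
      by (simp add: partial_deriv_def[of k "\<lambda>x. complex_of_real (q x)"])
    ultimately show ?thesis by (rule bexI[where x = ?h, rotated])
  qed
qed

lemma smooth_coord:
  fixes U :: "(real ^ 'n::finite) set"
  assumes "open U"
  shows "smooth_fun_on U (\<lambda>x. complex_of_real (x $ k))"
proof (rule smooth_alg_smooth[OF assms, where G = "{\<lambda>x. complex_of_real (x $ k)}"])
  have D: "((\<lambda>x. complex_of_real (x $ k)) has_derivative (\<lambda>h. complex_of_real (h $ k))) (at x)" for x :: "real ^ 'n"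
    by (intro bounded_linear_imp_has_derivative bounded_linear_compose[OF bounded_linear_of_real bounded_linear_vec_nth])
  then show "g differentiable (at x)" if "g \<in> {\<lambda>x. complex_of_real (x $ k)}" for g and x :: "real ^ 'n"
    using that by (auto simp: differentiable_def)
  show "\<exists>h\<in>smooth_alg {\<lambda>x. complex_of_real (x $ k)}. \<forall>x\<in>U. partial_deriv j g x = h x"
    if "g \<in> {\<lambda>x. complex_of_real (x $ k)}" for g and j :: 'n
    using that
    by (intro bexI[of _ "\<lambda>x. complex_of_real (axis j 1 $ k)"]) (auto simp: partial_deriv_eqI[OF D] smooth_alg.const)
qed (auto intro: smooth_alg.base)

lemma smooth_sqdist:
  fixes U :: "(real ^ 'n::finite) set"
  assumes "open U"
  shows "smooth_fun_on U (\<lambda>x. complex_of_real ((dist x a)\<^sup>2))"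
proof -
  have "(\<lambda>x. complex_of_real ((dist x a)\<^sup>2)) =
    (\<lambda>x. \<Sum>k\<in>UNIV. (complex_of_real (x $ k) - complex_of_real (a $ k)) * (complex_of_real (x $ k) - complex_of_real (a $ k)))"
    by (simp add: dist_norm power2_norm_eq_inner inner_vec_def)
  then show ?thesis
    using assms by (simp add: smooth_sum smooth_mult smooth_diff smooth_coord smooth_const)
qed

lemma ex_bump:
  fixes a :: "real ^ 'n::finite"
  assumes "r > 0"
  obtains \<phi> where "\<phi> \<in> test_funs (ball a r)" "\<And>x. \<phi> x = complex_of_real (Re (\<phi> x))" "\<And>x. Re (\<phi> x) \<ge> 0"
    "Re (\<phi> a) > 0"
proof
  \<comment> \<open>Positive exactly on the ball of radius r/2, so the closed support stays inside
    the open ball of radius r.\<close>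
  let ?\<phi> = "\<lambda>x. complex_of_real (flat_exp 0 ((r/2)\<^sup>2 - (dist x a)\<^sup>2))"
  have sm: "smooth_fun_on UNIV ?\<phi>"
    by (rule smooth_flat_exp_comp) (simp_all only: of_real_diff open_UNIV smooth_diff smooth_const smooth_sqdist)
  show "?\<phi> \<in> test_funs (ball a r)"
  proof (rule test_funsI[OF sm, of "cball a (r/2)"])
    fix x assume "?\<phi> x \<noteq> 0"
    then have "(dist x a)\<^sup>2 < (r/2)\<^sup>2" by (auto simp: flat_exp_def split: if_splits)
    then have "dist x a < r/2" by (rule power_less_imp_less_base) (use assms in simp)
    then show "x \<in> cball a (r/2)" by (simp add: dist_commute)
  qed (use assms in auto)
  show "Re (?\<phi> a) > 0" using assms by (simp add: flat_exp_def)
qed (auto simp: flat_exp_def)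

text \<open>The quotient f/(f+g), where f is positive exactly for dist < s' and g exactly for dist >
  r. As r < s', the denominator has no zeros, and the quotient is 1 where g vanishes and 0 where f
  vanishes.\<close>

lemma ex_cutoff:
  fixes a :: "real ^ 'n::finite"
  assumes "0 < r" "r < s"
  obtains \<zeta> where "\<zeta> \<in> test_funs (ball a s)" "\<And>x. x \<in> cball a r \<Longrightarrow> \<zeta> x = 1"
proof -
  define s' where "s' = (r + s) / 2"
  have s': "r < s'" "s' < s" using assms by (auto simp: s'_def)
  let ?f = "\<lambda>x. complex_of_real (flat_exp 0 (s'\<^sup>2 - (dist x a)\<^sup>2))"
  let ?g = "\<lambda>x. complex_of_real (flat_exp 0 ((dist x a)\<^sup>2 - r\<^sup>2))"
  define \<zeta> where "\<zeta> = (\<lambda>x. ?f x * inverse (?f x + ?g x))"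
  have sf: "smooth_fun_on UNIV ?f" and sg: "smooth_fun_on UNIV ?g"
    by (rule smooth_flat_exp_comp; simp only: of_real_diff open_UNIV smooth_diff smooth_const smooth_sqdist)+
  have nz: "?f x + ?g x \<noteq> 0" for x
  proof -
    have "(dist x a)\<^sup>2 < s'\<^sup>2 \<or> (dist x a)\<^sup>2 > r\<^sup>2"
      using s' assms power_strict_mono[of r s' 2] by linarith
    then have "flat_exp 0 (s'\<^sup>2 - (dist x a)\<^sup>2) + flat_exp 0 ((dist x a)\<^sup>2 - r\<^sup>2) > 0"
      by (auto simp: flat_exp_def add_pos_pos)
    then show ?thesis
      by (metis less_irrefl of_real_add of_real_eq_0_iff)
  qed
  have sm: "smooth_fun_on UNIV \<zeta>"
    unfolding \<zeta>_def by (intro smooth_mult smooth_inverse smooth_add sf sg nz open_UNIV)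
  have "\<zeta> \<in> test_funs (ball a s)"
  proof (rule test_funsI[OF sm, of "cball a s'"])
    fix x assume "\<zeta> x \<noteq> 0"
    then have "(dist x a)\<^sup>2 < s'\<^sup>2" by (auto simp: \<zeta>_def flat_exp_def split: if_splits)
    then have "dist x a < s'" using assms s' by (simp add: power_less_imp_less_base)
    then show "x \<in> cball a s'" by (simp add: dist_commute)
  qed (use s' in auto)
  moreover have "\<zeta> x = 1" if "x \<in> cball a r" for x
  proof -
    have "(dist x a)\<^sup>2 \<le> r\<^sup>2" using that by (simp add: dist_commute power_mono)
    then have "?g x = 0" by (simp add: flat_exp_def)
    then show ?thesis using nz[of x] by (simp add: \<zeta>_def)
  qed
  ultimately show ?thesis using that by blast
qed

lemma lborel_integral_pos:
  fixes f :: "'a::euclidean_space \<Rightarrow> real"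
  assumes "integrable lborel f" "\<And>x. f x \<ge> 0" "open V" "a \<in> V" "\<And>x. x \<in> V \<Longrightarrow> f x > 0"
  shows "(\<integral>x. f x \<partial>lborel) > 0"
proof -
  have "(\<integral>x. f x \<partial>lborel) \<noteq> 0"
  proof
    assume "(\<integral>x. f x \<partial>lborel) = 0"
    then have "AE x in lborel. f x = 0"
      using integral_nonneg_eq_0_iff_AE[OF assms(1)] assms(2) by simp
    then have "AE x in lebesgue. x \<notin> V"
      by (rule AE_completion[THEN AE_mp]) (use assms(5) in force)
    then have "negligible V"
      using assms(3) by (subst negligible_iff_null_sets) (simp add: AE_iff_null_sets[symmetric] fmeasurable_def)
    then show False using open_not_negligible[OF assms(3)] assms(4) by blast
  qed
  moreover have "(\<integral>x. f x \<partial>lborel) \<ge> 0" using assms(2) by simp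
  ultimately show ?thesis by simp
qed

lemma ex_mollifier:
  obtains \<rho> :: "real ^ 'n::finite \<Rightarrow> complex" where "\<rho> \<in> test_funs (ball 0 1)" "(\<integral>x. \<rho> x \<partial>lborel) = 1"
proof -
  obtain \<phi> :: "real ^ 'n \<Rightarrow> complex" where \<phi>: "\<phi> \<in> test_funs (ball 0 1)"
    "\<And>x. \<phi> x = complex_of_real (Re (\<phi> x))" "\<And>x. Re (\<phi> x) \<ge> 0" "Re (\<phi> 0) > 0"
    using ex_bump[of 1 0] by (metis zero_less_one)
  have cont: "continuous_on UNIV (\<lambda>x. Re (\<phi> x))"
    by (intro continuous_intros test_funs_continuous[OF \<phi>(1)])
  have int: "integrable lborel (\<lambda>x. Re (\<phi> x))"
    using integrable_test_fun[OF \<phi>(1)] by simp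
  have "(\<integral>x. Re (\<phi> x) \<partial>lborel) > 0"
    by (rule lborel_integral_pos[OF int \<phi>(3), of "{x. Re (\<phi> x) > 0}" 0])
      (use \<phi>(4) open_Collect_less[OF continuous_on_const cont] in auto)
  moreover have "(\<integral>x. \<phi> x \<partial>lborel) = complex_of_real (\<integral>x. Re (\<phi> x) \<partial>lborel)"
    by (subst \<phi>(2)) simp
  ultimately have "(\<integral>x. \<phi> x \<partial>lborel) \<noteq> 0" by auto
  moreover have "(\<lambda>x. inverse (\<integral>x. \<phi> x \<partial>lborel) * \<phi> x) \<in> test_funs (ball 0 1)"
    by (rule test_funs_cmult[OF _ \<phi>(1)]) auto
  ultimately show ?thesis
    using that[of "\<lambda>x. inverse (\<integral>x. \<phi> x \<partial>lborel) * \<phi> x"] by simp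
qed

subsection \<open>Uniform Taylor estimates\<close>

lemma norm_sum_coords_le:
  fixes h :: "real ^ 'n::finite" and c :: "'n \<Rightarrow> complex"
  shows "cmod (\<Sum>k\<in>UNIV. h $ k *\<^sub>R c k) \<le> norm h * (\<Sum>k\<in>UNIV. cmod (c k))"
proof -
  have "cmod (\<Sum>k\<in>UNIV. h $ k *\<^sub>R c k) \<le> (\<Sum>k\<in>UNIV. norm h * cmod (c k))"
    by (rule sum_norm_le) (simp add: mult_right_mono component_le_norm_cart)
  then show ?thesis by (simp add: sum_distrib_left)
qed

lemma test_funs_lipschitz:
  assumes "\<phi> \<in> test_funs U"
  obtains L where "L \<ge> 0" "\<And>x y. cmod (\<phi> y - \<phi> x) \<le> L * norm (y - x)"
proof -
  obtain B where B: "B \<ge> 0" "\<And>ks x. length ks \<le> 1 \<Longrightarrow> cmod (partial_derivs ks \<phi> x) \<le> B"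
    by (rule test_funs_derivs_bounded[OF assms, of 1]) blast
  have "cmod (\<phi> y - \<phi> x) \<le> (\<Sum>k\<in>(UNIV :: 'a set). B) * norm (y - x)" for x y
  proof (rule differentiable_bound[of UNIV])
    show "(\<phi> has_derivative (\<lambda>h. \<Sum>k\<in>UNIV. h $ k *\<^sub>R partial_deriv k \<phi> x)) (at x within UNIV)" for x
      using smooth_has_derivative[OF test_funsD(1)[OF assms]] by simp
    show "onorm (\<lambda>h. \<Sum>k\<in>UNIV. h $ k *\<^sub>R partial_deriv k \<phi> x) \<le> (\<Sum>k\<in>(UNIV :: 'a set). B)" for x
    proof (rule onorm_le)
      fix h :: "real ^ 'a"
      have "(\<Sum>k\<in>UNIV. cmod (partial_deriv k \<phi> x)) \<le> (\<Sum>k\<in>(UNIV :: 'a set). B)"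
        by (rule sum_mono) (use B(2)[of "[_]"] in simp)
      then show "cmod (\<Sum>k\<in>UNIV. h $ k *\<^sub>R partial_deriv k \<phi> x) \<le> (\<Sum>k\<in>(UNIV :: 'a set). B) * norm h"
        using norm_sum_coords_le[of h "\<lambda>k. partial_deriv k \<phi> x"] mult_left_mono[of _ _ "norm h"]
        by (fastforce simp: mult.commute)
    qed
  qed auto
  then show ?thesis using that[of "\<Sum>k\<in>(UNIV :: 'a set). B"] B(1) by (simp add: sum_nonneg)
qed

text \<open>Mean value inequality for the remainder as a function of the increment, whose gradient
  is Lipschitz small. The constant is independent of x, which is what a distribution applied to a
  Taylor remainder requires.\<close>

lemma test_funs_taylor:
  fixes \<phi> :: "real ^ 'n::finite \<Rightarrow> complex"
  assumes "\<phi> \<in> test_funs U"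
  obtains B where "B \<ge> 0"
    "\<And>x h. cmod (\<phi> (x + h) - \<phi> x - (\<Sum>k\<in>UNIV. h $ k *\<^sub>R partial_deriv k \<phi> x)) \<le> B * (norm h)\<^sup>2"
proof -
  have "\<forall>k. \<exists>L\<ge>0. \<forall>x y. cmod (partial_deriv k \<phi> y - partial_deriv k \<phi> x) \<le> L * norm (y - x)"
    using test_funs_lipschitz[OF test_funs_partial_deriv[OF assms]] by metis
  then obtain L where L: "\<And>k. L k \<ge> 0" "\<And>k x y. cmod (partial_deriv k \<phi> y - partial_deriv k \<phi> x) \<le> L k * norm (y - x)"
    by metis
  let ?B = "\<Sum>k\<in>UNIV. L k"
  have "cmod (\<phi> (x + h) - \<phi> x - (\<Sum>k\<in>UNIV. h $ k *\<^sub>R partial_deriv k \<phi> x)) \<le> ?B * (norm h)\<^sup>2" for x h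
  proof -
    let ?g = "\<lambda>v. \<phi> (x + v) - (\<Sum>k\<in>UNIV. v $ k *\<^sub>R partial_deriv k \<phi> x)"
    have "cmod (?g h - ?g 0) \<le> (?B * norm h) * norm (h - 0)"
    proof (rule differentiable_bound[of "cball 0 (norm h)"])
      fix v :: "real ^ 'n" assume v: "v \<in> cball 0 (norm h)"
      have 1: "((\<lambda>v. \<phi> (x + v)) has_derivative (\<lambda>w. \<Sum>k\<in>UNIV. w $ k *\<^sub>R partial_deriv k \<phi> (x + v))) (at v within cball 0 (norm h))"
        by (rule has_derivative_compose[OF _ smooth_has_derivative[OF test_funsD(1)[OF assms]]])
          (auto intro!: derivative_eq_intros)
      show "(?g has_derivative (\<lambda>w. (\<Sum>k\<in>UNIV. w $ k *\<^sub>R partial_deriv k \<phi> (x + v)) - (\<Sum>k\<in>UNIV. w $ k *\<^sub>R partial_deriv k \<phi> x)))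
        (at v within cball 0 (norm h))"
        by (intro has_derivative_diff[OF 1] has_derivative_sum has_derivative_scaleR_left
            bounded_linear_imp_has_derivative bounded_linear_vec_nth)
      show "onorm (\<lambda>w. (\<Sum>k\<in>UNIV. w $ k *\<^sub>R partial_deriv k \<phi> (x + v)) - (\<Sum>k\<in>UNIV. w $ k *\<^sub>R partial_deriv k \<phi> x))
         \<le> ?B * norm h"
      proof (rule onorm_le)
        fix w :: "real ^ 'n"
        have "(\<Sum>k\<in>UNIV. cmod (partial_deriv k \<phi> (x + v) - partial_deriv k \<phi> x)) \<le> (\<Sum>k\<in>UNIV. L k * norm h)"
        proof (rule sum_mono)
          fix k
          show "cmod (partial_deriv k \<phi> (x + v) - partial_deriv k \<phi> x) \<le> L k * norm h"
            using L(2)[of k "x + v" x] v mult_left_mono[of "norm v" "norm h" "L k"] L(1)[of k] by simp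
        qed
        then have "norm w * (\<Sum>k\<in>UNIV. cmod (partial_deriv k \<phi> (x + v) - partial_deriv k \<phi> x)) \<le> norm w * (?B * norm h)"
          by (intro mult_left_mono) (auto simp: sum_distrib_right)
        then show "cmod ((\<Sum>k\<in>UNIV. w $ k *\<^sub>R partial_deriv k \<phi> (x + v)) - (\<Sum>k\<in>UNIV. w $ k *\<^sub>R partial_deriv k \<phi> x)) \<le> ?B * norm h * norm w"
          using norm_sum_coords_le[of w "\<lambda>k. partial_deriv k \<phi> (x + v) - partial_deriv k \<phi> x"]
          by (simp add: sum_subtractf[symmetric] scaleR_diff_right mult_ac)
      qed
    qed auto
    then show ?thesis by (simp add: power2_eq_square algebra_simps)
  qed
  then show ?thesis using that[of ?B] L(1) by (simp add: sum_nonneg)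
qed

text \<open>Turns one bound for each list of derivatives into a common bound for all lists of length
  at most b. The parameter z bundles the points in which the bound is uniform.\<close>

lemma finite_list_bound:
  fixes g :: "'n::finite list \<Rightarrow> 'z \<Rightarrow> real"
  assumes "\<And>ks. \<exists>B. \<forall>z. g ks z \<le> B"
  obtains B where "B \<ge> 0" "\<And>ks z. length ks \<le> b \<Longrightarrow> g ks z \<le> B"
proof -
  obtain B where B: "\<And>ks z. g ks z \<le> B ks" using assms by metis
  have fin: "finite {ks :: 'n list. length ks \<le> b}"
    using finite_lists_length_le[of "UNIV :: 'n set" b] by simp
  show ?thesis
  proof (rule that[of "\<Sum>ks\<in>{ks. length ks \<le> b}. \<bar>B ks\<bar>"])
    fix ks :: "'n list" and z assume "length ks \<le> b"
    then have "\<bar>B ks\<bar> \<le> (\<Sum>ks\<in>{ks. length ks \<le> b}. \<bar>B ks\<bar>)"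
      by (intro member_le_sum) (use fin in auto)
    then show "g ks z \<le> (\<Sum>ks\<in>{ks. length ks \<le> b}. \<bar>B ks\<bar>)" using B[of ks z] by linarith
  qed (simp add: sum_nonneg)
qed

lemma has_derivative_quadratic:
  fixes F :: "real ^ 'n::finite \<Rightarrow> complex"
  assumes "\<eta> > 0" "\<And>h. norm h \<le> \<eta> \<Longrightarrow> cmod (F (x + h) - F x - (\<Sum>k\<in>UNIV. h $ k *\<^sub>R G k)) \<le> B * (norm h)\<^sup>2"
  shows "(F has_derivative (\<lambda>h. \<Sum>k\<in>UNIV. h $ k *\<^sub>R G k)) (at x)"
  unfolding has_derivative_at
proof
  show "bounded_linear (\<lambda>h. \<Sum>k\<in>UNIV. h $ k *\<^sub>R G k)"
    by (intro bounded_linear_sum bounded_linear_scaleR_const bounded_linear_vec_nth)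
  show "(\<lambda>h. cmod (F (x + h) - F x - (\<Sum>k\<in>UNIV. h $ k *\<^sub>R G k)) / norm h) \<midarrow>0\<rightarrow> 0"
  proof (rule Lim_null_comparison)
    show "\<forall>\<^sub>F h in at 0. norm (cmod (F (x + h) - F x - (\<Sum>k\<in>UNIV. h $ k *\<^sub>R G k)) / norm h) \<le> B * norm h"
      unfolding eventually_at
    proof (intro exI[of _ \<eta>] conjI ballI impI)
      fix h :: "real ^ 'n" assume "h \<noteq> 0 \<and> dist h 0 < \<eta>"
      then show "norm (cmod (F (x + h) - F x - (\<Sum>k\<in>UNIV. h $ k *\<^sub>R G k)) / norm h) \<le> B * norm h"
        using assms(2)[of h] by (simp add: divide_le_eq power2_eq_square mult.assoc)
    qed (rule assms(1))
    show "(\<lambda>h::real^'n. B * norm h) \<midarrow>0\<rightarrow> 0" by (auto intro!: tendsto_eq_intros)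
  qed
qed

text \<open>A common tool for weighted averages of translates: the path \<gamma> is -t for
  convolutions, \<epsilon> t for mollification, and runs along a leaf in the solution of
  \<open>dN N v = \<phi>\<close>. The quadratic Taylor remainder is integrated against the bounded
  weight.\<close>

lemma param_integral_partial_deriv:
  fixes \<gamma> :: "'b::euclidean_space \<Rightarrow> real ^ 'n::finite"
  assumes \<phi>: "\<phi> \<in> test_funs U" and w: "continuous_on (cbox a b) w" and \<gamma>: "continuous_on (cbox a b) \<gamma>"
  shows "((\<lambda>x. integral (cbox a b) (\<lambda>t. w t * \<phi> (x + \<gamma> t))) has_derivative
    (\<lambda>h. \<Sum>k\<in>UNIV. h $ k *\<^sub>R integral (cbox a b) (\<lambda>t. w t * partial_deriv k \<phi> (x + \<gamma> t)))) (at x)"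
proof -
  obtain B where B: "B \<ge> 0"
    "\<And>x h. cmod (\<phi> (x + h) - \<phi> x - (\<Sum>k\<in>UNIV. h $ k *\<^sub>R partial_deriv k \<phi> x)) \<le> B * (norm h)\<^sup>2"
    by (rule test_funs_taylor[OF \<phi>]) blast
  obtain M where M: "\<And>t. t \<in> cbox a b \<Longrightarrow> cmod (w t) \<le> M"
    using compact_imp_bounded[OF compact_continuous_image[OF w compact_cbox]] by (auto simp: bounded_iff)
  have int: "(\<lambda>t. w t * \<psi> (x + \<gamma> t)) integrable_on cbox a b" if "\<psi> \<in> test_funs U" for \<psi> x
    by (intro integrable_continuous continuous_intros w continuous_on_compose2[OF test_funs_continuous[OF that, of UNIV]] \<gamma>) auto
  show ?thesis
  proof (rule has_derivative_quadratic[of 1])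
    fix h :: "real ^ 'n"
    let ?R = "\<lambda>t. w t * (\<phi> (x + h + \<gamma> t) - \<phi> (x + \<gamma> t) - (\<Sum>k\<in>UNIV. h $ k *\<^sub>R partial_deriv k \<phi> (x + \<gamma> t)))"
    have "integral (cbox a b) (\<lambda>t. w t * \<phi> (x + h + \<gamma> t)) - integral (cbox a b) (\<lambda>t. w t * \<phi> (x + \<gamma> t))
        - (\<Sum>k\<in>UNIV. h $ k *\<^sub>R integral (cbox a b) (\<lambda>t. w t * partial_deriv k \<phi> (x + \<gamma> t)))
        = integral (cbox a b) (\<lambda>t. w t * \<phi> (x + h + \<gamma> t) - w t * \<phi> (x + \<gamma> t)
           - (\<Sum>k\<in>UNIV. h $ k *\<^sub>R (w t * partial_deriv k \<phi> (x + \<gamma> t))))"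
      by (subst Henstock_Kurzweil_Integration.integral_diff Henstock_Kurzweil_Integration.integral_sum;
          (intro integrable_diff integrable_sum integrable_cmul int test_funs_partial_deriv \<phi>)?;
          simp?)+
    also have "\<dots> = integral (cbox a b) ?R"
      by (simp add: algebra_simps sum_distrib_left)
    also have "cmod \<dots> \<le> integral (cbox a b) (\<lambda>t. M * (B * (norm h)\<^sup>2))"
    proof (rule integral_norm_bound_integral)
      show "?R integrable_on cbox a b"
        by (intro integrable_continuous continuous_intros w \<gamma>
            continuous_on_compose2[OF test_funs_continuous[OF \<phi>, of UNIV]]
            continuous_on_compose2[OF test_funs_continuous[OF test_funs_partial_deriv[OF \<phi>], of UNIV]]) auto
      show "cmod (?R t) \<le> M * (B * (norm h)\<^sup>2)" if "t \<in> cbox a b" for t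
        using M[OF that] B(2)[of "x + \<gamma> t" h] B(1) unfolding norm_mult
        by (intro mult_mono) (auto simp: algebra_simps intro: order_trans[OF norm_ge_zero])
    qed auto
    finally show "cmod (integral (cbox a b) (\<lambda>t. w t * \<phi> (x + h + \<gamma> t)) - integral (cbox a b) (\<lambda>t. w t * \<phi> (x + \<gamma> t))
        - (\<Sum>k\<in>UNIV. h $ k *\<^sub>R integral (cbox a b) (\<lambda>t. w t * partial_deriv k \<phi> (x + \<gamma> t))))
        \<le> (measure lborel (cbox a b) * M * B) * (norm h)\<^sup>2"
      by (simp add: mult_ac)
  qed simp
qed

lemma param_integral_smooth:
  fixes \<gamma> :: "'b::euclidean_space \<Rightarrow> real ^ 'n::finite"
  assumes \<phi>: "\<phi> \<in> test_funs U" and w: "continuous_on (cbox a b) w" and \<gamma>: "continuous_on (cbox a b) \<gamma>"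
  shows "smooth_fun_on UNIV (\<lambda>x. integral (cbox a b) (\<lambda>t. w t * \<phi> (x + \<gamma> t)))"
    and "partial_derivs ks (\<lambda>x. integral (cbox a b) (\<lambda>t. w t * \<phi> (x + \<gamma> t))) =
       (\<lambda>x. integral (cbox a b) (\<lambda>t. w t * partial_derivs ks \<phi> (x + \<gamma> t)))"
proof -
  let ?F = "\<lambda>\<phi> x. integral (cbox a b) (\<lambda>t. w t * \<phi> (x + \<gamma> t))"
  have p: "partial_deriv k (?F \<phi>) = ?F (partial_deriv k \<phi>)" if "\<phi> \<in> test_funs U" for k \<phi>
    using partial_deriv_eqI[OF param_integral_partial_deriv[OF that w \<gamma>], of k] by (auto simp: axis_sum)
  show "smooth_fun_on UNIV (?F \<phi>)"
  proof (rule smooth_fun_on_coinduct[where R = "\<lambda>f. \<exists>\<phi>\<in>test_funs U. f = ?F \<phi>"])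
    show "f differentiable (at x)" if "\<exists>\<phi>\<in>test_funs U. f = ?F \<phi>" for f x
      using that param_integral_partial_deriv[OF _ w \<gamma>] by (auto simp: differentiable_def)
    show "\<exists>g. (\<exists>\<phi>\<in>test_funs U. g = ?F \<phi>) \<and> (\<forall>x\<in>UNIV. partial_deriv k f x = g x)"
      if f: "\<exists>\<phi>\<in>test_funs U. f = ?F \<phi>" for f k
    proof -
      obtain \<psi> where \<psi>: "\<psi> \<in> test_funs U" "f = ?F \<psi>" using f by (elim bexE)
      show ?thesis
        by (intro exI[of _ "?F (partial_deriv k \<psi>)"] conjI bexI[of _ "partial_deriv k \<psi>"] refl
            test_funs_partial_deriv \<psi>) (simp add: \<psi>(2) p[OF \<psi>(1)])
    qed
  qed (use \<phi> in auto)
  show "partial_derivs ks (?F \<phi>) = ?F (partial_derivs ks \<phi>)"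
    using \<phi>
  proof (induction ks arbitrary: \<phi>)
    case (Cons k ks)
    then show ?case using p[OF Cons.prems, of k] test_funs_partial_deriv[OF Cons.prems, of k] by simp
  qed simp
qed

subsection \<open>Regularisation\<close>

lemma partial_derivs_sum:
  assumes "open U" "\<And>i. i \<in> I \<Longrightarrow> smooth_fun_on U (f i)" "x \<in> U"
  shows "partial_derivs ks (\<lambda>x. \<Sum>i\<in>I. f i x) x = (\<Sum>i\<in>I. partial_derivs ks (f i) x)"
  using assms(2)
proof (induction I rule: infinite_finite_induct)
  case (insert i I)
  then show ?case
    using partial_derivs_add[OF assms(1) _ smooth_sum[OF assms(1)] assms(3), of "f i" I f ks] by simp
qed (use partial_derivs_cmult[OF assms(1) smooth_const[OF assms(1)] assms(3), of ks 0] in auto)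

text \<open>The convolution of u with \<kappa>, meaningful at those x for which x minus the support
  of \<kappa> lies in X.\<close>

definition conv :: "'n::finite functional \<Rightarrow> (real ^ 'n \<Rightarrow> complex) \<Rightarrow> real ^ 'n \<Rightarrow> complex" where
  "conv u \<kappa> x = u (\<lambda>y. \<kappa> (x - y))"

lemma test_funs_reflect:
  assumes "\<kappa> \<in> test_funs U" "\<And>s. s \<in> fun_support \<kappa> \<Longrightarrow> x - s \<in> V"
  shows "(\<lambda>y. \<kappa> (x - y)) \<in> test_funs V"
proof -
  have "(\<lambda>y. \<kappa> ((-1) *\<^sub>R y + x)) \<in> test_funs V"
  proof (rule test_funs_affine[OF assms(1)])
    fix y assume "(-1) *\<^sub>R y + x \<in> fun_support \<kappa>"
    from assms(2)[OF this] show "y \<in> V" by simp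
  qed simp
  then show ?thesis by simp
qed

lemma partial_derivs_reflect:
  assumes "smooth_fun_on UNIV \<kappa>"
  shows "partial_derivs ks (\<lambda>y. \<kappa> (x - y)) = (\<lambda>y. (-1) ^ length ks * partial_derivs ks \<kappa> (x - y))"
  using partial_derivs_affine[OF assms, of ks "-1" x] by simp

lemma compact_diff_image:
  fixes A S :: "'a::real_normed_vector set"
  assumes "compact A" "compact S"
  shows "compact ((\<lambda>(x, s). x - s) ` (A \<times> S))"
  by (intro compact_continuous_image compact_Times assms) (auto simp: split_beta intro!: continuous_intros)

lemma conv_estimate:
  assumes u: "is_distribution X u" and A: "compact A" and S: "compact S"
    and AS: "\<And>x s. x \<in> A \<Longrightarrow> s \<in> S \<Longrightarrow> x - s \<in> X"
  obtains C b where "C \<ge> 0" "\<And>\<kappa> B x. \<kappa> \<in> test_funs UNIV \<Longrightarrow> fun_support \<kappa> \<subseteq> S \<Longrightarrow>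
     (\<And>ks z. length ks \<le> b \<Longrightarrow> cmod (partial_derivs ks \<kappa> z) \<le> B) \<Longrightarrow> x \<in> A \<Longrightarrow> cmod (conv u \<kappa> x) \<le> C * B"
proof -
  let ?K = "(\<lambda>(x, s). x - s) ` (A \<times> S)"
  have K: "compact ?K" "?K \<subseteq> X"
    using AS by (auto intro: compact_diff_image A S)
  obtain C b where C: "C \<ge> 0" "\<And>\<phi> B. \<phi> \<in> test_funs X \<Longrightarrow> fun_support \<phi> \<subseteq> ?K \<Longrightarrow>
       (\<And>ks x. length ks \<le> b \<Longrightarrow> cmod (partial_derivs ks \<phi> x) \<le> B) \<Longrightarrow> cmod (u \<phi>) \<le> C * B"
    by (rule is_distribution_estimate[OF u K]) blast
  show ?thesis
  proof (rule that[OF C(1)])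
    fix \<kappa> B x
    assume \<kappa>: "\<kappa> \<in> test_funs UNIV" "fun_support \<kappa> \<subseteq> S" and x: "x \<in> A"
      and B: "\<And>ks z. length ks \<le> b \<Longrightarrow> cmod (partial_derivs ks \<kappa> z) \<le> B"
    show "cmod (conv u \<kappa> x) \<le> C * B"
      unfolding conv_def
    proof (rule C(2))
      show "(\<lambda>y. \<kappa> (x - y)) \<in> test_funs X"
        by (rule test_funs_reflect[OF \<kappa>(1)]) (use AS x \<kappa>(2) in auto)
      show "fun_support (\<lambda>y. \<kappa> (x - y)) \<subseteq> ?K"
      proof (rule fun_support_subset[OF compact_imp_closed[OF K(1)]])
        fix y assume "\<kappa> (x - y) \<noteq> 0"
        then have "x - y \<in> S" using not_in_fun_support[of "x - y" \<kappa>] \<kappa>(2) by auto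
        then show "y \<in> ?K" using x by (intro image_eqI[of _ _ "(x, x - y)"]) auto
      qed
      show "cmod (partial_derivs ks (\<lambda>y. \<kappa> (x - y)) z) \<le> B" if "length ks \<le> b" for ks z
        using B[OF that] by (simp add: partial_derivs_reflect[OF test_funsD(1)[OF \<kappa>(1)]] norm_mult norm_power)
    qed
  qed
qed

text \<open>Apply u to the Taylor remainder of \<open>\<kappa> (x - y)\<close> as a function of y.
  Every derivative of it up to order b is a Taylor remainder again, hence O(|h|^2), and so is the
  value of u; a quadratic remainder gives differentiability.\<close>

lemma conv_has_derivative:
  assumes X: "open X" and u: "is_distribution X u" and \<kappa>: "\<kappa> \<in> test_funs UNIV" and \<eta>: "\<eta> > 0"
    and AS: "\<And>x' s. x' \<in> cball x \<eta> \<Longrightarrow> s \<in> fun_support \<kappa> \<Longrightarrow> x' - s \<in> X"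
  shows "(conv u \<kappa> has_derivative (\<lambda>h. \<Sum>k\<in>UNIV. h $ k *\<^sub>R conv u (partial_deriv k \<kappa>) x)) (at x)"
proof -
  let ?K = "(\<lambda>(x, s). x - s) ` (cball x \<eta> \<times> fun_support \<kappa>)"
  have K: "compact ?K" "?K \<subseteq> X"
    using AS by (auto intro!: compact_diff_image test_funsD(2)[OF \<kappa>])
  obtain C b where C: "C \<ge> 0" "\<And>\<phi> B. \<phi> \<in> test_funs X \<Longrightarrow> fun_support \<phi> \<subseteq> ?K \<Longrightarrow>
       (\<And>ks x. length ks \<le> b \<Longrightarrow> cmod (partial_derivs ks \<phi> x) \<le> B) \<Longrightarrow> cmod (u \<phi>) \<le> C * B"
    by (rule is_distribution_estimate[OF u K]) blast
  define T where "T \<psi> z h = \<psi> (z + h) - \<psi> z - (\<Sum>k\<in>UNIV. complex_of_real (h $ k) * partial_deriv k \<psi> z)"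
    for \<psi> :: "real ^ 'a \<Rightarrow> complex" and z h
  \<comment> \<open>The pair zh stands for point and increment. Dividing by the squared norm
    isolates the constant; for h = 0 the quotient is 0.\<close>
  have "\<exists>B. \<forall>zh. cmod (T (partial_derivs ks \<kappa>) (fst zh) (snd zh)) / (norm (snd zh))\<^sup>2 \<le> B" for ks
  proof -
    obtain B where "B \<ge> 0" "\<And>x h. cmod (partial_derivs ks \<kappa> (x + h) - partial_derivs ks \<kappa> x
        - (\<Sum>k\<in>UNIV. h $ k *\<^sub>R partial_deriv k (partial_derivs ks \<kappa>) x)) \<le> B * (norm h)\<^sup>2"
      by (rule test_funs_taylor[OF test_funs_partial_derivs[OF \<kappa>, of ks]]) blast
    then show ?thesis
      by (intro exI[of _ B]) (auto simp: T_def scaleR_conv_of_real[where 'a = complex] divide_le_eq)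
  qed
  then obtain B where B: "B \<ge> 0"
    "\<And>ks zh. length ks \<le> b \<Longrightarrow> cmod (T (partial_derivs ks \<kappa>) (fst zh) (snd zh)) / (norm (snd zh))\<^sup>2 \<le> B"
    by (rule finite_list_bound[where g = "\<lambda>ks zh. cmod (T (partial_derivs ks \<kappa>) (fst zh) (snd zh)) / (norm (snd zh))\<^sup>2" and b = b]) blast
  have B': "cmod (T (partial_derivs ks \<kappa>) z h) \<le> B * (norm h)\<^sup>2" if "length ks \<le> b" for ks z h
    using B(2)[OF that, of "(z, h)"] by (cases "h = 0") (auto simp: T_def divide_le_eq)
  note sm = test_funsD(1)[OF \<kappa>]
  have refl: "(\<lambda>y. \<psi> (x' - y)) \<in> test_funs X"
    if "\<psi> \<in> test_funs UNIV" "fun_support \<psi> \<subseteq> fun_support \<kappa>" "x' \<in> cball x \<eta>" for \<psi> x'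
    using that AS by (intro test_funs_reflect[OF that(1)]) auto
  have x: "x \<in> cball x \<eta>" using \<eta> by simp
  show ?thesis
  proof (rule has_derivative_quadratic[OF \<eta>])
    fix h :: "real ^ 'a" assume h: "norm h \<le> \<eta>"
    then have xh: "x + h \<in> cball x \<eta>" by (simp add: dist_norm)
    let ?\<phi> = "\<lambda>y. T \<kappa> (x - y) h"
    have t1: "(\<lambda>y. \<kappa> (x + h - y)) \<in> test_funs X" by (rule refl[OF \<kappa> _ xh]) simp
    have t2: "(\<lambda>y. \<kappa> (x - y)) \<in> test_funs X" by (rule refl[OF \<kappa> _ x]) simp
    have t3: "(\<lambda>y. partial_deriv k \<kappa> (x - y)) \<in> test_funs X" for k
      by (rule refl[OF test_funs_partial_deriv[OF \<kappa>] fun_support_partial_deriv x])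
    have t4: "(\<lambda>y. \<Sum>k\<in>UNIV. complex_of_real (h $ k) * partial_deriv k \<kappa> (x - y)) \<in> test_funs X"
      by (intro test_funs_sum test_funs_cmult X t3)
    have t5: "(\<lambda>y. \<kappa> (x + h - y) - \<kappa> (x - y)) \<in> test_funs X"
      using test_funs_add[OF t1 test_funs_cmult[OF X t2, of "-1"]] by simp
    have eq: "?\<phi> = (\<lambda>y. (\<kappa> (x + h - y) - \<kappa> (x - y)) - (\<Sum>k\<in>UNIV. complex_of_real (h $ k) * partial_deriv k \<kappa> (x - y)))"
      by (simp add: T_def algebra_simps)
    have t6: "?\<phi> \<in> test_funs X"
      unfolding eq using test_funs_add[OF t5 test_funs_cmult[OF X t4, of "-1"]] by simp
    have "u ?\<phi> = conv u \<kappa> (x + h) - conv u \<kappa> x - (\<Sum>k\<in>UNIV. h $ k *\<^sub>R conv u (partial_deriv k \<kappa>) x)"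
      unfolding eq conv_def
      by (simp add: is_distribution_diff[OF X u t5 t4] is_distribution_diff[OF X u t1 t2]
          is_distribution_sum[OF u test_funs_cmult[OF X t3]] is_distribution_cmult[OF u t3]
          scaleR_conv_of_real[where 'a = complex])
    moreover have "cmod (u ?\<phi>) \<le> C * (B * (norm h)\<^sup>2)"
    proof (rule C(2)[OF t6])
      show "fun_support ?\<phi> \<subseteq> ?K"
      proof (rule fun_support_subset[OF compact_imp_closed[OF K(1)]])
        fix y assume "?\<phi> y \<noteq> 0"
        then have "x + h - y \<in> fun_support \<kappa> \<or> x - y \<in> fun_support \<kappa>"
          using not_in_fun_support[of "x - y + h" \<kappa>] not_in_fun_support[of "x - y" \<kappa>]
            partial_deriv_outside_support[of "x - y" \<kappa>]
          by (cases "x - y \<in> fun_support \<kappa>"; cases "x - y + h \<in> fun_support \<kappa>")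
            (simp_all add: T_def add_diff_eq diff_add_eq)
        then show "y \<in> ?K"
          using x xh by (auto intro: image_eqI[of _ _ "(x + h, x + h - y)"] image_eqI[of _ _ "(x, x - y)"])
      qed
      fix ks :: "'a list" and y assume ks: "length ks \<le> b"
      have "partial_derivs ks ?\<phi> y = (-1) ^ length ks * T (partial_derivs ks \<kappa>) (x - y) h"
      proof -
        have s1: "partial_derivs ks (\<lambda>y. \<Sum>k\<in>UNIV. complex_of_real (h $ k) * partial_deriv k \<kappa> (x - y)) y
          = (\<Sum>k\<in>UNIV. complex_of_real (h $ k) * ((-1) ^ length ks * partial_derivs ks (partial_deriv k \<kappa>) (x - y)))"
          by (subst partial_derivs_sum[OF open_UNIV smooth_cmult[OF open_UNIV test_funsD(1)[OF t3]]])
            (simp_all add: partial_derivs_cmult[OF open_UNIV test_funsD(1)[OF t3]]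
              partial_derivs_reflect[OF smooth_partial_deriv[OF sm]])
        show ?thesis
          unfolding eq
          unfolding T_def partial_derivs_diff[OF open_UNIV test_funsD(1)[OF t5] test_funsD(1)[OF t4] UNIV_I]
            partial_derivs_diff[OF open_UNIV test_funsD(1)[OF t1] test_funsD(1)[OF t2] UNIV_I]
            s1 partial_derivs_reflect[OF sm] partial_deriv_partial_derivs[OF sm]
          by (simp add: algebra_simps sum_distrib_left)
      qed
      then show "cmod (partial_derivs ks ?\<phi> y) \<le> B * (norm h)\<^sup>2"
        using B'[OF ks] by (simp add: norm_mult norm_power)
    qed
    ultimately show "cmod (conv u \<kappa> (x + h) - conv u \<kappa> x - (\<Sum>k\<in>UNIV. h $ k *\<^sub>R conv u (partial_deriv k \<kappa>) x)) \<le> C * B * (norm h)\<^sup>2"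
      by (simp add: mult.assoc)
  qed
qed

lemma conv_smooth:
  assumes X: "open X" and u: "is_distribution X u" and \<kappa>: "\<kappa> \<in> test_funs UNIV" and U: "open U"
    and US: "\<And>x s. x \<in> U \<Longrightarrow> s \<in> fun_support \<kappa> \<Longrightarrow> x - s \<in> X"
  shows "smooth_fun_on U (conv u \<kappa>)"
    and "x \<in> U \<Longrightarrow> partial_deriv k (conv u \<kappa>) x = conv u (partial_deriv k \<kappa>) x"
proof -
  have D: "(conv u \<kappa> has_derivative (\<lambda>h. \<Sum>k\<in>UNIV. h $ k *\<^sub>R conv u (partial_deriv k \<kappa>) x)) (at x)"
    if \<kappa>: "\<kappa> \<in> test_funs UNIV" and US: "\<And>x s. x \<in> U \<Longrightarrow> s \<in> fun_support \<kappa> \<Longrightarrow> x - s \<in> X"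
      and x: "x \<in> U" for \<kappa> x
  proof -
    obtain \<eta> where "\<eta> > 0" "cball x \<eta> \<subseteq> U" using U x open_contains_cball by blast
    then show ?thesis using US by (intro conv_has_derivative[OF X u \<kappa>]) auto
  qed
  show "partial_deriv k (conv u \<kappa>) x = conv u (partial_deriv k \<kappa>) x" if "x \<in> U"
    using partial_deriv_eqI[OF D[OF \<kappa> US that], of k] by (simp add: axis_sum)
  let ?R = "\<lambda>f. \<exists>\<kappa>. \<kappa> \<in> test_funs UNIV \<and> (\<forall>x\<in>U. \<forall>s\<in>fun_support \<kappa>. x - s \<in> X) \<and> f = conv u \<kappa>"
  show "smooth_fun_on U (conv u \<kappa>)"
  proof (rule smooth_fun_on_coinduct[OF U, where R = ?R])
    show "f differentiable (at x)" if f: "?R f" and x: "x \<in> U" for f x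
    proof -
      obtain \<kappa> where "\<kappa> \<in> test_funs UNIV" "\<forall>x\<in>U. \<forall>s\<in>fun_support \<kappa>. x - s \<in> X" "f = conv u \<kappa>"
        using f by (elim exE conjE)
      then show ?thesis using D[of \<kappa>, OF _ _ x] unfolding differentiable_def by auto
    qed
    show "\<exists>g. ?R g \<and> (\<forall>x\<in>U. partial_deriv k f x = g x)" if f: "?R f" for f k
    proof -
      obtain \<kappa> where \<kappa>: "\<kappa> \<in> test_funs UNIV" and 1: "\<forall>x\<in>U. \<forall>s\<in>fun_support \<kappa>. x - s \<in> X" and f: "f = conv u \<kappa>"
        using f by (elim exE conjE)
      have "partial_deriv k f x = conv u (partial_deriv k \<kappa>) x" if "x \<in> U" for x
        unfolding f using partial_deriv_eqI[OF D[OF \<kappa> _ that], of k] 1 by (simp add: axis_sum)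
      moreover have "\<forall>x\<in>U. \<forall>s\<in>fun_support (partial_deriv k \<kappa>). x - s \<in> X"
        using 1 fun_support_partial_deriv by blast
      ultimately show ?thesis
        by (intro exI[of _ "conv u (partial_deriv k \<kappa>)"] conjI exI[of _ "partial_deriv k \<kappa>"]
            test_funs_partial_deriv \<kappa> refl ballI) auto
    qed
    show "?R (conv u \<kappa>)" using \<kappa> US by (intro exI[of _ \<kappa>]) auto
  qed
qed

lemma riemann_sum_bound:
  fixes f :: "'a::euclidean_space \<Rightarrow> complex"
  assumes p: "p tagged_division_of cbox a b" and f: "continuous_on (cbox a b) f" and M: "M \<ge> 0"
    and le: "\<And>t k x. (t, k) \<in> p \<Longrightarrow> x \<in> k \<Longrightarrow> cmod (f x - f t) \<le> M"
  shows "cmod (integral (cbox a b) f - (\<Sum>(t, k)\<in>p. measure lborel k *\<^sub>R f t)) \<le> M * measure lborel (cbox a b)"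
proof -
  have int: "f integrable_on cbox a b" by (rule integrable_continuous[OF f])
  have "integral (cbox a b) f - (\<Sum>(t, k)\<in>p. measure lborel k *\<^sub>R f t)
      = (\<Sum>(t, k)\<in>p. integral k f - measure lborel k *\<^sub>R f t)"
    using integral_combine_tagged_division_topdown[OF int p] by (simp add: split_beta sum_subtractf)
  also have "cmod \<dots> \<le> (\<Sum>(t, k)\<in>p. M * measure lborel k)"
  proof (rule sum_norm_le, clarify)
    fix t k assume tk: "(t, k) \<in> p"
    then obtain c d where k: "k = cbox c d" using tagged_division_ofD(4)[OF p] by blast
    have sub: "k \<subseteq> cbox a b" using tagged_division_ofD(3)[OF p tk] .
    have ik: "f integrable_on k"
      unfolding k by (rule integrable_continuous) (use continuous_on_subset[OF f sub] k in simp)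
    have "((\<lambda>x. f x - f t) has_integral (integral k f - measure lborel k *\<^sub>R f t)) (cbox c d)"
      using ik unfolding k by (intro has_integral_diff integrable_integral has_integral_const)
    then show "cmod (integral k f - measure lborel k *\<^sub>R f t) \<le> M * measure lborel k"
      unfolding k using le[OF tk] k by (intro has_integral_bound[OF M]) auto
  qed
  also have "\<dots> = M * (\<Sum>(t, k)\<in>p. measure lborel k)"
    by (simp add: sum_distrib_left split_beta)
  also have "(\<Sum>(t, k)\<in>p. measure lborel k) = measure lborel (cbox a b)"
    by (rule additive_content_tagged_division[OF p])
  finally show ?thesis .
qed

text \<open>Fubini for a distribution. Riemann sums of the function-valued integral of \<phi>(t)
  \<kappa>(t - y) over t converge uniformly in y with all derivatives up to order b, their supports
  lie in the fixed compact set ?K, and u passes through finite sums by linearity.\<close>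

lemma conv_exchange:
  assumes X: "open X" and u: "is_distribution X u" and \<kappa>: "\<kappa> \<in> test_funs UNIV" and \<phi>: "\<phi> \<in> test_funs UNIV"
    and AS: "\<And>x s. x \<in> fun_support \<phi> \<Longrightarrow> s \<in> fun_support \<kappa> \<Longrightarrow> x - s \<in> X"
  shows "integrable lborel (\<lambda>x. conv u \<kappa> x * \<phi> x)"
    and "(\<integral>x. conv u \<kappa> x * \<phi> x \<partial>lborel) = u (\<lambda>y. \<integral>x. \<kappa> (x - y) * \<phi> x \<partial>lborel)"
proof -
  obtain c where c: "fun_support \<phi> \<subseteq> cbox (-c) c"
    using bounded_subset_cbox_symmetric[OF compact_imp_bounded[OF test_funsD(2)[OF \<phi>]]] by metis
  let ?B = "cbox (-c) c"
  let ?K = "(\<lambda>(x, s). x - s) ` (fun_support \<phi> \<times> fun_support \<kappa>)"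
  have K: "compact ?K" "?K \<subseteq> X"
    using AS by (auto intro!: compact_diff_image test_funsD(2)[OF \<kappa>] test_funsD(2)[OF \<phi>])
  obtain C b where C: "C \<ge> 0" "\<And>\<phi> B. \<phi> \<in> test_funs X \<Longrightarrow> fun_support \<phi> \<subseteq> ?K \<Longrightarrow>
       (\<And>ks x. length ks \<le> b \<Longrightarrow> cmod (partial_derivs ks \<phi> x) \<le> B) \<Longrightarrow> cmod (u \<phi>) \<le> C * B"
    by (rule is_distribution_estimate[OF u K]) blast
  define g where "g t = (\<lambda>y. \<phi> t * \<kappa> (t - y))" for t
  note sm = test_funsD(1)[OF \<kappa>]
  have supp_g: "y \<in> ?K" if "g t y \<noteq> 0" for t y
  proof -
    have "\<phi> t \<noteq> 0" "\<kappa> (t - y) \<noteq> 0" using that by (auto simp: g_def)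
    then have "t \<in> fun_support \<phi>" "t - y \<in> fun_support \<kappa>" using not_in_fun_support by blast+
    then show ?thesis by (intro image_eqI[of _ _ "(t, t - y)"]) auto
  qed
  have smg: "smooth_fun_on UNIV (g t)" for t
  proof -
    have "(\<lambda>y. \<kappa> (t - y)) \<in> test_funs UNIV" by (rule test_funs_reflect[OF \<kappa>]) simp
    then show ?thesis unfolding g_def by (intro smooth_cmult test_funsD(1)) auto
  qed
  have tg: "g t \<in> test_funs X" for t
    by (rule test_funsI[OF smg K]) (rule supp_g)
  have dg: "partial_derivs ks (g t) y = (-1) ^ length ks * (\<phi> t * partial_derivs ks \<kappa> (t - y))" for ks t y
  proof -
    have "(\<lambda>y. \<kappa> (t - y)) \<in> test_funs UNIV" by (rule test_funs_reflect[OF \<kappa>]) simp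
    then show ?thesis
      unfolding g_def by (simp add: partial_derivs_cmult[OF open_UNIV test_funsD(1)] partial_derivs_reflect[OF sm])
  qed
  have ug: "u (g t) = conv u \<kappa> t * \<phi> t" for t
  proof (cases "\<phi> t = 0")
    case True
    then show ?thesis using is_distribution_zero[OF u] by (simp add: g_def)
  next
    case False
    then have "t \<in> fun_support \<phi>" using not_in_fun_support by blast
    then have "(\<lambda>y. \<kappa> (t - y)) \<in> test_funs X" using AS by (intro test_funs_reflect[OF \<kappa>])
    then show ?thesis unfolding g_def conv_def by (simp add: is_distribution_cmult[OF u])
  qed
  \<comment> \<open>Here z stands for (t, t', y): each derivative of g is Lipschitz in t, uniformly
    in y.\<close>
  have "\<exists>L. \<forall>z. cmod (partial_derivs ks (g (fst z)) (snd (snd z)) - partial_derivs ks (g (fst (snd z))) (snd (snd z)))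
      / norm (fst z - fst (snd z)) \<le> L" for ks
  proof -
    obtain L1 where L1: "L1 \<ge> 0" "\<And>x y. cmod (partial_derivs ks \<kappa> y - partial_derivs ks \<kappa> x) \<le> L1 * norm (y - x)"
      by (rule test_funs_lipschitz[OF test_funs_partial_derivs[OF \<kappa>, of ks]]) blast
    obtain L2 where L2: "L2 \<ge> 0" "\<And>x y. cmod (\<phi> y - \<phi> x) \<le> L2 * norm (y - x)"
      by (rule test_funs_lipschitz[OF \<phi>]) blast
    obtain M1 where M1: "M1 \<ge> 0" "\<And>x. cmod (partial_derivs ks \<kappa> x) \<le> M1"
      by (rule test_funs_bounded[OF test_funs_partial_derivs[OF \<kappa>, of ks]]) blast
    obtain M2 where M2: "M2 \<ge> 0" "\<And>x. cmod (\<phi> x) \<le> M2"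
      by (rule test_funs_bounded[OF \<phi>]) blast
    have "cmod (partial_derivs ks (g t) y - partial_derivs ks (g t') y) \<le> (L2 * M1 + M2 * L1) * norm (t - t')" for t t' y
    proof -
      have "partial_derivs ks (g t) y - partial_derivs ks (g t') y =
        (-1) ^ length ks * ((\<phi> t - \<phi> t') * partial_derivs ks \<kappa> (t - y) + \<phi> t' * (partial_derivs ks \<kappa> (t - y) - partial_derivs ks \<kappa> (t' - y)))"
        by (simp add: dg algebra_simps)
      also have "cmod \<dots> \<le> cmod (\<phi> t - \<phi> t') * cmod (partial_derivs ks \<kappa> (t - y))
           + cmod (\<phi> t') * cmod (partial_derivs ks \<kappa> (t - y) - partial_derivs ks \<kappa> (t' - y))"
        unfolding norm_mult norm_power by (simp add: norm_triangle_le norm_mult)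
      also have "\<dots> \<le> (L2 * norm (t - t')) * M1 + M2 * (L1 * norm (t - t'))"
        using L1(2)[of "t - y" "t' - y"] L2(2)[of t t'] M1 M2 L1(1) L2(1)
        by (intro add_mono mult_mono) auto
      finally show ?thesis by (simp add: algebra_simps)
    qed
    then show ?thesis
      using L1(1) L2(1) M1(1) M2(1) by (intro exI[of _ "L2 * M1 + M2 * L1"]) (auto simp: divide_le_eq)
  qed
  then obtain L where L: "L \<ge> 0" "\<And>ks z. length ks \<le> b \<Longrightarrow>
     cmod (partial_derivs ks (g (fst z)) (snd (snd z)) - partial_derivs ks (g (fst (snd z))) (snd (snd z)))
      / norm (fst z - fst (snd z)) \<le> L"
    by (rule finite_list_bound[where b = b and g = "\<lambda>ks z. cmod (partial_derivs ks (g (fst z)) (snd (snd z)) - partial_derivs ks (g (fst (snd z))) (snd (snd z)))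
      / norm (fst z - fst (snd z))"]) blast
  have L': "cmod (partial_derivs ks (g t) y - partial_derivs ks (g t') y) \<le> L * norm (t - t')" if "length ks \<le> b" for ks t t' y
    using L(2)[OF that, of "(t, t', y)"] by (cases "t = t'") (auto simp: divide_le_eq)
  have Lu: "cmod (u (g t) - u (g t')) \<le> C * L * norm (t - t')" for t t'
  proof -
    have t: "(\<lambda>y. g t y - g t' y) \<in> test_funs X"
      using test_funs_add[OF tg test_funs_cmult[OF X tg, of "-1"]] by simp
    have "cmod (u (\<lambda>y. g t y - g t' y)) \<le> C * (L * norm (t - t'))"
    proof (rule C(2)[OF t])
      show "fun_support (\<lambda>y. g t y - g t' y) \<subseteq> ?K"
      proof (rule fun_support_subset[OF compact_imp_closed[OF K(1)]], rule ccontr)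
        fix y assume *: "g t y - g t' y \<noteq> 0" and y: "y \<notin> ?K"
        have "g t y = 0" for t using supp_g[of t y] y by blast
        with * show False by simp
      qed
      show "cmod (partial_derivs ks (\<lambda>y. g t y - g t' y) x) \<le> L * norm (t - t')" if "length ks \<le> b" for ks x
        using L'[OF that] by (simp add: partial_derivs_diff[OF open_UNIV smg smg])
    qed
    then show ?thesis by (simp add: is_distribution_diff[OF X u tg tg] mult.assoc)
  qed
  have contu: "continuous_on ?B (\<lambda>t. u (g t))"
    unfolding continuous_on_iff
  proof (intro ballI allI impI)
    fix x and e :: real assume "x \<in> ?B" "e > 0"
    have "dist (u (g x')) (u (g x)) < e" if "dist x' x < e / (C * L + 1)" for x'
    proof -
      have CL: "0 \<le> C * L" using C(1) L(1) by simp
      have "dist (u (g x')) (u (g x)) \<le> C * L * norm (x' - x)" using Lu by (simp add: dist_norm)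
      also have "\<dots> \<le> (C * L + 1) * norm (x' - x)" by (intro mult_right_mono) auto
      also have "\<dots> < e" using that CL \<open>e > 0\<close> by (simp add: dist_norm pos_less_divide_eq mult.commute)
      finally show ?thesis .
    qed
    moreover have "e / (C * L + 1) > 0" using C(1) L(1) \<open>e > 0\<close> by (simp add: add_nonneg_pos)
    ultimately show "\<exists>d>0. \<forall>x'\<in>?B. dist x' x < d \<longrightarrow> dist (u (g x')) (u (g x)) < e" by blast
  qed
  have out: "u (g t) = 0" if "t \<notin> ?B" for t
    using that c not_in_fun_support[of t \<phi>] by (auto simp: ug)
  show int: "integrable lborel (\<lambda>x. conv u \<kappa> x * \<phi> x)"
    using lborel_integral_cbox(1)[OF contu out] by (simp add: ug)
  have lhs: "(\<integral>x. conv u \<kappa> x * \<phi> x \<partial>lborel) = integral ?B (\<lambda>t. u (g t))"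
    using lborel_integral_cbox(2)[OF contu out] by (simp add: ug)
  define \<Phi> where "\<Phi> y = integral ?B (\<lambda>t. g t y)" for y
  have \<Phi>_eq: "(\<integral>x. \<kappa> (x - y) * \<phi> x \<partial>lborel) = \<Phi> y" for y
  proof -
    have "(\<integral>x. \<phi> x * \<kappa> (x - y) \<partial>lborel) = integral ?B (\<lambda>x. \<phi> x * \<kappa> (x - y))"
      using c not_in_fun_support[of _ \<phi>]
      by (intro lborel_integral_cbox(2))
        (auto intro!: continuous_intros test_funs_continuous[OF \<phi>] continuous_on_compose2[OF test_funs_continuous[OF \<kappa>, of UNIV]])
    then show ?thesis by (simp add: \<Phi>_def g_def mult.commute)
  qed
  have \<kappa>': "(\<lambda>y. \<kappa> (0 - y)) \<in> test_funs UNIV" by (rule test_funs_reflect[OF \<kappa>]) simp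
  have \<Phi>_alt: "\<Phi> = (\<lambda>y. integral ?B (\<lambda>t. \<phi> t * (\<lambda>y. \<kappa> (0 - y)) (y + - t)))"
    by (simp add: \<Phi>_def g_def fun_eq_iff)
  have cm: "continuous_on ?B (\<lambda>t. - t)" by (intro continuous_intros)
  note P = param_integral_smooth[OF \<kappa>' test_funs_continuous[OF \<phi>, of ?B] cm]
  have sm\<Phi>: "smooth_fun_on UNIV \<Phi>" unfolding \<Phi>_alt by (rule P(1))
  have d\<Phi>: "partial_derivs ks \<Phi> y = integral ?B (\<lambda>t. partial_derivs ks (g t) y)" for ks y
    unfolding \<Phi>_alt P(2) partial_derivs_reflect[OF sm] by (simp add: dg mult_ac)
  have supp\<Phi>: "y \<in> ?K" if "\<Phi> y \<noteq> 0" for y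
  proof (rule ccontr)
    assume "y \<notin> ?K"
    then have "g t y = 0" for t using supp_g[of t y] by blast
    with that show False by (simp add: \<Phi>_def)
  qed
  have t\<Phi>: "\<Phi> \<in> test_funs X" by (rule test_funsI[OF sm\<Phi> K]) (rule supp\<Phi>)
  let ?m = "measure lborel ?B"
  \<comment> \<open>S is a Riemann sum of mesh e. Both u \<Phi> and the integral of u (g t) are
    within C L e times the volume of u S.\<close>
  have main: "cmod (u \<Phi> - integral ?B (\<lambda>t. u (g t))) \<le> 2 * (C * L * ?m) * e" if e: "e > 0" for e
  proof -
    have "gauge (\<lambda>t::real^'a. ball t e)" using e by (simp add: gauge_def)
    then obtain p where p: "p tagged_division_of ?B" "(\<lambda>t. ball t e) fine p"
      using fine_division_exists[of _ "-c" c] by metis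
    have near: "norm (x - t) \<le> e" if "(t, k) \<in> p" "x \<in> k" for t k x
      using p(2) that unfolding fine_def by (fastforce simp: dist_norm norm_minus_commute)
    have fin: "finite p" using p(1) by blast
    define S where "S y = (\<Sum>z\<in>p. complex_of_real (measure lborel (snd z)) * g (fst z) y)" for y
    have tS: "S \<in> test_funs X" unfolding S_def by (intro test_funs_sum test_funs_cmult X tg)
    have uS: "u S = (\<Sum>(t, k)\<in>p. measure lborel k *\<^sub>R u (g t))"
      unfolding S_def is_distribution_sum[OF u test_funs_cmult[OF X tg]]
      by (intro sum.cong refl) (auto simp: is_distribution_cmult[OF u tg] scaleR_conv_of_real)
    have 1: "cmod (integral ?B (\<lambda>t. u (g t)) - u S) \<le> (C * L * e) * ?m"
      unfolding uS
    proof (rule riemann_sum_bound[OF p(1) contu])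
      fix t k x assume *: "(t, k) \<in> p" "x \<in> k"
      show "cmod (u (g x) - u (g t)) \<le> C * L * e"
        using Lu[of x t] near[OF *] C(1) L(1) by (meson mult_left_mono mult_nonneg_nonneg order_trans)
    qed (use C(1) L(1) e in auto)
    have td: "(\<lambda>y. \<Phi> y - S y) \<in> test_funs X"
      using test_funs_add[OF t\<Phi> test_funs_cmult[OF X tS, of "-1"]] by simp
    have "cmod (u (\<lambda>y. \<Phi> y - S y)) \<le> C * ((L * e) * ?m)"
    proof (rule C(2)[OF td])
      show "fun_support (\<lambda>y. \<Phi> y - S y) \<subseteq> ?K"
      proof (rule fun_support_subset[OF compact_imp_closed[OF K(1)]], rule ccontr)
        fix y assume *: "\<Phi> y - S y \<noteq> 0" and y: "y \<notin> ?K"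
        have "\<Phi> y = 0" using supp\<Phi>[of y] y by blast
        moreover have "g t y = 0" for t using supp_g[of t y] y by blast
        ultimately show False using * by (simp add: S_def)
      qed
      fix ks :: "'a list" and y assume ks: "length ks \<le> b"
      have "partial_derivs ks S y = (\<Sum>z\<in>p. complex_of_real (measure lborel (snd z)) * partial_derivs ks (g (fst z)) y)"
        unfolding S_def
        by (subst partial_derivs_sum[OF open_UNIV smooth_cmult[OF open_UNIV smg]]) (simp_all add: partial_derivs_cmult[OF open_UNIV smg])
      also have "\<dots> = (\<Sum>(t, k)\<in>p. measure lborel k *\<^sub>R partial_derivs ks (g t) y)"
        by (intro sum.cong refl) (auto simp: scaleR_conv_of_real)
      finally have dS: "partial_derivs ks S y = (\<Sum>(t, k)\<in>p. measure lborel k *\<^sub>R partial_derivs ks (g t) y)" .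
      have "cmod (partial_derivs ks \<Phi> y - partial_derivs ks S y) \<le> (L * e) * ?m"
        unfolding d\<Phi> dS
      proof (rule riemann_sum_bound[OF p(1)])
        show "continuous_on ?B (\<lambda>t. partial_derivs ks (g t) y)"
          unfolding dg by (intro continuous_intros test_funs_continuous[OF \<phi>]
              continuous_on_compose2[OF test_funs_continuous[OF test_funs_partial_derivs[OF \<kappa>], of UNIV]]) auto
        fix t k x assume *: "(t, k) \<in> p" "x \<in> k"
        show "cmod (partial_derivs ks (g x) y - partial_derivs ks (g t) y) \<le> L * e"
          using L'[OF ks, of x y t] near[OF *] L(1) by (meson mult_left_mono order_trans)
      qed (use L(1) e in auto)
      then show "cmod (partial_derivs ks (\<lambda>y. \<Phi> y - S y) y) \<le> L * e * ?m"
        by (simp add: partial_derivs_diff[OF open_UNIV sm\<Phi> test_funsD(1)[OF tS]])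
    qed
    then have 2: "cmod (u \<Phi> - u S) \<le> (C * L * e) * ?m"
      by (simp add: is_distribution_diff[OF X u t\<Phi> tS] mult_ac)
    have "cmod (u \<Phi> - integral ?B (\<lambda>t. u (g t))) \<le> cmod (u \<Phi> - u S) + cmod (integral ?B (\<lambda>t. u (g t)) - u S)"
      by (metis norm_minus_commute norm_triangle_sub diff_add_cancel norm_triangle_ineq4 diff_diff_eq2 add_diff_cancel_right' add.commute)
    then show ?thesis using 1 2 by (simp add: algebra_simps)
  qed
  have "u \<Phi> = integral ?B (\<lambda>t. u (g t))"
  proof (rule ccontr)
    assume "u \<Phi> \<noteq> integral ?B (\<lambda>t. u (g t))"
    then have pos: "cmod (u \<Phi> - integral ?B (\<lambda>t. u (g t))) > 0" by simp
    let ?d = "cmod (u \<Phi> - integral ?B (\<lambda>t. u (g t)))" and ?c = "2 * (C * L * ?m)"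
    have c0: "?c \<ge> 0" using C(1) L(1) by simp
    have "?d \<le> ?c * (?d / (?c + 1))" using pos c0 by (intro main) simp
    also have "\<dots> < ?d" using pos c0 by (simp add: divide_less_eq)
    finally show False by simp
  qed
  then show "(\<integral>x. conv u \<kappa> x * \<phi> x \<partial>lborel) = u (\<lambda>y. \<integral>x. \<kappa> (x - y) * \<phi> x \<partial>lborel)"
    unfolding lhs \<Phi>_eq by simp
qed

lemma integral_affine:
  fixes h :: "'a::euclidean_space \<Rightarrow> complex"
  assumes h: "h \<in> borel_measurable borel" and c: "c \<noteq> 0"
  shows "(\<integral>x. h x \<partial>lborel) = complex_of_real (\<bar>c\<bar> ^ DIM('a)) * (\<integral>t. h (a + c *\<^sub>R t) \<partial>lborel)"
proof -
  have "(\<integral>x. h x \<partial>lborel) = (\<integral>x. h x \<partial>density (distr lborel borel (\<lambda>x. a + c *\<^sub>R x)) (\<lambda>_. ennreal (\<bar>c\<bar> ^ DIM('a))))"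
    using lborel_affine[OF c, of a] by simp
  also have "\<dots> = (\<integral>x. (\<bar>c\<bar> ^ DIM('a)) *\<^sub>R h x \<partial>distr lborel borel (\<lambda>x. a + c *\<^sub>R x))"
    by (rule integral_density) (use h in auto)
  also have "\<dots> = (\<integral>t. (\<bar>c\<bar> ^ DIM('a)) *\<^sub>R h (a + c *\<^sub>R t) \<partial>lborel)"
    by (rule integral_distr) (use h in auto)
  finally show ?thesis by (simp add: scaleR_conv_of_real)
qed

section \<open>Mollification and its limit\<close>

definition scaled :: "(real ^ 'n::finite \<Rightarrow> complex) \<Rightarrow> real \<Rightarrow> real ^ 'n \<Rightarrow> complex" where
  "scaled \<rho> \<epsilon> x = complex_of_real ((1 / \<epsilon>) ^ CARD('n)) * \<rho> ((1 / \<epsilon>) *\<^sub>R x)"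

lemma test_funs_scaled:
  assumes "\<rho> \<in> test_funs (ball 0 1)" "\<epsilon> > 0"
  shows "scaled \<rho> \<epsilon> \<in> test_funs (ball 0 \<epsilon>)"
proof -
  have "(\<lambda>x. \<rho> ((1 / \<epsilon>) *\<^sub>R x + 0)) \<in> test_funs (ball 0 \<epsilon>)"
  proof (rule test_funs_affine[OF assms(1)])
    fix x assume "(1 / \<epsilon>) *\<^sub>R x + 0 \<in> fun_support \<rho>"
    then have "(1 / \<epsilon>) *\<^sub>R x \<in> ball 0 1" using test_funsD(3)[OF assms(1)] by auto
    then show "x \<in> ball 0 \<epsilon>" using assms(2) by (simp add: divide_less_eq)
  qed (use assms in auto)
  then show ?thesis
    unfolding scaled_def[abs_def] by (intro test_funs_cmult) auto
qed

lemma scaled_test_UNIV: "\<rho> \<in> test_funs (ball 0 1) \<Longrightarrow> \<epsilon> > 0 \<Longrightarrow> scaled \<rho> \<epsilon> \<in> test_funs UNIV"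
  using test_funs_mono[OF test_funs_scaled subset_UNIV] by blast

lemma scaled_support:
  "\<rho> \<in> test_funs (ball 0 1) \<Longrightarrow> \<epsilon> > 0 \<Longrightarrow> s \<in> fun_support (scaled \<rho> \<epsilon>) \<Longrightarrow> norm s < \<epsilon>"
  using test_funsD(3)[OF test_funs_scaled, of \<rho> \<epsilon>] by auto

lemma partial_derivs_scaled:
  fixes \<rho> :: "real ^ 'n::finite \<Rightarrow> complex"
  assumes "smooth_fun_on UNIV \<rho>"
  shows "partial_derivs ks (scaled \<rho> \<epsilon>) x =
    complex_of_real ((1 / \<epsilon>) ^ (CARD('n) + length ks)) * partial_derivs ks \<rho> ((1 / \<epsilon>) *\<^sub>R x)"
proof -
  have sm: "smooth_fun_on UNIV (\<lambda>x. \<rho> ((1 / \<epsilon>) *\<^sub>R x + 0))"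
    by (rule smooth_affine[OF _ _ assms]) auto
  have "partial_derivs ks (scaled \<rho> \<epsilon>) x =
    complex_of_real ((1 / \<epsilon>) ^ CARD('n)) * partial_derivs ks (\<lambda>x. \<rho> ((1 / \<epsilon>) *\<^sub>R x + 0)) x"
    unfolding scaled_def[abs_def] using partial_derivs_cmult[OF open_UNIV sm] by simp
  then show ?thesis
    unfolding partial_derivs_affine[OF assms] by (simp add: power_add)
qed

text \<open>\<open>conv_exchange\<close> moves the mollifier from u to \<phi>. The mollified \<phi>
  agrees with \<phi> up to O(\<epsilon>) in all derivatives of order at most b, with supports in one
  compact set, so the continuity of u gives the limit.\<close>

lemma mollifier_tendsto:
  fixes \<rho> :: "real ^ 'n::finite \<Rightarrow> complex"
  assumes X: "open X" and u: "is_distribution X u" and \<phi>: "\<phi> \<in> test_funs X"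
    and \<rho>: "\<rho> \<in> test_funs (ball 0 1)" "(\<integral>x. \<rho> x \<partial>lborel) = 1"
    and e: "\<And>k. e k > 0" "e \<longlonglongrightarrow> 0"
  shows "\<forall>\<^sub>F k in sequentially. integrable lborel (\<lambda>x. conv u (scaled \<rho> (e k)) x * \<phi> x)"
    and "(\<lambda>k. \<integral>x. conv u (scaled \<rho> (e k)) x * \<phi> x \<partial>lborel) \<longlonglongrightarrow> u \<phi>"
proof -
  note \<phi>U = test_funs_mono[OF \<phi> subset_UNIV]
  \<comment> \<open>The convolution is meaningful only as long as the mollifier does not reach
    beyond X. On the support of \<phi> this is ensured for scales below \<delta>, hence the
    restriction of integrability to large k.\<close>
  have "\<exists>\<delta>>0. \<forall>x\<in>fun_support \<phi>. \<forall>s. norm s \<le> \<delta> \<longrightarrow> x - s \<in> X"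
  proof (cases "fun_support \<phi> = {}")
    case True
    then show ?thesis by (intro exI[of _ 1]) auto
  next
    case False
    then obtain \<delta> where \<delta>: "\<delta> > 0" "{x. infdist x (fun_support \<phi>) \<le> \<delta>} \<subseteq> X"
      using compact_in_open_separated[OF False test_funsD(2)[OF \<phi>] X test_funsD(3)[OF \<phi>]] by blast
    have "x - s \<in> X" if "x \<in> fun_support \<phi>" "norm s \<le> \<delta>" for x s
      using infdist_le2[OF that(1), of "x - s" \<delta>] that \<delta>(2) by (auto simp: dist_norm)
    then show ?thesis using \<delta>(1) by blast
  qed
  then obtain \<delta> where \<delta>: "\<delta> > 0" "\<And>x s. x \<in> fun_support \<phi> \<Longrightarrow> norm s \<le> \<delta> \<Longrightarrow> x - s \<in> X" by blast
  let ?K = "(\<lambda>(x, s). x - s) ` (fun_support \<phi> \<times> cball 0 \<delta>)"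
  have K: "compact ?K" "?K \<subseteq> X"
    using \<delta>(2) by (auto intro!: compact_diff_image test_funsD(2)[OF \<phi>])
  obtain C b where C: "C \<ge> 0" "\<And>\<phi> B. \<phi> \<in> test_funs X \<Longrightarrow> fun_support \<phi> \<subseteq> ?K \<Longrightarrow>
       (\<And>ks x. length ks \<le> b \<Longrightarrow> cmod (partial_derivs ks \<phi> x) \<le> B) \<Longrightarrow> cmod (u \<phi>) \<le> C * B"
    by (rule is_distribution_estimate[OF u K]) blast
  have "\<exists>L. \<forall>z. cmod (partial_derivs ks \<phi> (fst z + snd z) - partial_derivs ks \<phi> (fst z)) / norm (snd z) \<le> L" for ks
  proof -
    obtain L where L: "L \<ge> 0" "\<And>x y. cmod (partial_derivs ks \<phi> y - partial_derivs ks \<phi> x) \<le> L * norm (y - x)"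
      by (rule test_funs_lipschitz[OF test_funs_partial_derivs[OF \<phi>, of ks]]) blast
    show ?thesis
    proof (intro exI[of _ L] allI)
      fix z :: "(real ^ 'n) \<times> (real ^ 'n)"
      show "cmod (partial_derivs ks \<phi> (fst z + snd z) - partial_derivs ks \<phi> (fst z)) / norm (snd z) \<le> L"
        using L(1) L(2)[of "fst z + snd z" "fst z"] by (cases "snd z = 0") (auto simp: divide_le_eq)
    qed
  qed
  then obtain L where L: "L \<ge> 0" "\<And>ks z. length ks \<le> b \<Longrightarrow>
     cmod (partial_derivs ks \<phi> (fst z + snd z) - partial_derivs ks \<phi> (fst z)) / norm (snd z) \<le> L"
    by (rule finite_list_bound[where b = b and g = "\<lambda>ks z. cmod (partial_derivs ks \<phi> (fst z + snd z) - partial_derivs ks \<phi> (fst z)) / norm (snd z)"]) blast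
  have L': "cmod (partial_derivs ks \<phi> (y + h) - partial_derivs ks \<phi> y) \<le> L * norm h" if "length ks \<le> b" for ks y h
    using L(2)[OF that, of "(y, h)"] by (cases "h = 0") (auto simp: divide_le_eq)
  obtain c where c: "ball 0 1 \<subseteq> cbox (-c) (c :: real ^ 'n)"
    using bounded_subset_cbox_symmetric[OF bounded_ball] by metis
  let ?B = "cbox (-c) c"
  have out: "\<rho> t = 0" if "t \<notin> ?B" for t
    using that c test_funsD(3)[OF \<rho>(1)] not_in_fun_support[of t \<rho>] by blast
  have one: "integral ?B \<rho> = 1"
    using lborel_integral_cbox(2)[OF test_funs_continuous[OF \<rho>(1)] out] \<rho>(2) by simp
  let ?A = "integral ?B (\<lambda>t. cmod (\<rho> t))"
  have A: "?A \<ge> 0"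
    by (rule Henstock_Kurzweil_Integration.integral_nonneg)
      (auto intro!: integrable_continuous continuous_intros test_funs_continuous[OF \<rho>(1)])
  have main: "integrable lborel (\<lambda>x. conv u (scaled \<rho> \<epsilon>) x * \<phi> x) \<and>
      cmod ((\<integral>x. conv u (scaled \<rho> \<epsilon>) x * \<phi> x \<partial>lborel) - u \<phi>) \<le> C * (?A * L * \<epsilon>)" if \<epsilon>: "0 < \<epsilon>" "\<epsilon> \<le> \<delta>" for \<epsilon>
  proof
    have AS: "x - s \<in> X" if "x \<in> fun_support \<phi>" "s \<in> fun_support (scaled \<rho> \<epsilon>)" for x s
      using \<delta>(2)[OF that(1), of s] scaled_support[OF \<rho>(1) \<epsilon>(1) that(2)] \<epsilon>(2) by simp
    show "integrable lborel (\<lambda>x. conv u (scaled \<rho> \<epsilon>) x * \<phi> x)"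
      by (rule conv_exchange(1)[OF X u scaled_test_UNIV[OF \<rho>(1) \<epsilon>(1)] \<phi>U]) (rule AS)
    have ex: "(\<integral>x. conv u (scaled \<rho> \<epsilon>) x * \<phi> x \<partial>lborel) = u (\<lambda>y. \<integral>x. scaled \<rho> \<epsilon> (x - y) * \<phi> x \<partial>lborel)"
      by (rule conv_exchange(2)[OF X u scaled_test_UNIV[OF \<rho>(1) \<epsilon>(1)] \<phi>U]) (rule AS)
    define \<Phi> where "\<Phi> = (\<lambda>y. integral ?B (\<lambda>t. \<rho> t * \<phi> (y + \<epsilon> *\<^sub>R t)))"
    have \<Phi>_eq: "(\<integral>x. scaled \<rho> \<epsilon> (x - y) * \<phi> x \<partial>lborel) = \<Phi> y" for y
    proof -
      have m: "(\<lambda>x. scaled \<rho> \<epsilon> (x - y) * \<phi> x) \<in> borel_measurable borel"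
        by (intro borel_measurable_continuous_onI continuous_intros test_funs_continuous[OF \<phi>]
            continuous_on_compose2[OF test_funs_continuous[OF scaled_test_UNIV[OF \<rho>(1) \<epsilon>(1)], of UNIV]]) auto
      have "(\<integral>x. scaled \<rho> \<epsilon> (x - y) * \<phi> x \<partial>lborel) =
         complex_of_real (\<bar>\<epsilon>\<bar> ^ DIM(real ^ 'n)) * (\<integral>t. scaled \<rho> \<epsilon> ((y + \<epsilon> *\<^sub>R t) - y) * \<phi> (y + \<epsilon> *\<^sub>R t) \<partial>lborel)"
        by (rule integral_affine[OF m]) (use \<epsilon> in auto)
      also have "\<dots> = (\<integral>t. complex_of_real (\<epsilon> ^ CARD('n)) * (scaled \<rho> \<epsilon> (\<epsilon> *\<^sub>R t) * \<phi> (y + \<epsilon> *\<^sub>R t)) \<partial>lborel)"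
        using \<epsilon> by simp
      also have "\<dots> = (\<integral>t. \<rho> t * \<phi> (y + \<epsilon> *\<^sub>R t) \<partial>lborel)"
        using \<epsilon> by (simp add: scaled_def power_one_over)
      also have "\<dots> = \<Phi> y"
        unfolding \<Phi>_def using out
        by (intro lborel_integral_cbox(2) continuous_intros test_funs_continuous[OF \<rho>(1)]
            continuous_on_compose2[OF test_funs_continuous[OF \<phi>, of UNIV]]) auto
      finally show ?thesis .
    qed
    have ce: "continuous_on ?B (\<lambda>t. \<epsilon> *\<^sub>R t)" by (intro continuous_intros)
    note P = param_integral_smooth[OF \<phi> test_funs_continuous[OF \<rho>(1), of ?B] ce]
    have sm: "smooth_fun_on UNIV \<Phi>" unfolding \<Phi>_def by (rule P(1))
    have d\<Phi>: "partial_derivs ks \<Phi> = (\<lambda>y. integral ?B (\<lambda>t. \<rho> t * partial_derivs ks \<phi> (y + \<epsilon> *\<^sub>R t)))" for ks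
      unfolding \<Phi>_def by (rule P(2))
    have supp\<Phi>: "y \<in> ?K" if "\<Phi> y \<noteq> 0" for y
    proof (rule ccontr)
      assume y: "y \<notin> ?K"
      have "\<rho> t * \<phi> (y + \<epsilon> *\<^sub>R t) = 0" for t
      proof (rule ccontr)
        assume "\<rho> t * \<phi> (y + \<epsilon> *\<^sub>R t) \<noteq> 0"
        then have "t \<in> fun_support \<rho>" "y + \<epsilon> *\<^sub>R t \<in> fun_support \<phi>"
          using not_in_fun_support[of t \<rho>] not_in_fun_support[of "y + \<epsilon> *\<^sub>R t" \<phi>] by auto
        moreover from this have "norm (\<epsilon> *\<^sub>R t) \<le> \<delta>"
          using test_funsD(3)[OF \<rho>(1)] \<epsilon> mult_mono[of \<epsilon> \<delta> "norm t" 1] by auto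
        ultimately have "y \<in> ?K" by (intro image_eqI[of _ _ "(y + \<epsilon> *\<^sub>R t, \<epsilon> *\<^sub>R t)"]) auto
        with y show False by simp
      qed
      with that show False by (simp add: \<Phi>_def)
    qed
    have t\<Phi>: "\<Phi> \<in> test_funs X" by (rule test_funsI[OF sm K]) (rule supp\<Phi>)
    have td: "(\<lambda>y. \<Phi> y - \<phi> y) \<in> test_funs X"
      using test_funs_add[OF t\<Phi> test_funs_cmult[OF X \<phi>, of "-1"]] by simp
    have "cmod (u (\<lambda>y. \<Phi> y - \<phi> y)) \<le> C * (?A * L * \<epsilon>)"
    proof (rule C(2)[OF td])
      show "fun_support (\<lambda>y. \<Phi> y - \<phi> y) \<subseteq> ?K"
      proof (rule fun_support_subset[OF compact_imp_closed[OF K(1)]], rule ccontr)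
        fix y assume *: "\<Phi> y - \<phi> y \<noteq> 0" and y: "y \<notin> ?K"
        have "\<Phi> y = 0" using supp\<Phi>[of y] y by blast
        moreover have "\<phi> y = 0"
        proof (rule ccontr)
          assume "\<phi> y \<noteq> 0"
          then have "y \<in> fun_support \<phi>" using not_in_fun_support[of y \<phi>] by blast
          then have "y \<in> ?K" using \<delta>(1) by (intro image_eqI[of _ _ "(y, 0)"]) auto
          with y show False by simp
        qed
        ultimately show False using * by simp
      qed
      fix ks :: "'n list" and y assume ks: "length ks \<le> b"
      let ?d = "partial_derivs ks \<phi>"
      have cd: "continuous_on ?B (\<lambda>t. \<rho> t * ?d (y + \<epsilon> *\<^sub>R t))" "continuous_on ?B (\<lambda>t. \<rho> t * ?d y)"
        by (intro continuous_intros test_funs_continuous[OF \<rho>(1)]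
            continuous_on_compose2[OF test_funs_continuous[OF test_funs_partial_derivs[OF \<phi>], of UNIV]], auto)
          (intro continuous_intros test_funs_continuous[OF \<rho>(1)])
      have "partial_derivs ks (\<lambda>y. \<Phi> y - \<phi> y) y = integral ?B (\<lambda>t. \<rho> t * ?d (y + \<epsilon> *\<^sub>R t)) - integral ?B \<rho> * ?d y"
        unfolding partial_derivs_diff[OF open_UNIV sm test_funsD(1)[OF \<phi>] UNIV_I] d\<Phi> using one by simp
      also have "integral ?B \<rho> * ?d y = integral ?B (\<lambda>t. \<rho> t * ?d y)" by simp
      also have "integral ?B (\<lambda>t. \<rho> t * ?d (y + \<epsilon> *\<^sub>R t)) - integral ?B (\<lambda>t. \<rho> t * ?d y)
         = integral ?B (\<lambda>t. \<rho> t * ?d (y + \<epsilon> *\<^sub>R t) - \<rho> t * ?d y)"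
        by (rule Henstock_Kurzweil_Integration.integral_diff[symmetric]) (intro integrable_continuous cd)+
      also have "cmod \<dots> \<le> integral ?B (\<lambda>t. cmod (\<rho> t) * (L * \<epsilon>))"
      proof (rule integral_norm_bound_integral)
        show "(\<lambda>t. \<rho> t * ?d (y + \<epsilon> *\<^sub>R t) - \<rho> t * ?d y) integrable_on ?B"
          by (intro integrable_diff integrable_continuous cd)
        show "(\<lambda>t. cmod (\<rho> t) * (L * \<epsilon>)) integrable_on ?B"
          by (intro integrable_continuous continuous_intros test_funs_continuous[OF \<rho>(1)])
        fix t
        show "cmod (\<rho> t * ?d (y + \<epsilon> *\<^sub>R t) - \<rho> t * ?d y) \<le> cmod (\<rho> t) * (L * \<epsilon>)"
        proof (cases "\<rho> t = 0")
          case False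
          then have "norm t \<le> 1" using not_in_fun_support[of t \<rho>] test_funsD(3)[OF \<rho>(1)] by fastforce
          then have "L * norm (\<epsilon> *\<^sub>R t) \<le> L * \<epsilon>" using L(1) \<epsilon> by (intro mult_left_mono) (auto simp: mult_left_le)
          then have "cmod (?d (y + \<epsilon> *\<^sub>R t) - ?d y) \<le> L * \<epsilon>" using L'[OF ks, of y "\<epsilon> *\<^sub>R t"] by linarith
          then show ?thesis by (simp add: right_diff_distrib[symmetric] norm_mult mult_left_mono)
        qed simp
      qed
      also have "\<dots> = ?A * L * \<epsilon>" by (simp add: mult.assoc)
      finally show "cmod (partial_derivs ks (\<lambda>y. \<Phi> y - \<phi> y) y) \<le> ?A * L * \<epsilon>" .
    qed
    then show "cmod ((\<integral>x. conv u (scaled \<rho> \<epsilon>) x * \<phi> x \<partial>lborel) - u \<phi>) \<le> C * (?A * L * \<epsilon>)"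
      unfolding ex \<Phi>_eq by (simp add: is_distribution_diff[OF X u t\<Phi> \<phi>])
  qed
  have ev: "\<forall>\<^sub>F k in sequentially. e k \<le> \<delta>"
    using order_tendstoD(2)[OF e(2) \<delta>(1)] by eventually_elim simp
  then show "\<forall>\<^sub>F k in sequentially. integrable lborel (\<lambda>x. conv u (scaled \<rho> (e k)) x * \<phi> x)"
    by eventually_elim (use main e(1) in blast)
  have "(\<lambda>k. (\<integral>x. conv u (scaled \<rho> (e k)) x * \<phi> x \<partial>lborel) - u \<phi>) \<longlonglongrightarrow> 0"
  proof (rule Lim_null_comparison)
    show "\<forall>\<^sub>F k in sequentially. norm ((\<integral>x. conv u (scaled \<rho> (e k)) x * \<phi> x \<partial>lborel) - u \<phi>) \<le> C * (?A * L * e k)"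
      using ev by eventually_elim (use main e(1) in blast)
    show "(\<lambda>k. C * (?A * L * e k)) \<longlonglongrightarrow> 0"
      using e(2) by (auto intro!: tendsto_eq_intros)
  qed
  then show "(\<lambda>k. \<integral>x. conv u (scaled \<rho> (e k)) x * \<phi> x \<partial>lborel) \<longlonglongrightarrow> u \<phi>"
    by (rule LIM_zero_cancel)
qed

lemma represents_limit:
  fixes \<rho> :: "real ^ 'n::finite \<Rightarrow> complex"
  assumes X: "open X" and u: "is_distribution X u"
    and \<rho>: "\<rho> \<in> test_funs (ball 0 1)" "(\<integral>x. \<rho> x \<partial>lborel) = 1"
    and e: "\<And>k. e k > 0" "e \<longlonglongrightarrow> 0" and V: "V \<subseteq> X" and F: "continuous_on V F"
    and lim: "uniform_limit V (\<lambda>k x. \<Sum>i\<in>I. c i * conv u (scaled \<rho> (e (k + i))) x) F sequentially"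
    and c: "(\<Sum>i\<in>I. c i) = 1"
  shows "represents V u F"
  unfolding represents_def
proof
  fix \<phi> assume \<phi>V: "\<phi> \<in> test_funs V"
  then have \<phi>: "\<phi> \<in> test_funs X" using V test_funs_mono by blast
  have I: "finite I" using c by (metis sum.infinite zero_neq_one)
  let ?T = "\<lambda>k x. \<Sum>i\<in>I. c i * conv u (scaled \<rho> (e (k + i))) x"
  let ?J = "\<lambda>k. \<integral>x. conv u (scaled \<rho> (e k)) x * \<phi> x \<partial>lborel"
  note m = mollifier_tendsto[OF X u \<phi> \<rho> e]
  have int: "\<forall>\<^sub>F k in sequentially. \<forall>i\<in>I. integrable lborel (\<lambda>x. conv u (scaled \<rho> (e (k + i))) x * \<phi> x)"
    using m(1) I by (intro eventually_ball_finite ballI) (auto intro: eventually_sequentially_seg[THEN iffD2])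
  have "(\<lambda>k. \<Sum>i\<in>I. c i * ?J (k + i)) \<longlonglongrightarrow> (\<Sum>i\<in>I. c i * u \<phi>)"
    by (intro tendsto_sum tendsto_mult_left LIMSEQ_ignore_initial_segment m(2))
  then have lim1: "(\<lambda>k. \<Sum>i\<in>I. c i * ?J (k + i)) \<longlonglongrightarrow> u \<phi>"
    using c by (simp add: sum_distrib_right[symmetric])
  have eqT: "\<forall>\<^sub>F k in sequentially. integrable lborel (\<lambda>x. ?T k x * \<phi> x) \<and> (\<integral>x. ?T k x * \<phi> x \<partial>lborel) = (\<Sum>i\<in>I. c i * ?J (k + i))"
    using int
  proof eventually_elim
    case (elim k)
    have "?T k x * \<phi> x = (\<Sum>i\<in>I. c i * (conv u (scaled \<rho> (e (k + i))) x * \<phi> x))" for x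
      by (simp add: sum_distrib_right mult.assoc)
    then show ?case using elim by (simp add: Bochner_Integration.integral_sum)
  qed
  have cF: "continuous_on (fun_support \<phi>) (\<lambda>x. F x * \<phi> x)"
    by (intro continuous_intros continuous_on_subset[OF F] test_funs_continuous[OF \<phi>] test_funsD(3)[OF \<phi>V])
  have "(\<lambda>x. indicator (fun_support \<phi>) x *\<^sub>R (F x * \<phi> x)) = (\<lambda>x. F x * \<phi> x)"
    using not_in_fun_support[of _ \<phi>] by (auto simp: indicator_def)
  then have intF: "integrable lborel (\<lambda>x. F x * \<phi> x)"
    using borel_integrable_compact[OF test_funsD(2)[OF \<phi>] cF] by simp
  let ?M = "\<integral>x. cmod (\<phi> x) \<partial>lborel"
  have intn: "integrable lborel (\<lambda>x. cmod (\<phi> x))" using integrable_test_fun[OF \<phi>] by simp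
  have "(\<lambda>k. \<Sum>i\<in>I. c i * ?J (k + i)) \<longlonglongrightarrow> (\<integral>x. F x * \<phi> x \<partial>lborel)"
    unfolding tendsto_iff
  proof (intro allI impI)
    fix r :: real assume r: "r > 0"
    have M0: "?M \<ge> 0" by simp
    define d where "d = r / (?M + 1)"
    have d: "d > 0" "d * ?M < r"
      using r M0 by (auto simp: d_def add_nonneg_pos divide_less_eq mult.commute mult_less_cancel_left)
    have "\<forall>\<^sub>F k in sequentially. \<forall>x\<in>V. dist (?T k x) (F x) < d"
      using uniform_limitD[OF lim d(1)] .
    then show "\<forall>\<^sub>F k in sequentially. dist (\<Sum>i\<in>I. c i * ?J (k + i)) (\<integral>x. F x * \<phi> x \<partial>lborel) < r"
      using eqT
    proof eventually_elim
      case (elim k)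
      have "(\<Sum>i\<in>I. c i * ?J (k + i)) - (\<integral>x. F x * \<phi> x \<partial>lborel) = (\<integral>x. ?T k x * \<phi> x - F x * \<phi> x \<partial>lborel)"
        using elim(2) intF by (simp add: Bochner_Integration.integral_diff)
      also have "cmod \<dots> \<le> (\<integral>x. d * cmod (\<phi> x) \<partial>lborel)"
      proof (rule Bochner_Integration.integral_norm_bound_integral)
        show "integrable lborel (\<lambda>x. ?T k x * \<phi> x - F x * \<phi> x)" using elim(2) intF by simp
        fix x
        show "cmod (?T k x * \<phi> x - F x * \<phi> x) \<le> d * cmod (\<phi> x)"
        proof (cases "x \<in> V")
          case True
          then have "cmod (?T k x - F x) \<le> d" using elim(1) by (auto simp: dist_norm intro: less_imp_le)
          then show ?thesis by (simp add: left_diff_distrib[symmetric] norm_mult mult_right_mono)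
        next
          case False
          then have "\<phi> x = 0" using not_in_fun_support[of x \<phi>] test_funsD(3)[OF \<phi>V] by blast
          then show ?thesis by simp
        qed
      qed (use intn in simp)
      also have "\<dots> = d * ?M" by simp
      finally show ?case using d(2) by (simp add: dist_norm)
    qed
  qed
  from LIMSEQ_unique[OF lim1 this] show "u \<phi> = (\<integral>y. F y * \<phi> y \<partial>lborel)" .
qed

lemma conv_represented:
  fixes \<rho> :: "real ^ 'n::finite \<Rightarrow> complex"
  assumes rep: "represents V u f" and f: "continuous_on V f"
    and \<rho>: "\<rho> \<in> test_funs (ball 0 1)" and e: "\<epsilon> > 0" and x: "ball x \<epsilon> \<subseteq> V"
  shows "conv u (scaled \<rho> \<epsilon>) x = (\<integral>t. \<rho> t * f (x - \<epsilon> *\<^sub>R t) \<partial>lborel)"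
proof -
  let ?\<phi> = "\<lambda>y. scaled \<rho> \<epsilon> (x - y)"
  have "?\<phi> \<in> test_funs V"
  proof (rule test_funs_reflect[OF test_funs_scaled[OF \<rho> e]])
    fix s assume "s \<in> fun_support (scaled \<rho> \<epsilon>)"
    then have "x - s \<in> ball x \<epsilon>" using scaled_support[OF \<rho> e] by (simp add: dist_norm)
    then show "x - s \<in> V" using x by blast
  qed
  then have \<phi>: "?\<phi> \<in> test_funs V" .
  have "continuous_on (fun_support ?\<phi>) (\<lambda>y. f y * ?\<phi> y)"
    by (intro continuous_intros continuous_on_subset[OF f] test_funs_continuous[OF \<phi>] test_funsD(3)[OF \<phi>])
  from borel_integrable_compact[OF test_funsD(2)[OF \<phi>] this]
  have "integrable lborel (\<lambda>y. indicator (fun_support ?\<phi>) y *\<^sub>R (f y * ?\<phi> y))" .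
  moreover have "(\<lambda>y. indicator (fun_support ?\<phi>) y *\<^sub>R (f y * ?\<phi> y)) = (\<lambda>y. f y * ?\<phi> y)"
    using not_in_fun_support[of _ ?\<phi>] by (auto simp: indicator_def)
  ultimately have m: "(\<lambda>y. f y * ?\<phi> y) \<in> borel_measurable borel" by auto
  have "conv u (scaled \<rho> \<epsilon>) x = (\<integral>y. f y * ?\<phi> y \<partial>lborel)"
    using rep \<phi> by (simp add: conv_def represents_def)
  also have "\<dots> = complex_of_real (\<bar>- \<epsilon>\<bar> ^ DIM(real ^ 'n)) * (\<integral>t. f (x + (- \<epsilon>) *\<^sub>R t) * ?\<phi> (x + (- \<epsilon>) *\<^sub>R t) \<partial>lborel)"
    by (rule integral_affine[OF m]) (use e in auto)
  also have "\<dots> = (\<integral>t. complex_of_real (\<epsilon> ^ CARD('n)) * (f (x - \<epsilon> *\<^sub>R t) * scaled \<rho> \<epsilon> (\<epsilon> *\<^sub>R t)) \<partial>lborel)"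
    using e by simp
  also have "\<dots> = (\<integral>t. \<rho> t * f (x - \<epsilon> *\<^sub>R t) \<partial>lborel)"
    using e by (simp add: scaled_def power_one_over mult_ac)
  finally show ?thesis .
qed

lemma integrable_mollified:
  assumes f: "continuous_on V f" and \<rho>: "\<rho> \<in> test_funs (ball 0 1)" and e: "\<epsilon> > 0" and x: "ball x \<epsilon> \<subseteq> V"
  shows "integrable lborel (\<lambda>t. \<rho> t * f (x - \<epsilon> *\<^sub>R t))"
proof -
  have "continuous_on (fun_support \<rho>) (\<lambda>t. \<rho> t * f (x - \<epsilon> *\<^sub>R t))"
  proof (intro continuous_intros test_funs_continuous[OF \<rho>] continuous_on_compose2[OF f])
    show "(\<lambda>t. x - \<epsilon> *\<^sub>R t) ` fun_support \<rho> \<subseteq> V"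
    proof clarify
      fix t assume "t \<in> fun_support \<rho>"
      then have "norm t < 1" using test_funsD(3)[OF \<rho>] by fastforce
      then have "norm (\<epsilon> *\<^sub>R t) < \<epsilon>" using e by simp
      then show "x - \<epsilon> *\<^sub>R t \<in> V" using x by (auto simp: dist_norm subset_eq)
    qed
  qed
  from borel_integrable_compact[OF test_funsD(2)[OF \<rho>] this]
  have "integrable lborel (\<lambda>t. indicator (fun_support \<rho>) t *\<^sub>R (\<rho> t * f (x - \<epsilon> *\<^sub>R t)))" .
  moreover have "(\<lambda>t. indicator (fun_support \<rho>) t *\<^sub>R (\<rho> t * f (x - \<epsilon> *\<^sub>R t))) = (\<lambda>t. \<rho> t * f (x - \<epsilon> *\<^sub>R t))"
    using not_in_fun_support[of _ \<rho>] by (auto simp: indicator_def)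
  ultimately show ?thesis by simp
qed

lemma conv_uniform_limit:
  fixes \<rho> :: "real ^ 'n::finite \<Rightarrow> complex"
  assumes rep: "represents (ball a (2 * r)) u f" and f: "continuous_on (ball a (2 * r)) f" and r: "r > 0"
    and \<rho>: "\<rho> \<in> test_funs (ball 0 1)" "(\<integral>x. \<rho> x \<partial>lborel) = 1" and e: "\<And>k. e k > 0" "e \<longlonglongrightarrow> 0"
  shows "uniform_limit (ball a (r / 2)) (\<lambda>k. conv u (scaled \<rho> (e k))) f sequentially"
proof (rule uniform_limitI)
  fix d :: real assume d: "d > 0"
  let ?M = "\<integral>x. cmod (\<rho> x) \<partial>lborel"
  have M0: "?M \<ge> 0" by simp
  \<comment> \<open>The mollifier is complex valued, so its L1 norm M enters the estimate although
    its integral is 1; the added 1 keeps the denominator positive.\<close>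
  define d' where "d' = d / (?M + 1)"
  have d': "d' > 0" "d' * ?M < d"
    using d M0 by (auto simp: d'_def add_nonneg_pos divide_less_eq mult.commute mult_less_cancel_left)
  have "uniformly_continuous_on (cball a r) f"
    by (intro compact_uniformly_continuous continuous_on_subset[OF f]) (use r in auto)
  then obtain \<eta> where \<eta>: "\<eta> > 0" "\<And>x y. x \<in> cball a r \<Longrightarrow> y \<in> cball a r \<Longrightarrow> dist y x < \<eta> \<Longrightarrow> dist (f y) (f x) < d'"
    using d'(1) unfolding uniformly_continuous_on_def by metis
  have "\<forall>\<^sub>F k in sequentially. e k < min \<eta> (r / 2)"
    using order_tendstoD(2)[OF e(2), of "min \<eta> (r / 2)"] \<eta>(1) r by simp
  then show "\<forall>\<^sub>F k in sequentially. \<forall>x\<in>ball a (r / 2). dist (conv u (scaled \<rho> (e k)) x) (f x) < d"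
  proof eventually_elim
    case (elim k)
    show ?case
    proof
      fix x assume x: "x \<in> ball a (r / 2)"
      have sub: "ball x (e k) \<subseteq> cball a r"
      proof
        fix y assume "y \<in> ball x (e k)"
        then show "y \<in> cball a r" using x elim dist_triangle[of a y x] by auto
      qed
      then have sub2: "ball x (e k) \<subseteq> ball a (2 * r)" using r by (auto simp: subset_eq)
      have near: "x - e k *\<^sub>R t \<in> cball a r \<and> dist (x - e k *\<^sub>R t) x < \<eta>" if "\<rho> t \<noteq> 0" for t
      proof -
        have "norm t < 1" using that not_in_fun_support[of t \<rho>] test_funsD(3)[OF \<rho>(1)] by fastforce
        then have "norm (e k *\<^sub>R t) < e k" using e(1)[of k] by simp
        then show ?thesis using sub elim by (auto simp: dist_norm subset_eq)
      qed
      have xin: "x \<in> cball a r" using x r by auto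
      have c1: "conv u (scaled \<rho> (e k)) x = (\<integral>t. \<rho> t * f (x - e k *\<^sub>R t) \<partial>lborel)"
        by (rule conv_represented[OF rep f \<rho>(1) e(1) sub2])
      have int1: "integrable lborel (\<lambda>t. \<rho> t * f (x - e k *\<^sub>R t))"
        by (rule integrable_mollified[OF f \<rho>(1) e(1) sub2])
      have int2: "integrable lborel (\<lambda>t. \<rho> t * f x)" using integrable_test_fun[OF \<rho>(1)] by simp
      have "f x = (\<integral>t. \<rho> t * f x \<partial>lborel)" using \<rho>(2) by simp
      then have "conv u (scaled \<rho> (e k)) x - f x = (\<integral>t. \<rho> t * f (x - e k *\<^sub>R t) - \<rho> t * f x \<partial>lborel)"
        using c1 int1 int2 by (simp add: Bochner_Integration.integral_diff)
      also have "cmod \<dots> \<le> (\<integral>t. d' * cmod (\<rho> t) \<partial>lborel)"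
      proof (rule Bochner_Integration.integral_norm_bound_integral)
        show "integrable lborel (\<lambda>t. \<rho> t * f (x - e k *\<^sub>R t) - \<rho> t * f x)" using int1 int2 by simp
        show "integrable lborel (\<lambda>t. d' * cmod (\<rho> t))" using integrable_test_fun[OF \<rho>(1)] by simp
        fix t
        show "cmod (\<rho> t * f (x - e k *\<^sub>R t) - \<rho> t * f x) \<le> d' * cmod (\<rho> t)"
        proof (cases "\<rho> t = 0")
          case False
          then have "cmod (f (x - e k *\<^sub>R t) - f x) \<le> d'"
            using \<eta>(2)[OF xin, of "x - e k *\<^sub>R t"] near[OF False] by (simp add: dist_norm less_imp_le)
          then show ?thesis by (simp add: right_diff_distrib[symmetric] norm_mult mult.commute[of d'] mult_left_mono)
        qed simp
      qed
      also have "\<dots> = d' * ?M" by simp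
      finally show "dist (conv u (scaled \<rho> (e k)) x) (f x) < d" using d'(2) by (simp add: dist_norm)
    qed
  qed
qed

subsection \<open>Distributions all of whose derivatives are continuous functions\<close>

definition dpartial :: "'n::finite \<Rightarrow> 'n functional \<Rightarrow> 'n functional" where
  "dpartial k u = (\<lambda>\<phi>. - u (partial_deriv k \<phi>))"

lemma is_distribution_dpartial:
  assumes X: "open X" and u: "is_distribution X u"
  shows "is_distribution X (dpartial k u)"
proof -
  \<comment> \<open>The coefficient -i times the factor -i in \<open>PD\<close> is -1, so
    \<open>dpartial k u\<close> is u composed with this operator and inherits its
    continuity.\<close>
  let ?P = "Poly_Mapping.single (Poly_Mapping.single k 1) (- \<i>)"
  have "is_distribution X (dpartial k u) \<longleftrightarrow> is_distribution X (\<lambda>\<phi>. u (PD ?P \<phi>))"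
  proof (rule is_distribution_cong[OF X])
    fix \<phi> assume \<phi>: "\<phi> \<in> test_funs X"
    have "mi_deriv (Poly_Mapping.single k 1) \<phi> = partial_deriv k \<phi>"
      using mi_deriv_mi_of[OF test_funsD(1)[OF \<phi>], of "[k]"] by (simp add: mi_of_def)
    then have "PD ?P \<phi> = (\<lambda>x. (-1) * partial_deriv k \<phi> x)"
      unfolding PD_single mi_abs_single by simp
    then show "dpartial k u \<phi> = u (PD ?P \<phi>)"
      using is_distribution_cmult[OF u test_funs_partial_deriv[OF \<phi>], of "-1"] by (simp add: dpartial_def)
  qed
  then show ?thesis using is_distribution_PD[OF X u] by blast
qed

lemma dpartial_represented:
  assumes "open V" "smooth_fun_on V f" "represents V u f"
  shows "represents V (dpartial k u) (partial_deriv k f)"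
  unfolding represents_def
proof
  fix \<phi> assume \<phi>: "\<phi> \<in> test_funs V"
  have "dpartial k u \<phi> = - (\<integral>x. f x * partial_deriv k \<phi> x \<partial>lborel)"
    using assms(3) test_funs_partial_deriv[OF \<phi>, of k] by (simp add: represents_def dpartial_def)
  then show "dpartial k u \<phi> = (\<integral>x. partial_deriv k f x * \<phi> x \<partial>lborel)"
    using integral_by_parts[OF assms(1,2) \<phi>, of k] by simp
qed

lemma conv_dpartial:
  assumes "\<kappa> \<in> test_funs UNIV" "is_distribution X u" "\<And>s. s \<in> fun_support \<kappa> \<Longrightarrow> x - s \<in> X"
  shows "conv (dpartial k u) \<kappa> x = conv u (partial_deriv k \<kappa>) x"
proof -
  have t: "(\<lambda>y. partial_deriv k \<kappa> (x - y)) \<in> test_funs X"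
    by (rule test_funs_reflect[OF test_funs_partial_deriv[OF assms(1)]])
      (use assms(3) fun_support_partial_deriv in blast)
  have "partial_deriv k (\<lambda>y. \<kappa> (x - y)) = (\<lambda>y. (-1) * partial_deriv k \<kappa> (x - y))"
    using partial_derivs_reflect[OF test_funsD(1)[OF assms(1)], of "[k]" x] by simp
  then show ?thesis
    using is_distribution_cmult[OF assms(2) t, of "-1"] by (simp add: conv_def dpartial_def)
qed

text \<open>Locally the regularisations of u converge uniformly to F and their partial derivatives,
  which are regularisations of the distributional ones, uniformly to G. Limits and derivatives may
  then be interchanged.\<close>

lemma continuous_derivs_differentiable:
  fixes u :: "'n::finite functional"
  assumes X: "open X" and u: "is_distribution X u" and U: "open U" "U \<subseteq> X"
    and F: "continuous_on U F" "represents U u F"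
    and G: "\<And>k. continuous_on U (G k)" "\<And>k. represents U (dpartial k u) (G k)" and x: "x \<in> U"
  shows "(F has_derivative (\<lambda>h. \<Sum>k\<in>UNIV. h $ k *\<^sub>R G k x)) (at x)"
proof -
  obtain \<rho> :: "real ^ 'n \<Rightarrow> complex" where \<rho>: "\<rho> \<in> test_funs (ball 0 1)" "(\<integral>x. \<rho> x \<partial>lborel) = 1"
    by (rule ex_mollifier)
  obtain R where R: "R > 0" "ball x R \<subseteq> U" using U(1) x openE by blast
  define r where "r = R / 2"
  have r: "r > 0" "ball x (2 * r) \<subseteq> U" using R by (auto simp: r_def)
  define e where "e k = r / 2 * (1/2) ^ k" for k :: nat
  have e: "\<And>k. e k > 0" "e \<longlonglongrightarrow> 0"
  proof -
    have "(\<lambda>k. r / 2 * (1/2) ^ k) \<longlonglongrightarrow> r / 2 * 0"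
      by (intro tendsto_mult_left LIMSEQ_power_zero) simp
    then show "e \<longlonglongrightarrow> 0" by (simp add: e_def[abs_def])
  qed (use r in \<open>simp add: e_def\<close>)
  have e_le: "e k \<le> r / 2" for k using r(1) by (simp add: e_def power_le_one)
  let ?S = "ball x (r / 2)"
  have lim: "uniform_limit ?S (\<lambda>k. conv v (scaled \<rho> (e k))) H sequentially"
    if "represents U v H" "continuous_on U H" for v H
    by (rule conv_uniform_limit[OF represents_subset[OF that(1) r(2)] continuous_on_subset[OF that(2) r(2)] r(1) \<rho> e])
  let ?f = "\<lambda>n. conv u (scaled \<rho> (e n))"
  have AS: "y - s \<in> X" if "y \<in> ?S" "s \<in> fun_support (scaled \<rho> (e n))" for y s n
  proof -
    have "norm s < r / 2" using scaled_support[OF \<rho>(1) e(1) that(2)] e_le[of n] by simp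
    then have "y - s \<in> ball x (2 * r)"
      using that(1) r(1) norm_triangle_ineq[of "x - y" s] by (auto simp: dist_norm algebra_simps)
    then show ?thesis using r(2) U(2) by blast
  qed
  have der: "(?f n has_derivative (\<lambda>h. \<Sum>k\<in>UNIV. h $ k *\<^sub>R conv (dpartial k u) (scaled \<rho> (e n)) y)) (at y within ?S)"
    if y: "y \<in> ?S" for n y
  proof -
    have cs1: "smooth_fun_on ?S (?f n)"
      by (rule conv_smooth(1)[OF X u scaled_test_UNIV[OF \<rho>(1) e(1)] open_ball]) (rule AS)
    have cs2: "partial_deriv k (?f n) y = conv u (partial_deriv k (scaled \<rho> (e n))) y" for k
      by (rule conv_smooth(2)[OF X u scaled_test_UNIV[OF \<rho>(1) e(1)] open_ball _ y]) (rule AS)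
    have "(?f n has_derivative (\<lambda>h. \<Sum>k\<in>UNIV. h $ k *\<^sub>R partial_deriv k (?f n) y)) (at y)"
      by (rule smooth_has_derivative[OF cs1 y])
    moreover have "partial_deriv k (?f n) y = conv (dpartial k u) (scaled \<rho> (e n)) y" for k
      unfolding cs2 by (rule conv_dpartial[OF scaled_test_UNIV[OF \<rho>(1) e(1)] u AS[OF y], symmetric])
    ultimately show ?thesis by (simp add: has_derivative_at_withinI)
  qed
  have "\<exists>g. \<forall>y\<in>?S. (\<lambda>n. ?f n y) \<longlonglongrightarrow> g y \<and>
     (g has_derivative (\<lambda>h. \<Sum>k\<in>UNIV. h $ k *\<^sub>R G k y)) (at y within ?S)"
  proof (rule has_derivative_sequence[OF convex_ball der])
    fix d :: real assume d: "d > 0"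
    let ?d = "d / CARD('n)"
    have "\<forall>\<^sub>F n in sequentially. \<forall>k\<in>(UNIV :: 'n set). \<forall>y\<in>?S. dist (conv (dpartial k u) (scaled \<rho> (e n)) y) (G k y) < ?d"
      using d by (intro eventually_ball_finite ballI uniform_limitD[OF lim[OF G(2,1)]]) auto
    then show "\<forall>\<^sub>F n in sequentially. \<forall>y\<in>?S. \<forall>h. cmod ((\<Sum>k\<in>UNIV. h $ k *\<^sub>R conv (dpartial k u) (scaled \<rho> (e n)) y) - (\<Sum>k\<in>UNIV. h $ k *\<^sub>R G k y)) \<le> d * norm h"
    proof eventually_elim
      case (elim n)
      show ?case
      proof (intro ballI allI)
        fix y and h :: "real ^ 'n" assume y: "y \<in> ?S"
        have "(\<Sum>k\<in>UNIV. cmod (conv (dpartial k u) (scaled \<rho> (e n)) y - G k y)) \<le> (\<Sum>k\<in>(UNIV :: 'n set). ?d)"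
          using elim y by (intro sum_mono) (auto simp: dist_norm intro: less_imp_le)
        then have "(\<Sum>k\<in>UNIV. cmod (conv (dpartial k u) (scaled \<rho> (e n)) y - G k y)) \<le> d" by simp
        then have "norm h * (\<Sum>k\<in>UNIV. cmod (conv (dpartial k u) (scaled \<rho> (e n)) y - G k y)) \<le> norm h * d"
          by (rule mult_left_mono) simp
        then show "cmod ((\<Sum>k\<in>UNIV. h $ k *\<^sub>R conv (dpartial k u) (scaled \<rho> (e n)) y) - (\<Sum>k\<in>UNIV. h $ k *\<^sub>R G k y)) \<le> d * norm h"
          using norm_sum_coords_le[of h "\<lambda>k. conv (dpartial k u) (scaled \<rho> (e n)) y - G k y"]
          by (simp add: sum_subtractf[symmetric] scaleR_diff_right mult.commute)
      qed
    qed
  next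
    show "x \<in> ?S" using r by simp
    then show "(\<lambda>n. ?f n x) \<longlonglongrightarrow> F x"
      by (rule tendsto_uniform_limitI[OF lim[OF F(2,1)]])
  qed
  then obtain g where g': "\<forall>y\<in>?S. (\<lambda>n. ?f n y) \<longlonglongrightarrow> g y \<and>
     (g has_derivative (\<lambda>h. \<Sum>k\<in>UNIV. h $ k *\<^sub>R G k y)) (at y within ?S)" by (elim exE)
  have g: "(\<lambda>n. ?f n y) \<longlonglongrightarrow> g y" "(g has_derivative (\<lambda>h. \<Sum>k\<in>UNIV. h $ k *\<^sub>R G k y)) (at y within ?S)"
    if "y \<in> ?S" for y
    using bspec[OF g' that] by (rule conjunct1) (rule conjunct2[OF bspec[OF g' that]])
  have eq: "g y = F y" if "y \<in> ?S" for y
    using LIMSEQ_unique[OF g(1)[OF that] tendsto_uniform_limitI[OF lim[OF F(2,1)] that]] .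
  have xS: "x \<in> ?S" using r by simp
  have "(g has_derivative (\<lambda>h. \<Sum>k\<in>UNIV. h $ k *\<^sub>R G k x)) (at x)"
    using g(2)[OF xS] at_within_open[OF xS open_ball] by simp
  then show ?thesis
    by (rule has_derivative_transform_within_open[OF _ open_ball xS]) (rule eq)
qed

text \<open>The continuous functions representing the iterated derivatives are partial derivatives
  of each other, so together they form a class for \<open>smooth_fun_on_coinduct\<close>. It remains
  to prove continuity, for u and all its derivatives alike.\<close>

lemma smooth_if_derivs_continuous:
  fixes u :: "'n::finite functional"
  assumes X: "open X" and u: "is_distribution X u" and U: "open U" "U \<subseteq> X"
    and cont: "\<And>ks. \<exists>F. continuous_on U F \<and> represents U (fold dpartial ks u) F"
  obtains F where "smooth_fun_on U F" "represents U u F"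
proof -
  have dist: "is_distribution X (fold dpartial ks u)" for ks
    using u by (induction ks arbitrary: u) (auto simp: is_distribution_dpartial[OF X])
  obtain H where H: "\<And>ks. continuous_on U (H ks)" "\<And>ks. represents U (fold dpartial ks u) (H ks)"
    using cont by metis
  have D: "(H ks has_derivative (\<lambda>h. \<Sum>k\<in>UNIV. h $ k *\<^sub>R H (ks @ [k]) x)) (at x)" if x: "x \<in> U" for ks x
  proof (rule continuous_derivs_differentiable[OF X dist U H(1) H(2) H(1) _ x])
    show "represents U (dpartial k (fold dpartial ks u)) (H (ks @ [k]))" for k
      using H(2)[of "ks @ [k]"] by simp
  qed
  have "smooth_fun_on U (H [])"
  proof (rule smooth_fun_on_coinduct[OF U(1), where R = "\<lambda>f. f \<in> range H"])
    show "f differentiable (at x)" if "f \<in> range H" "x \<in> U" for f x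
      using D[OF that(2)] that(1) by (auto simp: differentiable_def)
    show "\<exists>g. g \<in> range H \<and> (\<forall>x\<in>U. partial_deriv k f x = g x)" if f: "f \<in> range H" for f k
    proof -
      obtain ks where ks: "f = H ks" using f by (elim rangeE)
      have "partial_deriv k f x = H (ks @ [k]) x" if "x \<in> U" for x
        unfolding ks using partial_deriv_eqI[OF D[OF that], of k ks] by (simp add: axis_sum)
      then show ?thesis by (intro exI[of _ "H (ks @ [k])"] conjI rangeI ballI)
    qed
  qed auto
  then show ?thesis using that H(2)[of "[]"] by simp
qed

subsection \<open>Functions annihilated by a complex vector field\<close>

definition dN :: "complex ^ 'n::finite \<Rightarrow> (real ^ 'n \<Rightarrow> complex) \<Rightarrow> real ^ 'n \<Rightarrow> complex" where
  "dN N f x = (\<Sum>k\<in>UNIV. N $ k * partial_deriv k f x)"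

definition dir :: "real ^ 'n::finite \<Rightarrow> (real ^ 'n \<Rightarrow> complex) \<Rightarrow> real ^ 'n \<Rightarrow> complex" where
  "dir v f x = (\<Sum>k\<in>UNIV. v $ k *\<^sub>R partial_deriv k f x)"

text \<open>Re N and Im N span W, so \<open>dN N f\<close> at a point depends only on f along the
  leaf through it.\<close>

lemma dN_dir: "dN N f x = dir (Re_vec N) f x + \<i> * dir (Im_vec N) f x"
proof -
  have "N $ k * z = Re_vec N $ k *\<^sub>R z + \<i> * (Im_vec N $ k *\<^sub>R z)" for k z
    by (simp add: Re_vec_def Im_vec_def complex_eq_iff)
  then show ?thesis by (simp add: dN_def dir_def sum.distrib sum_distrib_left)
qed

lemma dir_scaleR: "dir (c *\<^sub>R v) f x = c *\<^sub>R dir v f x"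
  by (simp add: dir_def scaleR_sum_right)

lemma dir_add: "dir (v + w) f x = dir v f x + dir w f x"
  by (simp add: dir_def scaleR_left_distrib sum.distrib)

lemma has_vector_derivative_dir:
  assumes "smooth_fun_on U f" "x + t *\<^sub>R e \<in> U"
  shows "((\<lambda>t. f (x + t *\<^sub>R e)) has_vector_derivative dir e f (x + t *\<^sub>R e)) (at t within T)"
  using has_vector_derivative_line[OF assms] by (simp add: dir_def)

lemma span_pair:
  assumes "x \<in> span {a, b :: real ^ 'n::finite}"
  obtains s t where "x = s *\<^sub>R a + t *\<^sub>R b"
proof -
  obtain s where "x - s *\<^sub>R a \<in> span {b}" using assms span_breakdown_eq[of x a "{b}"] by auto
  then obtain t where "x - s *\<^sub>R a = t *\<^sub>R b" using span_breakdown_eq[of "x - s *\<^sub>R a" b "{}"] by auto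
  then have "x = s *\<^sub>R a + t *\<^sub>R b" by (simp add: algebra_simps)
  then show ?thesis by (rule that)
qed

text \<open>The two kinds of leaves. If Re N and Im N are parallel, \<open>dN N\<close> is p + iq
  times a real derivative along a line. Otherwise it is a Cauchy-Riemann operator on planes;
  independence is stated as injectivity of the map that parametrises the leaf by complex
  numbers.\<close>

lemma direction_cases:
  fixes N :: "complex ^ 'n::finite"
  assumes "N \<noteq> 0"
  obtains (line) e p q where "e \<noteq> 0" "Re_vec N = p *\<^sub>R e" "Im_vec N = q *\<^sub>R e" "Complex p q \<noteq> 0"
  | (plane) "\<And>z. Re z *\<^sub>R Re_vec N + Im z *\<^sub>R Im_vec N = 0 \<Longrightarrow> z = 0"
proof (cases "Re_vec N = 0")
  case True
  have "Im_vec N \<noteq> 0"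
  proof
    assume "Im_vec N = 0"
    with True have "N = 0"
      by (simp add: vec_eq_iff Re_vec_def Im_vec_def complex_eq_iff)
    with assms show False by simp
  qed
  then show ?thesis using line[of "Im_vec N" 0 1] True by (simp add: complex_eq_iff)
next
  case False
  show ?thesis
  proof (cases "\<exists>q. Im_vec N = q *\<^sub>R Re_vec N")
    case True
    then obtain q where "Im_vec N = q *\<^sub>R Re_vec N" by blast
    then show ?thesis using line[of "Re_vec N" 1 q] False by (simp add: complex_eq_iff)
  next
    case nq: False
    have "z = 0" if z: "Re z *\<^sub>R Re_vec N + Im z *\<^sub>R Im_vec N = 0" for z
    proof -
      have "Im z = 0"
      proof (rule ccontr)
        assume "Im z \<noteq> 0"
        have "Im z *\<^sub>R Im_vec N = - (Re z *\<^sub>R Re_vec N)"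
          using z by (simp add: eq_neg_iff_add_eq_0 add.commute)
        then have "(1 / Im z) *\<^sub>R (Im z *\<^sub>R Im_vec N) = (1 / Im z) *\<^sub>R (- (Re z *\<^sub>R Re_vec N))" by simp
        then have "Im_vec N = (- Re z / Im z) *\<^sub>R Re_vec N" using \<open>Im z \<noteq> 0\<close> by simp
        with nq show False by blast
      qed
      then show ?thesis using z False by (simp add: complex_eq_iff)
    qed
    then show ?thesis by (rule plane)
  qed
qed

text \<open>\<alpha> t^\<theta> lies between \<alpha> and \<alpha> t and so dominates the smaller
  one. In the application these two are the Cauchy bounds of a Taylor coefficient on the large and
  the small circle.\<close>

lemma le_mult_powr:
  fixes a \<alpha> t \<theta> :: real
  assumes "a \<le> \<alpha>" "a \<le> \<alpha> * t" "0 \<le> \<alpha>" "0 < t" "0 < \<theta>" "\<theta> \<le> 1"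
  shows "a \<le> \<alpha> * t powr \<theta>"
proof (cases "t \<ge> 1")
  case True
  then have "\<alpha> * 1 \<le> \<alpha> * t powr \<theta>" using assms ge_one_powr_ge_zero by (intro mult_left_mono) auto
  then show ?thesis using assms(1) by simp
next
  case False
  then have "t powr 1 \<le> t powr \<theta>" using assms by (intro powr_mono') auto
  then have "\<alpha> * t \<le> \<alpha> * t powr \<theta>" using assms by (intro mult_left_mono) auto
  then show ?thesis using assms(2) by simp
qed

text \<open>Hadamard's three circles theorem up to constants: the Taylor coefficients obey Cauchy's
  estimates on both circles.\<close>
lemma holomorphic_interpolation:
  fixes R s :: real
  assumes "0 < s" "s \<le> R / 2"
  obtains \<theta> where "0 < \<theta>" "\<theta> \<le> 1"
    "\<And>f A B z. f holomorphic_on ball 0 R \<Longrightarrow> continuous_on (cball 0 R) f \<Longrightarrow>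
      (\<And>z. cmod z \<le> R \<Longrightarrow> cmod (f z) \<le> A) \<Longrightarrow> (\<And>z. cmod z \<le> s \<Longrightarrow> cmod (f z) \<le> B) \<Longrightarrow>
      0 < B \<Longrightarrow> B \<le> A \<Longrightarrow> cmod z \<le> R / 2 \<Longrightarrow> cmod (f z) \<le> 3 * (A * (B / A) powr \<theta>)"
proof -
  have R: "R > 0" "s < R" using assms by auto
  \<comment> \<open>Chosen such that (R/s)^\<theta> = 4/3. The interpolated bound on the n-th
    coefficient then grows like (4/3 / R)^n, so for |z| \<le> R/2 the series is dominated by a
    geometric one with ratio 2/3, whose sum is 3.\<close>
  define \<theta> where "\<theta> = ln (4/3) / ln (R / s)"
  have Rs: "R / s \<ge> 2" using assms by (simp add: field_simps)
  have l: "ln (4/3) \<le> ln (R / s)"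
    by (rule ln_le_cancel_iff[THEN iffD2]) (use Rs in linarith)+
  have l0: "ln (4/3 :: real) > 0" by (rule ln_gt_zero) simp
  then have pos: "ln (R / s) > 0" using l by linarith
  have \<theta>: "0 < \<theta>" unfolding \<theta>_def by (rule divide_pos_pos[OF l0 pos])
  have \<theta>1: "\<theta> \<le> 1" unfolding \<theta>_def pos_divide_le_eq[OF pos] using l by linarith
  have pw: "(R / s) powr \<theta> = 4/3"
  proof -
    have "\<theta> * ln (R / s) = ln (4/3)"
      by (rule nonzero_eq_divide_eq[THEN iffD1, OF _ \<theta>_def]) (use pos in linarith)
    then show ?thesis using R assms(1) unfolding powr_def by simp
  qed
  have pwn: "((R / s) ^ n) powr \<theta> = (4/3) ^ n" for n
  proof -
    have "((R / s) ^ n) powr \<theta> = ((R / s) powr real n) powr \<theta>" using Rs by (subst powr_realpow) auto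
    also have "\<dots> = ((R / s) powr \<theta>) powr real n" by (simp only: powr_powr mult.commute)
    also have "\<dots> = (4/3) ^ n" unfolding pw by (rule powr_realpow) simp
    finally show ?thesis .
  qed
  show ?thesis
  proof (rule that[OF \<theta> \<theta>1])
    fix f A B z
    assume hol: "f holomorphic_on ball 0 R" and cont: "continuous_on (cball 0 R) f"
      and A: "\<And>z. cmod z \<le> R \<Longrightarrow> cmod (f z) \<le> A" and B: "\<And>z. cmod z \<le> s \<Longrightarrow> cmod (f z) \<le> B"
      and AB: "0 < B" "B \<le> A" and z: "cmod z \<le> R / 2"
    let ?a = "\<lambda>n. (deriv ^^ n) f 0 / fact n"
    have a1: "cmod (?a n) \<le> A / R ^ n" for n
    proof -
      have "cmod ((deriv ^^ n) f 0) \<le> fact n * A / R ^ n"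
        by (rule Cauchy_inequality[OF hol cont R(1)]) (use A in auto)
      then show ?thesis by (simp add: norm_divide field_simps)
    qed
    have a2: "cmod (?a n) \<le> B / s ^ n" for n
    proof -
      have "cmod ((deriv ^^ n) f 0) \<le> fact n * B / s ^ n"
        by (rule Cauchy_inequality[OF holomorphic_on_subset[OF hol] continuous_on_subset[OF cont] assms(1)])
          (use B R in auto)
      then show ?thesis by (simp add: norm_divide field_simps)
    qed
    let ?M = "A * (B / A) powr \<theta>"
    have a3: "cmod (?a n) \<le> ?M * ((4/3) / R) ^ n" for n
    proof -
      have "B / s ^ n = A / R ^ n * ((B / A) * (R / s) ^ n)" using AB assms R by (simp add: field_simps)
      then have "cmod (?a n) \<le> A / R ^ n * ((B / A) * (R / s) ^ n) powr \<theta>"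
        using a1[of n] a2[of n] AB assms(1) R \<theta> \<theta>1 by (intro le_mult_powr) auto
      also have "\<dots> = A / R ^ n * ((B / A) powr \<theta> * (4/3) ^ n)"
        using AB assms(1) R by (subst powr_mult) (auto simp: pwn)
      also have "\<dots> = ?M * ((4/3) / R) ^ n" by (simp add: power_divide mult_ac)
      finally show ?thesis .
    qed
    have M0: "?M \<ge> 0" using AB by simp
    have le: "cmod (?a n * (z - 0) ^ n) \<le> ?M * (2/3) ^ n" for n
    proof -
      have "cmod (?a n * (z - 0) ^ n) \<le> (?M * ((4/3) / R) ^ n) * (R / 2) ^ n"
        unfolding norm_mult norm_power using z R M0 by (intro mult_mono a3 power_mono) auto
      also have "\<dots> = ?M * (((4/3) / R) * (R / 2)) ^ n" unfolding power_mult_distrib by (simp only: mult.assoc)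
      also have "((4/3) / R) * (R / 2) = 2/3" using R by simp
      finally show ?thesis .
    qed
    have "z \<in> ball 0 R" using z R by simp
    then have "(\<lambda>n. ?a n * (z - 0) ^ n) sums f z" by (rule holomorphic_power_series[OF hol])
    then have "f z = suminf (\<lambda>n. ?a n * (z - 0) ^ n)" by (simp only: sums_iff)
    also have "cmod \<dots> \<le> suminf (\<lambda>n. ?M * (2/3) ^ n)"
      by (rule norm_suminf_le[OF le]) (intro summable_mult summable_geometric, simp)
    also have "\<dots> = ?M * 3" by (subst suminf_mult) (auto simp: suminf_geometric summable_geometric)
    finally show "cmod (f z) \<le> 3 * ?M" by (simp only: mult.commute)
  qed
qed

text \<open>The functions \<open>g\<close> are constant on the leaves in \<open>ball x0 R\<close> if the leaves are lines, and holomorphic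
  along them if they are planes.\<close>
definition interpolates :: "complex ^ 'n::finite \<Rightarrow> real ^ 'n \<Rightarrow> real \<Rightarrow> real ^ 'n \<Rightarrow> real \<Rightarrow> bool" where
  "interpolates N x0 R x' s \<longleftrightarrow> (\<exists>\<eta> \<theta> C. 0 < \<eta> \<and> \<eta> \<le> R \<and> 0 < \<theta> \<and> \<theta> \<le> 1 \<and> 0 < C \<and>
     (\<forall>g A B. smooth_fun_on (ball x0 R) g \<longrightarrow> (\<forall>x\<in>ball x0 R. dN N g x = 0) \<longrightarrow> 0 < B \<longrightarrow> B \<le> A \<longrightarrow>
       (\<forall>x\<in>ball x0 R. cmod (g x) \<le> A) \<longrightarrow> (\<forall>x\<in>ball x' s. cmod (g x) \<le> B) \<longrightarrow>
       (\<forall>x\<in>ball x0 \<eta>. cmod (g x) \<le> C * (A * (B / A) powr \<theta>))))"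

text \<open>The order of quantifiers matters: r is fixed before x' and before the radius s of the
  ball on which the small bound holds. Hence information from an arbitrarily small neighbourhood of
  any leaf point within r reaches x0.\<close>

definition leaf_interpolation :: "complex ^ 'n::finite \<Rightarrow> bool" where
  "leaf_interpolation N \<longleftrightarrow> (\<forall>x0 R. 0 < R \<longrightarrow> (\<exists>r>0. \<forall>x'\<in>ball x0 r.
     x' - x0 \<in> span {Re_vec N, Im_vec N} \<longrightarrow> (\<forall>s>0. interpolates N x0 R x' s)))"

lemma dN_line:
  assumes "Re_vec N = p *\<^sub>R e" "Im_vec N = q *\<^sub>R e"
  shows "dN N f x = Complex p q * dir e f x"
  by (simp add: dN_dir assms dir_scaleR complex_eq_iff)

lemma leaf_interpolation_line:
  fixes N :: "complex ^ 'n::finite"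
  assumes e: "e \<noteq> 0" "Re_vec N = p *\<^sub>R e" "Im_vec N = q *\<^sub>R e" "Complex p q \<noteq> 0"
  shows "leaf_interpolation N"
  unfolding leaf_interpolation_def
proof (intro allI impI)
  fix x0 :: "real ^ 'n" and R :: real assume R: "R > 0"
  show "\<exists>r>0. \<forall>x'\<in>ball x0 r. x' - x0 \<in> span {Re_vec N, Im_vec N} \<longrightarrow> (\<forall>s>0. interpolates N x0 R x' s)"
  proof (intro exI[of _ "R / 2"] conjI ballI impI allI)
    fix x' and s :: real
    assume x': "x' \<in> ball x0 (R / 2)" "x' - x0 \<in> span {Re_vec N, Im_vec N}" and s: "s > 0"
    obtain s1 t1 where "x' - x0 = s1 *\<^sub>R Re_vec N + t1 *\<^sub>R Im_vec N" by (rule span_pair[OF x'(2)])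
    then have "x' - x0 = (s1 * p + t1 * q) *\<^sub>R e" by (simp add: e scaleR_left_distrib)
    then obtain \<tau> where \<tau>: "x' = x0 + \<tau> *\<^sub>R e" by (metis add_diff_cancel_left' add.commute diff_add_cancel)
    show "interpolates N x0 R x' s"
      unfolding interpolates_def
    \<comment> \<open>For \<theta> = C = 1 the bound is B itself: g is constant on the segment from
      y to y + \<tau> e, which stays in \<open>ball x0 R\<close> and ends in
      \<open>ball x' s\<close>.\<close>
    proof (rule exI[of _ "min s (R / 2)"], rule exI[of _ 1], rule exI[of _ 1], intro conjI allI impI ballI)
      fix g A B y
      assume g: "smooth_fun_on (ball x0 R) g" "\<forall>x\<in>ball x0 R. dN N g x = 0" and AB: "0 < B" "B \<le> A"
        and "\<forall>x\<in>ball x0 R. cmod (g x) \<le> A"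
        and B: "\<forall>x\<in>ball x' s. cmod (g x) \<le> B" and y: "y \<in> ball x0 (min s (R / 2))"
      have in_ball: "y + t *\<^sub>R (\<tau> *\<^sub>R e) \<in> ball x0 R" if "t \<in> {0..1}" for t
      proof -
        have "norm (t *\<^sub>R (\<tau> *\<^sub>R e)) \<le> norm (\<tau> *\<^sub>R e)"
          unfolding norm_scaleR[of t "\<tau> *\<^sub>R e"] by (rule mult_left_le_one_le) (use that in auto)
        also have "\<dots> < R / 2" using x'(1) by (simp add: \<tau> dist_norm)
        finally show ?thesis
          using y norm_triangle_ineq4[of "x0 - y" "t *\<^sub>R (\<tau> *\<^sub>R e)"] by (simp add: dist_norm diff_diff_eq)
      qed
      have "((\<lambda>t. g (y + t *\<^sub>R (\<tau> *\<^sub>R e))) has_vector_derivative 0) (at t within {0..1})" if "t \<in> {0..1}" for t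
      proof -
        have "dir e g (y + t *\<^sub>R (\<tau> *\<^sub>R e)) = 0"
          using g(2) in_ball[OF that] e(4) by (simp add: dN_line[OF e(2,3)])
        then have "dir (\<tau> *\<^sub>R e) g (y + t *\<^sub>R (\<tau> *\<^sub>R e)) = 0" by (simp add: dir_scaleR)
        then show ?thesis
          using has_vector_derivative_dir[OF g(1) in_ball[OF that], of "{0..1}"] by simp
      qed
      then obtain c where c: "\<And>t. t \<in> {0..1} \<Longrightarrow> g (y + t *\<^sub>R (\<tau> *\<^sub>R e)) = c"
        by (rule has_vector_derivative_zero_constant[rotated]) auto
      have "g y = g (y + \<tau> *\<^sub>R e)" using c[of 0] c[of 1] by simp
      moreover have "y + \<tau> *\<^sub>R e \<in> ball x' s" using y by (simp add: \<tau> dist_norm)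
      ultimately have "cmod (g y) \<le> B" using B by auto
      then show "cmod (g y) \<le> 1 * (A * (B / A) powr 1)" using AB by simp
    qed (use s R in auto)
  qed (use R in simp)
qed

text \<open>Restricted to a leaf and read in its complex coordinate, g is holomorphic, so the three
  circles estimate applies on a disc centred near x' and large enough to reach the points near
  x0.\<close>

lemma leaf_interpolation_plane:
  fixes N :: "complex ^ 'n::finite"
  assumes inj: "\<And>z. Re z *\<^sub>R Re_vec N + Im z *\<^sub>R Im_vec N = 0 \<Longrightarrow> z = 0"
  shows "leaf_interpolation N"
  unfolding leaf_interpolation_def
proof (intro allI impI)
  fix x0 :: "real ^ 'n" and R :: real assume R: "R > 0"
  define L where "L z = Re z *\<^sub>R Re_vec N + Im z *\<^sub>R Im_vec N" for z
  have lin: "linear L" by (rule linearI) (simp_all add: L_def algebra_simps)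
  have "inj L" using inj by (auto simp: linear_injective_0[OF lin] L_def)
  then obtain m where m: "m > 0" "\<And>z. m * cmod z \<le> norm (L z)"
    using linear_inj_bounded_below_pos[OF lin] by metis
  obtain M where M: "M > 0" "\<And>z. norm (L z) \<le> M * cmod z"
    using linear_bounded_pos[OF lin] by (metis mult.commute)
  \<comment> \<open>L maps the disc of radius \<rho> into a ball of radius R/4. With |L \<zeta>'|
    \<le> R/4 and |y - x0| < R/4 all points in question remain in \<open>ball x0 R\<close>.\<close>
  define \<rho> where "\<rho> = R / (4 * M)"
  have \<rho>: "\<rho> > 0" using R M by (simp add: \<rho>_def)
  have L\<rho>: "norm (L z) \<le> R / 4" if "cmod z \<le> \<rho>" for z
  proof -
    have "norm (L z) \<le> M * \<rho>" using M(2)[of z] mult_left_mono[OF that, of M] M(1) by linarith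
    then show ?thesis using M(1) by (simp add: \<rho>_def)
  qed
  show "\<exists>r>0. \<forall>x'\<in>ball x0 r. x' - x0 \<in> span {Re_vec N, Im_vec N} \<longrightarrow> (\<forall>s>0. interpolates N x0 R x' s)"
  proof (intro exI[of _ "m * \<rho> / 2"] conjI ballI impI allI)
    fix x' and s :: real
    assume x': "x' \<in> ball x0 (m * \<rho> / 2)" "x' - x0 \<in> span {Re_vec N, Im_vec N}" and s: "s > 0"
    obtain s1 t1 where "x' - x0 = s1 *\<^sub>R Re_vec N + t1 *\<^sub>R Im_vec N" by (rule span_pair[OF x'(2)])
    then have \<zeta>: "x' - x0 = L (Complex s1 t1)" by (simp add: L_def)
    define \<zeta>' where "\<zeta>' = Complex s1 t1"
    have x'_eq: "x' = x0 + L \<zeta>'" using \<zeta> by (simp add: \<zeta>'_def algebra_simps)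
    have "m * cmod \<zeta>' < m * (\<rho> / 2)" using x'(1) m(2)[of \<zeta>'] by (simp add: x'_eq dist_norm)
    then have \<zeta>_le: "cmod \<zeta>' \<le> \<rho> / 2" using m(1) by simp
    define s1 where "s1 = min (\<rho> / 2) (s / (2 * M))"
    have s1: "s1 > 0" "s1 \<le> \<rho> / 2" using \<rho> s M by (auto simp: s1_def)
    have Ls1: "norm (L z) \<le> s / 2" if "cmod z \<le> s1" for z
    proof -
      have "cmod z \<le> s / (2 * M)" using that by (simp add: s1_def)
      then have "norm (L z) \<le> M * (s / (2 * M))" using M(2)[of z] mult_left_mono[of "cmod z" "s / (2 * M)" M] M(1) by linarith
      then show ?thesis using M(1) by simp
    qed
    obtain \<theta> where \<theta>: "0 < \<theta>" "\<theta> \<le> 1" and interp: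
      "\<And>f A B z. f holomorphic_on ball 0 \<rho> \<Longrightarrow> continuous_on (cball 0 \<rho>) f \<Longrightarrow>
      (\<And>z. cmod z \<le> \<rho> \<Longrightarrow> cmod (f z) \<le> A) \<Longrightarrow> (\<And>z. cmod z \<le> s1 \<Longrightarrow> cmod (f z) \<le> B) \<Longrightarrow>
      0 < B \<Longrightarrow> B \<le> A \<Longrightarrow> cmod z \<le> \<rho> / 2 \<Longrightarrow> cmod (f z) \<le> 3 * (A * (B / A) powr \<theta>)"
      by (rule holomorphic_interpolation[OF s1]) blast
    show "interpolates N x0 R x' s"
      unfolding interpolates_def
    proof (rule exI[of _ "min (s / 2) (R / 4)"], rule exI[of _ \<theta>], rule exI[of _ 3], intro conjI allI impI ballI)
      fix g A B y
      assume g: "smooth_fun_on (ball x0 R) g" "\<forall>x\<in>ball x0 R. dN N g x = 0" and AB: "0 < B" "B \<le> A"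
        and A: "\<forall>x\<in>ball x0 R. cmod (g x) \<le> A"
        and B: "\<forall>x\<in>ball x' s. cmod (g x) \<le> B" and y: "y \<in> ball x0 (min (s / 2) (R / 4))"
      \<comment> \<open>The centre w differs from x' by y - x0, so a small disc around it lies in
        \<open>ball x' s\<close>. The point y has the coordinate -\<zeta>', which is in the disc of
        half the radius.\<close>
      define w where "w = y + L \<zeta>'"
      have in_ball: "w + L z \<in> ball x0 R" if "cmod z \<le> \<rho>" for z
      proof -
        have "norm (L \<zeta>') \<le> R / 4" using L\<rho>[of \<zeta>'] \<zeta>_le \<rho> by simp
        moreover have "norm (L z) \<le> R / 4" by (rule L\<rho>[OF that])
        moreover have "norm (y - x0) < R / 4" using y by (simp add: dist_norm norm_minus_commute)
        moreover have "norm ((y - x0) + L \<zeta>' + L z) \<le> norm (y - x0) + norm (L \<zeta>') + norm (L z)"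
          by (meson norm_triangle_ineq norm_triangle_le add_right_mono order_trans)
        moreover have "(y - x0) + L \<zeta>' + L z = w + L z - x0" by (simp add: w_def)
        ultimately have "norm (w + L z - x0) < R" using R by simp
        then show ?thesis by (simp add: dist_norm norm_minus_commute)
      qed
      define G where "G z = g (w + L z)" for z
      have der: "(G has_field_derivative dir (Re_vec N) g (w + L z)) (at z)" if "cmod z \<le> \<rho>" for z
      proof -
        have "(L has_derivative L) (at z)" by (rule linear_imp_has_derivative[OF lin])
        then have 1: "((\<lambda>z. w + L z) has_derivative L) (at z)" by (auto intro!: derivative_eq_intros)
        have "(g has_derivative (\<lambda>h. dir h g (w + L z))) (at (w + L z))"
          using smooth_has_derivative[OF g(1) in_ball[OF that]] by (simp add: dir_def)
        from has_derivative_compose[OF 1 this]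
        have "(G has_derivative (\<lambda>h. dir (L h) g (w + L z))) (at z)" by (simp add: G_def[abs_def])
        moreover have "dir (L h) g (w + L z) = dir (Re_vec N) g (w + L z) * h" for h
        proof -
          have "dir (Re_vec N) g (w + L z) + \<i> * dir (Im_vec N) g (w + L z) = 0"
            using g(2) in_ball[OF that] by (simp add: dN_dir)
          \<comment> \<open>The equation says that the derivative along Im N is i times the one
            along Re N, which makes the derivative of G complex linear.\<close>
          then have "\<i> * (dir (Re_vec N) g (w + L z) + \<i> * dir (Im_vec N) g (w + L z)) = 0" by simp
          then have "dir (Im_vec N) g (w + L z) = \<i> * dir (Re_vec N) g (w + L z)"
            by (simp add: distrib_left)
          then show ?thesis
            unfolding L_def dir_add dir_scaleR by (simp add: complex_eq_iff algebra_simps)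
        qed
        ultimately show ?thesis by (simp add: has_field_derivative_def)
      qed
      have "cmod (G (- \<zeta>')) \<le> 3 * (A * (B / A) powr \<theta>)"
      proof (rule interp[where f = G and z = "- \<zeta>'", OF _ _ _ _ AB])
        show "G holomorphic_on ball 0 \<rho>"
        proof (rule holomorphic_onI)
          fix z :: complex assume "z \<in> ball 0 \<rho>"
          then show "G field_differentiable at z within ball 0 \<rho>"
            using has_field_derivative_at_within[OF der[of z]] by (auto simp: field_differentiable_def)
        qed
        show "continuous_on (cball 0 \<rho>) G"
        proof (intro continuous_at_imp_continuous_on ballI)
          fix z :: complex assume "z \<in> cball 0 \<rho>"
          then show "isCont G z" by (intro DERIV_isCont[OF der]) simp
        qed
        show "cmod (G z) \<le> A" if "cmod z \<le> \<rho>" for z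
          using A in_ball[OF that] by (simp add: G_def)
        show "cmod (G z) \<le> B" if "cmod z \<le> s1" for z
        proof -
          have eq: "w + L z - x' = (y - x0) + L z" by (simp add: w_def x'_eq)
          have "norm (y - x0) < s / 2" using y by (simp add: dist_norm norm_minus_commute)
          then have "norm (w + L z - x') < s"
            unfolding eq using Ls1[OF that] norm_triangle_ineq[of "y - x0" "L z"] by linarith
          then show ?thesis using B by (simp add: G_def dist_norm norm_minus_commute)
        qed
        show "cmod (- \<zeta>') \<le> \<rho> / 2" using \<zeta>_le by simp
      qed
      moreover have "G (- \<zeta>') = g y" by (simp add: G_def w_def linear_neg[OF lin])
      ultimately show "cmod (g y) \<le> 3 * (A * (B / A) powr \<theta>)" by simp
    qed (use s R \<theta> in auto)
  qed (use m \<rho> in simp)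
qed

lemma leaf_interpolation: "N \<noteq> 0 \<Longrightarrow> leaf_interpolation N"
proof (erule direction_cases)
  show "leaf_interpolation N" if "e \<noteq> 0" "Re_vec N = p *\<^sub>R e" "Im_vec N = q *\<^sub>R e" "Complex p q \<noteq> 0" for e p q
    by (rule leaf_interpolation_line[OF that])
  show "leaf_interpolation N" if "\<And>z. Re z *\<^sub>R Re_vec N + Im z *\<^sub>R Im_vec N = 0 \<Longrightarrow> z = 0"
    by (rule leaf_interpolation_plane[OF that])
qed

section \<open>Solving the inhomogeneous equation along the leaves\<close>

lemma test_funs_vanish_outside:
  assumes "\<phi> \<in> test_funs U"
  obtains Q where "Q > 0" "\<And>x. norm x \<ge> Q \<Longrightarrow> \<phi> x = 0"
proof -
  obtain Q where Q: "Q > 0" "\<And>x. x \<in> fun_support \<phi> \<Longrightarrow> norm x \<le> Q"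
    using compact_imp_bounded[OF test_funsD(2)[OF assms]] by (auto simp: bounded_pos)
  have "\<phi> x = 0" if "norm x \<ge> Q + 1" for x
    using Q(2)[of x] that not_in_fun_support[of x \<phi>] by auto
  then show ?thesis using that[of "Q + 1"] Q(1) by simp
qed

lemma dN_param_integral:
  fixes \<gamma> :: "'b::euclidean_space \<Rightarrow> real ^ 'n::finite"
  assumes \<phi>: "\<phi> \<in> test_funs U" and w: "continuous_on (cbox a b) w" and \<gamma>: "continuous_on (cbox a b) \<gamma>"
  shows "dN N (\<lambda>x. integral (cbox a b) (\<lambda>t. w t * \<phi> (x + \<gamma> t))) x =
     integral (cbox a b) (\<lambda>t. w t * dN N \<phi> (x + \<gamma> t))"
proof -
  have p: "partial_deriv k (\<lambda>x. integral (cbox a b) (\<lambda>t. w t * \<phi> (x + \<gamma> t))) x =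
      integral (cbox a b) (\<lambda>t. w t * partial_deriv k \<phi> (x + \<gamma> t))" for k
    using param_integral_smooth(2)[OF \<phi> w \<gamma>, of "[k]"] by simp
  have int: "(\<lambda>t. w t * partial_deriv k \<phi> (x + \<gamma> t)) integrable_on cbox a b" for k
    by (intro integrable_continuous continuous_intros w continuous_on_compose2[OF test_funs_continuous[OF test_funs_partial_deriv[OF \<phi>], of UNIV]] \<gamma>) auto
  have "dN N (\<lambda>x. integral (cbox a b) (\<lambda>t. w t * \<phi> (x + \<gamma> t))) x =
     (\<Sum>k\<in>UNIV. integral (cbox a b) (\<lambda>t. N $ k * (w t * partial_deriv k \<phi> (x + \<gamma> t))))"
    unfolding dN_def p by simp
  also have "\<dots> = integral (cbox a b) (\<lambda>t. \<Sum>k\<in>UNIV. N $ k * (w t * partial_deriv k \<phi> (x + \<gamma> t)))"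
    by (rule Henstock_Kurzweil_Integration.integral_sum[symmetric]) (auto intro: integrable_on_mult_right int)
  finally show ?thesis by (simp add: dN_def sum_distrib_left mult.left_commute)
qed

lemma smooth_dir: "open U \<Longrightarrow> smooth_fun_on U f \<Longrightarrow> smooth_fun_on U (dir v f)"
  unfolding dir_def[abs_def] scaleR_conv_of_real[where 'a = complex]
  by (intro smooth_sum smooth_cmult smooth_partial_deriv)

lemma ex_leaf_solution_line:
  fixes N :: "complex ^ 'n::finite"
  assumes e: "e \<noteq> 0" "Re_vec N = p *\<^sub>R e" "Im_vec N = q *\<^sub>R e" "Complex p q \<noteq> 0"
    and \<phi>: "\<phi> \<in> test_funs UNIV"
  shows "\<exists>v. smooth_fun_on UNIV v \<and> (\<forall>x\<in>ball x0 R. dN N v x = \<phi> x)"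
proof -
  obtain Q where Q: "Q > 0" "\<And>x. norm x \<ge> Q \<Longrightarrow> \<phi> x = 0" by (rule test_funs_vanish_outside[OF \<phi>]) blast
  \<comment> \<open>So large that every x in the ball, moved back by T e, has left the support of
    \<phi>.\<close>
  define T where "T = (Q + norm x0 + \<bar>R\<bar>) / norm e"
  have T: "T \<ge> 0" using Q(1) by (simp add: T_def)
  let ?v = "\<lambda>x. integral (cbox 0 T) (\<lambda>t. inverse (Complex p q) * \<phi> (x + t *\<^sub>R (- e)))"
  have c: "continuous_on (cbox 0 T) (\<lambda>t. inverse (Complex p q))" "continuous_on (cbox 0 T) (\<lambda>t. t *\<^sub>R (- e))"
    by (intro continuous_intros)+
  have "dN N ?v x = \<phi> x" if x: "x \<in> ball x0 R" for x
  proof -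
    have "dN N ?v x = integral {0..T} (\<lambda>t. dir e \<phi> (x + t *\<^sub>R (- e)))"
      unfolding dN_param_integral[OF \<phi> c] dN_line[OF e(2,3)] using e(4) by (simp add: mult.assoc[symmetric])
    also have "\<dots> = (- \<phi> (x + T *\<^sub>R (- e))) - (- \<phi> (x + 0 *\<^sub>R (- e)))"
    proof (rule integral_unique, rule fundamental_theorem_of_calculus[OF T])
      fix t
      have "((\<lambda>t. \<phi> (x + t *\<^sub>R (- e))) has_vector_derivative dir (- e) \<phi> (x + t *\<^sub>R (- e))) (at t within {0..T})"
        by (rule has_vector_derivative_dir[OF test_funsD(1)[OF \<phi>]]) simp
      then have "((\<lambda>t. - \<phi> (x + t *\<^sub>R (- e))) has_vector_derivative - dir (- e) \<phi> (x + t *\<^sub>R (- e))) (at t within {0..T})"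
        by (rule has_vector_derivative_minus)
      then show "((\<lambda>t. - \<phi> (x + t *\<^sub>R (- e))) has_vector_derivative dir e \<phi> (x + t *\<^sub>R (- e))) (at t within {0..T})"
        using dir_scaleR[of "-1" e \<phi>] by simp
    qed
    also have "\<phi> (x + T *\<^sub>R (- e)) = 0"
    proof (rule Q(2))
      have "norm (T *\<^sub>R e) = Q + norm x0 + \<bar>R\<bar>" using T e(1) Q(1) by (simp add: T_def)
      moreover have "norm x \<le> norm x0 + \<bar>R\<bar>"
        using x norm_triangle_ineq2[of x x0] by (auto simp: dist_norm norm_minus_commute)
      moreover have "norm (T *\<^sub>R e) \<le> norm x + norm (x + T *\<^sub>R (- e))"
        using norm_triangle_ineq4[of x "x + T *\<^sub>R (- e)"] by simp
      ultimately show "Q \<le> norm (x + T *\<^sub>R (- e))" by linarith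
    qed
    finally show ?thesis by simp
  qed
  then show ?thesis using param_integral_smooth(1)[OF \<phi> c] by (intro exI[of _ ?v]) auto
qed

text \<open>In polar coordinates on the leaf, convolution with the fundamental solution \<open>1/(2\<pi>z)\<close> of
  \<open>\<partial>\<^sub>s + i\<partial>\<^sub>t\<close> has a bounded integrand, since \<open>dz/z\<close> becomes \<open>e\<^bsup>-it\<^esup> dr dt\<close>.\<close>
lemma ex_leaf_solution_plane:
  fixes N :: "complex ^ 'n::finite"
  assumes inj: "\<And>z. Re z *\<^sub>R Re_vec N + Im z *\<^sub>R Im_vec N = 0 \<Longrightarrow> z = 0"
    and \<phi>: "\<phi> \<in> test_funs UNIV"
  shows "\<exists>v. smooth_fun_on UNIV v \<and> (\<forall>x\<in>ball x0 R. dN N v x = \<phi> x)"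
proof -
  let ?a = "Re_vec N" and ?b = "Im_vec N"
  obtain Q where Q: "Q > 0" "\<And>x. norm x \<ge> Q \<Longrightarrow> \<phi> x = 0" by (rule test_funs_vanish_outside[OF \<phi>]) blast
  define L where "L z = Re z *\<^sub>R ?a + Im z *\<^sub>R ?b" for z
  have lin: "linear L" by (rule linearI) (simp_all add: L_def algebra_simps)
  have "inj L" using inj by (auto simp: linear_injective_0[OF lin] L_def)
  then obtain m where m: "m > 0" "\<And>z. m * cmod z \<le> norm (L z)"
    using linear_inj_bounded_below_pos[OF lin] by metis
  define T where "T = (Q + norm x0 + \<bar>R\<bar>) / m"
  have T: "T \<ge> 0" using Q(1) m by (simp add: T_def)
  let ?E = "\<lambda>\<theta>. cos \<theta> *\<^sub>R ?a + sin \<theta> *\<^sub>R ?b" and ?E' = "\<lambda>\<theta>. (- sin \<theta>) *\<^sub>R ?a + cos \<theta> *\<^sub>R ?b"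
  define w :: "real \<times> real \<Rightarrow> complex" where "w z = cis (- snd z) / (2 * pi)" for z
  define \<gamma> where "\<gamma> z = - (fst z *\<^sub>R ?E (snd z))" for z :: "real \<times> real"
  let ?B = "cbox (0, 0) (T, 2 * pi)"
  have cw: "continuous_on S w" for S
    unfolding w_def cis_conv_exp by (intro continuous_intros) auto
  have c\<gamma>: "continuous_on S \<gamma>" for S
    unfolding \<gamma>_def by (intro continuous_intros)
  let ?v = "\<lambda>x. integral ?B (\<lambda>z. w z * \<phi> (x + \<gamma> z))"
  have "dN N ?v x = \<phi> x" if x: "x \<in> ball x0 R" for x
  proof -
    have cd: "continuous_on S (\<lambda>z. dir c \<phi> (x + \<gamma> z))" for c and S :: "(real \<times> real) set"
      by (intro continuous_on_compose2[OF smooth_fun_on_continuous[OF smooth_dir[OF open_UNIV test_funsD(1)[OF \<phi>]]]]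
          continuous_intros c\<gamma>) auto
    define F1 where "F1 z = dir (?E (snd z)) \<phi> (x + \<gamma> z)" for z
    define F2 where "F2 z = dir (?E' (snd z)) \<phi> (x + \<gamma> z)" for z
    have cF1: "continuous_on S F1" for S
      unfolding F1_def dir_add dir_scaleR by (intro continuous_intros cd)
    have cF2: "continuous_on S F2" for S
      unfolding F2_def dir_add dir_scaleR by (intro continuous_intros cd)
    \<comment> \<open>The factor e^(-it) of the kernel rotates the frame: the vector field becomes
      the radial derivative plus i times the angular one.\<close>
    have rot: "cis (- t) * dN N \<phi> y = dir (?E t) \<phi> y + \<i> * dir (?E' t) \<phi> y" for t y
      unfolding dN_dir dir_add dir_scaleR by (simp add: complex_eq_iff algebra_simps)
    have "dN N ?v x = integral ?B (\<lambda>z. w z * dN N \<phi> (x + \<gamma> z))"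
      by (rule dN_param_integral[OF \<phi> cw c\<gamma>])
    also have "\<dots> = integral ?B (\<lambda>z. (1 / (2 * pi)) *\<^sub>R (F1 z + \<i> * F2 z))"
    proof -
      have "w z * dN N \<phi> (x + \<gamma> z) = (cis (- snd z) * dN N \<phi> (x + \<gamma> z)) / (2 * pi)" for z
        by (simp add: w_def)
      then have "w z * dN N \<phi> (x + \<gamma> z) = (1 / (2 * pi)) *\<^sub>R (F1 z + \<i> * F2 z)" for z
        unfolding rot F1_def F2_def by (simp add: scaleR_conv_of_real[where 'a = complex])
      then show ?thesis by simp
    qed
    also have "\<dots> = (1 / (2 * pi)) *\<^sub>R (integral ?B F1 + \<i> * integral ?B F2)"
    proof -
      have "F1 integrable_on ?B" "(\<lambda>z. \<i> * F2 z) integrable_on ?B"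
        by (intro integrable_continuous continuous_intros cF1 cF2)+
      then show ?thesis by (simp add: Henstock_Kurzweil_Integration.integral_add)
    qed
    \<comment> \<open>-r F2 is the derivative in t of \<phi> along the circle of radius r, whose
      integral over a full period is 0.\<close>
    also have "integral ?B F2 = 0"
    proof -
      have z: "integral (cbox 0 (2 * pi)) (\<lambda>t. F2 (r, t)) = 0" if "r \<noteq> 0" for r
      proof -
        have "((\<lambda>t. F2 (r, t)) has_integral
          ((- 1 / r) *\<^sub>R \<phi> (x + \<gamma> (r, 2 * pi)) - (- 1 / r) *\<^sub>R \<phi> (x + \<gamma> (r, 0)))) {0..2 * pi}"
        proof (rule fundamental_theorem_of_calculus)
          fix t
          have "((\<lambda>t. \<gamma> (r, t)) has_vector_derivative (- (r *\<^sub>R ?E' t))) (at t within {0..2 * pi})"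
            unfolding \<gamma>_def has_vector_derivative_def
            by (auto intro!: derivative_eq_intros simp: algebra_simps)
          then have "((\<lambda>t. x + \<gamma> (r, t)) has_derivative (\<lambda>h. h *\<^sub>R (- (r *\<^sub>R ?E' t)))) (at t within {0..2 * pi})"
            unfolding has_vector_derivative_def by (auto intro!: derivative_eq_intros)
          from has_derivative_compose[OF this smooth_has_derivative[OF test_funsD(1)[OF \<phi>] UNIV_I]]
          have "((\<lambda>t. \<phi> (x + \<gamma> (r, t))) has_derivative (\<lambda>h. dir (h *\<^sub>R (- (r *\<^sub>R ?E' t))) \<phi> (x + \<gamma> (r, t)))) (at t within {0..2 * pi})"
            by (simp add: dir_def)
          moreover have "dir (h *\<^sub>R (- (r *\<^sub>R ?E' t))) \<phi> y = h *\<^sub>R ((- r) *\<^sub>R dir (?E' t) \<phi> y)" for h y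
            by (metis dir_scaleR scaleR_minus_left)
          ultimately have "((\<lambda>t. \<phi> (x + \<gamma> (r, t))) has_vector_derivative (- r) *\<^sub>R F2 (r, t)) (at t within {0..2 * pi})"
            by (simp only: has_vector_derivative_def F2_def snd_conv)
          from has_vector_derivative_scaleR[OF _ this, of "\<lambda>_. - 1 / r" 0]
          show "((\<lambda>t. (- 1 / r) *\<^sub>R \<phi> (x + \<gamma> (r, t))) has_vector_derivative F2 (r, t)) (at t within {0..2 * pi})"
            using \<open>r \<noteq> 0\<close> by simp
        qed simp
        moreover have "\<gamma> (r, 2 * pi) = \<gamma> (r, 0)" by (simp add: \<gamma>_def)
        ultimately show ?thesis by (simp add: integral_unique)
      qed
      have "integral ?B F2 = integral (cbox 0 T) (\<lambda>r. integral (cbox 0 (2 * pi)) (\<lambda>t. F2 (r, t)))"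
        by (rule integral_prod_continuous[OF cF2])
      also have "\<dots> = integral (cbox 0 T) (\<lambda>r. 0)"
        \<comment> \<open>The division by r excludes r = 0, but a single radius is
          negligible.\<close>
        by (rule integral_spike[of "{0}"]) (use z in auto)
      finally show ?thesis by simp
    qed
    \<comment> \<open>F1 is minus the r-derivative of \<phi> along the ray, and the far end of the
      ray is outside the support. So every angle contributes \<phi> x.\<close>
    also have "integral ?B F1 = (2 * pi) *\<^sub>R \<phi> x"
    proof -
      have z: "integral (cbox 0 T) (\<lambda>r. F1 (r, t)) = \<phi> x" for t
      proof -
        have "((\<lambda>r. F1 (r, t)) has_integral (- \<phi> (x + T *\<^sub>R (- ?E t)) - (- \<phi> (x + 0 *\<^sub>R (- ?E t))))) {0..T}"
        proof (rule fundamental_theorem_of_calculus[OF T])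
          fix r
          have "((\<lambda>r. \<phi> (x + r *\<^sub>R (- ?E t))) has_vector_derivative dir (- ?E t) \<phi> (x + r *\<^sub>R (- ?E t))) (at r within {0..T})"
            by (rule has_vector_derivative_dir[OF test_funsD(1)[OF \<phi>]]) simp
          then have "((\<lambda>r. - \<phi> (x + r *\<^sub>R (- ?E t))) has_vector_derivative - dir (- ?E t) \<phi> (x + r *\<^sub>R (- ?E t))) (at r within {0..T})"
            by (rule has_vector_derivative_minus)
          moreover have "- dir (- ?E t) \<phi> y = dir (?E t) \<phi> y" for y
            using dir_scaleR[of "-1" "?E t" \<phi> y] by simp
          ultimately show "((\<lambda>r. - \<phi> (x + r *\<^sub>R (- ?E t))) has_vector_derivative F1 (r, t)) (at r within {0..T})"
            by (simp only: F1_def \<gamma>_def fst_conv snd_conv scaleR_minus_right)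
        qed
        moreover have "\<phi> (x + T *\<^sub>R (- ?E t)) = 0"
        proof (rule Q(2))
          have "m * cmod (cis t) \<le> norm (L (cis t))" by (rule m(2))
          then have "m \<le> norm (?E t)" by (simp add: L_def)
          then have "T * m \<le> norm (T *\<^sub>R ?E t)" using T by (simp add: mult_left_mono)
          moreover have "T * m = Q + norm x0 + \<bar>R\<bar>" using m by (simp add: T_def)
          moreover have "norm x \<le> norm x0 + \<bar>R\<bar>"
            using x norm_triangle_ineq2[of x x0] by (auto simp: dist_norm norm_minus_commute)
          moreover have *: "norm (T *\<^sub>R v) \<le> norm x + norm (x + T *\<^sub>R (- v))" for v
            using norm_triangle_ineq4[of x "x + T *\<^sub>R (- v)"] by simp
          ultimately show "Q \<le> norm (x + T *\<^sub>R (- ?E t))" using *[of "?E t"] by linarith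
        qed
        ultimately show ?thesis by (simp add: integral_unique)
      qed
      have "integral ?B F1 = integral (cbox 0 T) (\<lambda>r. integral (cbox 0 (2 * pi)) (\<lambda>t. F1 (r, t)))"
        by (rule integral_prod_continuous[OF cF1])
      also have "\<dots> = integral (cbox 0 (2 * pi)) (\<lambda>t. integral (cbox 0 T) (\<lambda>r. F1 (r, t)))"
        by (rule integral_swap_continuous) (use cF1 in \<open>simp add: split_beta\<close>)
      also have "\<dots> = (2 * pi) *\<^sub>R \<phi> x" unfolding z by simp
      finally show ?thesis .
    qed
    finally show ?thesis by simp
  qed
  then show ?thesis using param_integral_smooth(1)[OF \<phi> cw c\<gamma>] by (intro exI[of _ ?v]) auto
qed

lemma ex_leaf_solution:
  assumes "N \<noteq> 0" "\<phi> \<in> test_funs UNIV"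
  shows "\<exists>v. smooth_fun_on UNIV v \<and> (\<forall>x\<in>ball x0 R. dN N v x = \<phi> x)"
  using assms(1)
proof (cases rule: direction_cases)
  case (line e p q)
  then show ?thesis by (rule ex_leaf_solution_line[OF _ _ _ _ assms(2)])
next
  case plane
  then show ?thesis by (rule ex_leaf_solution_plane[OF _ assms(2)])
qed

subsection \<open>First order operators\<close>

text \<open>\<open>opL\<close> is P(D) for a linear factor, and \<open>opT\<close> is its transpose
  under the integral. Convolutions with a distribution see \<open>opT\<close>, because
  \<open>\<kappa> (x - y)\<close> changes the sign of its derivative when x replaces y as the
  variable.\<close>

definition opL :: "complex ^ 'n::finite \<Rightarrow> complex \<Rightarrow> (real ^ 'n \<Rightarrow> complex) \<Rightarrow> real ^ 'n \<Rightarrow> complex" where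
  "opL N c \<phi> x = - \<i> * dN N \<phi> x + c * \<phi> x"

definition opT :: "complex ^ 'n::finite \<Rightarrow> complex \<Rightarrow> (real ^ 'n \<Rightarrow> complex) \<Rightarrow> real ^ 'n \<Rightarrow> complex" where
  "opT N c f x = \<i> * dN N f x + c * f x"

lemma PD_opL: "smooth_fun_on UNIV f \<Longrightarrow> PD (linear_poly N + const_poly c) f = opL N c f"
  by (simp add: PD_linear_factor opL_def[abs_def] dN_def)

lemma dN_mult:
  assumes "f differentiable (at x)" "g differentiable (at x)"
  shows "dN N (\<lambda>x. f x * g x) x = f x * dN N g x + dN N f x * g x"
  using assms by (simp add: dN_def partial_deriv_mult algebra_simps sum.distrib sum_distrib_left)

lemma ex_exponential_solution:
  fixes N :: "complex ^ 'n::finite"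
  assumes "N \<noteq> 0"
  obtains E where "smooth_fun_on UNIV E" "\<And>x. E x \<noteq> 0" "\<And>x. opT N c E x = 0"
proof -
  define S where "S = (\<Sum>k\<in>UNIV. (cmod (N $ k))\<^sup>2)"
  have "S \<noteq> 0"
  proof
    assume "S = 0"
    then have "\<forall>k. N $ k = 0" unfolding S_def by (subst (asm) sum_nonneg_eq_0_iff) auto
    with assms show False by (simp add: vec_eq_iff)
  qed
  \<comment> \<open>The exponential of <\<mu>,x> solves the equation if <N,\<mu>> = i c. The pairing
    is bilinear and may vanish on N itself, so the conjugate of N is used, for which it equals the
    nonzero number S.\<close>
  define \<mu> where "\<mu> k = (\<i> * c / complex_of_real S) * cnj (N $ k)" for k
  have N\<mu>: "(\<Sum>k\<in>UNIV. N $ k * \<mu> k) = \<i> * c"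
  proof -
    have "(\<Sum>k\<in>UNIV. N $ k * \<mu> k) = (\<i> * c / complex_of_real S) * (\<Sum>k\<in>UNIV. N $ k * cnj (N $ k))"
      by (simp add: \<mu>_def sum_distrib_left mult_ac)
    also have "(\<Sum>k\<in>UNIV. N $ k * cnj (N $ k)) = complex_of_real S"
      by (simp only: S_def of_real_sum complex_norm_square)
    finally show ?thesis using \<open>S \<noteq> 0\<close> by simp
  qed
  define E where "E x = exp (\<Sum>k\<in>UNIV. \<mu> k * complex_of_real (x $ k))" for x :: "real ^ 'n"
  have D: "(E has_derivative (\<lambda>h. E x * (\<Sum>k\<in>UNIV. \<mu> k * complex_of_real (h $ k)))) (at x)" for x
  proof -
    have 1: "((\<lambda>x. \<Sum>k\<in>UNIV. \<mu> k * complex_of_real (x $ k)) has_derivative (\<lambda>h. \<Sum>k\<in>UNIV. \<mu> k * complex_of_real (h $ k))) (at x)"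
      by (intro bounded_linear_imp_has_derivative bounded_linear_sum bounded_linear_const_mult
          bounded_linear_compose[OF bounded_linear_of_real bounded_linear_vec_nth])
    have "(exp has_derivative (*) (exp z)) (at z)" for z :: complex
      using DERIV_exp[of z] by (simp add: has_field_derivative_def)
    from has_derivative_compose[OF 1 this] show ?thesis unfolding E_def[abs_def] .
  qed
  have p: "partial_deriv k E x = \<mu> k * E x" for k x
    using partial_deriv_eqI[OF D, of k x]
    by (simp add: axis_def if_distrib[of complex_of_real] if_distrib[of "\<lambda>z. _ * z"] mult.commute cong: if_cong)
  have sm: "smooth_fun_on UNIV E"
  proof (rule smooth_alg_smooth[of _ _ "{E}"])
    show "E \<in> smooth_alg {E}" by (rule smooth_alg.base) simp
    show "g differentiable (at x)" if "g \<in> {E}" for g x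
      using D that by (auto simp: differentiable_def)
    show "\<exists>h\<in>smooth_alg {E}. \<forall>x\<in>UNIV. partial_deriv k g x = h x" if "g \<in> {E}" for g k
    proof (rule bexI[of _ "\<lambda>x. \<mu> k * E x"])
      show "(\<lambda>x. \<mu> k * E x) \<in> smooth_alg {E}"
        by (intro smooth_alg.mult smooth_alg.const smooth_alg.base) simp
    qed (use that p in simp)
  qed simp
  have "dN N E x = \<i> * c * E x" for x
    unfolding dN_def p N\<mu>[symmetric] by (simp add: sum_distrib_right mult.assoc)
  then have "opT N c E x = 0" for x by (simp add: opT_def mult.assoc)
  then show ?thesis using that[of E] sm by (simp add: E_def)
qed

lemma opT_mult_exponential:
  assumes "opT N c E x = 0" "E differentiable (at x)" "v differentiable (at x)"
  shows "opT N c (\<lambda>x. E x * v x) x = \<i> * E x * dN N v x"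
proof -
  have "opT N c (\<lambda>x. E x * v x) x = \<i> * E x * dN N v x + opT N c E x * v x"
    using assms(2,3) by (simp add: opT_def dN_mult algebra_simps)
  then show ?thesis using assms(1) by simp
qed

lemma ex_opT_solution:
  assumes "N \<noteq> 0" "\<phi> \<in> test_funs UNIV"
  shows "\<exists>v. smooth_fun_on UNIV v \<and> (\<forall>x\<in>ball x0 R. opT N c v x = \<phi> x)"
proof -
  obtain E where E: "smooth_fun_on UNIV E" "\<And>x. E x \<noteq> 0" "\<And>x. opT N c E x = 0"
    by (rule ex_exponential_solution[OF assms(1), of c]) blast
  \<comment> \<open>Ansatz E v: \<open>opT\<close> maps it to i E times \<open>dN N v\<close>, which
    has to be \<phi>.\<close>
  have "(\<lambda>x. (- \<i> * inverse (E x)) * \<phi> x) \<in> test_funs UNIV"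
    by (intro test_funs_smooth_mult smooth_cmult smooth_inverse E assms(2) open_UNIV)
  from ex_leaf_solution[OF assms(1) this, of x0 R]
  obtain v where v: "smooth_fun_on UNIV v" "\<forall>x\<in>ball x0 R. dN N v x = (- \<i> * inverse (E x)) * \<phi> x"
    by (elim exE conjE)
  have "opT N c (\<lambda>x. E x * v x) x = \<phi> x" if "x \<in> ball x0 R" for x
    using opT_mult_exponential[OF E(3) smooth_fun_onD[OF E(1) UNIV_I] smooth_fun_onD[OF v(1) UNIV_I], of x] v(2) that E(2)[of x]
    by (simp add: field_simps)
  moreover have "smooth_fun_on UNIV (\<lambda>x. E x * v x)" by (intro smooth_mult E(1) v(1) open_UNIV)
  ultimately show ?thesis by (intro exI[of _ "\<lambda>x. E x * v x"] conjI ballI)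
qed

text \<open>The counterpart of \<open>interpolates\<close> for the full operator. The constants are
  arguments because the order of extrapolation is chosen in terms of \<theta>, and the same ball of
  radius \<eta> has to serve all derivatives of u.\<close>

definition interpolating ::
    "complex ^ 'n::finite \<Rightarrow> complex \<Rightarrow> real ^ 'n \<Rightarrow> real \<Rightarrow> real ^ 'n \<Rightarrow> real \<Rightarrow> real \<Rightarrow> real \<Rightarrow> real \<Rightarrow> bool" where
  "interpolating N c x0 R x' s \<eta> \<theta> C \<longleftrightarrow> 0 < \<eta> \<and> \<eta> \<le> R \<and> 0 < \<theta> \<and> \<theta> \<le> 1 \<and> 0 < C \<and>
     (\<forall>g A B. smooth_fun_on (ball x0 R) g \<longrightarrow> (\<forall>x\<in>ball x0 R. opT N c g x = 0) \<longrightarrow> 0 < B \<longrightarrow> B \<le> A \<longrightarrow>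
       (\<forall>x\<in>ball x0 R. cmod (g x) \<le> A) \<longrightarrow> (\<forall>x\<in>ball x' s. cmod (g x) \<le> B) \<longrightarrow>
       (\<forall>x\<in>ball x0 \<eta>. cmod (g x) \<le> C * (A * (B / A) powr \<theta>)))"

lemma interpolatingD:
  assumes "interpolating N c x0 R x' s \<eta> \<theta> C" "smooth_fun_on (ball x0 R) g" "\<forall>x\<in>ball x0 R. opT N c g x = 0"
    "0 < B" "B \<le> A" "\<forall>x\<in>ball x0 R. cmod (g x) \<le> A" "\<forall>x\<in>ball x' s. cmod (g x) \<le> B" "x \<in> ball x0 \<eta>"
  shows "cmod (g x) \<le> C * (A * (B / A) powr \<theta>)"
  using assms unfolding interpolating_def by simp

text \<open>Division by the exponential solution E leads back to \<open>dN\<close>. If M bounds E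
  and 1/E on both balls, then A and B are multiplied by M, which leaves B/A unchanged, and the way
  back costs another factor M.\<close>

lemma ex_interpolating:
  fixes N :: "complex ^ 'n::finite"
  assumes N: "N \<noteq> 0" and i: "interpolates N x0 R x' s" and R: "R > 0" and s: "s > 0"
  obtains \<eta> \<theta> C where "interpolating N c x0 R x' s \<eta> \<theta> C"
proof -
  obtain \<eta> \<theta> C where c: "0 < \<eta>" "\<eta> \<le> R" "0 < \<theta>" "\<theta> \<le> 1" "0 < C" and
    H: "\<forall>g A B. smooth_fun_on (ball x0 R) g \<longrightarrow> (\<forall>x\<in>ball x0 R. dN N g x = 0) \<longrightarrow> 0 < B \<longrightarrow> B \<le> A \<longrightarrow>
       (\<forall>x\<in>ball x0 R. cmod (g x) \<le> A) \<longrightarrow> (\<forall>x\<in>ball x' s. cmod (g x) \<le> B) \<longrightarrow>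
       (\<forall>x\<in>ball x0 \<eta>. cmod (g x) \<le> C * (A * (B / A) powr \<theta>))"
    using i unfolding interpolates_def by (elim exE conjE)
  obtain E where E: "smooth_fun_on UNIV E" "\<And>x. E x \<noteq> 0" "\<And>x. opT N c E x = 0"
    by (rule ex_exponential_solution[OF N, of c]) blast
  have iE: "smooth_fun_on UNIV (\<lambda>x. inverse (E x))" by (rule smooth_inverse[OF open_UNIV E(1)]) (rule E(2))
  let ?K = "cball x0 R \<union> cball x' s"
  have K: "compact ?K" by (intro compact_Un compact_cball)
  obtain M1 where M1: "\<And>x. x \<in> ?K \<Longrightarrow> cmod (E x) \<le> M1"
    using compact_imp_bounded[OF compact_continuous_image[OF continuous_on_subset[OF smooth_fun_on_continuous[OF E(1)] subset_UNIV] K]]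
    unfolding bounded_iff by blast
  obtain M2 where M2: "\<And>x. x \<in> ?K \<Longrightarrow> cmod (inverse (E x)) \<le> M2"
    using compact_imp_bounded[OF compact_continuous_image[OF continuous_on_subset[OF smooth_fun_on_continuous[OF iE] subset_UNIV] K]]
    unfolding bounded_iff by blast
  define M where "M = max 1 (max M1 M2)"
  have M: "M \<ge> 1" "\<And>x. x \<in> ?K \<Longrightarrow> cmod (E x) \<le> M" "\<And>x. x \<in> ?K \<Longrightarrow> cmod (inverse (E x)) \<le> M"
    using M1 M2 by (auto simp: M_def le_max_iff_disj)
  have "interpolating N c x0 R x' s \<eta> \<theta> (M * C * M)"
    unfolding interpolating_def
  proof (intro conjI allI impI ballI)
    fix g A B x
    assume g: "smooth_fun_on (ball x0 R) g" "\<forall>x\<in>ball x0 R. opT N c g x = 0" and AB: "0 < B" "B \<le> A"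
      and A: "\<forall>x\<in>ball x0 R. cmod (g x) \<le> A" and B: "\<forall>x\<in>ball x' s. cmod (g x) \<le> B" and x: "x \<in> ball x0 \<eta>"
    define h where "h = (\<lambda>x. inverse (E x) * g x)"
    have smh: "smooth_fun_on (ball x0 R) h"
      unfolding h_def by (intro smooth_mult g(1) smooth_fun_on_subset[OF iE] open_ball subset_UNIV)
    have dh: "\<forall>x\<in>ball x0 R. dN N h x = 0"
    proof
      fix y assume y: "y \<in> ball x0 R"
      have "opT N c (\<lambda>x. E x * h x) y = \<i> * E y * dN N h y"
        by (rule opT_mult_exponential[OF E(3) smooth_fun_onD[OF E(1) UNIV_I] smooth_fun_onD[OF smh y]])
      moreover have "(\<lambda>x. E x * h x) = g" using E(2) by (auto simp: h_def fun_eq_iff)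
      ultimately show "dN N h y = 0" using g(2) y E(2)[of y] by simp
    qed
    have hA: "\<forall>x\<in>ball x0 R. cmod (h x) \<le> M * A"
      unfolding h_def norm_mult using A M(1) M(3) by (auto intro!: mult_mono)
    have hB: "\<forall>x\<in>ball x' s. cmod (h x) \<le> M * B"
      unfolding h_def norm_mult using B M(1) M(3) by (auto intro!: mult_mono)
    have MB: "0 < M * B" "M * B \<le> M * A" using AB M(1) by auto
    have "cmod (h x) \<le> C * ((M * A) * ((M * B) / (M * A)) powr \<theta>)"
      by (rule H[rule_format, OF smh dh[rule_format] MB hA[rule_format] hB[rule_format] x])
    also have "(M * B) / (M * A) = B / A" using M(1) by simp
    finally have hx: "cmod (h x) \<le> C * ((M * A) * (B / A) powr \<theta>)" .
    have "x \<in> ?K" using x c(2) by auto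
    have "cmod (g x) = cmod (E x) * cmod (h x)" using E(2)[of x] by (simp add: h_def norm_mult norm_inverse)
    also have "\<dots> \<le> M * (C * ((M * A) * (B / A) powr \<theta>))"
      using M(1) M(2)[OF \<open>x \<in> ?K\<close>] hx by (intro mult_mono) auto
    finally show "cmod (g x) \<le> M * C * M * (A * (B / A) powr \<theta>)" by (simp add: mult_ac)
  qed (use c M in auto)
  then show ?thesis by (rule that)
qed

section \<open>Regularisations of homogeneous solutions\<close>

lemma conv_opT:
  fixes u :: "'n::finite functional"
  assumes X: "open X" and u: "is_distribution X u" and \<kappa>: "\<kappa> \<in> test_funs UNIV" and U: "open U" "x \<in> U"
    and US: "\<And>x s. x \<in> U \<Longrightarrow> s \<in> fun_support \<kappa> \<Longrightarrow> x - s \<in> X"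
  shows "opT N c (conv u \<kappa>) x = u (opL N c (\<lambda>y. \<kappa> (x - y)))"
proof -
  have p: "partial_deriv k (conv u \<kappa>) x = conv u (partial_deriv k \<kappa>) x" for k
    by (rule conv_smooth(2)[OF X u \<kappa> U(1) _ U(2)]) (rule US)
  have t: "(\<lambda>y. \<kappa> (x - y)) \<in> test_funs X"
    by (rule test_funs_reflect[OF \<kappa>]) (rule US[OF U(2)])
  have tk: "(\<lambda>y. partial_deriv k \<kappa> (x - y)) \<in> test_funs X" for k
    by (rule test_funs_reflect[OF test_funs_partial_deriv[OF \<kappa>]]) (use US[OF U(2)] fun_support_partial_deriv in blast)
  have ts: "(\<lambda>y. \<Sum>k\<in>UNIV. (\<i> * N $ k) * partial_deriv k \<kappa> (x - y)) \<in> test_funs X"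
    by (intro test_funs_sum test_funs_cmult X tk)
  have "partial_deriv k (\<lambda>y. \<kappa> (x - y)) y = - partial_deriv k \<kappa> (x - y)" for k y
    using partial_derivs_reflect[OF test_funsD(1)[OF \<kappa>], of "[k]" x] by simp
  then have "opL N c (\<lambda>y. \<kappa> (x - y)) = (\<lambda>y. (\<Sum>k\<in>UNIV. (\<i> * N $ k) * partial_deriv k \<kappa> (x - y)) + c * \<kappa> (x - y))"
    by (simp add: opL_def dN_def fun_eq_iff sum_distrib_left sum_negf mult.assoc)
  then have "u (opL N c (\<lambda>y. \<kappa> (x - y))) = (\<Sum>k\<in>UNIV. (\<i> * N $ k) * conv u (partial_deriv k \<kappa>) x) + c * conv u \<kappa> x"
    by (simp add: is_distribution_add[OF u ts test_funs_cmult[OF X t]] is_distribution_cmult[OF u t]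
        is_distribution_sum[OF u test_funs_cmult[OF X tk]] is_distribution_cmult[OF u tk] conv_def)
  then show ?thesis by (simp add: opT_def dN_def p sum_distrib_left mult.assoc)
qed

lemma homogeneous_conv:
  fixes u :: "'n::finite functional"
  assumes X: "open X" and u: "is_distribution X u" and sub: "ball x0 (2 * R) \<subseteq> X"
    and hom: "\<And>\<phi>. \<phi> \<in> test_funs (ball x0 (2 * R)) \<Longrightarrow> u (opL N c \<phi>) = 0"
    and \<rho>: "\<rho> \<in> test_funs (ball 0 1)" and \<epsilon>: "0 < \<epsilon>" "\<epsilon> \<le> R"
  shows "smooth_fun_on (ball x0 R) (conv u (scaled \<rho> \<epsilon>))" "\<forall>x\<in>ball x0 R. opT N c (conv u (scaled \<rho> \<epsilon>)) x = 0"
proof -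
  note \<kappa> = scaled_test_UNIV[OF \<rho> \<epsilon>(1)]
  have in2: "x - s \<in> ball x0 (2 * R)" if "x \<in> ball x0 R" "s \<in> fun_support (scaled \<rho> \<epsilon>)" for x s
    using scaled_support[OF \<rho> \<epsilon>(1) that(2)] that(1) \<epsilon>(2) norm_triangle_ineq[of "x0 - x" s]
    by (simp add: dist_norm algebra_simps)
  then have US: "x - s \<in> X" if "x \<in> ball x0 R" "s \<in> fun_support (scaled \<rho> \<epsilon>)" for x s
    using that sub by blast
  show "smooth_fun_on (ball x0 R) (conv u (scaled \<rho> \<epsilon>))"
    by (rule conv_smooth(1)[OF X u \<kappa> open_ball]) (rule US)
  show "\<forall>x\<in>ball x0 R. opT N c (conv u (scaled \<rho> \<epsilon>)) x = 0"
  proof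
    fix x assume x: "x \<in> ball x0 R"
    have "opT N c (conv u (scaled \<rho> \<epsilon>)) x = u (opL N c (\<lambda>y. scaled \<rho> \<epsilon> (x - y)))"
      by (rule conv_opT[OF X u \<kappa> open_ball x]) (rule US)
    also have "\<dots> = 0"
      by (rule hom, rule test_funs_reflect[OF \<kappa>]) (rule in2[OF x])
    finally show "opT N c (conv u (scaled \<rho> \<epsilon>)) x = 0" .
  qed
qed

text \<open>On a compact set u is controlled by b derivatives, and these cost (1/\<epsilon>)^b
  beyond the height (1/\<epsilon>)^d of the scaled mollifier, d being the dimension.\<close>

lemma conv_scaled_bound:
  fixes u :: "'n::finite functional"
  assumes u: "is_distribution X u" and sub: "ball x0 (2 * R) \<subseteq> X" and R: "R > 0" and \<rho>: "\<rho> \<in> test_funs (ball 0 1)"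
  obtains C n where "C \<ge> 0" "\<And>\<epsilon> x. 0 < \<epsilon> \<Longrightarrow> \<epsilon> \<le> 1 \<Longrightarrow> \<epsilon> \<le> R / 2 \<Longrightarrow> x \<in> cball x0 R \<Longrightarrow> cmod (conv u (scaled \<rho> \<epsilon>) x) \<le> C * (1 / \<epsilon>) ^ n"
proof -
  have AS: "x - s \<in> X" if "x \<in> cball x0 R" "s \<in> cball 0 (R / 2)" for x s
  proof -
    have "x - s \<in> ball x0 (2 * R)"
      using that R norm_triangle_ineq[of "x0 - x" s] by (simp add: dist_norm algebra_simps)
    then show ?thesis using sub by blast
  qed
  obtain C b where C: "C \<ge> 0" "\<And>\<kappa> B x. \<kappa> \<in> test_funs UNIV \<Longrightarrow> fun_support \<kappa> \<subseteq> cball 0 (R / 2) \<Longrightarrow>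
     (\<And>ks z. length ks \<le> b \<Longrightarrow> cmod (partial_derivs ks \<kappa> z) \<le> B) \<Longrightarrow> x \<in> cball x0 R \<Longrightarrow> cmod (conv u \<kappa> x) \<le> C * B"
    using conv_estimate[OF u compact_cball compact_cball AS] by blast
  obtain B where B: "B \<ge> 0" "\<And>ks x. length ks \<le> b \<Longrightarrow> cmod (partial_derivs ks \<rho> x) \<le> B"
    by (rule test_funs_derivs_bounded[OF \<rho>, of b]) blast
  show ?thesis
  proof (rule that[of "C * B" "CARD('n) + b"])
    show "C * B \<ge> 0" using C(1) B(1) by simp
    fix \<epsilon> :: real and x assume \<epsilon>: "0 < \<epsilon>" "\<epsilon> \<le> 1" "\<epsilon> \<le> R / 2" and x: "x \<in> cball x0 R"
    have "cmod (conv u (scaled \<rho> \<epsilon>) x) \<le> C * ((1 / \<epsilon>) ^ (CARD('n) + b) * B)"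
    proof (rule C(2)[OF scaled_test_UNIV[OF \<rho> \<epsilon>(1)] _ _ x])
      show "fun_support (scaled \<rho> \<epsilon>) \<subseteq> cball 0 (R / 2)"
        using scaled_support[OF \<rho> \<epsilon>(1)] \<epsilon>(3) by force
      fix ks :: "'n list" and z assume ks: "length ks \<le> b"
      have "(1 / \<epsilon>) ^ (CARD('n) + length ks) \<le> (1 / \<epsilon>) ^ (CARD('n) + b)"
        using \<epsilon> ks by (intro power_increasing) auto
      then show "cmod (partial_derivs ks (scaled \<rho> \<epsilon>) z) \<le> (1 / \<epsilon>) ^ (CARD('n) + b) * B"
        unfolding partial_derivs_scaled[OF test_funsD(1)[OF \<rho>]] norm_mult norm_of_real
        using \<epsilon> B(1) B(2)[OF ks] by (intro mult_mono) auto
    qed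
    then show "cmod (conv u (scaled \<rho> \<epsilon>) x) \<le> C * B * (1 / \<epsilon>) ^ (CARD('n) + b)" by (simp add: mult_ac)
  qed
qed

lemma zero_if_interpolated:
  fixes z A C \<theta> :: real
  assumes "A > 0" "C > 0" "0 < \<theta>" "z \<ge> 0" "\<And>B. 0 < B \<Longrightarrow> B \<le> A \<Longrightarrow> z \<le> C * (A * (B / A) powr \<theta>)"
  shows "z = 0"
proof (rule ccontr)
  assume "z \<noteq> 0"
  then have z: "z > 0" using assms(4) by simp
  \<comment> \<open>With B = A t^(1/\<theta>) the assumed bound becomes C A t, and t is chosen to
    make this at most z/2.\<close>
  define t where "t = min 1 (z / (2 * C * A))"
  have t: "0 < t" "t \<le> 1" "C * A * t \<le> z / 2"
  proof -
    have "C * A * t \<le> C * A * (z / (2 * C * A))" using assms by (intro mult_left_mono) (auto simp: t_def)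
    then show "C * A * t \<le> z / 2" using assms by simp
  qed (use z assms in \<open>auto simp: t_def\<close>)
  have p: "(t powr (1 / \<theta>)) powr \<theta> = t" using t assms(3) by (simp add: powr_powr)
  have "t powr (1 / \<theta>) \<le> 1 powr (1 / \<theta>)" using t assms(3) by (intro powr_mono2) auto
  then have "z \<le> C * (A * ((A * t powr (1 / \<theta>)) / A) powr \<theta>)"
    using assms t by (intro assms(5)) auto
  also have "\<dots> = C * A * t" using assms(1) p by simp
  finally show False using t(3) z by simp
qed

text \<open>Halving makes a change of scale an index shift, so extrapolated regularisations are
  combinations of shifts of one sequence, as \<open>represents_limit\<close> expects.\<close>

lemma halving_sequence:
  fixes e0 :: real and e :: "nat \<Rightarrow> real"
  assumes "e0 > 0" and e_def: "e = (\<lambda>k. e0 * (1/2) ^ k)"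
  shows "\<And>k. e k > 0" "e \<longlonglongrightarrow> 0" "\<And>k. e k \<le> e0" "\<And>k i. e (k + i) = e k * (1/2) ^ i"
proof -
  have "(\<lambda>k. e0 * (1/2) ^ k) \<longlonglongrightarrow> e0 * 0"
    by (intro tendsto_mult_left LIMSEQ_power_zero) simp
  then show "e \<longlonglongrightarrow> 0" by (simp add: e_def)
  show "e k \<le> e0" for k using assms(1) by (simp add: e_def power_le_one)
qed (use assms(1) in \<open>auto simp: e_def power_add\<close>)

text \<open>For small scales the regularisations vanish near x', so at each fixed scale B may be
  arbitrarily small and interpolation forces them to vanish near x0. This passes to the limit
  u.\<close>

lemma homogeneous_vanishing:
  fixes u :: "'n::finite functional"
  assumes X: "open X" and u: "is_distribution X u" and sub: "ball x0 (2 * R) \<subseteq> X" and R: "R > 0" and s: "s > 0"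
    and hom: "\<And>\<phi>. \<phi> \<in> test_funs (ball x0 (2 * R)) \<Longrightarrow> u (opL N c \<phi>) = 0"
    and int: "interpolating N c x0 R x' s \<eta> \<theta> C"
    and van: "\<forall>\<phi>\<in>test_funs (ball x' (2 * s)). u \<phi> = 0"
  shows "\<forall>\<phi>\<in>test_funs (ball x0 \<eta>). u \<phi> = 0"
proof -
  obtain \<rho> :: "real ^ 'n \<Rightarrow> complex" where \<rho>: "\<rho> \<in> test_funs (ball 0 1)" "(\<integral>x. \<rho> x \<partial>lborel) = 1"
    by (rule ex_mollifier)
  have \<eta>: "0 < \<eta>" "\<eta> \<le> R" "0 < \<theta>" "0 < C" using int by (auto simp: interpolating_def)
  obtain K n where K: "K \<ge> 0" "\<And>\<epsilon> x. 0 < \<epsilon> \<Longrightarrow> \<epsilon> \<le> 1 \<Longrightarrow> \<epsilon> \<le> R / 2 \<Longrightarrow> x \<in> cball x0 R \<Longrightarrow> cmod (conv u (scaled \<rho> \<epsilon>) x) \<le> K * (1 / \<epsilon>) ^ n"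
    by (rule conv_scaled_bound[OF u sub R \<rho>(1)]) blast
  define e0 where "e0 = min 1 (min (R / 2) s)"
  define e where "e = (\<lambda>k::nat. e0 * (1/2) ^ k)"
  have e0: "e0 > 0" "e0 \<le> 1" "e0 \<le> R / 2" "e0 \<le> s" using R s by (auto simp: e0_def)
  note e = halving_sequence[OF e0(1) e_def]
  have zero: "conv u (scaled \<rho> (e k)) x = 0" if x: "x \<in> ball x0 \<eta>" for k x
  proof -
    let ?g = "conv u (scaled \<rho> (e k))"
    have ek: "0 < e k" "e k \<le> 1" "e k \<le> R / 2" "e k \<le> R" "e k \<le> s" using e(1,3)[of k] e0 R by auto
    define A where "A = K * (1 / e k) ^ n + 1"
    have A: "A > 0" using K(1) ek(1) by (simp add: A_def add_nonneg_pos)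
    have gA: "\<forall>x\<in>ball x0 R. cmod (?g x) \<le> A"
    proof
      fix x assume "x \<in> ball x0 R"
      then have "x \<in> cball x0 R" by simp
      then show "cmod (?g x) \<le> A" using K(2)[OF ek(1-3), of x] by (simp add: A_def)
    qed
    have gz: "?g y = 0" if y: "y \<in> ball x' s" for y
    proof -
      have "(\<lambda>z. scaled \<rho> (e k) (y - z)) \<in> test_funs (ball x' (2 * s))"
      proof (rule test_funs_reflect[OF test_funs_scaled[OF \<rho>(1) ek(1)]])
        fix t assume "t \<in> fun_support (scaled \<rho> (e k))"
        from scaled_support[OF \<rho>(1) ek(1) this] show "y - t \<in> ball x' (2 * s)"
          using y ek(5) norm_triangle_ineq[of "x' - y" t] by (simp add: dist_norm algebra_simps)
      qed
      then show ?thesis using van by (simp add: conv_def)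
    qed
    note h = homogeneous_conv[OF X u sub hom \<rho>(1) ek(1,4)]
    have "cmod (?g x) = 0"
    proof (rule zero_if_interpolated[OF A \<eta>(4,3)])
      fix B :: real assume B: "0 < B" "B \<le> A"
      show "cmod (?g x) \<le> C * (A * (B / A) powr \<theta>)"
        by (rule interpolatingD[OF int h B gA _ x]) (use gz B in auto)
    qed simp
    then show ?thesis by simp
  qed
  have "represents (ball x0 \<eta>) u (\<lambda>x. 0)"
  proof (rule represents_limit[OF X u \<rho> e(1,2), where I = "{0}" and c = "\<lambda>_. 1"])
    show "ball x0 \<eta> \<subseteq> X" using sub \<eta> R by (auto simp: subset_eq)
    show "uniform_limit (ball x0 \<eta>) (\<lambda>k x. \<Sum>i\<in>{0}. 1 * conv u (scaled \<rho> (e (k + i))) x) (\<lambda>x. 0) sequentially"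
      by (rule uniform_limitI) (simp add: zero)
  qed auto
  then show ?thesis by (simp add: represents_def)
qed

subsection \<open>Extrapolation to the limit\<close>

text \<open>Richardson extrapolation: the c i are the coefficients of the polynomial with zeros
  2^-1, ..., 2^-m, normalised to have value 1 at 1. The conditions are its values at 1 and at
  2^-j.\<close>

lemma ex_extrapolation_coeffs:
  obtains c :: "nat \<Rightarrow> real" where "(\<Sum>i\<le>m. c i) = 1" "\<And>j. j \<in> {1..m} \<Longrightarrow> (\<Sum>i\<le>m. c i * ((1/2) ^ i) ^ j) = 0"
proof -
  define p :: "real poly" where "p = (\<Prod>j\<in>{1..m}. [:- ((1/2) ^ j), 1:])"
  have deg: "degree p \<le> m"
    using degree_prod_sum_le[of "{1..m}" "\<lambda>j. [:- ((1/2) ^ j), 1:] :: real poly"] by (simp add: p_def o_def)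
  have ev: "poly p x = (\<Sum>i\<le>m. coeff p i * x ^ i)" for x
    unfolding poly_altdef using deg by (intro sum.mono_neutral_left) (auto simp: coeff_eq_0)
  have "poly p 1 \<noteq> 0"
  proof -
    have "(1/2::real) ^ j < 1" if "j \<in> {1..m}" for j using that by (simp add: power_Suc_less_one power_less_one_iff)
    then show ?thesis unfolding p_def poly_prod by (subst prod_zero_iff) force+
  qed
  show ?thesis
  proof (rule that[of "\<lambda>i. coeff p i / poly p 1"])
    show "(\<Sum>i\<le>m. coeff p i / poly p 1) = 1"
      using ev[of 1] \<open>poly p 1 \<noteq> 0\<close> by (simp add: sum_divide_distrib[symmetric])
    fix j assume j: "j \<in> {1..m}"
    have "poly p ((1/2) ^ j) = 0"
      unfolding p_def poly_prod by (subst prod_zero_iff) (use j in auto)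
    then have "(\<Sum>i\<le>m. coeff p i * ((1/2) ^ j) ^ i) = 0" using ev by simp
    then show "(\<Sum>i\<le>m. coeff p i / poly p 1 * ((1/2) ^ i) ^ j) = 0"
      by (simp add: sum_divide_distrib[symmetric] power_mult[symmetric] mult.commute)
  qed
qed

text \<open>The functions D i are successive derivatives. A mean value inequality in each induction
  step gives the remainder without the factorial, which is immaterial here and spares an integral
  formula.\<close>

lemma taylor_bound:
  fixes D :: "nat \<Rightarrow> real \<Rightarrow> complex"
  assumes "\<And>i t. i \<le> m \<Longrightarrow> t \<in> {0..a} \<Longrightarrow> (D i has_vector_derivative D (Suc i) t) (at t within {0..a})"
    and "\<And>t. t \<in> {0..a} \<Longrightarrow> cmod (D (Suc m) t) \<le> Q" and "t \<in> {0..a}" and "Q \<ge> 0"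
  shows "cmod (D 0 t - (\<Sum>i\<le>m. (t ^ i / fact i) *\<^sub>R D i 0)) \<le> Q * t ^ Suc m"
  using assms
proof (induction m arbitrary: D t)
  case (0 D t)
  have "cmod (D 0 t - D 0 0) \<le> Q * norm (t - 0)"
  proof (rule differentiable_bound[of "{0..a}" "D 0" "\<lambda>t h. h *\<^sub>R D 1 t"])
    show "(D 0 has_derivative (\<lambda>h. h *\<^sub>R D 1 x)) (at x within {0..a})" if "x \<in> {0..a}" for x
      using 0(1)[of 0 x] that by (simp add: has_vector_derivative_def)
    show "onorm (\<lambda>h. h *\<^sub>R D 1 x) \<le> Q" if "x \<in> {0..a}" for x
      using 0(2)[OF that] by (intro onorm_le) (simp add: mult.commute[of Q] mult_left_mono)
  qed (use 0(3) in auto)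
  then show ?case using 0(3) by simp
next
  case (Suc m D t)
  let ?r = "\<lambda>t. D 0 t - (\<Sum>i\<le>Suc m. (t ^ i / fact i) *\<^sub>R D i 0)"
  \<comment> \<open>The derivative of the remainder is the remainder of order m for D 1, since
    differentiation shifts the Taylor polynomial.\<close>
  let ?r' = "\<lambda>t. D 1 t - (\<Sum>i\<le>m. (t ^ i / fact i) *\<^sub>R D (Suc i) 0)"
  have IH: "cmod (?r' x) \<le> Q * x ^ Suc m" if "x \<in> {0..a}" for x
    using Suc.IH[of "\<lambda>i. D (Suc i)" x] Suc.prems that by simp
  have pw: "((\<lambda>x. (x ^ i / fact i) *\<^sub>R D i 0) has_vector_derivative
      (real i * x ^ (i - 1) / fact i) *\<^sub>R D i 0) (at x within S)" for i x S
    by (auto intro!: derivative_eq_intros)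
  have der: "(?r has_vector_derivative ?r' x) (at x within {0..t})" if "x \<in> {0..t}" for x
  proof -
    have "(D 0 has_vector_derivative D 1 x) (at x within {0..a})"
      using Suc.prems(1)[of 0 x] Suc.prems(3) that by simp
    then have 1: "(D 0 has_vector_derivative D 1 x) (at x within {0..t})"
      by (rule has_vector_derivative_within_subset) (use Suc.prems(3) in auto)
    have "(?r has_vector_derivative D 1 x - (\<Sum>i\<le>Suc m. (real i * x ^ (i - 1) / fact i) *\<^sub>R D i 0)) (at x within {0..t})"
      by (intro has_vector_derivative_diff 1 has_vector_derivative_sum pw)
    moreover have "(\<Sum>i\<le>Suc m. (real i * x ^ (i - 1) / fact i) *\<^sub>R D i 0) = (\<Sum>i\<le>m. (x ^ i / fact i) *\<^sub>R D (Suc i) 0)"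
    proof -
      have "real (Suc i) * x ^ (Suc i - 1) / fact (Suc i) = x ^ i / fact i" for i
        by (simp del: of_nat_Suc)
      then show ?thesis by (subst sum.atMost_Suc_shift) (simp del: fact_Suc of_nat_Suc)
    qed
    ultimately show ?thesis by simp
  qed
  have t: "0 \<le> t" "t \<le> a" using Suc.prems(3) by auto
  have "cmod (?r t - ?r 0) \<le> (Q * t ^ Suc m) * norm (t - 0)"
  proof (rule differentiable_bound[of "{0..t}" ?r "\<lambda>x h. h *\<^sub>R ?r' x"])
    show "(?r has_derivative (\<lambda>h. h *\<^sub>R ?r' x)) (at x within {0..t})" if "x \<in> {0..t}" for x
      using der[OF that] by (simp add: has_vector_derivative_def)
    show "onorm (\<lambda>h. h *\<^sub>R ?r' x) \<le> Q * t ^ Suc m" if x: "x \<in> {0..t}" for x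
    proof (intro onorm_le)
      fix h :: real
      have "cmod (?r' x) \<le> Q * x ^ Suc m" using IH x t by simp
      also have "\<dots> \<le> Q * t ^ Suc m" using x Suc.prems(4) by (intro mult_left_mono power_mono) auto
      finally have "cmod (?r' x) \<le> Q * t ^ Suc m" .
      from mult_right_mono[OF this, of "norm h"] show "norm (h *\<^sub>R ?r' x) \<le> Q * t ^ Suc m * norm h"
        unfolding norm_scaleR real_norm_def by (simp only: mult.commute abs_ge_zero)
    qed
  qed (use t in auto)
  moreover have "?r 0 = 0" by (subst sum.atMost_Suc_shift) simp
  ultimately show ?case using t by (simp add: mult_ac)
qed

lemma smooth_dir_pow: "open U \<Longrightarrow> smooth_fun_on U f \<Longrightarrow> smooth_fun_on U ((dir v ^^ i) f)"
  by (induction i) (auto intro: smooth_dir)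

lemma dir_pow_bound:
  fixes v :: "real ^ 'n::finite"
  assumes U: "open U" and f: "smooth_fun_on U f" and y: "y \<in> U" and v: "norm v \<le> 1"
    and B: "\<And>ls. length ls \<le> length ks + i \<Longrightarrow> cmod (partial_derivs ls f y) \<le> B"
  shows "cmod (partial_derivs ks ((dir v ^^ i) f) y) \<le> real CARD('n) ^ i * B"
  using B
proof (induction i arbitrary: ks)
  case (Suc i)
  let ?g = "(dir v ^^ i) f"
  have sm: "smooth_fun_on U ?g" by (rule smooth_dir_pow[OF U f])
  have dir_eq: "dir v g = (\<lambda>x. \<Sum>k\<in>UNIV. complex_of_real (v $ k) * partial_deriv k g x)" for g
    by (simp add: dir_def fun_eq_iff scaleR_conv_of_real[where 'a = complex])
  have "partial_derivs ks (dir v ?g) y = (\<Sum>k\<in>UNIV. complex_of_real (v $ k) * partial_derivs (k # ks) ?g y)"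
    unfolding dir_eq[of ?g]
    by (subst partial_derivs_sum[OF U smooth_cmult[OF U smooth_partial_deriv[OF sm]] y])
      (simp_all add: partial_derivs_cmult[OF U smooth_partial_deriv[OF sm] y])
  also have "cmod \<dots> \<le> (\<Sum>k\<in>(UNIV :: 'n set). real CARD('n) ^ i * B)"
  proof (rule sum_norm_le)
    fix k
    have 1: "cmod (partial_derivs (k # ks) ?g y) \<le> real CARD('n) ^ i * B"
      by (rule Suc.IH) (use Suc.prems in simp)
    have "\<bar>v $ k\<bar> \<le> 1" using component_le_norm_cart[of v k] v by linarith
    then have "\<bar>v $ k\<bar> * cmod (partial_derivs (k # ks) ?g y) \<le> 1 * (real CARD('n) ^ i * B)"
      by (intro mult_mono 1) auto
    then show "cmod (complex_of_real (v $ k) * partial_derivs (k # ks) ?g y) \<le> real CARD('n) ^ i * B"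
      by (simp add: norm_mult)
  qed
  finally show ?case by (simp add: mult.assoc)
qed simp

text \<open>Taylor expansion along the ray in direction -t. The weights cancel the orders 1 to m and
  reproduce order 0 because their sum is 1, so only the remainder of order m + 1 is left, uniformly
  in x and t.\<close>

lemma extrapolation_bound:
  fixes f :: "real ^ 'n::finite \<Rightarrow> complex" and c :: "nat \<Rightarrow> real"
  assumes f: "smooth_fun_on (ball x' (2 * s)) f" and s: "s > 0"
    and c: "(\<Sum>i\<le>m. c i) = 1" "\<And>j. j \<in> {1..m} \<Longrightarrow> (\<Sum>i\<le>m. c i * ((1/2) ^ i) ^ j) = 0"
  obtains Q where "Q \<ge> 0" "\<And>x t \<epsilon>. x \<in> ball x' s \<Longrightarrow> norm t \<le> 1 \<Longrightarrow> 0 \<le> \<epsilon> \<Longrightarrow> \<epsilon> \<le> s / 2 \<Longrightarrow>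
    cmod ((\<Sum>i\<le>m. complex_of_real (c i) * f (x - (\<epsilon> * (1/2) ^ i) *\<^sub>R t)) - f x) \<le> Q * \<epsilon> ^ Suc m"
proof -
  \<comment> \<open>The compact ball contains every point reached from \<open>ball x' s\<close> by a
    step of length at most s/2 and lies in the domain of f, so derivatives of f are bounded on
    it.\<close>
  let ?U = "ball x' (2 * s)" and ?K = "cball x' (3 * s / 2)"
  have KU: "?K \<subseteq> ?U" using s by auto
  have "\<exists>B. \<forall>z. (if z \<in> ?K then cmod (partial_derivs ls f z) else 0) \<le> B" for ls
  proof -
    have "continuous_on ?K (partial_derivs ls f)"
      by (rule continuous_on_subset[OF smooth_fun_on_continuous[OF smooth_partial_derivs[OF f]] KU])
    then have "bounded (partial_derivs ls f ` ?K)"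
      by (intro compact_imp_bounded compact_continuous_image compact_cball)
    then obtain B where "\<And>z. z \<in> ?K \<Longrightarrow> cmod (partial_derivs ls f z) \<le> B" unfolding bounded_iff by blast
    then show ?thesis by (intro exI[of _ "max B 0"]) (auto simp: le_max_iff_disj)
  qed
  then obtain B where B: "B \<ge> 0" "\<And>ls z. length ls \<le> Suc m \<Longrightarrow> (if z \<in> ?K then cmod (partial_derivs ls f z) else 0) \<le> B"
    by (rule finite_list_bound[where b = "Suc m" and g = "\<lambda>ls z. if z \<in> ?K then cmod (partial_derivs ls f z) else 0"]) blast
  have B': "cmod (partial_derivs ls f z) \<le> B" if "length ls \<le> Suc m" "z \<in> ?K" for ls z
    using B(2)[OF that(1), of z] that(2) by simp
  define Q0 where "Q0 = real CARD('n) ^ Suc m * B"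
  have Q0: "Q0 \<ge> 0" using B(1) by (simp add: Q0_def)
  define S where "S = (\<Sum>i\<le>m. \<bar>c i\<bar>)"
  have S: "S \<ge> 0" by (simp add: S_def)
  show ?thesis
  proof (rule that[of "S * Q0"])
    show "S * Q0 \<ge> 0" using S Q0 by simp
    fix x t :: "real ^ 'n" and \<epsilon> :: real
    assume x: "x \<in> ball x' s" and t: "norm t \<le> 1" and \<epsilon>: "0 \<le> \<epsilon>" "\<epsilon> \<le> s / 2"
    let ?D = "\<lambda>i r. (dir (- t) ^^ i) f (x + r *\<^sub>R (- t))"
    have inK: "x + r *\<^sub>R (- t) \<in> ?K" if "r \<in> {0..s / 2}" for r
    proof -
      have "norm (r *\<^sub>R t) \<le> (s / 2) * 1" unfolding norm_scaleR using that t by (intro mult_mono) auto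
      then show ?thesis using x norm_triangle_ineq[of "x' - x" "r *\<^sub>R t"] by (simp add: dist_norm algebra_simps)
    qed
    have T: "cmod (?D 0 r - (\<Sum>j\<le>m. (r ^ j / fact j) *\<^sub>R ?D j 0)) \<le> Q0 * r ^ Suc m" if r: "r \<in> {0..s / 2}" for r
    proof (rule taylor_bound[OF _ _ r Q0])
      show "(?D i has_vector_derivative ?D (Suc i) r) (at r within {0..s / 2})" if "r \<in> {0..s / 2}" for i r
        using has_vector_derivative_dir[OF smooth_dir_pow[OF open_ball f], of x r "- t"] inK[OF that] KU by auto
      show "cmod (?D (Suc m) r) \<le> Q0" if "r \<in> {0..s / 2}" for r
      proof -
        have "cmod (partial_derivs [] ((dir (- t) ^^ Suc m) f) (x + r *\<^sub>R (- t))) \<le> real CARD('n) ^ Suc m * B"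
          by (rule dir_pow_bound[OF open_ball f]) (use inK[OF that] KU t B' in auto)
        then show ?thesis by (simp only: Q0_def partial_derivs_Nil)
      qed
    qed
    let ?e = "\<lambda>i. \<epsilon> * (1/2) ^ i"
    have e_in: "?e i \<in> {0..s / 2}" and e_le: "?e i \<le> \<epsilon>" for i
    proof -
      show "?e i \<le> \<epsilon>" using \<epsilon>(1) by (simp add: mult_left_le power_le_one)
      then show "?e i \<in> {0..s / 2}" using \<epsilon> by simp
    qed
    \<comment> \<open>After exchanging the sums, the coefficient of the j-th Taylor term is the j-th
      moment of the weights: 1 for j = 0 and 0 otherwise.\<close>
    have poly: "(\<Sum>i\<le>m. complex_of_real (c i) * (\<Sum>j\<le>m. (?e i ^ j / fact j) *\<^sub>R ?D j 0)) = f x"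
    proof -
      have "(\<Sum>i\<le>m. complex_of_real (c i) * (\<Sum>j\<le>m. (?e i ^ j / fact j) *\<^sub>R ?D j 0))
        = (\<Sum>i\<le>m. \<Sum>j\<le>m. complex_of_real (c i * ((1/2) ^ i) ^ j) * ((\<epsilon> ^ j / fact j) *\<^sub>R ?D j 0))"
        by (simp add: sum_distrib_left scaleR_conv_of_real[where 'a = complex] power_mult_distrib mult_ac)
      also have "\<dots> = (\<Sum>j\<le>m. \<Sum>i\<le>m. complex_of_real (c i * ((1/2) ^ i) ^ j) * ((\<epsilon> ^ j / fact j) *\<^sub>R ?D j 0))"
        by (rule sum.swap)
      also have "\<dots> = (\<Sum>j\<le>m. complex_of_real (\<Sum>i\<le>m. c i * ((1/2) ^ i) ^ j) * ((\<epsilon> ^ j / fact j) *\<^sub>R ?D j 0))"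
        by (simp only: of_real_sum sum_distrib_right)
      also have "\<dots> = (\<Sum>j\<le>m. if j = 0 then f x else 0)"
      proof (intro sum.cong refl)
        fix j assume j: "j \<in> {..m}"
        show "complex_of_real (\<Sum>i\<le>m. c i * ((1/2) ^ i) ^ j) * ((\<epsilon> ^ j / fact j) *\<^sub>R ?D j 0) = (if j = 0 then f x else 0)"
        proof (cases "j = 0")
          case True
          then show ?thesis using c(1) by simp
        next
          case False
          then have "(\<Sum>i\<le>m. c i * ((1/2) ^ i) ^ j) = 0" using j by (intro c(2)) auto
          then show ?thesis using False by (simp only: of_real_0 mult_zero_left if_False)
        qed
      qed
      finally show ?thesis by simp
    qed
    have "(\<Sum>i\<le>m. complex_of_real (c i) * f (x - ?e i *\<^sub>R t)) - f x
       = (\<Sum>i\<le>m. complex_of_real (c i) * (?D 0 (?e i) - (\<Sum>j\<le>m. (?e i ^ j / fact j) *\<^sub>R ?D j 0)))"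
      unfolding right_diff_distrib sum_subtractf poly by simp
    also have "cmod \<dots> \<le> (\<Sum>i\<le>m. \<bar>c i\<bar> * (Q0 * \<epsilon> ^ Suc m))"
    proof (rule sum_norm_le)
      fix i
      have "Q0 * ?e i ^ Suc m \<le> Q0 * \<epsilon> ^ Suc m"
        using e_le e_in Q0 by (intro mult_left_mono power_mono) auto
      then show "cmod (complex_of_real (c i) * (?D 0 (?e i) - (\<Sum>j\<le>m. (?e i ^ j / fact j) *\<^sub>R ?D j 0))) \<le> \<bar>c i\<bar> * (Q0 * \<epsilon> ^ Suc m)"
        unfolding norm_mult norm_of_real using T[OF e_in[of i]] by (intro mult_left_mono) auto
    qed
    also have "\<dots> = S * Q0 * \<epsilon> ^ Suc m" by (simp add: S_def sum_distrib_right mult.assoc)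
    finally show "cmod ((\<Sum>i\<le>m. complex_of_real (c i) * f (x - ?e i *\<^sub>R t)) - f x) \<le> S * Q0 * \<epsilon> ^ Suc m" .
  qed
qed

subsection \<open>Propagation of regularity along the leaves\<close>

text \<open>Differentiability of the sum is carried along, because the induction step uses
  it.\<close>

lemma dN_sum:
  assumes "\<And>i. i \<in> I \<Longrightarrow> f i differentiable (at x)"
  shows "dN N (\<lambda>x. \<Sum>i\<in>I. a i * f i x) x = (\<Sum>i\<in>I. a i * dN N (f i) x)
    \<and> (\<lambda>x. \<Sum>i\<in>I. a i * f i x) differentiable (at x)"
  using assms
proof (induction I rule: infinite_finite_induct)
  case (insert i I)
  then have 1: "f i differentiable (at x)" "\<And>j. j \<in> I \<Longrightarrow> f j differentiable (at x)" by auto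
  note IH = insert.IH[OF 1(2)]
  have 2: "(\<lambda>x. a i * f i x) differentiable (at x)" using 1(1) by (intro derivative_intros)
  have "dN N (\<lambda>x. a i * f i x + (\<Sum>i\<in>I. a i * f i x)) x = a i * dN N (f i) x + dN N (\<lambda>x. \<Sum>i\<in>I. a i * f i x) x"
    using partial_deriv_add[OF 2 IH[THEN conjunct2]] partial_deriv_cmult[OF 1(1)]
    by (simp add: dN_def algebra_simps sum.distrib sum_distrib_left)
  moreover have "(\<lambda>x. a i * f i x + (\<Sum>i\<in>I. a i * f i x)) differentiable (at x)"
    by (rule differentiable_add[OF 2 IH[THEN conjunct2]])
  ultimately show ?case using IH insert.hyps by simp
qed (auto simp: dN_def partial_deriv_const)

lemma opT_sum:
  assumes "\<And>i. i \<in> I \<Longrightarrow> f i differentiable (at x)"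
  shows "opT N c (\<lambda>x. \<Sum>i\<in>I. a i * f i x) x = (\<Sum>i\<in>I. a i * opT N c (f i) x)"
proof -
  have d: "dN N (\<lambda>x. \<Sum>i\<in>I. a i * f i x) x = (\<Sum>i\<in>I. a i * dN N (f i) x)"
    by (rule conjunct1[OF dN_sum]) (rule assms)
  show ?thesis
    unfolding opT_def d by (simp add: sum_distrib_left sum.distrib[symmetric] distrib_left mult_ac)
qed

text \<open>The coefficients \<open>a i\<close> cancel the Taylor terms of order \<open>1, \<dots>, m\<close> in the scale \<open>e k\<close>.  With
  \<open>m\<close> chosen such that \<open>\<theta> m \<ge> n + 1\<close>, interpolation makes the differences of the regularisations
  summable.\<close>
lemma homogeneous_continuous:
  fixes u :: "'n::finite functional"
  assumes X: "open X" and u: "is_distribution X u" and sub: "ball x0 (2 * R) \<subseteq> X" and R: "R > 0" and s: "s > 0"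
    and hom: "\<And>\<phi>. \<phi> \<in> test_funs (ball x0 (2 * R)) \<Longrightarrow> u (opL N c \<phi>) = 0"
    and int: "interpolating N c x0 R x' s \<eta> \<theta> C"
    and f: "smooth_fun_on (ball x' (2 * s)) f" and rep: "represents (ball x' (2 * s)) u f"
  shows "\<exists>F. continuous_on (ball x0 \<eta>) F \<and> represents (ball x0 \<eta>) u F"
proof -
  obtain \<rho> :: "real ^ 'n \<Rightarrow> complex" where \<rho>: "\<rho> \<in> test_funs (ball 0 1)" "(\<integral>x. \<rho> x \<partial>lborel) = 1"
    by (rule ex_mollifier)
  have \<eta>: "0 < \<eta>" "\<eta> \<le> R" "0 < \<theta>" "0 < C" using int by (auto simp: interpolating_def)
  obtain K n where K: "K \<ge> 0" "\<And>\<epsilon> x. 0 < \<epsilon> \<Longrightarrow> \<epsilon> \<le> 1 \<Longrightarrow> \<epsilon> \<le> R / 2 \<Longrightarrow> x \<in> cball x0 R \<Longrightarrow> cmod (conv u (scaled \<rho> \<epsilon>) x) \<le> K * (1 / \<epsilon>) ^ n"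
    by (rule conv_scaled_bound[OF u sub R \<rho>(1)]) blast
  define m where "m = nat \<lceil>(real n + 1) / \<theta>\<rceil>"
  have m: "real n + 1 \<le> \<theta> * real m"
  proof -
    have "(real n + 1) / \<theta> \<le> real m" unfolding m_def by (rule real_nat_ceiling_ge)
    then show ?thesis using \<eta>(3) by (simp add: divide_le_eq mult.commute)
  qed
  obtain a :: "nat \<Rightarrow> real" where a: "(\<Sum>i\<le>m. a i) = 1" "\<And>j. j \<in> {1..m} \<Longrightarrow> (\<Sum>i\<le>m. a i * ((1/2) ^ i) ^ j) = 0"
    by (rule ex_extrapolation_coeffs[of m]) blast
  obtain Q where Q: "Q \<ge> 0" "\<And>x t \<epsilon>. x \<in> ball x' s \<Longrightarrow> norm t \<le> 1 \<Longrightarrow> 0 \<le> \<epsilon> \<Longrightarrow> \<epsilon> \<le> s / 2 \<Longrightarrow>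
    cmod ((\<Sum>i\<le>m. complex_of_real (a i) * f (x - (\<epsilon> * (1/2) ^ i) *\<^sub>R t)) - f x) \<le> Q * \<epsilon> ^ Suc m"
    by (rule extrapolation_bound[OF f s a]) blast+
  define e0 where "e0 = min 1 (min (R / 2) (s / 2))"
  define e where "e = (\<lambda>k::nat. e0 * (1/2) ^ k)"
  have e0: "e0 > 0" "e0 \<le> 1" "e0 \<le> R / 2" "e0 \<le> s / 2" using R s by (auto simp: e0_def)
  note e = halving_sequence[OF e0(1) e_def]
  have ek: "0 < e k" "e k \<le> 1" "e k \<le> R / 2" "e k \<le> R" "e k \<le> s / 2" "e k \<le> s" for k
    using e(1,3)[of k] e0 R s by linarith+
  define T where "T k x = (\<Sum>i\<le>m. complex_of_real (a i) * conv u (scaled \<rho> (e (k + i))) x)" for k x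
  define M where "M = (\<integral>x. cmod (\<rho> x) \<partial>lborel)"
  have M: "M \<ge> 0" by (simp add: M_def)
  have near: "cmod (T k x - f x) \<le> M * Q * e k ^ Suc m" if x: "x \<in> ball x' s" for k x
  proof -
    have b: "ball x (e j) \<subseteq> ball x' (2 * s)" for j
    proof
      fix y assume "y \<in> ball x (e j)"
      then show "y \<in> ball x' (2 * s)" using x ek(6)[of j] dist_triangle[of x' y x] by simp
    qed
    let ?I = "\<lambda>i t. \<rho> t * f (x - (e k * (1/2) ^ i) *\<^sub>R t)"
    have int: "integrable lborel (?I i)" for i
      using integrable_mollified[OF smooth_fun_on_continuous[OF f] \<rho>(1) e(1) b, of "k + i"] by (simp add: e(4))
    have cv: "conv u (scaled \<rho> (e (k + i))) x = (\<integral>t. ?I i t \<partial>lborel)" for i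
      using conv_represented[OF rep smooth_fun_on_continuous[OF f] \<rho>(1) e(1) b, of "k + i"] by (simp add: e(4))
    have int2: "integrable lborel (\<lambda>t. \<Sum>i\<le>m. complex_of_real (a i) * ?I i t)" using int by simp
    have int3: "integrable lborel (\<lambda>t. \<rho> t * f x)" using integrable_test_fun[OF \<rho>(1)] by simp
    have "T k x = (\<integral>t. (\<Sum>i\<le>m. complex_of_real (a i) * ?I i t) \<partial>lborel)"
      unfolding T_def cv using int by (simp add: Bochner_Integration.integral_sum)
    moreover have "f x = (\<integral>t. \<rho> t * f x \<partial>lborel)" using \<rho>(2) by simp
    ultimately have "T k x - f x = (\<integral>t. (\<Sum>i\<le>m. complex_of_real (a i) * ?I i t) - \<rho> t * f x \<partial>lborel)"
      using int2 int3 by (simp add: Bochner_Integration.integral_diff)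
    also have "cmod \<dots> \<le> (\<integral>t. (Q * e k ^ Suc m) * cmod (\<rho> t) \<partial>lborel)"
    proof (rule Bochner_Integration.integral_norm_bound_integral)
      show "integrable lborel (\<lambda>t. (\<Sum>i\<le>m. complex_of_real (a i) * ?I i t) - \<rho> t * f x)" using int2 int3 by simp
      show "integrable lborel (\<lambda>t. (Q * e k ^ Suc m) * cmod (\<rho> t))" using integrable_test_fun[OF \<rho>(1)] by simp
      fix t
      show "cmod ((\<Sum>i\<le>m. complex_of_real (a i) * ?I i t) - \<rho> t * f x) \<le> (Q * e k ^ Suc m) * cmod (\<rho> t)"
      proof (cases "\<rho> t = 0")
        case False
        then have t: "norm t \<le> 1" using not_in_fun_support[of t \<rho>] test_funsD(3)[OF \<rho>(1)] by fastforce
        have "(\<Sum>i\<le>m. complex_of_real (a i) * ?I i t) - \<rho> t * f x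
           = \<rho> t * ((\<Sum>i\<le>m. complex_of_real (a i) * f (x - (e k * (1/2) ^ i) *\<^sub>R t)) - f x)"
          by (simp add: right_diff_distrib sum_distrib_left mult.left_commute)
        then show ?thesis
          using mult_left_mono[OF Q(2)[OF x t, of "e k"], of "cmod (\<rho> t)"] ek[of k] by (simp add: norm_mult mult.commute)
      qed simp
    qed
    also have "\<dots> = M * Q * e k ^ Suc m" by (simp add: M_def mult_ac)
    finally show ?thesis .
  qed
  define S where "S = (\<Sum>i\<le>m. \<bar>a i\<bar>)"
  define A1 where "A1 = S * K * 2 ^ (m * n)"
  have A1: "A1 \<ge> 0" using K(1) by (auto simp: A1_def S_def intro!: mult_nonneg_nonneg sum_nonneg)
  have big: "cmod (T k x) \<le> A1 * (1 / e k) ^ n" if x: "x \<in> ball x0 R" for k x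
  proof -
    have "cmod (T k x) \<le> (\<Sum>i\<le>m. \<bar>a i\<bar> * (K * 2 ^ (m * n) * (1 / e k) ^ n))"
      unfolding T_def
    proof (rule sum_norm_le)
      fix i assume i: "i \<in> {..m}"
      have "x \<in> cball x0 R" using x by simp
      from K(2)[OF ek(1-3) this, of "k + i"]
      have "cmod (conv u (scaled \<rho> (e (k + i))) x) \<le> K * (1 / e (k + i)) ^ n" .
      \<comment> \<open>The finest scale involved is 2^-m e k, so the extrapolated functions grow at
        the same rate up to the factor 2^(m n).\<close>
      also have "1 / e (k + i) = 2 ^ i * (1 / e k)" by (simp add: e(4) power_one_over)
      also have "K * (2 ^ i * (1 / e k)) ^ n \<le> K * (2 ^ (m * n) * (1 / e k) ^ n)"
      proof -
        have "(2::real) ^ (i * n) \<le> 2 ^ (m * n)" using i by (intro power_increasing) auto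
        then show ?thesis
          unfolding power_mult_distrib power_mult[symmetric] using K(1) ek(1)[of k]
          by (intro mult_left_mono mult_right_mono) auto
      qed
      finally show "cmod (complex_of_real (a i) * conv u (scaled \<rho> (e (k + i))) x) \<le> \<bar>a i\<bar> * (K * 2 ^ (m * n) * (1 / e k) ^ n)"
        by (simp add: norm_mult mult_left_mono mult.assoc)
    qed
    then show ?thesis by (simp add: S_def A1_def sum_distrib_right mult.assoc)
  qed
  have h: "smooth_fun_on (ball x0 R) (conv u (scaled \<rho> (e k)))" "\<forall>x\<in>ball x0 R. opT N c (conv u (scaled \<rho> (e k))) x = 0" for k
    using homogeneous_conv[OF X u sub hom \<rho>(1) ek(1,4)] by auto
  have smT: "smooth_fun_on (ball x0 R) (T k)" for k
    unfolding T_def[abs_def] by (intro smooth_sum smooth_cmult h open_ball)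
  have opT_T: "opT N c (T k) x = 0" if x: "x \<in> ball x0 R" for k x
  proof -
    have "opT N c (T k) x = (\<Sum>i\<le>m. complex_of_real (a i) * opT N c (conv u (scaled \<rho> (e (k + i)))) x)"
      unfolding T_def[abs_def] by (rule opT_sum) (rule smooth_fun_onD[OF h(1) x])
    then show ?thesis using h(2) x by simp
  qed
  \<comment> \<open>Near x' both terms approximate f, so their difference is small there although T
    itself is not. It solves the same equation, and the series of differences telescopes to the
    limit of T.\<close>
  define g where "g k x = T (Suc k) x - T k x" for k x
  \<comment> \<open>Serves both bounds on g: 2^n + 1 stems from growth at the scales e k / 2 and e
    k, the 2 from two approximations of f, and the 1 makes it positive.\<close>
  define A0 where "A0 = A1 * (2 ^ n + 1) + 2 * (M * Q) + 1"
  have A0: "A0 > 0" "A1 * (2 ^ n + 1) \<le> A0" "2 * (M * Q) \<le> A0"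
    using A1 M Q(1) by (auto simp: A0_def add_nonneg_pos intro!: add_nonneg_nonneg)
  have eSuc: "e (Suc k) = e k / 2" "e (Suc k) \<le> e k" for k using ek(1)[of k] by (auto simp: e_def)
  have g_bound: "cmod (g k x) \<le> C * A0 * e k" if x: "x \<in> ball x0 \<eta>" for k x
  proof -
    let ?A = "A0 * (1 / e k) ^ n" and ?B = "A0 * e k ^ Suc m"
    have smg: "smooth_fun_on (ball x0 R) (g k)"
      unfolding g_def[abs_def] by (intro smooth_diff smT open_ball)
    have opg: "\<forall>x\<in>ball x0 R. opT N c (g k) x = 0"
    proof
      fix x assume x: "x \<in> ball x0 R"
      \<comment> \<open>The difference is written as a sum with weights -1 and 1 to fit
        \<open>opT_sum\<close>.\<close>
      have "(\<lambda>x. \<Sum>j\<in>{0, 1::nat}. (if j = 0 then - 1 else 1) * T (k + j) x) = g k"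
        by (simp add: g_def fun_eq_iff)
      moreover have "opT N c (\<lambda>x. \<Sum>j\<in>{0, 1::nat}. (if j = 0 then - 1 else 1) * T (k + j) x) x = 0"
        by (subst opT_sum) (auto simp: smooth_fun_onD[OF smT x] opT_T[OF x])
      ultimately show "opT N c (g k) x = 0" by simp
    qed
    have gA: "\<forall>x\<in>ball x0 R. cmod (g k x) \<le> ?A"
    proof
      fix x assume x: "x \<in> ball x0 R"
      have "cmod (g k x) \<le> A1 * (1 / e (Suc k)) ^ n + A1 * (1 / e k) ^ n"
        unfolding g_def using big[OF x, of "Suc k"] big[OF x, of k] by (rule norm_triangle_le_diff[OF add_mono])
      also have "\<dots> = A1 * (2 ^ n + 1) * (1 / e k) ^ n"
        by (simp add: eSuc power_divide algebra_simps)
      also have "\<dots> \<le> ?A" using A0(2) ek(1)[of k] by (intro mult_right_mono) auto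
      finally show "cmod (g k x) \<le> ?A" .
    qed
    have gB: "\<forall>x\<in>ball x' s. cmod (g k x) \<le> ?B"
    proof
      fix x assume x: "x \<in> ball x' s"
      have "g k x = (T (Suc k) x - f x) - (T k x - f x)" by (simp add: g_def)
      also have "cmod \<dots> \<le> M * Q * e (Suc k) ^ Suc m + M * Q * e k ^ Suc m"
        using near[OF x, of "Suc k"] near[OF x, of k] by (rule norm_triangle_le_diff[OF add_mono])
      also have "\<dots> \<le> M * Q * e k ^ Suc m + M * Q * e k ^ Suc m"
        using M Q(1) eSuc(2)[of k] ek(1)[of "Suc k"] by (intro add_mono mult_left_mono power_mono order_refl mult_nonneg_nonneg) auto
      also have "\<dots> = 2 * (M * Q) * e k ^ Suc m" by simp
      also have "\<dots> \<le> ?B" using A0(3) ek(1)[of k] by (intro mult_right_mono) auto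
      finally show "cmod (g k x) \<le> ?B" .
    qed
    have B0: "0 < ?B" using A0 ek(1)[of k] by simp
    have BA: "?B \<le> ?A"
    proof -
      have "e k ^ Suc m \<le> 1" using ek(1,2)[of k] by (intro power_le_one) auto
      also have "1 \<le> (1 / e k) ^ n" using ek(1,2)[of k] by (intro one_le_power) auto
      finally show ?thesis using A0(1) by simp
    qed
    have "cmod (g k x) \<le> C * (?A * (?B / ?A) powr \<theta>)"
      by (rule interpolatingD[OF int smg opg B0 BA gA gB x])
    also have "?B / ?A = e k ^ (Suc m + n)"
      using A0(1) ek(1)[of k] by (simp add: power_add power_one_over field_simps)
    \<comment> \<open>One power more than the growth (1 / e k)^n, so that a factor e k is left,
      which is summable.\<close>
    also have "(e k ^ (Suc m + n)) powr \<theta> \<le> e k ^ Suc n"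
    proof -
      have "(e k ^ (Suc m + n)) powr \<theta> = e k powr (real (Suc m + n) * \<theta>)"
        using ek(1)[of k] by (subst powr_realpow[symmetric]) (auto simp: powr_powr)
      also have "\<dots> \<le> e k powr real (Suc n)"
      proof (rule powr_mono')
        have "\<theta> * real m \<le> real (Suc m + n) * \<theta>" using \<eta>(3) by (simp add: mult.commute mult_left_mono)
        then show "real (Suc n) \<le> real (Suc m + n) * \<theta>" using m by simp
      qed (use ek[of k] in auto)
      also have "\<dots> = e k ^ Suc n" using ek(1)[of k] by (simp only: powr_realpow)
      finally show ?thesis .
    qed
    then have "C * (?A * (e k ^ (Suc m + n)) powr \<theta>) \<le> C * (?A * e k ^ Suc n)"
      using \<eta>(4) A0(1) ek(1)[of k] by (intro mult_left_mono) auto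
    also have "\<dots> = C * A0 * e k" using ek(1)[of k] by (simp add: power_one_over)
    finally show ?thesis .
  qed
  have "summable (\<lambda>k. C * A0 * e k)"
    unfolding e_def by (intro summable_mult summable_geometric) simp
  then have "uniform_limit (ball x0 \<eta>) (\<lambda>k x. \<Sum>i<k. g i x) (\<lambda>x. suminf (\<lambda>i. g i x)) sequentially"
    by (rule Weierstrass_m_test[rotated]) (rule g_bound)
  then have "uniform_limit (ball x0 \<eta>) (\<lambda>k x. T 0 x + (\<Sum>i<k. g i x)) (\<lambda>x. T 0 x + suminf (\<lambda>i. g i x)) sequentially"
    by (intro uniform_limit_add uniform_limit_const)
  moreover have "T 0 x + (\<Sum>i<k. g i x) = T k x" for k x
    unfolding g_def using sum_lessThan_telescope[of "\<lambda>i. T i x" k] by simp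
  ultimately have lim: "uniform_limit (ball x0 \<eta>) T (\<lambda>x. T 0 x + suminf (\<lambda>i. g i x)) sequentially"
    by simp
  let ?F = "\<lambda>x. T 0 x + suminf (\<lambda>i. g i x)"
  have sub': "ball x0 \<eta> \<subseteq> ball x0 R" using \<eta>(2) by auto
  have cF: "continuous_on (ball x0 \<eta>) ?F"
    by (rule uniform_limit_theorem[OF _ lim])
      (auto intro!: always_eventually continuous_on_subset[OF smooth_fun_on_continuous[OF smT] sub'])
  have "represents (ball x0 \<eta>) u ?F"
  proof (rule represents_limit[OF X u \<rho> e(1,2) _ cF, where I = "{..m}" and c = "\<lambda>i. complex_of_real (a i)"])
    show "ball x0 \<eta> \<subseteq> X" using sub \<eta> R by (auto simp: subset_eq)
    show "uniform_limit (ball x0 \<eta>) (\<lambda>k x. \<Sum>i\<le>m. complex_of_real (a i) * conv u (scaled \<rho> (e (k + i))) x) ?F sequentially"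
      using lim unfolding T_def[abs_def] .
    show "(\<Sum>i\<le>m. complex_of_real (a i)) = 1" using a(1) by (metis of_real_1 of_real_sum)
  qed
  with cF show ?thesis by (intro exI[of _ ?F] conjI)
qed

lemma partial_deriv_PD:
  assumes "smooth_fun_on UNIV f"
  shows "partial_deriv k (PD P f) = PD P (partial_deriv k f)"
proof -
  \<comment> \<open>The coefficient i cancels the factor -i of \<open>PD\<close>, so a partial
    derivative is itself of the form \<open>PD\<close>, and commutation follows from that of
    polynomials.\<close>
  let ?S = "Poly_Mapping.single (Poly_Mapping.single k 1) \<i>"
  have S: "PD ?S g = partial_deriv k g" if "smooth_fun_on UNIV g" for g
    using mi_deriv_mi_of[OF that, of "[k]"] by (simp add: PD_single mi_abs_single mi_of_def)
  have "PD ?S (PD P f) = PD P (PD ?S f)"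
    using PD_mult[OF assms] by (metis mult.commute)
  then show ?thesis using assms by (simp only: S smooth_PD open_UNIV)
qed

text \<open>The coefficients are constant, so every derivative of u again solves the homogeneous
  equation and is smooth near x'. The interpolation constants do not involve u; hence
  \<open>homogeneous_continuous\<close> applies to all derivatives on the same ball.\<close>

lemma homogeneous_smooth:
  fixes u :: "'n::finite functional"
  assumes X: "open X" and u: "is_distribution X u" and sub: "ball x0 (2 * R) \<subseteq> X" and R: "R > 0" and s: "s > 0"
    and hom: "\<And>\<phi>. \<phi> \<in> test_funs (ball x0 (2 * R)) \<Longrightarrow> u (opL N c \<phi>) = 0"
    and int: "interpolating N c x0 R x' s \<eta> \<theta> C"
    and f: "smooth_fun_on (ball x' (2 * s)) f" and rep: "represents (ball x' (2 * s)) u f"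
  obtains F where "smooth_fun_on (ball x0 \<eta>) F" "represents (ball x0 \<eta>) u F"
proof -
  have \<eta>: "\<eta> \<le> R" using int by (auto simp: interpolating_def)
  have sub': "ball x0 \<eta> \<subseteq> X" using sub \<eta> R by (auto simp: subset_eq)
  have "\<exists>F. continuous_on (ball x0 \<eta>) F \<and> represents (ball x0 \<eta>) (fold dpartial ks u) F" for ks
    using u hom f rep
  proof (induction ks arbitrary: u f)
    case Nil
    show ?case using homogeneous_continuous[OF X Nil(1) sub R s Nil(2) int Nil(3,4)] by simp
  next
    case (Cons k ks)
    have "\<exists>F. continuous_on (ball x0 \<eta>) F \<and> represents (ball x0 \<eta>) (fold dpartial ks (dpartial k u)) F"
    proof (rule Cons.IH)
      show "is_distribution X (dpartial k u)" by (rule is_distribution_dpartial[OF X Cons.prems(1)])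
      show "smooth_fun_on (ball x' (2 * s)) (partial_deriv k f)" by (rule smooth_partial_deriv[OF Cons.prems(3)])
      show "represents (ball x' (2 * s)) (dpartial k u) (partial_deriv k f)"
        by (rule dpartial_represented[OF open_ball Cons.prems(3,4)])
      show "dpartial k u (opL N c \<phi>) = 0" if \<phi>: "\<phi> \<in> test_funs (ball x0 (2 * R))" for \<phi>
      proof -
        have "partial_deriv k (opL N c \<phi>) = opL N c (partial_deriv k \<phi>)"
          using partial_deriv_PD[OF test_funsD(1)[OF \<phi>], of k "linear_poly N + const_poly c"]
          by (simp add: PD_opL test_funsD(1)[OF \<phi>] smooth_partial_deriv)
        then show ?thesis
          using Cons.prems(2)[OF test_funs_partial_deriv[OF \<phi>]] by (simp add: dpartial_def)
      qed
    qed
    then show ?case by simp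
  qed
  from smooth_if_derivs_continuous[OF X u open_ball sub' this] show ?thesis using that by metis
qed

section \<open>Smooth functions as distributions\<close>

lemma integrable_represented:
  "open V \<Longrightarrow> smooth_fun_on V f \<Longrightarrow> \<phi> \<in> test_funs V \<Longrightarrow> integrable lborel (\<lambda>x. f x * \<phi> x)"
  by (rule integrable_test_fun[OF test_funs_smooth_mult])

lemma integral_opL:
  assumes V: "open V" and v: "smooth_fun_on V v" and \<phi>: "\<phi> \<in> test_funs V"
  shows "(\<integral>x. v x * opL N c \<phi> x \<partial>lborel) = (\<integral>x. opT N c v x * \<phi> x \<partial>lborel)"
proof -
  have i1: "integrable lborel (\<lambda>x. v x * partial_deriv k \<phi> x)" for k
    by (rule integrable_represented[OF V v test_funs_partial_deriv[OF \<phi>]])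
  have i2: "integrable lborel (\<lambda>x. partial_deriv k v x * \<phi> x)" for k
    by (rule integrable_represented[OF V smooth_partial_deriv[OF v] \<phi>])
  have i3: "integrable lborel (\<lambda>x. v x * \<phi> x)" by (rule integrable_represented[OF V v \<phi>])
  have "(\<lambda>x. v x * opL N c \<phi> x) = (\<lambda>x. (\<Sum>k\<in>UNIV. (- \<i> * N $ k) * (v x * partial_deriv k \<phi> x)) + c * (v x * \<phi> x))"
    by (simp add: opL_def dN_def fun_eq_iff algebra_simps sum_distrib_left sum_negf)
  then have "(\<integral>x. v x * opL N c \<phi> x \<partial>lborel) =
     (\<Sum>k\<in>UNIV. (- \<i> * N $ k) * (\<integral>x. v x * partial_deriv k \<phi> x \<partial>lborel)) + c * (\<integral>x. v x * \<phi> x \<partial>lborel)"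
    using i1 i3 by (simp add: Bochner_Integration.integral_add Bochner_Integration.integral_sum Bochner_Integration.integrable_sum)
  also have "\<dots> = (\<Sum>k\<in>UNIV. (\<i> * N $ k) * (\<integral>x. partial_deriv k v x * \<phi> x \<partial>lborel)) + c * (\<integral>x. v x * \<phi> x \<partial>lborel)"
    by (simp add: integral_by_parts[OF V v \<phi>])
  also have "\<dots> = (\<integral>x. (\<Sum>k\<in>UNIV. (\<i> * N $ k) * (partial_deriv k v x * \<phi> x)) + c * (v x * \<phi> x) \<partial>lborel)"
    using i2 i3 by (simp add: Bochner_Integration.integral_add Bochner_Integration.integral_sum Bochner_Integration.integrable_sum)
  also have "(\<lambda>x. (\<Sum>k\<in>UNIV. (\<i> * N $ k) * (partial_deriv k v x * \<phi> x)) + c * (v x * \<phi> x)) = (\<lambda>x. opT N c v x * \<phi> x)"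
    by (simp add: opT_def dN_def fun_eq_iff algebra_simps sum_distrib_left sum_distrib_right)
  finally show ?thesis .
qed

lemma is_distribution_integral:
  fixes v :: "real ^ 'n::finite \<Rightarrow> complex"
  assumes v: "smooth_fun_on UNIV v"
  shows "is_distribution X (\<lambda>\<phi>. \<integral>x. v x * \<phi> x \<partial>lborel)"
  unfolding is_distribution_iff
proof (intro conjI ballI allI impI)
  have i: "integrable lborel (\<lambda>x. v x * \<phi> x)" if "\<phi> \<in> test_funs X" for \<phi>
    by (rule integrable_represented[OF open_UNIV v test_funs_mono[OF that subset_UNIV]])
  show "(\<integral>x. v x * (\<phi> x + \<psi> x) \<partial>lborel) = (\<integral>x. v x * \<phi> x \<partial>lborel) + (\<integral>x. v x * \<psi> x \<partial>lborel)"
    if "\<phi> \<in> test_funs X" "\<psi> \<in> test_funs X" for \<phi> \<psi>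
    using i[OF that(1)] i[OF that(2)] by (simp add: distrib_left)
  show "(\<integral>x. v x * (c * \<phi> x) \<partial>lborel) = c * (\<integral>x. v x * \<phi> x \<partial>lborel)" for \<phi> c
    by (simp add: mult.left_commute)
  fix K assume K: "compact K \<and> K \<subseteq> X"
  have cv: "continuous_on K v" using smooth_fun_on_continuous[OF v] continuous_on_subset by blast
  let ?w = "\<lambda>x. indicator K x *\<^sub>R cmod (v x)"
  have iw: "integrable lborel ?w"
    using borel_integrable_compact[of K "\<lambda>x. cmod (v x)"] K cv continuous_on_norm by blast
  show "\<exists>C b. C \<ge> 0 \<and> (\<forall>\<phi>\<in>test_funs X. \<forall>B. fun_support \<phi> \<subseteq> K \<longrightarrow>
      (\<forall>ks x. length ks \<le> b \<longrightarrow> cmod (partial_derivs ks \<phi> x) \<le> B) \<longrightarrow> cmod (\<integral>x. v x * \<phi> x \<partial>lborel) \<le> C * B)"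
  proof (intro exI[of _ "\<integral>x. ?w x \<partial>lborel"] exI[of _ 0] conjI ballI allI impI)
    fix \<phi> B assume \<phi>: "\<phi> \<in> test_funs X" "fun_support \<phi> \<subseteq> K"
      and B: "\<forall>ks x. length ks \<le> 0 \<longrightarrow> cmod (partial_derivs ks \<phi> x) \<le> B"
    have "cmod (\<integral>x. v x * \<phi> x \<partial>lborel) \<le> (\<integral>x. ?w x * B \<partial>lborel)"
    proof (rule Bochner_Integration.integral_norm_bound_integral[OF i[OF \<phi>(1)]])
      show "integrable lborel (\<lambda>x. ?w x * B)" using iw by simp
      fix x
      have "cmod (\<phi> x) \<le> B" using B[rule_format, of "[]" x] by simp
      then show "cmod (v x * \<phi> x) \<le> ?w x * B"
        using not_in_fun_support[of x \<phi>] subsetD[OF \<phi>(2), of x]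
        by (cases "x \<in> K"; cases "x \<in> fun_support \<phi>") (simp_all add: norm_mult mult_left_mono)
    qed
    then show "cmod (\<integral>x. v x * \<phi> x \<partial>lborel) \<le> (\<integral>x. ?w x \<partial>lborel) * B" by simp
  qed simp
qed

lemma is_distribution_minus:
  assumes u: "is_distribution X u" and v: "is_distribution X v"
  shows "is_distribution X (\<lambda>\<phi>. u \<phi> - v \<phi>)"
  unfolding is_distribution_iff
proof (intro conjI ballI allI impI)
  show "u (\<lambda>x. \<phi> x + \<psi> x) - v (\<lambda>x. \<phi> x + \<psi> x) = u \<phi> - v \<phi> + (u \<psi> - v \<psi>)"
    if "\<phi> \<in> test_funs X" "\<psi> \<in> test_funs X" for \<phi> \<psi>
    using is_distribution_add[OF u that] is_distribution_add[OF v that] by simp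
  show "u (\<lambda>x. c * \<phi> x) - v (\<lambda>x. c * \<phi> x) = c * (u \<phi> - v \<phi>)" if "\<phi> \<in> test_funs X" for \<phi> c
    using is_distribution_cmult[OF u that] is_distribution_cmult[OF v that] by (simp add: right_diff_distrib)
  fix K assume K: "compact K \<and> K \<subseteq> X"
  obtain C b where C: "C \<ge> 0" "\<And>\<phi> B. \<phi> \<in> test_funs X \<Longrightarrow> fun_support \<phi> \<subseteq> K \<Longrightarrow>
       (\<And>ks x. length ks \<le> b \<Longrightarrow> cmod (partial_derivs ks \<phi> x) \<le> B) \<Longrightarrow> cmod (u \<phi>) \<le> C * B"
    using is_distribution_estimate[OF u] K by metis
  obtain C' b' where C': "C' \<ge> 0" "\<And>\<phi> B. \<phi> \<in> test_funs X \<Longrightarrow> fun_support \<phi> \<subseteq> K \<Longrightarrow>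
       (\<And>ks x. length ks \<le> b' \<Longrightarrow> cmod (partial_derivs ks \<phi> x) \<le> B) \<Longrightarrow> cmod (v \<phi>) \<le> C' * B"
    using is_distribution_estimate[OF v] K by metis
  show "\<exists>C b. C \<ge> 0 \<and> (\<forall>\<phi>\<in>test_funs X. \<forall>B. fun_support \<phi> \<subseteq> K \<longrightarrow>
      (\<forall>ks x. length ks \<le> b \<longrightarrow> cmod (partial_derivs ks \<phi> x) \<le> B) \<longrightarrow> cmod (u \<phi> - v \<phi>) \<le> C * B)"
  proof (intro exI[of _ "C + C'"] exI[of _ "max b b'"] conjI ballI allI impI)
    fix \<phi> B assume \<phi>: "\<phi> \<in> test_funs X" "fun_support \<phi> \<subseteq> K"
      and B: "\<forall>ks x. length ks \<le> max b b' \<longrightarrow> cmod (partial_derivs ks \<phi> x) \<le> B"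
    have "cmod (u \<phi>) \<le> C * B" by (rule C(2)[OF \<phi>]) (use B in simp)
    moreover have "cmod (v \<phi>) \<le> C' * B" by (rule C'(2)[OF \<phi>]) (use B in simp)
    ultimately show "cmod (u \<phi> - v \<phi>) \<le> (C + C') * B"
      using norm_triangle_ineq4[of "u \<phi>" "v \<phi>"] by (simp add: distrib_right)
  qed (use C C' in simp)
qed

text \<open>By contraposition: if u vanished near a leaf point y close to x0, interpolation starting
  from y would make u vanish near x0. The radius r is found before y and the size of its
  neighbourhood are given.\<close>

lemma propagation_supp:
  fixes u :: "'n::finite functional"
  assumes X: "open X" and u: "is_distribution X u" and N: "N \<noteq> 0"
    and x0: "x0 \<in> dist_supp X u" "x0 \<notin> dist_supp X (diff_op_neg (linear_poly N + const_poly c) u)"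
  shows "\<exists>r>0. \<forall>y\<in>ball x0 r. y - x0 \<in> span {Re_vec N, Im_vec N} \<longrightarrow> y \<in> dist_supp X u"
proof -
  let ?P = "linear_poly N + const_poly c"
  have x0X: "x0 \<in> X" using x0(1) dist_supp_subset by blast
  have "\<exists>V. open V \<and> x0 \<in> V \<and> V \<subseteq> X \<and> (\<forall>\<phi>\<in>test_funs V. diff_op_neg ?P u \<phi> = 0)"
    using x0(2) x0X dist_suppI[of x0 X "diff_op_neg ?P u"] by metis
  then obtain V where V: "open V" "x0 \<in> V" "V \<subseteq> X" "\<forall>\<phi>\<in>test_funs V. diff_op_neg ?P u \<phi> = 0"
    by (elim exE conjE)
  obtain R' where R': "R' > 0" "ball x0 R' \<subseteq> V" using V(1,2) openE by blast
  define R where "R = R' / 2"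
  have R: "R > 0" "ball x0 (2 * R) \<subseteq> V" using R' by (auto simp: R_def)
  have hom: "u (opL N c \<phi>) = 0" if \<phi>: "\<phi> \<in> test_funs (ball x0 (2 * R))" for \<phi>
  proof -
    have \<phi>V: "\<phi> \<in> test_funs V" by (rule test_funs_mono[OF \<phi> R(2)])
    then have "diff_op_neg ?P u \<phi> = 0" using V(4) by blast
    then show ?thesis
      using diff_op_neg_eq[OF X u test_funs_mono[OF \<phi>V V(3)], of ?P] PD_opL[OF test_funsD(1)[OF \<phi>]] by simp
  qed
  obtain r where r: "r > 0" "\<forall>x'\<in>ball x0 r. x' - x0 \<in> span {Re_vec N, Im_vec N} \<longrightarrow> (\<forall>s>0. interpolates N x0 R x' s)"
    using leaf_interpolation[OF N] R(1) unfolding leaf_interpolation_def by blast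
  have "y \<in> dist_supp X u" if y: "y \<in> ball x0 (min r R)" "y - x0 \<in> span {Re_vec N, Im_vec N}" for y
  proof (rule dist_suppI)
    have "y \<in> ball x0 (2 * R)" using y R(1) by simp
    then show "y \<in> X" using R(2) V(3) by blast
    fix W assume W: "open W" "y \<in> W" "W \<subseteq> X" "\<forall>\<phi>\<in>test_funs W. u \<phi> = 0"
    obtain s' where s': "s' > 0" "ball y s' \<subseteq> W" using W(1,2) openE by blast
    define s where "s = s' / 2"
    have s: "s > 0" "ball y (2 * s) \<subseteq> W" using s' by (auto simp: s_def)
    have "interpolates N x0 R y s" using r(2) y s(1) by simp
    then obtain \<eta> \<theta> C where int: "interpolating N c x0 R y s \<eta> \<theta> C"
      by (rule ex_interpolating[OF N _ R(1) s(1)])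
    have sub: "ball x0 (2 * R) \<subseteq> X" using R(2) V(3) by blast
    have van: "\<forall>\<phi>\<in>test_funs (ball y (2 * s)). u \<phi> = 0" using W(4) test_funs_mono[OF _ s(2)] by blast
    have "\<forall>\<phi>\<in>test_funs (ball x0 \<eta>). u \<phi> = 0"
      by (rule homogeneous_vanishing[OF X u sub R(1) s(1) hom int van])
    moreover have "0 < \<eta>" "\<eta> \<le> R" using int by (auto simp: interpolating_def)
    moreover from this have "ball x0 \<eta> \<subseteq> X" using sub R(1) by (auto simp: subset_eq)
    ultimately show False using dist_suppD[OF x0(1) open_ball[of x0 \<eta>]] by simp
  qed
  then show ?thesis using r(1) R(1) by (intro exI[of _ "min r R"]) auto
qed

lemma propagation_sing_supp:
  fixes u :: "'n::finite functional"
  assumes X: "open X" and u: "is_distribution X u" and N: "N \<noteq> 0"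
    and x0: "x0 \<in> dist_sing_supp X u" "x0 \<notin> dist_sing_supp X (diff_op_neg (linear_poly N + const_poly c) u)"
  shows "\<exists>r>0. \<forall>y\<in>ball x0 r. y - x0 \<in> span {Re_vec N, Im_vec N} \<longrightarrow> y \<in> dist_sing_supp X u"
proof -
  let ?P = "linear_poly N + const_poly c"
  have x0X: "x0 \<in> X" using x0(1) dist_sing_supp_subset by blast
  have "\<exists>V f. open V \<and> x0 \<in> V \<and> V \<subseteq> X \<and> smooth_fun_on V f \<and> represents V (diff_op_neg ?P u) f"
    using x0(2) x0X dist_sing_suppI[of x0 X "diff_op_neg ?P u"] by metis
  then obtain V f where V: "open V" "x0 \<in> V" "V \<subseteq> X" and f: "smooth_fun_on V f" "represents V (diff_op_neg ?P u) f"
    by (elim exE conjE)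
  obtain R' where R': "R' > 0" "ball x0 R' \<subseteq> V" using V(1,2) openE by blast
  define R where "R = R' / 4"
  have R: "R > 0" "ball x0 (4 * R) \<subseteq> V" using R' by (auto simp: R_def)
  then have R2: "ball x0 (2 * R) \<subseteq> V" by (auto simp: subset_eq)
  \<comment> \<open>The solution along the leaves is constructed for compactly supported right hand
    sides. The cutoff achieves this without changing f on the ball in which the equation is
    used.\<close>
  have "0 < 2 * R" "2 * R < 4 * R" using R(1) by auto
  from ex_cutoff[OF this, of x0]
  obtain \<zeta> where \<zeta>: "\<zeta> \<in> test_funs (ball x0 (4 * R))" "\<And>x. x \<in> cball x0 (2 * R) \<Longrightarrow> \<zeta> x = 1" by blast
  have "(\<lambda>x. f x * \<zeta> x) \<in> test_funs V"
    by (rule test_funs_smooth_mult[OF V(1) f(1) test_funs_mono[OF \<zeta>(1) R(2)]])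
  from ex_opT_solution[OF N test_funs_mono[OF this subset_UNIV], of x0 "2 * R" c]
  obtain v where v: "smooth_fun_on UNIV v" "\<forall>x\<in>ball x0 (2 * R). opT N c v x = f x * \<zeta> x" by (elim exE conjE)
  \<comment> \<open>w solves the homogeneous equation near x0 and differs from u by a smooth
    function, so the two are smooth near the same points.\<close>
  define w where "w = (\<lambda>\<phi>. u \<phi> - (\<integral>x. v x * \<phi> x \<partial>lborel))"
  have w: "is_distribution X w"
    unfolding w_def by (rule is_distribution_minus[OF u is_distribution_integral[OF v(1)]])
  have hom: "w (opL N c \<phi>) = 0" if \<phi>: "\<phi> \<in> test_funs (ball x0 (2 * R))" for \<phi>
  proof -
    have \<phi>V: "\<phi> \<in> test_funs V" by (rule test_funs_mono[OF \<phi> R2])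
    have "u (opL N c \<phi>) = (\<integral>x. f x * \<phi> x \<partial>lborel)"
      using f(2) \<phi>V diff_op_neg_eq[OF X u test_funs_mono[OF \<phi>V V(3)], of ?P] PD_opL[OF test_funsD(1)[OF \<phi>]]
      by (simp add: represents_def)
    moreover have "(\<integral>x. v x * opL N c \<phi> x \<partial>lborel) = (\<integral>x. opT N c v x * \<phi> x \<partial>lborel)"
      by (rule integral_opL[OF open_UNIV v(1) test_funs_mono[OF \<phi> subset_UNIV]])
    moreover have "opT N c v x * \<phi> x = f x * \<phi> x" for x
    proof (cases "x \<in> ball x0 (2 * R)")
      case True
      then show ?thesis using v(2) \<zeta>(2)[of x] by simp
    next
      case False
      then have "\<phi> x = 0" using not_in_fun_support[of x \<phi>] test_funsD(3)[OF \<phi>] by blast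
      then show ?thesis by simp
    qed
    ultimately show ?thesis by (simp add: w_def)
  qed
  obtain r where r: "r > 0" "\<forall>x'\<in>ball x0 r. x' - x0 \<in> span {Re_vec N, Im_vec N} \<longrightarrow> (\<forall>s>0. interpolates N x0 R x' s)"
    using leaf_interpolation[OF N] R(1) unfolding leaf_interpolation_def by blast
  have "y \<in> dist_sing_supp X u" if y: "y \<in> ball x0 (min r R)" "y - x0 \<in> span {Re_vec N, Im_vec N}" for y
  proof (rule dist_sing_suppI)
    have "y \<in> ball x0 (2 * R)" using y R(1) by simp
    then show "y \<in> X" using R2 V(3) by blast
    fix W h assume W: "open W" "y \<in> W" "W \<subseteq> X" and h: "smooth_fun_on W h" "represents W u h"
    obtain s' where s': "s' > 0" "ball y s' \<subseteq> W" using W(1,2) openE by blast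
    define s where "s = s' / 2"
    have s: "s > 0" "ball y (2 * s) \<subseteq> W" using s' by (auto simp: s_def)
    have "interpolates N x0 R y s" using r(2) y s(1) by simp
    then obtain \<eta> \<theta> C where int: "interpolating N c x0 R y s \<eta> \<theta> C"
      by (rule ex_interpolating[OF N _ R(1) s(1)])
    have sub: "ball x0 (2 * R) \<subseteq> X" using R2 V(3) by blast
    have hs: "smooth_fun_on (ball y (2 * s)) h" by (rule smooth_fun_on_subset[OF h(1) s(2)])
    have vs: "smooth_fun_on A v" for A by (rule smooth_fun_on_subset[OF v(1) subset_UNIV])
    have sm: "smooth_fun_on (ball y (2 * s)) (\<lambda>x. h x - v x)" by (intro smooth_diff hs vs open_ball)
    have rep: "represents (ball y (2 * s)) w (\<lambda>x. h x - v x)"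
      unfolding represents_def
    proof
      fix \<phi> assume \<phi>: "\<phi> \<in> test_funs (ball y (2 * s))"
      have "u \<phi> = (\<integral>x. h x * \<phi> x \<partial>lborel)" using h(2) test_funs_mono[OF \<phi> s(2)] by (simp add: represents_def)
      then show "w \<phi> = (\<integral>x. (h x - v x) * \<phi> x \<partial>lborel)"
        using integrable_represented[OF open_ball hs \<phi>] integrable_represented[OF open_ball vs \<phi>]
        by (simp add: w_def left_diff_distrib)
    qed
    obtain F where F: "smooth_fun_on (ball x0 \<eta>) F" "represents (ball x0 \<eta>) w F"
      by (rule homogeneous_smooth[OF X w sub R(1) s(1) hom int sm rep])
    have \<eta>: "0 < \<eta>" "\<eta> \<le> R" using int by (auto simp: interpolating_def)
    have sub\<eta>: "ball x0 \<eta> \<subseteq> X" using sub \<eta> R(1) by (auto simp: subset_eq)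
    have "represents (ball x0 \<eta>) u (\<lambda>x. F x + v x)"
      unfolding represents_def
    proof
      fix \<phi> assume \<phi>: "\<phi> \<in> test_funs (ball x0 \<eta>)"
      have "w \<phi> = (\<integral>x. F x * \<phi> x \<partial>lborel)" using F(2) \<phi> by (simp add: represents_def)
      then have "u \<phi> = (\<integral>x. F x * \<phi> x \<partial>lborel) + (\<integral>x. v x * \<phi> x \<partial>lborel)" by (simp add: w_def diff_eq_eq)
      then show "u \<phi> = (\<integral>x. (F x + v x) * \<phi> x \<partial>lborel)"
        using integrable_represented[OF open_ball F(1) \<phi>] integrable_represented[OF open_ball vs \<phi>]
        by (simp add: distrib_right)
    qed
    moreover have "smooth_fun_on (ball x0 \<eta>) (\<lambda>x. F x + v x)" by (intro smooth_add F(1) vs open_ball)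
    moreover have "x0 \<in> ball x0 \<eta>" using \<eta>(1) by simp
    ultimately show False using dist_sing_suppD[OF x0(1) open_ball _ sub\<eta>] by blast
  qed
  then show ?thesis using r(1) R(1) by (intro exI[of _ "min r R"]) auto
qed

subsection \<open>The minimum principle confines compact sets\<close>

lemma mem_frontier_of_iff:
  fixes K F :: "'a::metric_space set"
  assumes "compact K" "K \<subseteq> F"
  shows "p \<in> top_of_set F frontier_of K \<longleftrightarrow> p \<in> K \<and> \<not> (\<exists>r>0. F \<inter> ball p r \<subseteq> K)"
proof -
  have "closedin (top_of_set F) K"
    using assms by (metis closed_subset compact_imp_closed)
  then have "top_of_set F closure_of K = K" by (rule closure_of_closedin)
  moreover have "p \<in> top_of_set F interior_of K \<longleftrightarrow> (\<exists>r>0. F \<inter> ball p r \<subseteq> K)" if p: "p \<in> K"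
  proof
    assume "p \<in> top_of_set F interior_of K"
    then obtain T where "openin (top_of_set F) T" "p \<in> T" "T \<subseteq> K" unfolding interior_of_def by blast
    then obtain r where "r > 0" "ball p r \<inter> F \<subseteq> T" unfolding openin_contains_ball by blast
    then show "\<exists>r>0. F \<inter> ball p r \<subseteq> K" using \<open>T \<subseteq> K\<close> by blast
  next
    assume "\<exists>r>0. F \<inter> ball p r \<subseteq> K"
    then obtain r where r: "r > 0" "F \<inter> ball p r \<subseteq> K" by blast
    moreover have "p \<in> F \<inter> ball p r" using p assms(2) r(1) by auto
    ultimately show "p \<in> top_of_set F interior_of K" unfolding interior_of_def by blast
  qed
  ultimately show ?thesis unfolding frontier_of_def by auto
qed

text \<open>A point of greatest norm cannot be interior relative to the leaf: moving it along w or
  -w, whichever has nonnegative inner product with it, increases the norm. In particular the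
  frontier is nonempty.\<close>

lemma ex_frontier_max_norm:
  fixes K :: "'a::euclidean_space set"
  assumes K: "compact K" "K \<noteq> {}" "K \<subseteq> (+) x ` W" and W: "subspace W" "w \<in> W" "w \<noteq> 0"
  obtains p where "p \<in> top_of_set ((+) x ` W) frontier_of K" "\<And>q. q \<in> K \<Longrightarrow> norm q \<le> norm p"
proof -
  obtain p where p: "p \<in> K" "\<And>q. q \<in> K \<Longrightarrow> norm q \<le> norm p"
    using continuous_attains_sup[OF K(1,2), of norm] continuous_on_norm_id by blast
  define w' where "w' = (if p \<bullet> w \<ge> 0 then w else - w)"
  have w': "w' \<in> W" "w' \<noteq> 0" "p \<bullet> w' \<ge> 0" using W by (auto simp: w'_def subspace_neg)
  have "False" if r: "r > 0" "(+) x ` W \<inter> ball p r \<subseteq> K" for r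
  proof -
    define t where "t = r / (2 * norm w')"
    have t: "t > 0" using r(1) w'(2) by (simp add: t_def)
    obtain y where y: "y \<in> W" "p = x + y" using K(3) p(1) by blast
    have "p + t *\<^sub>R w' = x + (y + t *\<^sub>R w')" using y(2) by (simp add: add.assoc)
    moreover have "y + t *\<^sub>R w' \<in> W" by (intro subspace_add subspace_scale W(1) y(1) w'(1))
    ultimately have "p + t *\<^sub>R w' \<in> (+) x ` W" by (rule image_eqI)
    moreover have "p + t *\<^sub>R w' \<in> ball p r" using r(1) w'(2) by (simp add: dist_norm t_def)
    ultimately have "norm (p + t *\<^sub>R w') \<le> norm p" using r(2) p(2) by blast
    then have "(p + t *\<^sub>R w') \<bullet> (p + t *\<^sub>R w') \<le> p \<bullet> p" by (simp only: norm_le)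
    then have "2 * t * (p \<bullet> w') + t\<^sup>2 * (w' \<bullet> w') \<le> 0"
      by (simp add: inner_add_left inner_add_right inner_commute power2_eq_square mult.assoc)
    moreover have "t\<^sup>2 * (w' \<bullet> w') > 0" "2 * t * (p \<bullet> w') \<ge> 0" using t w'(2,3) by auto
    ultimately show False by simp
  qed
  then have "p \<in> top_of_set ((+) x ` W) frontier_of K"
    using p(1) by (subst mem_frontier_of_iff[OF K(1,3)]) blast
  then show ?thesis using that p(2) by blast
qed

text \<open>For X = UNIV the two disagree, as \<open>infdist\<close> to the empty set is 0 and not
  \<infinity>; later proofs therefore treat that case apart.\<close>

lemma boundary_dist_infdist:
  assumes "open X" "X \<noteq> UNIV"
  shows "boundary_dist X x = ereal (infdist (x :: 'a::euclidean_space) (- X))"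
proof (rule antisym)
  have c: "closed (- X)" "- X \<noteq> {}" using assms by auto
  obtain y where "y \<in> - X" "infdist x (- X) = dist x y" using infdist_attains_inf[OF c] by metis
  then show "boundary_dist X x \<le> ereal (infdist x (- X))"
    unfolding boundary_dist_def by (intro INF_lower2[of y]) auto
  show "ereal (infdist x (- X)) \<le> boundary_dist X x"
    unfolding boundary_dist_def by (rule INF_greatest) (simp add: infdist_le)
qed

text \<open>A point of S outside K has a neighbourhood in its leaf that belongs to S, so the
  frontier of S in the leaf lies in K. The minimum principle then compares the boundary distance
  with values on K, and the point of greatest norm does the same for the norm.\<close>

lemma propagating_set_confined:
  fixes S K :: "'a::euclidean_space set"
  assumes W: "subspace W" "w \<in> W" "w \<noteq> 0" and S: "compact S" "S \<subseteq> X"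
    and propagate: "\<forall>x\<in>S - K. \<exists>r>0. \<forall>y\<in>ball x r. y - x \<in> W \<longrightarrow> y \<in> S"
    and mp: "minimum_principle X (boundary_dist X) ((+) x ` W)" and x: "x \<in> S"
  shows "\<exists>z\<in>K. boundary_dist X z \<le> boundary_dist X x" "\<exists>z\<in>K. norm x \<le> norm z"
proof -
  let ?F = "(+) x ` W" and ?T = "S \<inter> (+) x ` W"
  have "closed ?F" using W(1) by (intro closed_translation closed_subspace)
  then have T: "compact ?T" "?T \<subseteq> ?F" using S(1) by auto
  have xT: "x \<in> ?T" using x W(1) by (auto intro!: image_eqI[of _ _ 0] simp: subspace_0)
  have fr: "z \<in> K" if z: "z \<in> top_of_set ?F frontier_of ?T" for z
  proof (rule ccontr)
    assume "z \<notin> K"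
    moreover have zT: "z \<in> ?T" "\<not> (\<exists>r>0. ?F \<inter> ball z r \<subseteq> ?T)"
      using z unfolding mem_frontier_of_iff[OF T] by auto
    ultimately obtain r where r: "r > 0" "\<forall>y\<in>ball z r. y - z \<in> W \<longrightarrow> y \<in> S" using propagate by blast
    have "?F \<inter> ball z r \<subseteq> ?T"
    proof
      fix y assume y: "y \<in> ?F \<inter> ball z r"
      then obtain a b where "a \<in> W" "y = x + a" "b \<in> W" "z = x + b" using zT(1) by blast
      then have "y - z \<in> W" using subspace_diff[OF W(1), of a b] by simp
      then show "y \<in> ?T" using r(2) y by blast
    qed
    then show False using zT(2) r(1) by blast
  qed
  have "compact ?T \<and> ?T \<noteq> {} \<and> ?T \<subseteq> ?F \<inter> X" using T S(2) xT by auto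
  then obtain v where v: "is_min_on (boundary_dist X) ?T v"
      "is_min_on (boundary_dist X) (top_of_set ?F frontier_of ?T) v"
    using mp unfolding minimum_principle_def by blast
  from v(2) obtain z where "z \<in> top_of_set ?F frontier_of ?T" "v = boundary_dist X z"
    unfolding is_min_on_def by auto
  moreover have "v \<le> boundary_dist X x" using v(1) xT unfolding is_min_on_def by blast
  ultimately show "\<exists>z\<in>K. boundary_dist X z \<le> boundary_dist X x" using fr by blast
  have "?T \<noteq> {}" using xT by blast
  from ex_frontier_max_norm[OF T(1) this T(2) W]
  obtain p where "p \<in> top_of_set ?F frontier_of ?T" "\<And>q. q \<in> ?T \<Longrightarrow> norm q \<le> norm p" by blast
  then show "\<exists>z\<in>K. norm x \<le> norm z" using fr xT by blast
qed

text \<open>L consists of the points no farther from the origin than a bound R for K and no closer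
  to the complement of X than K. Positivity of that distance makes L a subset of X. If K is empty,
  so is S; if X is everything, the ball alone is enough.\<close>

lemma ex_confining_compact:
  fixes X K :: "'a::euclidean_space set"
  assumes X: "open X" and W: "subspace W" "w \<in> W" "w \<noteq> 0" and K: "compact K" "K \<subseteq> X"
    and mp: "\<And>x. minimum_principle X (boundary_dist X) ((+) x ` W)"
  obtains L where "compact L" "L \<subseteq> X"
    "\<And>S. compact S \<Longrightarrow> S \<subseteq> X \<Longrightarrow> \<forall>x\<in>S - K. \<exists>r>0. \<forall>y\<in>ball x r. y - x \<in> W \<longrightarrow> y \<in> S \<Longrightarrow> S \<subseteq> L"
proof -
  obtain R where R: "\<And>z. z \<in> K \<Longrightarrow> norm z \<le> R" using compact_imp_bounded[OF K(1)] bounded_iff by blast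
  note conf = propagating_set_confined[OF W _ _ _ mp]
  consider "K = {}" | "K \<noteq> {}" "X = UNIV" | "K \<noteq> {}" "X \<noteq> UNIV" by blast
  then show ?thesis
  proof cases
    case 1
    show ?thesis
    proof (rule that[of "{}"])
      fix S assume "compact S" "S \<subseteq> X" "\<forall>x\<in>S - K. \<exists>r>0. \<forall>y\<in>ball x r. y - x \<in> W \<longrightarrow> y \<in> S"
      from conf(1)[OF this] show "S \<subseteq> {}" using 1 by blast
    qed auto
  next
    case 2
    show ?thesis
    proof (rule that[of "cball 0 R"])
      fix S assume "compact S" "S \<subseteq> X" "\<forall>x\<in>S - K. \<exists>r>0. \<forall>y\<in>ball x r. y - x \<in> W \<longrightarrow> y \<in> S"
      from conf(2)[OF this] show "S \<subseteq> cball 0 R" using R order_trans by (fastforce simp: subset_eq)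
    qed (use 2 in auto)
  next
    case 3
    have c: "closed (- X)" "- X \<noteq> {}" using X 3 by auto
    obtain z0 where z0: "z0 \<in> K" "\<And>z. z \<in> K \<Longrightarrow> infdist z0 (- X) \<le> infdist z (- X)"
      using continuous_attains_inf[OF K(1) 3(1), of "\<lambda>z. infdist z (- X)"] continuous_on_infdist[OF continuous_on_id] by blast
    have pos: "infdist z0 (- X) > 0" using infdist_pos_not_in_closed[OF c] z0(1) K(2) by blast
    let ?L = "cball 0 R \<inter> {x. infdist z0 (- X) \<le> infdist x (- X)}"
    have "closed {x. infdist z0 (- X) \<le> infdist x (- X)}"
      by (intro closed_Collect_le continuous_intros)
    then have L: "compact ?L" by (intro compact_Int_closed compact_cball)
    have LX: "?L \<subseteq> X"
    proof
      fix x assume "x \<in> ?L"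
      then have "infdist x (- X) \<noteq> 0" using pos by auto
      then show "x \<in> X" using in_closed_iff_infdist_zero[OF c, of x] by blast
    qed
    show ?thesis
    proof (rule that[OF L LX])
      fix S assume S: "compact S" "S \<subseteq> X" "\<forall>x\<in>S - K. \<exists>r>0. \<forall>y\<in>ball x r. y - x \<in> W \<longrightarrow> y \<in> S"
      show "S \<subseteq> ?L"
      proof
        fix x assume x: "x \<in> S"
        obtain z where z: "z \<in> K" "boundary_dist X z \<le> boundary_dist X x" using conf(1)[OF S x] by blast
        have "infdist z (- X) \<le> infdist x (- X)" using z(2) by (simp add: boundary_dist_infdist[OF X 3(2)])
        then have "infdist z0 (- X) \<le> infdist x (- X)" using z0(2)[OF z(1)] by linarith
        moreover have "norm x \<le> R" using conf(2)[OF S x] R order_trans by blast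
        ultimately show "x \<in> ?L" by simp
      qed
    qed
  qed
qed

lemma nonzero_in_span_Re_Im:
  fixes N :: "complex ^ 'n::finite"
  assumes "N \<noteq> 0"
  obtains w where "w \<in> span {Re_vec N, Im_vec N}" "w \<noteq> 0"
proof -
  have "Re_vec N \<noteq> 0 \<or> Im_vec N \<noteq> 0"
    using assms by (auto simp: Re_vec_def Im_vec_def vec_eq_iff complex_eq_iff)
  then show ?thesis using that span_superset[of "{Re_vec N, Im_vec N}"] by blast
qed

lemma P_convex_linear_factor:
  fixes N :: "complex ^ 'n::finite"
  assumes X: "open X" and N: "N \<noteq> 0"
    and mp: "\<And>x. minimum_principle X (boundary_dist X) ((+) x ` span {Re_vec N, Im_vec N})"
  shows "P_convex_supports (linear_poly N + const_poly c) X"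
    and "P_convex_sing_supports (linear_poly N + const_poly c) X"
proof -
  let ?P = "linear_poly N + const_poly c" and ?W = "span {Re_vec N, Im_vec N}"
  obtain w where w: "w \<in> ?W" "w \<noteq> 0" by (rule nonzero_in_span_Re_Im[OF N])
  note conf = ex_confining_compact[OF X subspace_span w _ _ mp]
  show "P_convex_supports ?P X"
    unfolding P_convex_supports_def
  proof (intro allI impI)
    fix K assume K: "compact K \<and> K \<subseteq> X"
    obtain L where L: "compact L" "L \<subseteq> X" and
      conf: "\<And>S. compact S \<Longrightarrow> S \<subseteq> X \<Longrightarrow> \<forall>x\<in>S - K. \<exists>r>0. \<forall>y\<in>ball x r. y - x \<in> ?W \<longrightarrow> y \<in> S \<Longrightarrow> S \<subseteq> L"
      using conf[of K] K by metis
    show "\<exists>L. compact L \<and> L \<subseteq> X \<and> (\<forall>u\<in>compact_dists X. dist_supp X (diff_op_neg ?P u) \<subseteq> K \<longrightarrow> dist_supp X u \<subseteq> L)"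
    proof (intro exI[of _ L] conjI L ballI impI)
      fix u assume u: "u \<in> compact_dists X" and sub: "dist_supp X (diff_op_neg ?P u) \<subseteq> K"
      have d: "is_distribution X u" "compact (dist_supp X u)" using u by (simp_all add: compact_dists_def)
      show "dist_supp X u \<subseteq> L"
      proof (rule conf[OF d(2) dist_supp_subset], rule ballI)
        fix x assume x: "x \<in> dist_supp X u - K"
        show "\<exists>r>0. \<forall>y\<in>ball x r. y - x \<in> ?W \<longrightarrow> y \<in> dist_supp X u"
          by (rule propagation_supp[OF X d(1) N, of _ c]) (use x sub in auto)
      qed
    qed
  qed
  show "P_convex_sing_supports ?P X"
    unfolding P_convex_sing_supports_def
  proof (intro allI impI)
    fix K assume K: "compact K \<and> K \<subseteq> X"
    obtain L where L: "compact L" "L \<subseteq> X" and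
      conf: "\<And>S. compact S \<Longrightarrow> S \<subseteq> X \<Longrightarrow> \<forall>x\<in>S - K. \<exists>r>0. \<forall>y\<in>ball x r. y - x \<in> ?W \<longrightarrow> y \<in> S \<Longrightarrow> S \<subseteq> L"
      using conf[of K] K by metis
    show "\<exists>L. compact L \<and> L \<subseteq> X \<and> (\<forall>u\<in>compact_dists X. dist_sing_supp X (diff_op_neg ?P u) \<subseteq> K \<longrightarrow> dist_sing_supp X u \<subseteq> L)"
    proof (intro exI[of _ L] conjI L ballI impI)
      fix u assume u: "u \<in> compact_dists X" and sub: "dist_sing_supp X (diff_op_neg ?P u) \<subseteq> K"
      have d: "is_distribution X u" "compact (dist_supp X u)" using u by (simp_all add: compact_dists_def)
      \<comment> \<open>Compactness of the singular support is inherited from the support around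
        it.\<close>
      have cs: "compact (dist_sing_supp X u)"
        by (rule compact_relatively_closed[OF d(2) dist_supp_subset dist_sing_supp_subset_supp open_Diff_dist_sing_supp[OF X]])
      show "dist_sing_supp X u \<subseteq> L"
      proof (rule conf[OF cs dist_sing_supp_subset], rule ballI)
        fix x assume x: "x \<in> dist_sing_supp X u - K"
        show "\<exists>r>0. \<forall>y\<in>ball x r. y - x \<in> ?W \<longrightarrow> y \<in> dist_sing_supp X u"
          by (rule propagation_sing_supp[OF X d(1) N, of _ c]) (use x sub in auto)
      qed
    qed
  qed
qed

subsection \<open>Distributions carried by compact pieces of leaves\<close>

text \<open>The measure with density h on the piece \<open>lf\<close> of a leaf parametrised by A:
  the image of Lebesgue measure on the parameter space, which is the real line for lines and the
  complex plane for planes.\<close>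

definition leaf_dist :: "'e::euclidean_space set \<Rightarrow> ('e \<Rightarrow> real ^ 'n::finite) \<Rightarrow> (real ^ 'n \<Rightarrow> complex) \<Rightarrow> 'n functional" where
  "leaf_dist A lf h \<phi> = (\<integral>z. indicator A z *\<^sub>R (h (lf z) * \<phi> (lf z)) \<partial>lborel)"

lemma leaf_dist_zero: "(\<And>z. z \<in> A \<Longrightarrow> \<phi> (lf z) = 0) \<Longrightarrow> leaf_dist A lf h \<phi> = 0"
proof -
  assume "\<And>z. z \<in> A \<Longrightarrow> \<phi> (lf z) = 0"
  then have "(\<lambda>z. indicator A z *\<^sub>R (h (lf z) * \<phi> (lf z))) = (\<lambda>z. 0)" by (intro ext) (auto simp: indicator_def)
  then show ?thesis unfolding leaf_dist_def by (simp only: Bochner_Integration.integral_zero)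
qed

lemma integrable_leaf:
  fixes g :: "real ^ 'n::finite \<Rightarrow> complex"
  assumes "compact A" "continuous_on UNIV lf" "continuous_on UNIV g"
  shows "integrable lborel (\<lambda>z. indicator A z *\<^sub>R g (lf z))"
  by (rule borel_integrable_compact[OF assms(1)])
    (rule continuous_on_compose2[OF assms(3) continuous_on_subset[OF assms(2)]], auto)

lemma is_distribution_leaf:
  assumes A: "compact A" and lf: "continuous_on UNIV lf" and h: "continuous_on UNIV h"
  shows "is_distribution X (leaf_dist A lf h)"
  unfolding is_distribution_iff
proof (intro conjI ballI allI impI)
  have i: "integrable lborel (\<lambda>z. indicator A z *\<^sub>R (h (lf z) * \<phi> (lf z)))" if "\<phi> \<in> test_funs X" for \<phi>
    by (rule integrable_leaf[OF A lf, of "\<lambda>y. h y * \<phi> y"]) (intro continuous_intros h test_funs_continuous[OF that])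
  show "leaf_dist A lf h (\<lambda>x. \<phi> x + \<psi> x) = leaf_dist A lf h \<phi> + leaf_dist A lf h \<psi>"
    if "\<phi> \<in> test_funs X" "\<psi> \<in> test_funs X" for \<phi> \<psi>
    unfolding leaf_dist_def using Bochner_Integration.integral_add[OF i[OF that(1)] i[OF that(2)]]
    by (simp add: distrib_left scaleR_add_right)
  show "leaf_dist A lf h (\<lambda>x. a * \<phi> x) = a * leaf_dist A lf h \<phi>" for \<phi> a
  proof -
    have "indicator A z *\<^sub>R (h (lf z) * (a * \<phi> (lf z))) = a * (indicator A z *\<^sub>R (h (lf z) * \<phi> (lf z)))" for z
      by simp
    then show ?thesis unfolding leaf_dist_def by (simp only: integral_mult_right_zero)
  qed
  fix K
  let ?w = "\<lambda>z. indicator A z *\<^sub>R cmod (h (lf z))"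
  have iw: "integrable lborel ?w"
    by (rule borel_integrable_compact[OF A], rule continuous_on_norm)
      (rule continuous_on_compose2[OF h continuous_on_subset[OF lf]], auto)
  show "\<exists>C b. C \<ge> 0 \<and> (\<forall>\<phi>\<in>test_funs X. \<forall>B. fun_support \<phi> \<subseteq> K \<longrightarrow>
      (\<forall>ks x. length ks \<le> b \<longrightarrow> cmod (partial_derivs ks \<phi> x) \<le> B) \<longrightarrow> cmod (leaf_dist A lf h \<phi>) \<le> C * B)"
  proof (intro exI[of _ "\<integral>z. ?w z \<partial>lborel"] exI[of _ 0] conjI ballI allI impI)
    fix \<phi> B assume \<phi>: "\<phi> \<in> test_funs X"
      and B: "\<forall>ks x. length ks \<le> 0 \<longrightarrow> cmod (partial_derivs ks \<phi> x) \<le> B"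
    have "cmod (leaf_dist A lf h \<phi>) \<le> (\<integral>z. ?w z * B \<partial>lborel)"
      unfolding leaf_dist_def
    proof (rule Bochner_Integration.integral_norm_bound_integral[OF i[OF \<phi>]])
      show "integrable lborel (\<lambda>z. ?w z * B)" using iw by simp
      fix z
      have "cmod (\<phi> (lf z)) \<le> B" using B[rule_format, of "[]" "lf z"] by simp
      then show "cmod (indicator A z *\<^sub>R (h (lf z) * \<phi> (lf z))) \<le> ?w z * B"
        by (cases "z \<in> A") (simp_all add: norm_mult mult_left_mono)
    qed
    then show "cmod (leaf_dist A lf h \<phi>) \<le> (\<integral>z. ?w z \<partial>lborel) * B" by simp
  qed simp
qed

text \<open>Multiplication by the conjugate of h at the chosen point makes the real part of h
  positive nearby, so a nonnegative bump gives a positive integral. With the identity as leaf map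
  the lemma also shows that a nonzero function is a nonzero distribution.\<close>

lemma leaf_dist_nonzero:
  fixes h :: "real ^ 'n::finite \<Rightarrow> complex"
  assumes A: "compact A" and lf: "continuous_on UNIV lf" and z0: "z0 \<in> interior A"
    and V: "open V" "lf z0 \<in> V" and h: "smooth_fun_on V h" "h (lf z0) \<noteq> 0"
  shows "\<exists>\<phi>\<in>test_funs V. leaf_dist A lf h \<phi> \<noteq> 0"
proof -
  let ?g = "\<lambda>y. Re (cnj (h (lf z0)) * h y)"
  have "continuous_on V ?g" by (intro continuous_intros smooth_fun_on_continuous[OF h(1)])
  then have "open (V \<inter> ?g -` {0<..})" by (rule continuous_open_preimage) (auto simp: V)
  moreover have "?g (lf z0) > 0"
    using h(2) by (simp add: complex_neq_0 power2_eq_square[symmetric])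
  ultimately obtain r where r: "r > 0" "ball (lf z0) r \<subseteq> V \<inter> ?g -` {0<..}"
    using V(2) by (metis IntI greaterThan_iff openE vimageI2)
  obtain \<phi> where \<phi>: "\<phi> \<in> test_funs (ball (lf z0) r)" "\<And>x. \<phi> x = complex_of_real (Re (\<phi> x))"
      "\<And>x. Re (\<phi> x) \<ge> 0" "Re (\<phi> (lf z0)) > 0"
    by (rule ex_bump[OF r(1)]) blast
  have \<phi>V: "\<phi> \<in> test_funs V" by (rule test_funs_mono[OF \<phi>(1)]) (use r(2) in blast)
  have out: "\<phi> y = 0" if "y \<notin> ball (lf z0) r" for y
    using that test_funsD(3)[OF \<phi>(1)] not_in_fun_support by blast
  let ?F = "\<lambda>z. indicator A z *\<^sub>R (h (lf z) * \<phi> (lf z))"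
  let ?G = "\<lambda>z. Re (cnj (h (lf z0)) * ?F z)"
  have iF: "integrable lborel ?F"
    by (rule integrable_leaf[OF A lf, of "\<lambda>y. h y * \<phi> y"])
      (rule test_funs_continuous[OF test_funs_smooth_mult[OF V(1) h(1) \<phi>V]])
  have iF2: "integrable lborel (\<lambda>z. cnj (h (lf z0)) * ?F z)" by (rule integrable_mult_right[OF iF])
  have iG: "integrable lborel ?G" by (rule integrable_Re[OF iF2])
  have G: "?G z = indicator A z * (?g (lf z) * Re (\<phi> (lf z)))" for z
  proof -
    have "cnj (h (lf z0)) * ?F z = (indicator A z * Re (\<phi> (lf z))) *\<^sub>R (cnj (h (lf z0)) * h (lf z))"
      by (subst \<phi>(2)) (simp add: scaleR_conv_of_real mult_ac)
    then show ?thesis by (simp only: scaleR_complex.sel mult_ac)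
  qed
  have g0: "?g (lf z) * Re (\<phi> (lf z)) \<ge> 0" for z
  proof (cases "lf z \<in> ball (lf z0) r")
    case True
    then have "?g (lf z) > 0" using r(2) by blast
    then show ?thesis using \<phi>(3)[of "lf z"] by (intro mult_nonneg_nonneg) auto
  qed (simp add: out)
  let ?O = "interior A \<inter> lf -` (ball (lf z0) r \<inter> (\<lambda>y. Re (\<phi> y)) -` {0<..})"
  have "continuous_on UNIV (\<lambda>y. Re (\<phi> y))" by (intro continuous_intros test_funs_continuous[OF \<phi>(1)])
  from open_vimage[OF open_greaterThan this] have O: "open ?O"
    by (intro open_Int[OF open_interior open_vimage[OF open_Int[OF open_ball] lf]])
  have "(\<integral>z. ?G z \<partial>lborel) > 0"
  proof (rule lborel_integral_pos[OF iG _ O])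
    show "?G z \<ge> 0" for z unfolding G by (rule mult_nonneg_nonneg[OF _ g0]) simp
    show "z0 \<in> ?O" using z0 \<phi>(4) r(1) by simp
    fix z assume z: "z \<in> ?O"
    then have zi: "z \<in> interior A" "lf z \<in> ball (lf z0) r" and pos: "Re (\<phi> (lf z)) > 0" by auto
    have zA: "z \<in> A" using zi(1) interior_subset by blast
    have "?g (lf z) > 0" using subsetD[OF r(2) zi(2)] by simp
    then have "?g (lf z) * Re (\<phi> (lf z)) > 0" using pos by (rule mult_pos_pos)
    then show "?G z > 0" unfolding G using zA by (simp only: indicator_simps mult_1)
  qed
  moreover have "(\<integral>z. ?G z \<partial>lborel) = Re (\<integral>z. cnj (h (lf z0)) * ?F z \<partial>lborel)"
    by (rule integral_Re[OF iF2])
  ultimately have "leaf_dist A lf h \<phi> \<noteq> 0" unfolding leaf_dist_def integral_mult_right_zero by auto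
  then show ?thesis using \<phi>V by blast
qed

text \<open>A divergence theorem without boundary term: \<psi> vanishes near the frontier, so the
  restriction to A extended by 0 is continuously differentiable along r, and the integral of such a
  derivative is 0.\<close>

lemma leaf_integral_dir_zero:
  fixes B :: "'e::euclidean_space \<Rightarrow> real ^ 'n::finite"
  assumes \<psi>: "\<psi> \<in> test_funs UNIV" and A: "compact A" and B: "linear B" and lf: "\<And>z. lf z = a + B z"
    and fr: "\<And>z. z \<in> frontier A \<Longrightarrow> lf z \<notin> fun_support \<psi>"
  shows "(\<integral>z. indicator A z *\<^sub>R dir (B r) \<psi> (lf z) \<partial>lborel) = 0"
proof -
  have c_lf: "continuous_on S lf" for S
    unfolding lf[abs_def] using linear_continuous_on[OF B[unfolded linear_conv_bounded_linear]] by (intro continuous_intros)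
  have sm: "smooth_fun_on UNIV \<psi>" "smooth_fun_on UNIV (dir (B r) \<psi>)"
    using test_funsD(1)[OF \<psi>] by (auto intro: smooth_dir)
  have dir0: "dir (B r) \<psi> y = 0" if "y \<notin> fun_support \<psi>" for y
    using partial_deriv_outside_support[OF that] by (simp add: dir_def)
  have cA: "closed A" using A by (rule compact_imp_closed)
  \<comment> \<open>Extension by 0 across the frontier of A is continuous because g vanishes
    there.\<close>
  have cut: "continuous_on UNIV (\<lambda>z. indicator A z *\<^sub>R g (lf z))"
    if g: "continuous_on UNIV g" "\<And>y. y \<notin> fun_support \<psi> \<Longrightarrow> g y = 0" for g :: "real ^ 'n \<Rightarrow> complex"
  proof -
    have "continuous_on (A \<union> closure (- A)) (\<lambda>z. if z \<in> A then g (lf z) else 0)"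
    proof (rule continuous_on_cases[OF cA closed_closure _ continuous_on_const])
      show "continuous_on A (\<lambda>z. g (lf z))" by (rule continuous_on_compose2[OF g(1) c_lf]) auto
      show "\<forall>z. z \<in> A \<and> z \<notin> A \<or> z \<in> closure (- A) \<and> z \<in> A \<longrightarrow> g (lf z) = 0"
        using fr g(2) cA by (auto simp: frontier_closures)
    qed
    moreover have "A \<union> closure (- A) = UNIV" using closure_subset[of "- A"] by blast
    moreover have "(\<lambda>z. if z \<in> A then g (lf z) else 0) = (\<lambda>z. indicator A z *\<^sub>R g (lf z))"
      by (simp add: fun_eq_iff indicator_def)
    ultimately show ?thesis by (simp only:)
  qed
  let ?p = "\<lambda>z. indicator A z *\<^sub>R \<psi> (lf z)" and ?p' = "\<lambda>z. indicator A z *\<^sub>R dir (B r) \<psi> (lf z)"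
  have "((\<lambda>t. ?p (z + t *\<^sub>R r)) has_vector_derivative ?p' (z + t *\<^sub>R r)) (at t)" for z t
  proof -
    let ?y = "z + t *\<^sub>R r"
    have line: "lf (z + s *\<^sub>R r) = lf z + s *\<^sub>R B r" for s
      by (simp add: lf linear_add[OF B] linear_scale[OF B] add.assoc)
    have der: "((\<lambda>t. \<psi> (lf (z + t *\<^sub>R r))) has_vector_derivative dir (B r) \<psi> (lf ?y)) (at t)"
      unfolding line by (rule has_vector_derivative_dir[OF sm(1)]) simp
    have op: "open ((\<lambda>s. z + s *\<^sub>R r) -` U)" if "open U" for U
      by (rule open_vimage[OF that]) (intro continuous_intros)
    \<comment> \<open>Near interior points the indicator is 1, near outer points it is 0, and near
      frontier points \<psi> itself vanishes; in each case the derivative along the line is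
      known.\<close>
    consider "?y \<in> interior A" | "?y \<notin> A" | "?y \<in> frontier A" using cA by (auto simp: frontier_def)
    then show ?thesis
    proof cases
      case 1
      then have e: "?p' ?y = dir (B r) \<psi> (lf ?y)" using interior_subset[of A] by auto
      show ?thesis unfolding e
        by (rule has_vector_derivative_transform_within_open[OF der op[OF open_interior[of A]]])
          (use 1 interior_subset[of A] in auto)
    next
      case 2
      have "((\<lambda>t. ?p (z + t *\<^sub>R r)) has_vector_derivative 0) (at t)"
        by (rule has_vector_derivative_transform_within_open[OF has_vector_derivative_const[of 0] op[of "- A"]])
          (use 2 cA in auto)
      then show ?thesis using 2 by simp
    next
      case 3
      let ?U = "lf -` (- fun_support \<psi>)"
      have "open ?U" by (intro open_vimage c_lf) (simp add: open_closed closed_fun_support)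
      have "((\<lambda>t. ?p (z + t *\<^sub>R r)) has_vector_derivative 0) (at t)"
        by (rule has_vector_derivative_transform_within_open[OF has_vector_derivative_const[of 0] op[OF \<open>open ?U\<close>]])
          (use fr[OF 3] not_in_fun_support in auto)
      then show ?thesis using dir0[OF fr[OF 3]] by simp
    qed
  qed
  moreover have "continuous_on UNIV ?p"
    by (rule cut[where g = \<psi>, OF smooth_fun_on_continuous[OF sm(1)] not_in_fun_support[where f = \<psi>]])
  moreover have "continuous_on UNIV ?p'" by (rule cut[where g = "dir (B r) \<psi>", OF smooth_fun_on_continuous[OF sm(2)] dir0])
  moreover have "bounded {z. ?p z \<noteq> 0 \<or> ?p' z \<noteq> 0}"
    by (rule bounded_subset[OF compact_imp_bounded[OF A]]) (auto simp: indicator_def split: if_splits)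
  ultimately show ?thesis by (rule integral_line_deriv_zero)
qed

text \<open>As \<open>opT N c h\<close> is 0, h times \<open>opL N c \<phi>\<close> equals -i times
  \<open>dN N\<close> of the product of h and \<phi>. This is a combination of derivatives
  tangential to the leaf, which integrate to 0 when \<phi> avoids the edge of the piece.\<close>

lemma leaf_dist_opL_zero:
  fixes B :: "'e::euclidean_space \<Rightarrow> real ^ 'n::finite"
  assumes \<phi>: "\<phi> \<in> test_funs UNIV" and A: "compact A" and B: "linear B" and lf: "\<And>z. lf z = a + B z"
    and fr: "\<And>z. z \<in> frontier A \<Longrightarrow> lf z \<notin> fun_support \<phi>"
    and N: "Re_vec N = B r1" "Im_vec N = B r2"
    and h: "smooth_fun_on UNIV h" "\<And>x. opT N c h x = 0"
  shows "leaf_dist A lf h (opL N c \<phi>) = 0"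
proof -
  let ?\<psi> = "\<lambda>x. h x * \<phi> x"
  have \<psi>: "?\<psi> \<in> test_funs UNIV" by (rule test_funs_smooth_mult[OF open_UNIV h(1) \<phi>])
  have "fun_support ?\<psi> \<subseteq> fun_support \<phi>"
    by (rule fun_support_subset[OF closed_fun_support]) (use not_in_fun_support[of _ \<phi>] in fastforce)
  then have fr': "lf z \<notin> fun_support ?\<psi>" if "z \<in> frontier A" for z using fr[OF that] by blast
  have c_lf: "continuous_on UNIV lf"
    unfolding lf[abs_def] using linear_continuous_on[OF B[unfolded linear_conv_bounded_linear]] by (intro continuous_intros)
  have i: "integrable lborel (\<lambda>z. indicator A z *\<^sub>R dir (B r) ?\<psi> (lf z))" for r
    by (rule integrable_leaf[OF A c_lf])
      (rule smooth_fun_on_continuous[OF smooth_dir[OF open_UNIV test_funsD(1)[OF \<psi>]]])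
  have eq: "h x * opL N c \<phi> x = - \<i> * dN N ?\<psi> x" for x
  proof -
    have "dN N ?\<psi> x = h x * dN N \<phi> x + dN N h x * \<phi> x"
      by (rule dN_mult) (use smooth_fun_onD[OF h(1)] smooth_fun_onD[OF test_funsD(1)[OF \<phi>]] in auto)
    moreover have "c * h x = - \<i> * dN N h x" using h(2)[of x] by (simp add: opT_def add_eq_0_iff)
    then have "h x * (c * \<phi> x) = - \<i> * (dN N h x * \<phi> x)" by (metis mult.assoc mult.commute)
    ultimately show ?thesis by (simp add: opL_def algebra_simps)
  qed
  have "indicator A z *\<^sub>R (h (lf z) * opL N c \<phi> (lf z)) = - \<i> * (indicator A z *\<^sub>R dir (B r1) ?\<psi> (lf z)
      + \<i> * (indicator A z *\<^sub>R dir (B r2) ?\<psi> (lf z)))" for z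
    using eq[of "lf z", unfolded dN_dir N] by (cases "z \<in> A") simp_all
  then have "leaf_dist A lf h (opL N c \<phi>) = (\<integral>z. - \<i> * (indicator A z *\<^sub>R dir (B r1) ?\<psi> (lf z)
      + \<i> * (indicator A z *\<^sub>R dir (B r2) ?\<psi> (lf z))) \<partial>lborel)"
    unfolding leaf_dist_def by (simp only:)
  also have "\<dots> = - \<i> * ((\<integral>z. indicator A z *\<^sub>R dir (B r1) ?\<psi> (lf z) \<partial>lborel)
      + \<i> * (\<integral>z. indicator A z *\<^sub>R dir (B r2) ?\<psi> (lf z) \<partial>lborel))"
    using Bochner_Integration.integral_add[OF i[of r1] integrable_mult_right[OF i[of r2]], of \<i>]
    by (simp only: integral_mult_right_zero)
  also have "\<dots> = 0" using leaf_integral_dir_zero[OF \<psi> A B lf fr'] by simp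
  finally show ?thesis .
qed

text \<open>By \<open>thin\<close> every point of the piece is a limit of points off it. A smooth
  density vanishes off the piece and then by continuity everywhere, whereas the distribution is not
  0.\<close>

lemma leaf_dist_not_represented:
  fixes lf :: "'e::euclidean_space \<Rightarrow> real ^ 'n::finite" and h :: "real ^ 'n \<Rightarrow> complex"
  assumes A: "compact A" and lf: "continuous_on UNIV lf" and z0: "z0 \<in> interior A"
    and h: "smooth_fun_on UNIV h" "h (lf z0) \<noteq> 0"
    and thin: "\<And>z t. z \<in> A \<Longrightarrow> t > 0 \<Longrightarrow> lf z + t *\<^sub>R v \<notin> lf ` A"
    and V: "open V" "lf z0 \<in> V" and f: "smooth_fun_on V f" "represents V (leaf_dist A lf h) f"
  shows False
proof -
  have leaf: "closed (lf ` A)"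
    by (rule compact_imp_closed[OF compact_continuous_image[OF continuous_on_subset[OF lf subset_UNIV] A]])
  \<comment> \<open>The distribution vanishes off the compact piece. A nonzero value of its density
    there would be detected by \<open>leaf_dist_nonzero\<close> with the identity as leaf
    map.\<close>
  have f0: "f y = 0" if y: "y \<in> V" "y \<notin> lf ` A" for y
  proof (rule ccontr)
    assume fy: "f y \<noteq> 0"
    have "open (V - lf ` A)" by (rule open_Diff[OF V(1) leaf])
    then obtain r where r: "r > 0" "ball y r \<subseteq> V - lf ` A" using y by (meson DiffI openE)
    have "\<exists>\<phi>\<in>test_funs (ball y r). leaf_dist (cball y r) (\<lambda>y. y) f \<phi> \<noteq> 0"
    proof (rule leaf_dist_nonzero)
      show "smooth_fun_on (ball y r) f" by (rule smooth_fun_on_subset[OF f(1)]) (use r(2) in blast)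
    qed (use fy r(1) in \<open>auto simp: interior_cball\<close>)
    then obtain \<phi> where \<phi>: "\<phi> \<in> test_funs (ball y r)" "leaf_dist (cball y r) (\<lambda>y. y) f \<phi> \<noteq> 0" by blast
    have out: "\<phi> x = 0" if "x \<notin> ball y r" for x
      using that test_funsD(3)[OF \<phi>(1)] not_in_fun_support by blast
    have "indicator (cball y r) x *\<^sub>R (f x * \<phi> x) = f x * \<phi> x" for x
      using out[of x] by (cases "x \<in> ball y r") (auto simp: indicator_def)
    then have "leaf_dist (cball y r) (\<lambda>y. y) f \<phi> = (\<integral>x. f x * \<phi> x \<partial>lborel)" by (simp add: leaf_dist_def)
    moreover have "\<phi> \<in> test_funs V" by (rule test_funs_mono[OF \<phi>(1)]) (use r(2) in blast)
    then have "leaf_dist A lf h \<phi> = (\<integral>x. f x * \<phi> x \<partial>lborel)" using f(2) by (simp add: represents_def)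
    moreover have "leaf_dist A lf h \<phi> = 0" by (rule leaf_dist_zero) (use out r(2) in blast)
    ultimately show False using \<phi>(2) by simp
  qed
  have "f y = 0" if y: "y \<in> V" for y
  proof (cases "y \<in> lf ` A")
    case True
    \<comment> \<open>Approach along v from outside the piece, where f is already known to be
      0.\<close>
    let ?s = "\<lambda>n::nat. y + inverse (real (Suc n)) *\<^sub>R v"
    have "?s \<longlonglongrightarrow> y + 0 *\<^sub>R v" by (intro tendsto_intros LIMSEQ_inverse_real_of_nat)
    then have s: "?s \<longlonglongrightarrow> y" by simp
    have "isCont f y" using smooth_fun_on_continuous[OF f(1)] V(1) y continuous_on_eq_continuous_at by blast
    then have lim: "(\<lambda>n. f (?s n)) \<longlonglongrightarrow> f y" by (rule isCont_tendsto_compose[OF _ s])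
    have "\<forall>\<^sub>F n in sequentially. ?s n \<in> V" by (rule topological_tendstoD[OF s V(1) y])
    then have "\<forall>\<^sub>F n in sequentially. f (?s n) = 0"
    proof eventually_elim
      case (elim n)
      obtain z where "z \<in> A" "y = lf z" using True by blast
      then show ?case using thin[of z "inverse (real (Suc n))"] f0[OF elim] by simp
    qed
    then have "(\<lambda>n. f (?s n)) \<longlonglongrightarrow> 0" by (rule tendsto_eventually)
    then show ?thesis using lim LIMSEQ_unique by blast
  qed (use f0 y in blast)
  then have zero: "f x * \<phi> x = 0" if "\<phi> \<in> test_funs V" for \<phi> x
    using not_in_fun_support[of x \<phi>] test_funsD(3)[OF that] by (cases "x \<in> V") auto
  have "\<exists>\<phi>\<in>test_funs V. leaf_dist A lf h \<phi> \<noteq> 0"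
    by (rule leaf_dist_nonzero[OF A lf z0 V smooth_fun_on_subset[OF h(1) subset_UNIV] h(2)])
  then obtain \<phi> where \<phi>: "\<phi> \<in> test_funs V" "leaf_dist A lf h \<phi> \<noteq> 0" by blast
  have "(\<lambda>x. f x * \<phi> x) = (\<lambda>x. 0)" using zero[OF \<phi>(1)] by (rule ext)
  moreover have "leaf_dist A lf h \<phi> = (\<integral>x. f x * \<phi> x \<partial>lborel)" using f(2) \<phi>(1) unfolding represents_def by blast
  ultimately show False using \<phi>(2) by (simp only: Bochner_Integration.integral_zero)
qed

subsection \<open>Necessity of the minimum principle\<close>

text \<open>The length of v is the least boundary distance on K, and on the frontier the distance is
  strictly larger because the minimum is not attained there. Hence K stays in X when moved by tv
  with t < 1, and its frontier even for t = 1.\<close>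

lemma minimum_principle_failure:
  fixes X :: "'a::euclidean_space set"
  assumes X: "open X" and W: "subspace W" "w \<in> W" "w \<noteq> 0"
    and fail: "\<not> minimum_principle X (boundary_dist X) ((+) x ` W)"
  obtains K x0 v where "compact K" "K \<subseteq> (+) x ` W" "x0 \<in> K" "x0 \<notin> top_of_set ((+) x ` W) frontier_of K"
    "v \<notin> W" "x0 + v \<notin> X" "\<And>z t. z \<in> K \<Longrightarrow> 0 \<le> t \<Longrightarrow> t < 1 \<Longrightarrow> z + t *\<^sub>R v \<in> X"
    "\<And>z t. z \<in> top_of_set ((+) x ` W) frontier_of K \<Longrightarrow> 0 \<le> t \<Longrightarrow> t \<le> 1 \<Longrightarrow> z + t *\<^sub>R v \<in> X"
proof -
  let ?F = "(+) x ` W"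
  obtain K where K: "compact K" "K \<noteq> {}" "K \<subseteq> ?F \<inter> X"
    and no: "\<not> (\<exists>v. is_min_on (boundary_dist X) K v \<and> is_min_on (boundary_dist X) (top_of_set ?F frontier_of K) v)"
    using fail unfolding minimum_principle_def by blast
  have KF: "K \<subseteq> ?F" and KX: "K \<subseteq> X" using K(3) by auto
  let ?Fr = "top_of_set ?F frontier_of K"
  obtain p where p: "p \<in> ?Fr" by (rule ex_frontier_max_norm[OF K(1,2) KF W]) blast
  have Fr: "?Fr \<subseteq> K" using mem_frontier_of_iff[OF K(1) KF] by blast
  have "X \<noteq> UNIV"
  proof
    assume "X = UNIV"
    \<comment> \<open>With all distances infinite, the frontier point p attains the minimum and the
      principle could not fail.\<close>
    then have "boundary_dist X y = \<infinity>" for y by (simp add: boundary_dist_def top_ereal_def)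
    then have "is_min_on (boundary_dist X) K \<infinity> \<and> is_min_on (boundary_dist X) ?Fr \<infinity>"
      using K(2) p unfolding is_min_on_def by auto
    then show False using no by blast
  qed
  note bd = boundary_dist_infdist[OF X this]
  have c: "closed (- X)" "- X \<noteq> {}" using X \<open>X \<noteq> UNIV\<close> by auto
  let ?d = "\<lambda>z. infdist z (- X)"
  obtain x0 where x0: "x0 \<in> K" "\<And>z. z \<in> K \<Longrightarrow> ?d x0 \<le> ?d z"
    using continuous_attains_inf[OF K(1,2), of ?d] continuous_on_infdist[OF continuous_on_id] by blast
  have big: "?d x0 < ?d z" if z: "z \<in> ?Fr" for z
  proof (rule ccontr)
    assume "\<not> ?d x0 < ?d z"
    then have "?d z = ?d x0" using x0(2)[of z] z Fr by force
    then have "ereal (?d x0) \<in> boundary_dist X ` ?Fr" using z by (intro image_eqI[of _ _ z]) (simp_all add: bd)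
    moreover have "ereal (?d x0) \<in> boundary_dist X ` K" by (rule image_eqI[OF bd[symmetric] x0(1)])
    moreover have "ereal (?d x0) \<le> boundary_dist X y" if "y \<in> K" for y using x0(2)[OF that] by (simp add: bd)
    ultimately have "is_min_on (boundary_dist X) K (ereal (?d x0)) \<and> is_min_on (boundary_dist X) ?Fr (ereal (?d x0))"
      using Fr unfolding is_min_on_def by blast
    then show False using no by blast
  qed
  obtain y0 where y0: "y0 \<in> - X" "?d x0 = dist x0 y0" using infdist_attains_inf[OF c] by metis
  define v where "v = y0 - x0"
  have nv: "norm v = ?d x0" by (simp add: v_def y0(2) dist_norm norm_minus_commute)
  have inX: "z + t *\<^sub>R v \<in> X" if "\<bar>t\<bar> * norm v < ?d z" for z t
  proof (rule ccontr)
    assume "z + t *\<^sub>R v \<notin> X"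
    then have "?d z \<le> dist z (z + t *\<^sub>R v)" by (intro infdist_le) simp
    then show False using that by (simp add: dist_norm)
  qed
  have nv0: "norm v > 0" using infdist_pos_not_in_closed[OF c] x0(1) KX nv by auto
  show ?thesis
  proof (rule that[of K x0 v, OF K(1) KF x0(1)])
    show "x0 \<notin> ?Fr" using big[of x0] by auto
    show "x0 + v \<notin> X" using y0(1) by (simp add: v_def)
    show "z + t *\<^sub>R v \<in> X" if z: "z \<in> K" and t: "0 \<le> t" "t < 1" for z t
    proof (rule inX)
      have "\<bar>t\<bar> * norm v < 1 * norm v" using t nv0 by (intro mult_strict_right_mono) auto
      then show "\<bar>t\<bar> * norm v < ?d z" using x0(2)[OF z] nv by simp
    qed
    show "z + t *\<^sub>R v \<in> X" if z: "z \<in> ?Fr" and t: "0 \<le> t" "t \<le> 1" for z t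
    proof (rule inX)
      have "\<bar>t\<bar> * norm v \<le> 1 * norm v" using t nv0 by (intro mult_right_mono) auto
      then show "\<bar>t\<bar> * norm v < ?d z" using big[OF z] nv by simp
    qed
    show "v \<notin> W"
    proof
      assume v: "v \<in> W"
      obtain a where a: "a \<in> W" "x0 = x + a" using x0(1) KF by blast
      \<comment> \<open>If v were tangential, this segment would lead from K to the complement of X
        inside the leaf and meet the frontier of K in a point q, no farther from y0 than x0 is. That
        contradicts \<open>big\<close>.\<close>
      have "closed_segment x0 y0 \<subseteq> ?F"
      proof
        fix y assume "y \<in> closed_segment x0 y0"
        then obtain t where "y = (1 - t) *\<^sub>R x0 + t *\<^sub>R y0" unfolding closed_segment_def by blast
        then have "y = x + (a + t *\<^sub>R v)" by (simp add: v_def a(2) algebra_simps)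
        then show "y \<in> ?F" using subspace_add[OF W(1) a(1) subspace_scale[OF W(1) v]] by (rule image_eqI)
      qed
      then have "connectedin (top_of_set ?F) (closed_segment x0 y0)"
        by (simp add: connectedin_subtopology)
      moreover have "closed_segment x0 y0 \<inter> K \<noteq> {}" "closed_segment x0 y0 - K \<noteq> {}" using x0(1) y0(1) KX by auto
      ultimately have "closed_segment x0 y0 \<inter> ?Fr \<noteq> {}" by (rule connectedin_Int_frontier_of)
      then obtain q where q: "q \<in> closed_segment x0 y0" "q \<in> ?Fr" by blast
      have "?d q \<le> dist q y0" by (rule infdist_le[OF y0(1)])
      also have "\<dots> \<le> dist x0 y0" using dist_in_closed_segment[OF q(1)] by (simp add: dist_commute)
      finally show False using big[OF q(2)] y0(2) by simp
    qed
  qed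
qed

text \<open>The premise combines the support of the image with the singular support of u, so it fits
  either notion: the inclusion of sing supp in supp is used for u in one case and for the image in
  the other. The points x0 + tv then lie in a compact subset L of X, and so does their limit for t
  tending to 1.\<close>

lemma P_convex_limit_in:
  fixes v :: "real ^ 'n::finite"
  assumes "P_convex_supports P X \<or> P_convex_sing_supports P X" and C: "compact C" "C \<subseteq> X"
    and u: "\<And>t. 0 \<le> t \<Longrightarrow> t < 1 \<Longrightarrow> \<exists>u\<in>compact_dists X. dist_supp X (diff_op_neg P u) \<subseteq> C \<and> x0 + t *\<^sub>R v \<in> dist_sing_supp X u"
  shows "x0 + v \<in> X"
proof -
  have "\<exists>L. compact L \<and> L \<subseteq> X \<and> (\<forall>u\<in>compact_dists X. dist_supp X (diff_op_neg P u) \<subseteq> C \<longrightarrow> dist_sing_supp X u \<subseteq> L)"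
    using assms(1)
  proof
    assume "P_convex_supports P X"
    then obtain L where "compact L" "L \<subseteq> X" "\<forall>u\<in>compact_dists X. dist_supp X (diff_op_neg P u) \<subseteq> C \<longrightarrow> dist_supp X u \<subseteq> L"
      unfolding P_convex_supports_def using C by metis
    then show ?thesis by (metis dist_sing_supp_subset_supp order_trans)
  next
    assume "P_convex_sing_supports P X"
    then obtain L where "compact L" "L \<subseteq> X" "\<forall>u\<in>compact_dists X. dist_sing_supp X (diff_op_neg P u) \<subseteq> C \<longrightarrow> dist_sing_supp X u \<subseteq> L"
      unfolding P_convex_sing_supports_def using C by metis
    then show ?thesis by (metis dist_sing_supp_subset_supp order_trans)
  qed
  then obtain L where L: "compact L" "L \<subseteq> X"
    "\<forall>u\<in>compact_dists X. dist_supp X (diff_op_neg P u) \<subseteq> C \<longrightarrow> dist_sing_supp X u \<subseteq> L" by (elim exE conjE)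
  have inL: "x0 + t *\<^sub>R v \<in> L" if t: "0 \<le> t" "t < 1" for t using u[OF t] L(3) by blast
  have lim: "(\<lambda>n. x0 + (1 - inverse (real (Suc (Suc n)))) *\<^sub>R v) \<longlonglongrightarrow> x0 + (1 - 0) *\<^sub>R v"
    by (intro tendsto_intros LIMSEQ_Suc[OF LIMSEQ_inverse_real_of_nat])
  have mem: "x0 + (1 - inverse (real (Suc (Suc n)))) *\<^sub>R v \<in> L" for n
    by (rule inL) (auto simp: inverse_le_1_iff)
  have "x0 + (1 - 0) *\<^sub>R v \<in> L"
    by (rule closed_sequentially[OF compact_imp_closed[OF L(1)] mem lim])
  then show ?thesis using L(2) by auto
qed

text \<open>Stated for an injective parametrisation B of W, so that lines and planes share the
  construction of the measures on leaves.\<close>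

lemma minimum_principle_if_P_convex_leaf:
  fixes B :: "'e::euclidean_space \<Rightarrow> real ^ 'n::finite"
  assumes X: "open X" and N: "N \<noteq> 0" and B: "linear B" "inj B" "range B = span {Re_vec N, Im_vec N}"
    and P: "P_convex_supports (linear_poly N + const_poly c) X \<or> P_convex_sing_supports (linear_poly N + const_poly c) X"
  shows "minimum_principle X (boundary_dist X) ((+) x ` span {Re_vec N, Im_vec N})"
proof (rule ccontr)
  let ?W = "span {Re_vec N, Im_vec N}" and ?P = "linear_poly N + const_poly c"
  let ?F = "(+) x ` ?W"
  assume fail: "\<not> minimum_principle X (boundary_dist X) ?F"
  obtain w where w: "w \<in> ?W" "w \<noteq> 0" by (rule nonzero_in_span_Re_Im[OF N])
  obtain K x0 v where K: "compact K" "K \<subseteq> ?F" and x0: "x0 \<in> K" "x0 \<notin> top_of_set ?F frontier_of K"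
    and v: "v \<notin> ?W" "x0 + v \<notin> X" and KX: "\<And>z t. z \<in> K \<Longrightarrow> 0 \<le> t \<Longrightarrow> t < 1 \<Longrightarrow> z + t *\<^sub>R v \<in> X"
    and FX: "\<And>z t. z \<in> top_of_set ?F frontier_of K \<Longrightarrow> 0 \<le> t \<Longrightarrow> t \<le> 1 \<Longrightarrow> z + t *\<^sub>R v \<in> X"
    by (rule minimum_principle_failure[OF X subspace_span w fail]) blast
  let ?Fr = "top_of_set ?F frontier_of K"
  have cF: "closed ?F" by (intro closed_translation closed_subspace subspace_span)
  have "closedin (top_of_set ?F) ?Fr" by (rule closedin_frontier_of)
  then have "closed ?Fr" using cF by (rule closedin_closed_trans)
  moreover have FrK: "?Fr \<subseteq> K" using mem_frontier_of_iff[OF K] by blast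
  ultimately have cFr: "compact ?Fr" using K(1) by (metis compact_Int_closed inf.absorb_iff2)
  \<comment> \<open>The path of the frontier with t = 1 included: one compact subset of X that
    contains the supports of all images.\<close>
  define C where "C = (\<lambda>(z, t). z + t *\<^sub>R v) ` (?Fr \<times> {0..1})"
  have C: "compact C" "C \<subseteq> X"
    unfolding C_def using FX
    by (auto intro!: compact_continuous_image compact_Times cFr continuous_intros simp: case_prod_beta)
  obtain r1 r2 where r: "Re_vec N = B r1" "Im_vec N = B r2"
    using B(3) span_base[of "Re_vec N" "{Re_vec N, Im_vec N}"] span_base[of "Im_vec N" "{Re_vec N, Im_vec N}"] by blast
  obtain G where G: "linear G" "\<And>z. G (B z) = z"
    using linear_injective_left_inverse[OF B(1,2)] by (metis comp_apply id_apply)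
  \<comment> \<open>The piece in parameters. It is compact as the image of K under a left inverse of
    B.\<close>
  define A where "A = {z. x + B z \<in> K}"
  have BG: "x + B (G (y - x)) = y" if "y \<in> K" for y
  proof -
    obtain z where "y = x + B z" using \<open>y \<in> K\<close> K(2) unfolding B(3)[symmetric] by blast
    then show ?thesis using G(2) by simp
  qed
  have "A = (\<lambda>y. G (y - x)) ` K"
  proof
    show "A \<subseteq> (\<lambda>y. G (y - x)) ` K"
    proof
      fix z assume "z \<in> A"
      then show "z \<in> (\<lambda>y. G (y - x)) ` K" using G(2) by (intro image_eqI[of _ _ "x + B z"]) (simp_all add: A_def)
    qed
    show "(\<lambda>y. G (y - x)) ` K \<subseteq> A" using BG by (auto simp: A_def)
  qed
  moreover have "continuous_on K (\<lambda>y. G (y - x))"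
    using linear_continuous_on[OF G(1)[unfolded linear_conv_bounded_linear]]
    by (rule continuous_on_compose2[where t = UNIV]) (auto intro: continuous_intros)
  ultimately have A: "compact A" using compact_continuous_image K(1) by metis
  have cB: "continuous_on UNIV (\<lambda>z. y + B z)" for y
    using linear_continuous_on[OF B(1)[unfolded linear_conv_bounded_linear]] by (intro continuous_intros)
  \<comment> \<open>Interiors are taken in the parameter space for A but relative to the leaf for K;
    continuity of the parametrisation carries relative neighbourhoods in K back to neighbourhoods in
    A.\<close>
  have FrA: "x + B z \<in> ?Fr" if z: "z \<in> A" "z \<notin> interior A" for z
  proof (subst mem_frontier_of_iff[OF K], intro conjI notI)
    show "x + B z \<in> K" using z(1) by (simp add: A_def)
    assume "\<exists>r>0. ?F \<inter> ball (x + B z) r \<subseteq> K"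
    then obtain r where r: "r > 0" "?F \<inter> ball (x + B z) r \<subseteq> K" by blast
    have "open ((\<lambda>z. x + B z) -` ball (x + B z) r)" by (intro open_vimage open_ball cB)
    moreover have "(\<lambda>z. x + B z) -` ball (x + B z) r \<subseteq> A"
      using r(2) B(3) unfolding A_def by blast
    ultimately show False using z(2) r(1) interiorI[of _ z A] by auto
  qed
  define z0 where "z0 = G (x0 - x)"
  have z0: "x + B z0 = x0" "z0 \<in> interior A" using BG[OF x0(1)] FrA[of z0] x0 by (auto simp: z0_def A_def)
  obtain h where h: "smooth_fun_on UNIV h" "\<And>x. h x \<noteq> 0" "\<And>x. opT N c h x = 0"
    by (rule ex_exponential_solution[OF N]) blast
  have ch: "continuous_on UNIV h" by (rule smooth_fun_on_continuous[OF h(1)])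
  have "x0 + v \<in> X"
  proof (rule P_convex_limit_in[OF P C])
    fix t :: real assume t: "0 \<le> t" "t < 1"
    let ?l = "\<lambda>z. (x + t *\<^sub>R v) + B z"
    let ?u = "leaf_dist A ?l h"
    have lA: "?l z \<in> (\<lambda>y. t *\<^sub>R v + y) ` K" if "z \<in> A" for z
      using that by (auto simp: A_def intro!: image_eqI[of _ _ "x + B z"])
    have u: "is_distribution X ?u" by (rule is_distribution_leaf[OF A cB ch])
    have S: "compact ((\<lambda>y. t *\<^sub>R v + y) ` K)" by (intro compact_translation K(1))
    have SX: "(\<lambda>y. t *\<^sub>R v + y) ` K \<subseteq> X" using KX[OF _ t] by (auto simp: add.commute)
    have supp: "dist_supp X ?u \<subseteq> (\<lambda>y. t *\<^sub>R v + y) ` K"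
    proof (rule subsetI, rule ccontr)
      fix y assume y: "y \<in> dist_supp X ?u" "y \<notin> (\<lambda>y. t *\<^sub>R v + y) ` K"
      have V: "open (X - (\<lambda>y. t *\<^sub>R v + y) ` K)" by (rule open_Diff[OF X compact_imp_closed[OF S]])
      have "?u \<phi> = 0" if "\<phi> \<in> test_funs (X - (\<lambda>y. t *\<^sub>R v + y) ` K)" for \<phi>
        using lA test_funsD(3)[OF that] not_in_fun_support[of _ \<phi>] by (intro leaf_dist_zero) blast
      then show False using dist_suppD[OF y(1) V] y dist_supp_subset by blast
    qed
    have uc: "?u \<in> compact_dists X"
      using u compact_relatively_closed[OF S SX supp open_Diff_dist_supp[OF X]] by (simp add: compact_dists_def)
    moreover have "dist_supp X (diff_op_neg ?P ?u) \<subseteq> C"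
    proof (rule subsetI, rule ccontr)
      fix y assume y: "y \<in> dist_supp X (diff_op_neg ?P ?u)" "y \<notin> C"
      have V: "open (X - C)" by (rule open_Diff[OF X compact_imp_closed[OF C(1)]])
      have "diff_op_neg ?P ?u \<phi> = 0" if \<phi>: "\<phi> \<in> test_funs (X - C)" for \<phi>
      proof -
        have \<phi>': "\<phi> \<in> test_funs X" by (rule test_funs_mono[OF \<phi>]) blast
        have "diff_op_neg ?P ?u \<phi> = ?u (opL N c \<phi>)"
          using diff_op_neg_eq[OF X u \<phi>'] by (simp only: PD_opL[OF test_funsD(1)[OF \<phi>]])
        also have "\<dots> = 0"
        proof (rule leaf_dist_opL_zero[OF test_funs_mono[OF \<phi> subset_UNIV] A B(1) refl _ r h(1,3)])
          fix z assume "z \<in> frontier A"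
          then have "x + B z \<in> ?Fr" using FrA[of z] compact_imp_closed[OF A] by (simp add: frontier_def)
          then have "?l z \<in> C" unfolding C_def using t by (intro image_eqI[of _ _ "(x + B z, t)"]) auto
          then show "?l z \<notin> fun_support \<phi>" using test_funsD(3)[OF \<phi>] by blast
        qed
        finally show ?thesis .
      qed
      then show False using dist_suppD[OF y(1) V] y dist_supp_subset by blast
    qed
    moreover have "x0 + t *\<^sub>R v \<in> dist_sing_supp X ?u"
    proof (rule dist_sing_suppI)
      show "x0 + t *\<^sub>R v \<in> X" by (rule KX[OF x0(1) t])
      have l0: "?l z0 = x0 + t *\<^sub>R v" using z0(1) by (simp add: add_ac flip: z0(1))
      fix V f assume V: "open V" "x0 + t *\<^sub>R v \<in> V" and f: "smooth_fun_on V f" "represents V ?u f"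
      show False
      proof (rule leaf_dist_not_represented[OF A cB z0(2) h(1,2) _ V(1) _ f])
        show "?l z0 \<in> V" unfolding l0 by (rule V(2))
        fix z and s :: real assume s: "s > 0"
        show "?l z + s *\<^sub>R v \<notin> ?l ` A"
        proof
          assume "?l z + s *\<^sub>R v \<in> ?l ` A"
          then obtain z' where "?l z + s *\<^sub>R v = ?l z'" by blast
          \<comment> \<open>Points of one leaf differ by an element of W, while v is transversal;
            this makes the piece thin in the direction v.\<close>
          then have "s *\<^sub>R v = B (z' - z)" by (simp add: linear_diff[OF B(1)] algebra_simps)
          then have "s *\<^sub>R v \<in> ?W" using B(3) by blast
          then have "inverse s *\<^sub>R (s *\<^sub>R v) \<in> ?W" by (rule span_scale)
          then show False using v(1) s by simp
        qed
      qed
    qed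
    ultimately show "\<exists>u\<in>compact_dists X. dist_supp X (diff_op_neg ?P u) \<subseteq> C \<and> x0 + t *\<^sub>R v \<in> dist_sing_supp X u"
      by blast
  qed
  then show False using v(2) by blast
qed

lemma minimum_principle_if_P_convex:
  fixes N :: "complex ^ 'n::finite"
  assumes X: "open X" and N: "N \<noteq> 0"
    and P: "P_convex_supports (linear_poly N + const_poly c) X \<or> P_convex_sing_supports (linear_poly N + const_poly c) X"
  shows "minimum_principle X (boundary_dist X) ((+) x ` span {Re_vec N, Im_vec N})"
  using N
proof (cases rule: direction_cases)
  case (line e p q)
  let ?B = "\<lambda>s::real. s *\<^sub>R e"
  have pq: "p \<noteq> 0 \<or> q \<noteq> 0" using line(4) by (auto simp: complex_eq_iff)
  have e: "e \<in> span {Re_vec N, Im_vec N}"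
  proof -
    have "inverse p *\<^sub>R Re_vec N = e \<or> inverse q *\<^sub>R Im_vec N = e" using pq line(2,3) by auto
    then show ?thesis using span_scale[OF span_base] by (metis insertCI)
  qed
  have "range ?B = span {Re_vec N, Im_vec N}"
  proof
    show "range ?B \<subseteq> span {Re_vec N, Im_vec N}" using span_scale[OF e] by blast
    have "{Re_vec N, Im_vec N} \<subseteq> span {e}" using line(2,3) by (simp add: span_scale span_base)
    then show "span {Re_vec N, Im_vec N} \<subseteq> range ?B" using span_minimal[OF _ subspace_span] span_singleton by metis
  qed
  moreover have "linear ?B" by (rule bounded_linear.linear[OF bounded_linear_scaleR_left])
  moreover have "inj ?B" using line(1) by (simp add: inj_on_def)
  ultimately show ?thesis using minimum_principle_if_P_convex_leaf[OF X N _ _ _ P] by blast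
next
  case plane
  let ?B = "\<lambda>z. Re z *\<^sub>R Re_vec N + Im z *\<^sub>R Im_vec N"
  have lin: "linear ?B" by (rule linearI) (simp_all add: algebra_simps)
  moreover have "inj ?B" using linear_injective_0[OF lin] plane by blast
  moreover have "range ?B = span {Re_vec N, Im_vec N}"
  proof
    show "range ?B \<subseteq> span {Re_vec N, Im_vec N}" by (auto intro!: span_add span_scale intro: span_base)
    show "span {Re_vec N, Im_vec N} \<subseteq> range ?B"
    proof
      fix y assume "y \<in> span {Re_vec N, Im_vec N}"
      then obtain s t where "y = s *\<^sub>R Re_vec N + t *\<^sub>R Im_vec N" by (rule span_pair)
      then show "y \<in> range ?B" by (intro image_eqI[of _ _ "Complex s t"]) auto
    qed
  qed
  ultimately show ?thesis using minimum_principle_if_P_convex_leaf[OF X N _ _ _ P] by blast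
qed

theorem corollary10:
  fixes P :: "'n::finite cpoly"
    and \<alpha> :: complex
    and l :: nat
    and N :: "nat \<Rightarrow> complex ^ 'n"
    and c :: "nat \<Rightarrow> complex"
    and X :: "(real ^ 'n) set"
  assumes "l \<ge> 1"
    and "\<And>j. j \<in> {1..l} \<Longrightarrow> N j \<noteq> 0"
    and "\<alpha> \<noteq> 0"
    and "P = const_poly \<alpha> * (\<Prod>j = 1..l. linear_poly (N j) + const_poly (c j))"
    and "open X"
  shows "(P_convex_supports P X \<longleftrightarrow> P_convex_sing_supports P X) \<and>
         (P_convex_sing_supports P X \<longleftrightarrow>
           (\<forall>j\<in>{1..l}. \<forall>x. minimum_principle X (boundary_dist X)
              ((+) x ` span {Re_vec (N j), Im_vec (N j)})))"
proof -
  let ?Q = "\<lambda>j. linear_poly (N j) + const_poly (c j)"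
  let ?mp = "\<lambda>j. \<forall>x. minimum_principle X (boundary_dist X) ((+) x ` span {Re_vec (N j), Im_vec (N j)})"
  \<comment> \<open>For a single factor either convexity yields the principle, and the principle
    yields both.\<close>
  have "P_convex_supports (?Q j) X \<longleftrightarrow> ?mp j" "P_convex_sing_supports (?Q j) X \<longleftrightarrow> ?mp j" if "j \<in> {1..l}" for j
    using P_convex_linear_factor[OF assms(5) assms(2)[OF that]]
      minimum_principle_if_P_convex[OF assms(5) assms(2)[OF that]] by blast+
  then show ?thesis
    unfolding assms(4) P_convex_supports_mult[OF assms(5)] P_convex_sing_supports_mult[OF assms(5)]
    by (simp add: P_convex_prod[OF assms(5)] P_convex_const[OF assms(5,3)])
qed

end
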